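(* Assume $\sup_x\int_0^\infty\xi^2\gamma(x,d\xi)<\infty$. Suppose that $(\Omega,X_t,\mathbf{Q}_\mu)$ is a realization of the SDSM with parameters $(a,\rho,\Psi)$, started at $\mu\in M(\mathbb{R})$, with $\inf_x|c(x)|\ge\epsilon>0$. Let $f\in B(\mathbb{R})$ and $t>0$. Then $$\mathbf{E}(\langle f,X_t\rangle)=\int_{\mathbb{R}}\int_{\mathbb{R}}f(y)p_t(x,y)\,dy\,\mu(dx),$$ and for all $0<s\le t$, $f\in B(\mathbb{R})$ and $g\in B(\mathbb{R})$, $$\begin{aligned}\mathbf{E}(\langle f,X_s\rangle\langle g,X_t\rangle)&=\mathbf{E}(\langle f,X_s\rangle\langle P_{t-s}g,X_s\rangle)\\&=\int_{\mathbb{R}}\int_{\mathbb{R}}\int_{\mathbb{R}^2}f(y_1)\Big(\int_{\mathbb{R}}g(z)p_{t-s}(y_2,z)dz\Big)p^2_s(x,y;y_1,y_2)\,dy_1dy_2\,\mu(dy)\mu(dx)\\&\quad+\int_0^sdu\int_{\mathbb{R}}\mu(dx)\int_{\mathbb{R}}dy\int_{\mathbb{R}^2}dy_1dy_2\,p_{s-u}(x,y)\sigma(y)p^2_u(y,y;y_1,y_2)f(y_1)\Big(\int_{\mathbb{R}}p_{t-s}(y_2,z)g(z)dz\Big)\\&\quad+\int_0^sdu\int_{\mathbb{R}}\mu(dx)\int_{\mathbb{R}}dy\int_{\mathbb{R}^2}dy_1dy_2\,p_{s-u}(x,y)\Big(\int_0^\infty\xi^2\gamma(y,d\xi)\Big)p^2_u(y,y;y_1,y_2)f(y_1)\Big(\int_{\mathbb{R}}p_{t-s}(y_2,z)g(z)dz\Big).\end{aligned}$$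 (When $s=t$, $\int_{\mathbb{R}}p_{0}(y_2,z)g(z)dz$ is read as $P_0g(y_2)=g(y_2)$.)
   Context: Function spaces. $B(E)$ and $C(E)$ denote the bounded measurable, resp. bounded continuous, functions on $E$; $\hat C(\mathbb{R}^n)$ the continuous functions vanishing at infinity; $C^2(\mathbb{R}^n)$ the functions in $C(\mathbb{R}^n)$ that are twice continuously differentiable with bounded derivatives up to second order; $C^2_c(\mathbb{R}^n)$ its compactly supported elements; $\hat C^2(\mathbb{R}^n)$ the elements of $C^2(\mathbb{R}^n)$ vanishing at infinity together with all derivatives up to second order; $C^2_\partial(\mathbb{R}^n)=\{f+c:c\in\mathbb{R},f\in\hat C^2(\mathbb{R}^n)\}$; $C^2_0(\mathbb{R}^n)=\{f\in C^2_\partial(\mathbb{R}^n):(1+|x|^2)D^\alpha f(x)\in\hat C(\mathbb{R}^n),\ \alpha=1,2\}$, where $D^1f=\sum_i|\partial f/\partial x_i|$, $D^2f=\sum_{i,j}|\partial^2f/\partial x_i\partial x_j|$. A superscript $+$ means nonnegative elements. $f^i,f^{ij}$ are first and second partial derivatives. $M(\mathbb{R})$ is the space of finite Borel measures on $\mathbb{R}$ with the weak topology, $\langle f,\mu\rangle=\int f\,d\mu$. $\Omega=D([0,\infty),M(\mathbb{R}))$ is the Skorokhod space of càdlàg paths. Standing assumptions. $c\in C^2(\mathbb{R})$ with $|c|$ bounded away from zero; $h\in C(\mathbb{R})$ is square-integrable; $\rho(x)=\int_{\mathbb{R}}h(y-x)h(y)dy$ belongs to $C^2(\mathbb{R})$;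 $a(x)=c(x)^2+\rho(0)$; $\sigma\in C^2_\partial(\mathbb{R})^+$; $\gamma(x,d\xi)$ is a kernel from $\mathbb{R}$ to $(0,\infty)$ with $\sup_x\int_0^\infty \xi\wedge\xi^2\,\gamma(x,d\xi)<\infty$ and $x\mapsto\int_\Gamma\xi\wedge\xi^2\,\gamma(x,d\xi)\in C^2_\partial(\mathbb{R})$ for each Borel $\Gamma\subset(0,\infty)$. SDSM. Let $\Psi(x,z)=\frac12\sigma(x)z^2+\int_0^\infty(e^{-z\xi}-1+z\xi)\gamma(x,d\xi)$. The superprocess with dependent spatial motion (SDSM) with parameters $(a,\rho,\Psi)$ and initial state $\mu$ is the unique solution of the $(\mathcal{L},\mu)$-martingale problem, that is, the $M(\mathbb{R})$-valued càdlàg Markov process $X$ with $X_0=\mu$ such that $F(X_t)-F(X_0)-\int_0^t\mathcal{L}F(X_s)ds$, $t\ge0$, is a local martingale for each $F\in\mathcal{D}(\mathcal{L})$. Here $\mathcal{D}(\mathcal{L})$ is the set of all $F(\mu)=f(\langle\phi_1,\mu\rangle,\dots,\langle\phi_m,\mu\rangle)$ with $m\ge 0$, $f\in C^2_0(\mathbb{R}^m)$, $\phi_i\in C^2_c(\mathbb{R})^+$, and, writing $\vec\phi(\mu)=(\langle\phi_1,\mu\rangle,\dots,\langle\phi_m,\mu\rangle)$ and $\vec\phi(x)=(\phi_1(x),\dots,\phi_m(x))$, $\mathcal{L}F=\mathcal{A}F+\mathcal{B}F$ with $$\mathcal{A}F(\mu)=\tfrac12\sum_i f^i(\vec\phi(\mu))\langle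 a\phi_i'',\mu\rangle+\tfrac12\sum_{i,j}f^{ij}(\vec\phi(\mu))\int_{\mathbb{R}^2}\rho(x-y)\phi_i'(x)\phi_j'(y)\mu(dx)\mu(dy),$$ $$\mathcal{B}F(\mu)=\tfrac12\sum_{i,j}f^{ij}(\vec\phi(\mu))\langle\sigma\phi_i\phi_j,\mu\rangle+\int_{\mathbb{R}}\mu(dx)\int_0^\infty\Big\{f(\vec\phi(\mu)+\xi\vec\phi(x))-f(\vec\phi(\mu))-\xi\sum_if^i(\vec\phi(\mu))\phi_i(x)\Big\}\gamma(x,d\xi).$$ Semigroups. $(P^m_t)_{t\ge0}$ is the Feller semigroup on $\mathbb{R}^m$ (extended to $B(\mathbb{R}^m)$) generated by the closure of $G^m=\frac12\sum_{i=1}^ma(x_i)\frac{\partial^2}{\partial x_i^2}+\frac12\sum_{i\ne j}\rho(x_i-x_j)\frac{\partial^2}{\partial x_i\partial x_j}$ on $C_c^\infty(\mathbb{R}^m)$; $p^m_t(x,y)$ is its transition density with respect to Lebesgue measure. $P_t=P^1_t$, $p_t=p^1_t$, and $p^2_t(x,y;y_1,y_2)$ denotes $p^2_t((x,y),(y_1,y_2))$. $\mathbf{E}$ is expectation under $\mathbf{Q}_\mu$. *)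

theory Defs
  imports "HOL-Probability.Probability"
begin

section \<open>Function spaces\<close>

text \<open>
  The test functions of the martingale problem live on \<open>\<real>\<^sup>n\<close> with \<open>n\<close> quantified inside a
  hypothesis, so \<open>\<real>\<^sup>n\<close> is the set of extensional functions on \<open>{..<n}\<close>.  Its topology as a subset
  of \<open>nat \<Rightarrow> real\<close> (product topology) is the Euclidean one.  A function on \<open>\<real>\<^sup>n\<close> is a function
  on \<open>nat \<Rightarrow> real\<close> of which only the values on \<open>Rn n\<close> matter.
\<close>

definition Rn :: "nat \<Rightarrow> (nat \<Rightarrow> real) set" where
  "Rn n = {..<n} \<rightarrow>\<^sub>E UNIV"

definition Bm :: "('e::topological_space \<Rightarrow> real) set" where
  "Bm = {f \<in> borel_measurable borel. bounded (range f)}"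

definition Cb :: "'e::topological_space set \<Rightarrow> ('e \<Rightarrow> real) set" where
  "Cb E = {f. continuous_on E f \<and> bounded (f ` E)}"

definition Chat :: "'e::topological_space set \<Rightarrow> ('e \<Rightarrow> real) set" where
  "Chat E = {f. continuous_on E f \<and>
     (\<forall>e>0. \<exists>K. compact K \<and> K \<subseteq> E \<and> (\<forall>x\<in>E - K. \<bar>f x\<bar> < e))}"

definition pd :: "nat \<Rightarrow> ((nat \<Rightarrow> real) \<Rightarrow> real) \<Rightarrow> (nat \<Rightarrow> real) \<Rightarrow> real" where
  "pd i f x = deriv (\<lambda>r. f (x(i := r))) (x i)"

definition has_pd :: "nat \<Rightarrow> nat \<Rightarrow> ((nat \<Rightarrow> real) \<Rightarrow> real) \<Rightarrow> bool" where
  "has_pd n i f \<longleftrightarrow> (\<forall>x\<in>Rn n. (\<lambda>r. f (x(i := r))) differentiable (at (x i)))"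

definition C2 :: "nat \<Rightarrow> ((nat \<Rightarrow> real) \<Rightarrow> real) set" where
  "C2 n = {f \<in> Cb (Rn n).
     (\<forall>i<n. has_pd n i f \<and> pd i f \<in> Cb (Rn n)) \<and>
     (\<forall>i<n. \<forall>j<n. has_pd n i (pd j f) \<and> pd i (pd j f) \<in> Cb (Rn n))}"

definition C2c :: "nat \<Rightarrow> ((nat \<Rightarrow> real) \<Rightarrow> real) set" where
  "C2c n = {f \<in> C2 n. \<exists>K. compact K \<and> K \<subseteq> Rn n \<and> (\<forall>x\<in>Rn n - K. f x = 0)}"

definition C2hat :: "nat \<Rightarrow> ((nat \<Rightarrow> real) \<Rightarrow> real) set" where
  "C2hat n = {f \<in> C2 n. f \<in> Chat (Rn n) \<and> (\<forall>i<n. pd i f \<in> Chat (Rn n)) \<and>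
     (\<forall>i<n. \<forall>j<n. pd i (pd j f) \<in> Chat (Rn n))}"

definition C2del :: "nat \<Rightarrow> ((nat \<Rightarrow> real) \<Rightarrow> real) set" where
  "C2del n = {f. \<exists>k. (\<lambda>x. f x - k) \<in> C2hat n}"

definition C20 :: "nat \<Rightarrow> ((nat \<Rightarrow> real) \<Rightarrow> real) set" where
  "C20 n = {f \<in> C2del n.
     (\<lambda>x. (1 + (\<Sum>k<n. (x k)\<^sup>2)) * (\<Sum>i<n. \<bar>pd i f x\<bar>)) \<in> Chat (Rn n) \<and>
     (\<lambda>x. (1 + (\<Sum>k<n. (x k)\<^sup>2)) * (\<Sum>i<n. \<Sum>j<n. \<bar>pd i (pd j f) x\<bar>)) \<in> Chat (Rn n)}"

text \<open>Functions of a real variable, regarded as functions on \<open>Rn 1\<close>.\<close>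

definition on_real :: "((nat \<Rightarrow> real) \<Rightarrow> real) set \<Rightarrow> (real \<Rightarrow> real) set" where
  "on_real S = {g. (\<lambda>v. g (v 0)) \<in> S}"

definition nonneg :: "('e \<Rightarrow> real) set \<Rightarrow> ('e \<Rightarrow> real) set" where
  "nonneg S = {f \<in> S. \<forall>x. 0 \<le> f x}"


section \<open>Feller semigroups and transition densities\<close>

text \<open>
  For the semigroups the dimension is fixed, so \<open>\<real>\<^sup>m\<close> is a Euclidean space \<open>'a\<close> and its
  coordinates are \<open>x \<bullet> b\<close> for \<open>b \<in> Basis\<close>.
\<close>

definition pde :: "'a::euclidean_space \<Rightarrow> ('a \<Rightarrow> real) \<Rightarrow> 'a \<Rightarrow> real" where
  "pde b f x = deriv (\<lambda>r. f (x + r *\<^sub>R b)) 0"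

definition Ccinf :: "('a::euclidean_space \<Rightarrow> real) set" where
  "Ccinf = {f. (\<exists>K. compact K \<and> (\<forall>x. x \<notin> K \<longrightarrow> f x = 0)) \<and>
     (\<forall>bs. set bs \<subseteq> Basis \<longrightarrow> continuous_on UNIV (foldr pde bs f) \<and>
        (\<forall>b\<in>Basis. \<forall>x. (\<lambda>r. foldr pde bs f (x + r *\<^sub>R b)) differentiable (at 0)))}"

definition Gop :: "(real \<Rightarrow> real) \<Rightarrow> (real \<Rightarrow> real) \<Rightarrow> ('a::euclidean_space \<Rightarrow> real) \<Rightarrow> 'a \<Rightarrow> real"
  where
  "Gop a \<rho> f x =
     (1/2) * (\<Sum>i\<in>Basis. a (x \<bullet> i) * pde i (pde i f) x) +
     (1/2) * (\<Sum>i\<in>Basis. \<Sum>j\<in>Basis - {i}. \<rho> (x \<bullet> i - x \<bullet> j) * pde i (pde j f) x)"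

text \<open>Conservativeness is not demanded: for bounded coefficients it follows from the identification
  of the generator in \<open>G_semigroup\<close> below.\<close>

definition feller_semigroup :: "(real \<Rightarrow> ('a::euclidean_space \<Rightarrow> real) \<Rightarrow> 'a \<Rightarrow> real) \<Rightarrow> bool" where
  "feller_semigroup P \<longleftrightarrow>
     (\<forall>t\<ge>0. \<forall>f\<in>Chat UNIV. P t f \<in> Chat UNIV) \<and>
     (\<forall>t\<ge>0. \<forall>f\<in>Chat UNIV. \<forall>g\<in>Chat UNIV. \<forall>k l.
        P t (\<lambda>x. k * f x + l * g x) = (\<lambda>x. k * P t f x + l * P t g x)) \<and>
     (\<forall>t\<ge>0. \<forall>f\<in>Chat UNIV. (\<forall>x. 0 \<le> f x) \<longrightarrow> (\<forall>x. 0 \<le> P t f x)) \<and>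
     (\<forall>t\<ge>0. \<forall>f\<in>Chat UNIV. \<forall>k. (\<forall>x. \<bar>f x\<bar> \<le> k) \<longrightarrow> (\<forall>x. \<bar>P t f x\<bar> \<le> k)) \<and>
     (\<forall>f\<in>Chat UNIV. P 0 f = f) \<and>
     (\<forall>s\<ge>0. \<forall>t\<ge>0. \<forall>f\<in>Chat UNIV. P (s + t) f = P s (P t f)) \<and>
     (\<forall>f\<in>Chat UNIV. uniform_limit UNIV (\<lambda>t. P t f) f (at_right 0))"

text \<open>The canonical extension of a Feller semigroup to \<open>Bm\<close>: integration against the
  (sub-Markov) kernel which represents it on \<open>Chat UNIV\<close>.\<close>

definition extended_to_Bm :: "(real \<Rightarrow> ('a::euclidean_space \<Rightarrow> real) \<Rightarrow> 'a \<Rightarrow> real) \<Rightarrow> bool" where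
  "extended_to_Bm P \<longleftrightarrow>
     (\<forall>t\<ge>0. \<forall>x. \<exists>\<nu>. subprob_space \<nu> \<and> sets \<nu> = sets borel \<and> (\<forall>f\<in>Bm. P t f x = (\<integral>y. f y \<partial>\<nu>)))"

definition generator :: "(real \<Rightarrow> ('a::euclidean_space \<Rightarrow> real) \<Rightarrow> 'a \<Rightarrow> real) \<Rightarrow>
    (('a \<Rightarrow> real) \<times> ('a \<Rightarrow> real)) set" where
  "generator P = {(f, g). f \<in> Chat UNIV \<and> g \<in> Chat UNIV \<and>
     uniform_limit UNIV (\<lambda>t x. (P t f x - f x) / t) g (at_right 0)}"

definition Gclosure :: "(real \<Rightarrow> real) \<Rightarrow> (real \<Rightarrow> real) \<Rightarrow>
    (('a::euclidean_space \<Rightarrow> real) \<times> ('a \<Rightarrow> real)) set" where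
  "Gclosure a \<rho> = {(f, g). f \<in> Chat UNIV \<and> g \<in> Chat UNIV \<and>
     (\<exists>F :: nat \<Rightarrow> 'a \<Rightarrow> real. (\<forall>n. F n \<in> Ccinf) \<and> uniform_limit UNIV F f sequentially \<and>
        uniform_limit UNIV (\<lambda>n. Gop a \<rho> (F n)) g sequentially)}"

definition G_semigroup :: "(real \<Rightarrow> real) \<Rightarrow> (real \<Rightarrow> real) \<Rightarrow>
    (real \<Rightarrow> ('a::euclidean_space \<Rightarrow> real) \<Rightarrow> 'a \<Rightarrow> real) \<Rightarrow> bool" where
  "G_semigroup a \<rho> P \<longleftrightarrow>
     feller_semigroup P \<and> extended_to_Bm P \<and> generator P = Gclosure a \<rho>"

definition transition_density :: "(real \<Rightarrow> ('a::euclidean_space \<Rightarrow> real) \<Rightarrow> 'a \<Rightarrow> real) \<Rightarrow>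
    (real \<Rightarrow> 'a \<Rightarrow> 'a \<Rightarrow> real) \<Rightarrow> bool" where
  "transition_density P p \<longleftrightarrow>
     (\<forall>t>0. \<forall>x. integrable lborel (p t x) \<and> (\<forall>y. 0 \<le> p t x y) \<and>
        (\<forall>f\<in>Bm. P t f x = (\<integral>y. f y * p t x y \<partial>lborel)))"

text \<open>\<open>\<integral> p\<^sub>r(y, z) g(z) dz\<close>, read as \<open>g y\<close> when \<open>r = 0\<close>.\<close>

definition pint :: "(real \<Rightarrow> real \<Rightarrow> real \<Rightarrow> real) \<Rightarrow> real \<Rightarrow> (real \<Rightarrow> real) \<Rightarrow> real \<Rightarrow> real" where
  "pint p r g y = (if r = 0 then g y else (\<integral>z. p r y z * g z \<partial>lborel))"


section \<open>Measure-valued paths\<close>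

definition weak_top :: "real measure topology" where
  "weak_top = topology_generated_by
     {{\<mu>. finite_borel_measure \<mu> \<and> (\<integral>x. f x \<partial>\<mu>) \<in> U} | f U. f \<in> Cb UNIV \<and> open U}"

definition MR :: "real measure measure" where
  "MR = sigma (topspace weak_top) {U. openin weak_top U}"

definition cadlag_paths :: "(real \<Rightarrow> real measure) set" where
  "cadlag_paths = {\<omega> \<in> {0..} \<rightarrow>\<^sub>E topspace weak_top.
     (\<forall>t\<ge>0. limitin weak_top \<omega> (\<omega> t) (at_right t)) \<and>
     (\<forall>t>0. \<exists>l. limitin weak_top \<omega> l (at_left t))}"

text \<open>
  The natural filtration of the coordinate process \<open>X\<^sub>s(\<omega>) = \<omega> s\<close>.  Its index is extended to
  \<open>[0,\<infty>]\<close> so that stopping times may be infinite; at \<open>\<infty>\<close> it is the \<open>\<sigma>\<close>-algebra generated by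
  all coordinates, which is the Borel \<open>\<sigma>\<close>-algebra of the Skorokhod topology.
\<close>

definition path_filt :: "ennreal \<Rightarrow> (real \<Rightarrow> real measure) measure" where
  "path_filt t = sigma cadlag_paths
     {(\<lambda>\<omega>. \<omega> s) -` A \<inter> cadlag_paths | s A. 0 \<le> s \<and> ennreal s \<le> t \<and> A \<in> sets MR}"


section \<open>Martingales and the Markov property\<close>

definition martingale ::
    "'w measure \<Rightarrow> (ennreal \<Rightarrow> 'w measure) \<Rightarrow> (real \<Rightarrow> 'w \<Rightarrow> real) \<Rightarrow> bool" where
  "martingale Q F N \<longleftrightarrow>
     (\<forall>t\<ge>0. integrable Q (N t) \<and> N t \<in> borel_measurable (F (ennreal t))) \<and>
     (\<forall>s t. 0 \<le> s \<and> s \<le> t \<longrightarrow> (AE \<omega> in Q. real_cond_exp Q (F (ennreal s)) (N t) \<omega> = N s \<omega>))"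

definition local_martingale ::
    "'w measure \<Rightarrow> (ennreal \<Rightarrow> 'w measure) \<Rightarrow> (real \<Rightarrow> 'w \<Rightarrow> real) \<Rightarrow> bool" where
  "local_martingale Q F N \<longleftrightarrow>
     (\<forall>t\<ge>0. N t \<in> borel_measurable (F (ennreal t))) \<and>
     (\<exists>\<tau> :: nat \<Rightarrow> 'w \<Rightarrow> ennreal.
        (\<forall>n. stopping_time F (\<tau> n)) \<and>
        (AE \<omega> in Q. incseq (\<lambda>n. \<tau> n \<omega>) \<and> (\<lambda>n. \<tau> n \<omega>) \<longlonglongrightarrow> \<infinity>) \<and>
        (\<forall>n. martingale Q F (\<lambda>t \<omega>. N (enn2real (min (ennreal t) (\<tau> n \<omega>))) \<omega>)))"

definition markov_paths :: "(real \<Rightarrow> real measure) measure \<Rightarrow> bool" where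
  "markov_paths Q \<longleftrightarrow>
     (\<forall>s t. 0 \<le> s \<and> s \<le> t \<longrightarrow>
        (\<forall>\<Phi> \<in> borel_measurable MR. bounded (\<Phi> ` space MR) \<longrightarrow>
           (AE \<omega> in Q. real_cond_exp Q (path_filt (ennreal s)) (\<lambda>\<omega>. \<Phi> (\<omega> t)) \<omega> =
              real_cond_exp Q (vimage_algebra cadlag_paths (\<lambda>\<omega>. \<omega> s) MR) (\<lambda>\<omega>. \<Phi> (\<omega> t)) \<omega>)))"


section \<open>The superprocess with dependent spatial motion\<close>

definition phivec :: "nat \<Rightarrow> (nat \<Rightarrow> real \<Rightarrow> real) \<Rightarrow> real measure \<Rightarrow> nat \<Rightarrow> real" where
  "phivec m \<phi> \<mu> = (\<lambda>i\<in>{..<m}. \<integral>x. \<phi> i x \<partial>\<mu>)"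

definition cyl :: "nat \<Rightarrow> ((nat \<Rightarrow> real) \<Rightarrow> real) \<Rightarrow> (nat \<Rightarrow> real \<Rightarrow> real) \<Rightarrow> real measure \<Rightarrow> real" where
  "cyl m f \<phi> \<mu> = f (phivec m \<phi> \<mu>)"

definition Aop :: "(real \<Rightarrow> real) \<Rightarrow> (real \<Rightarrow> real) \<Rightarrow>
    nat \<Rightarrow> ((nat \<Rightarrow> real) \<Rightarrow> real) \<Rightarrow> (nat \<Rightarrow> real \<Rightarrow> real) \<Rightarrow> real measure \<Rightarrow> real" where
  "Aop a \<rho> m f \<phi> \<mu> =
     (1/2) * (\<Sum>i<m. pd i f (phivec m \<phi> \<mu>) * (\<integral>x. a x * deriv (deriv (\<phi> i)) x \<partial>\<mu>)) +
     (1/2) * (\<Sum>i<m. \<Sum>j<m. pd i (pd j f) (phivec m \<phi> \<mu>) *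
        (\<integral>(x, y). \<rho> (x - y) * deriv (\<phi> i) x * deriv (\<phi> j) y \<partial>(\<mu> \<Otimes>\<^sub>M \<mu>)))"

definition Bop :: "(real \<Rightarrow> real) \<Rightarrow> (real \<Rightarrow> real measure) \<Rightarrow>
    nat \<Rightarrow> ((nat \<Rightarrow> real) \<Rightarrow> real) \<Rightarrow> (nat \<Rightarrow> real \<Rightarrow> real) \<Rightarrow> real measure \<Rightarrow> real" where
  "Bop \<sigma> \<gamma> m f \<phi> \<mu> =
     (1/2) * (\<Sum>i<m. \<Sum>j<m. pd i (pd j f) (phivec m \<phi> \<mu>) * (\<integral>x. \<sigma> x * \<phi> i x * \<phi> j x \<partial>\<mu>)) +
     (\<integral>x. (\<integral>\<xi>. f (\<lambda>i\<in>{..<m}. phivec m \<phi> \<mu> i + \<xi> * \<phi> i x) - f (phivec m \<phi> \<mu>)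
                 - \<xi> * (\<Sum>i<m. pd i f (phivec m \<phi> \<mu>) * \<phi> i x) \<partial>\<gamma> x) \<partial>\<mu>)"

definition Lop :: "(real \<Rightarrow> real) \<Rightarrow> (real \<Rightarrow> real) \<Rightarrow> (real \<Rightarrow> real) \<Rightarrow> (real \<Rightarrow> real measure) \<Rightarrow>
    nat \<Rightarrow> ((nat \<Rightarrow> real) \<Rightarrow> real) \<Rightarrow> (nat \<Rightarrow> real \<Rightarrow> real) \<Rightarrow> real measure \<Rightarrow> real" where
  "Lop a \<rho> \<sigma> \<gamma> m f \<phi> \<mu> = Aop a \<rho> m f \<phi> \<mu> + Bop \<sigma> \<gamma> m f \<phi> \<mu>"

text \<open>
  The branching mechanism
  \<open>\<Psi>(x,z) = \<sigma>(x) z\<^sup>2 / 2 + \<integral> (exp (- z \<xi>) - 1 + z \<xi>) \<gamma>(x,d\<xi>)\<close> enters through the pair \<open>(\<sigma>, \<gamma>)\<close>.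
\<close>

definition kernel_pos :: "(real \<Rightarrow> real measure) \<Rightarrow> bool" where
  "kernel_pos \<gamma> \<longleftrightarrow>
     (\<forall>x. sets (\<gamma> x) = sets (restrict_space borel {0<..})) \<and>
     (\<forall>\<Gamma> \<in> sets (restrict_space borel {0<..}). (\<lambda>x. emeasure (\<gamma> x) \<Gamma>) \<in> borel_measurable borel)"

text \<open>\<open>Q\<close> is the law on path space of the SDSM started at \<open>\<mu>\<close>: a Markov solution of the
  \<open>(\<L>, \<mu>)\<close>-martingale problem.  That this solution is unique is a theorem about the
  problem, not a condition on \<open>Q\<close>, and is not assumed.\<close>

definition SDSM :: "(real \<Rightarrow> real) \<Rightarrow> (real \<Rightarrow> real) \<Rightarrow> (real \<Rightarrow> real) \<Rightarrow> (real \<Rightarrow> real measure) \<Rightarrow>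
    real measure \<Rightarrow> (real \<Rightarrow> real measure) measure \<Rightarrow> bool" where
  "SDSM a \<rho> \<sigma> \<gamma> \<mu> Q \<longleftrightarrow>
     prob_space Q \<and> sets Q = sets (path_filt \<infinity>) \<and>
     (AE \<omega> in Q. \<omega> 0 = \<mu>) \<and>
     markov_paths Q \<and>
     (\<forall>m f \<phi>. f \<in> C20 m \<and> (\<forall>i<m. \<phi> i \<in> nonneg (on_real (C2c 1))) \<longrightarrow>
        local_martingale Q path_filt (\<lambda>t \<omega>. cyl m f \<phi> (\<omega> t) - cyl m f \<phi> (\<omega> 0) -
          (LINT s:{0..t}|lborel. Lop a \<rho> \<sigma> \<gamma> m f \<phi> (\<omega> s))))"

end

theory Submission
 imports Defs
begin

text \<open>
 For the functions \<open>z\<close> and \<open>z\<^sup>2\<close> of one linear functional the martingale problem would give closed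
 equations for the first two moments, but these functions are not admissible and the solution is
 only a local martingale.  Both obstacles are removed by damping with
 \<open>exp (- \<theta> \<integral> (1 + \<langle>1, X\<rangle>)\<^sup>2)\<close>: damped quantities are uniformly bounded, so truncated test functions
 may be used, and letting \<open>\<theta> \<rightarrow> 0\<close> yields first the integrability of \<open>\<langle>1, X\<rangle>\<^sup>2\<close> and then the moment identities.
 By polarisation and mollification they become forward equations for the mean of \<open>X\<close> and of
 \<open>X \<otimes> X\<close>, driven by \<open>G\<^sup>1\<close> and \<open>G\<^sup>2\<close>, the latter with the source \<open>\<sigma>(x) + \<integral> \<xi>\<^sup>2 \<gamma>(x, d\<xi>)\<close> on the
 diagonal.  Since the domain of a Feller generator is dense and invariant, telescoping
 \<open>r \<mapsto> L\<^sub>r (P\<^sub>t\<^sub>-\<^sub>r h)\<close> over small steps solves such an equation, which gives Duhamel's formula.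
\<close>

section \<open>Bounded measurable functions\<close>

text \<open>The clock rate is quadratic because the generator applied to g(<f, X>) is linear in the
  total mass except for the interaction through \<rho>, which is quadratic. The localising times are
  arbitrary, so every bound must survive stopping at an unknown earlier time. With Y = \<integral>
  (1 + <1, X>)^2 the compensated process is at most 2B + C Y at any time up to the present, and (2B
  + C Y) exp(-\<theta> Y) is bounded; this is what makes dominated convergence possible. A drift
  bounded by c (1 + <1, X>)^2 then costs c/\<theta>, so truncation has to outrun damping: level (j +
  1)^2 against \<theta> = 1/(j + 1). The branching part of the second moment does not shrink under
  truncation, but it is of first order in the mass, and the first moment, obtained before, pays for
  it. Polarisation must respect that test functions are nonnegative, hence f + g and large added
  bumps instead of differences. Mollification helps because a smooth function convolved with a
  product kernel is a superposition of shifted products; smooth functions are a core of the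
  generator, and all of its domain follows by closure.\<close>

lemma BmI:
 assumes "f \<in> borel_measurable borel" "!!x. \<bar>f x\<bar> <= C"
 shows "f \<in> Bm"
 using assms by (auto simp: Bm_def bounded_iff)

lemma Bm_measurable[measurable_dest]: "f \<in> Bm ==> f \<in> borel_measurable borel"
 by (simp add: Bm_def)

lemma BmE:
 assumes "f \<in> Bm"
 obtains C where "0 <= C" "!!x. \<bar>f x\<bar> <= C"
proof -
 from assms obtain C where "!!x. \<bar>f x\<bar> <= C"
  by (auto simp: Bm_def bounded_iff)
 then show thesis using that[of C] abs_ge_zero order_trans by blast
qed

lemma Bm_const[simp]: "(%x. c) \<in> Bm"
 by (rule BmI[where C = "\<bar>c\<bar>"]) auto

lemma Bm_add:
 assumes "f \<in> Bm" "g \<in> Bm" shows "(%x. f x + g x) \<in> Bm"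
proof -
 obtain C D where "!!x. \<bar>f x\<bar> <= C" "!!x. \<bar>g x\<bar> <= D" using assms by (metis BmE)
 then show ?thesis using assms
  by (intro BmI[where C = "C + D"]) (auto dest!: Bm_measurable intro: order_trans[OF abs_triangle_ineq add_mono])
qed

lemma Bm_mult:
 assumes "f \<in> Bm" "g \<in> Bm" shows "(%x. f x * g x) \<in> Bm"
proof -
 obtain C D where "!!x. \<bar>f x\<bar> <= C" "!!x. \<bar>g x\<bar> <= D" "0 <= C" using assms by (metis BmE)
 then show ?thesis using assms
  by (intro BmI[where C = "C * D"]) (auto dest!: Bm_measurable simp: abs_mult intro!: mult_mono)
qed

lemma Bm_diff:
 assumes "f \<in> Bm" "g \<in> Bm" shows "(%x. f x - g x) \<in> Bm"
 using Bm_add[OF assms(1) Bm_mult[OF Bm_const[of "-1"] assms(2)]] by simp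

lemma Bm_compose:
 fixes f :: "'b::topological_space => real"
 assumes "f \<in> Bm" "g \<in> borel_measurable borel" shows "(%x. f (g x)) \<in> Bm"
proof -
 obtain C where "!!x. \<bar>f x\<bar> <= C" using assms by (metis BmE)
 then show ?thesis using assms
  by (intro BmI[where C = C]) (auto dest!: Bm_measurable)
qed

lemma Cb_UNIV_Bm:
 fixes f :: "'a::topological_space => real"
 shows "f \<in> Cb UNIV ==> f \<in> Bm"
 by (auto simp: Cb_def Bm_def intro!: borel_measurable_continuous_onI)

lemma Bm_integrable:
 assumes "finite_measure M" "sets M = sets borel" "f \<in> Bm"
 shows "integrable M f"
proof -
 interpret finite_measure M by fact
 obtain C where "!!x. \<bar>f x\<bar> <= C" using assms by (metis BmE)
 moreover have "f \<in> borel_measurable M"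
  using Bm_measurable[OF assms(3)] by (simp add: measurable_cong_sets[OF assms(2) refl])
 ultimately show ?thesis
  by (intro integrable_const_bound[where B=C]) auto
qed

lemma ChatI:
 fixes f :: "'a::euclidean_space => real"
 assumes "continuous_on UNIV f" "compact K" "!!x. x \<notin> K ==> f x = 0"
 shows "f \<in> Chat UNIV"
 using assms unfolding Chat_def by fastforce

lemma Chat_bounded:
 fixes f :: "'a::topological_space => real"
 assumes "f \<in> Chat UNIV"
 obtains C where "0 <= C" "!!x. \<bar>f x\<bar> <= C"
proof -
 have "\<exists>K. compact K \<and> K \<subseteq> UNIV \<and> (\<forall>x\<in>UNIV - K. \<bar>f x\<bar> < 1)"
  using assms zero_less_one unfolding Chat_def by blast
 then obtain K where K: "compact K" "!!x. x \<notin> K ==> \<bar>f x\<bar> < 1" by auto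
 have cf: "continuous_on UNIV f" using assms by (simp add: Chat_def)
 have "compact (f ` K)"
  using compact_continuous_image[OF continuous_on_subset[OF cf]] K by auto
 then have "bounded (f ` K)" by (rule compact_imp_bounded)
 then obtain D where D: "!!x. x \<in> K ==> \<bar>f x\<bar> <= D" by (auto simp: bounded_iff)
 show thesis
 proof (rule that[of "max 1 D"])
  show "\<bar>f x\<bar> <= max 1 D" for x
   using K(2)[of x] D[of x] by (cases "x \<in> K") auto
 qed auto
qed

lemma Chat_Cb: 
 fixes f :: "'a::topological_space => real"
 assumes "f \<in> Chat UNIV" shows "f \<in> Cb UNIV"
proof -
 obtain C where "!!x. \<bar>f x\<bar> <= C" using Chat_bounded[OF assms] by blast
 then show ?thesis using assms by (auto simp: Cb_def Chat_def bounded_iff)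
qed

lemma Chat_Bm:
 fixes f :: "'a::topological_space => real"
 shows "f \<in> Chat UNIV ==> f \<in> Bm"
 by (intro Cb_UNIV_Bm Chat_Cb)

lemma Chat_lin:
 fixes f g :: "'a::t2_space => real"
 assumes "f \<in> Chat UNIV" "g \<in> Chat UNIV"
 shows "(%x. k * f x + l * g x) \<in> Chat UNIV"
proof -
 have "\<exists>K. compact K \<and> (\<forall>x. x \<notin> K \<longrightarrow> \<bar>k * f x + l * g x\<bar> < e)" if e: "0 < e" for e
 proof -
  define d where "d = e / (1 + \<bar>k\<bar> + \<bar>l\<bar>)"
  have d: "0 < d" using e by (auto simp: d_def intro!: divide_pos_pos)
  obtain K where K: "compact K" "!!x. x \<notin> K ==> \<bar>f x\<bar> < d"
   using assms(1) d unfolding Chat_def by force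
  obtain L where L: "compact L" "!!x. x \<notin> L ==> \<bar>g x\<bar> < d"
   using assms(2) d unfolding Chat_def by force
  have "\<bar>k * f x + l * g x\<bar> < e" if "x \<notin> K \<union> L" for x
  proof -
   have "\<bar>k * f x + l * g x\<bar> <= \<bar>k\<bar> * \<bar>f x\<bar> + \<bar>l\<bar> * \<bar>g x\<bar>"
    by (metis abs_mult abs_triangle_ineq)
   also have "\<dots> <= \<bar>k\<bar> * d + \<bar>l\<bar> * d"
    using that K(2)[of x] L(2)[of x] by (intro add_mono mult_left_mono) auto
   also have "\<dots> < d + \<bar>k\<bar> * d + \<bar>l\<bar> * d" using d by simp
   also have "\<dots> = e"
   proof -
    have "1 + \<bar>k\<bar> + \<bar>l\<bar> > 0" by (simp add: add_pos_nonneg)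
    then have "d * (1 + \<bar>k\<bar> + \<bar>l\<bar>) = e" unfolding d_def by simp
     then show ?thesis by (simp only: ring_distribs mult_1_right mult.commute)
   qed
   finally show ?thesis .
  qed
  then show ?thesis using K(1) L(1) by (intro exI[of _ "K \<union> L"]) auto
 qed
 moreover have "continuous_on UNIV (%x. k * f x + l * g x)"
  using assms by (auto simp: Chat_def intro!: continuous_intros)
 ultimately show ?thesis unfolding Chat_def by (auto simp: Ball_def)
qed

text \<open>A monotone class theorem with bounded pointwise limits. Bounded open sets are limits of
  functions built from the distance to the complement, boxes form an intersection-stable generator,
  and disjoint unions, simple functions and increasing limits do the rest. It reduces identities
  between functionals from bounded measurable functions to continuous ones vanishing at
  infinity.\<close>

theorem Bm_induct[consumes 1, case_names Chat lin lim]: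
 fixes f :: "'a::euclidean_space => real"
 assumes f: "f \<in> Bm"
  and Chat: "!!f. f \<in> Chat UNIV ==> P f"
  and lin: "!!f g c. f \<in> Bm ==> g \<in> Bm ==> P f ==> P g ==> P (%x. f x + c * g x)"
  and lim: "!!F f C. (!!n::nat. F n \<in> Bm) ==> (!!n. P (F n)) ==> (!!n x. \<bar>F n x\<bar> <= C) ==>
   (!!x. (%n. F n x) \<longlonglongrightarrow> f x) ==> P f"
 shows "P f"
proof -
 have ind_Bm: "(indicator A :: 'a => real) \<in> Bm" if "A \<in> sets borel" for A
  using that by (intro BmI[where C=1]) (auto simp: indicator_def)
 have P0: "P (%x. 0)" by (rule Chat) (rule ChatI[of _ "{}"], auto)
 have P_open: "P (indicator U)" if U: "open U" "bounded U" for U :: "'a set"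
 proof -
  \<comment> \<open>\<open>infdist\<close> to the empty set is 0, which would make \<open>F\<close>
    vanish identically; boundedness of \<open>U\<close> rules this out.\<close>
  have ne: "- U \<noteq> {}" using U(2) by (metis Compl_empty_eq double_compl not_bounded_UNIV)
  define F where "F n x = min 1 (real n * infdist x (- U))" for n :: nat and x
  have "F n \<in> Chat UNIV" for n
  proof (rule ChatI[where K = "closure U"])
   show "continuous_on UNIV (F n)" unfolding F_def by (intro continuous_intros)
   show "compact (closure U)" using U(2) by simp
   fix x assume "x \<notin> closure U"
   then have "x \<in> - U" using closure_subset by auto
   then show "F n x = 0" by (simp add: F_def)
  qed
  moreover have "\<bar>F n x\<bar> <= 1" for n x unfolding F_def by (simp add: infdist_nonneg abs_le_iff)
  moreover have "(%n. F n x) \<longlonglongrightarrow> indicator U x" for x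
  proof (cases "x \<in> U")
   case True
   then have pos: "0 < infdist x (- U)"
    using infdist_pos_not_in_closed[of "- U" x] U(1) ne by auto
   obtain n0 where n0: "1 / infdist x (- U) < real n0" using reals_Archimedean2 by blast
   have "F n x = 1" if "n0 <= n" for n
   proof -
    have "1 / infdist x (- U) < real n" using n0 that by linarith
    then have "1 < real n * infdist x (- U)" using pos by (simp add: field_simps)
    then show ?thesis by (simp add: F_def)
   qed
   then have "(%n. F n x) \<longlonglongrightarrow> 1"
    by (intro tendsto_eventually) (auto simp: eventually_sequentially)
   then show ?thesis using True by simp
  next
   case False
   then show ?thesis by (simp add: F_def)
  qed
  ultimately show ?thesis using lim[of F 1 "indicator U"] Chat Chat_Bm by blast
 qed
 have P1: "P (%x. 1)"
 proof (rule lim[of "%n. indicator (ball 0 (real n))" 1])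
  show "(%n. indicator (ball 0 (real n)) x :: real) \<longlonglongrightarrow> 1" for x :: 'a
  proof (rule tendsto_eventually)
   obtain n0 where "norm x < real n0" using reals_Archimedean2 by blast
   then show "\<forall>\<^sub>F n in sequentially. indicator (ball 0 (real n)) x = (1::real)"
    unfolding eventually_sequentially
    by (intro exI[of _ n0]) (auto simp: indicator_def)
  qed
 qed (auto intro!: P_open ind_Bm simp: indicator_def)
 have P_ind: "P (indicator A)" if "A \<in> sets borel" for A :: "'a set"
 proof -
  have eq: "sets borel = sigma_sets (UNIV :: 'a set) (range (%(a, b). box a b))"
   unfolding borel_eq_box by (simp add: sets_measure_of)
  have "A \<in> sigma_sets UNIV (range (%(a, b). box a b))" using that eq by simp
  then have 3: "A \<in> sigma_sets UNIV (range (%(a, b). box a b))" .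
  have 1: "Int_stable (range (%(a, b). box a (b :: 'a)))"
   by (auto simp: Int_stable_def box_Int_box)
  have 2: "range (%(a, b). box a (b :: 'a)) \<subseteq> Pow UNIV" by simp
  show ?thesis
   using 1 2 3
  proof (induction rule: sigma_sets_induct_disjoint)
   case (basic A)
   then show ?case by (auto intro!: P_open bounded_box)
  next
   case empty
   then show ?case using P0 by (simp add: indicator_def[abs_def])
  next
   case (compl A)
   have "(indicator (UNIV - A) :: 'a => real) = (%x. 1 + (-1) * indicator A x)"
    by (auto simp: indicator_def)
   then show ?case using lin[of "%x. 1" "indicator A" "-1"] P1 compl ind_Bm[of A] eq by auto
  next
   case (union A)
   have A[measurable]: "A i \<in> sets borel" for i using union(2) eq by auto
   define S where "S n = (indicator (\<Union>i<n. A i) :: 'a => real)" for n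
   have SB: "S n \<in> Bm" for n unfolding S_def by (intro ind_Bm) auto
   have PS: "P (S n)" for n
   proof (induction n)
    case 0
    then show ?case using P0 by (simp add: S_def indicator_def[abs_def])
   next
    case (Suc n)
    have "S (Suc n) = (%x. S n x + 1 * indicator (A n) x)"
    proof
     fix x
     have "x \<notin> A i" if "x \<in> A n" "i < n" for i
      using disjoint_family_onD[OF union(1), of n i] that by auto
     then show "S (Suc n) x = S n x + 1 * indicator (A n) x"
      by (auto simp: S_def indicator_def less_Suc_eq)
    qed
    then show ?case using lin[OF SB[of n] ind_Bm[OF A[of n]] Suc union(3), of 1] by simp
   qed
   show ?case
   proof (rule lim[of S 1])
    show "(%n. S n x) \<longlonglongrightarrow> indicator (\<Union> (range A)) x" for x
     unfolding S_def by (rule LIMSEQ_indicator_UN)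
    show "\<bar>S n x\<bar> <= 1" for n x by (simp add: S_def indicator_def)
    show "S n \<in> Bm" "P (S n)" for n by (rule SB PS)+
   qed
  qed
 qed
 have P_pos: "P u" if u: "u \<in> Bm" "!!x. 0 <= u x" for u
 proof -
  have um: "u \<in> borel_measurable borel" using u by (simp add: Bm_def)
  \<comment> \<open>Membership in \<open>Bm\<close> is kept as a premise: the induction rule for
    nonnegative measurable functions forgets boundedness, and in each case the bound on the
    composite passes to its nonnegative constituents.\<close>
  have "u \<in> Bm \<longrightarrow> P u"
   using um u(2)
  proof (induction rule: borel_measurable_induct_real)
   case (set A)
   then show ?case using P_ind by auto
  next
   case (mult u c)
   show ?case
   proof
    assume b: "(%x. c * u x) \<in> Bm"
    show "P (%x. c * u x)"
    proof (cases "c = 0")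
     case True
     then show ?thesis using P0 by simp
    next
     case False
     have "u \<in> Bm" using Bm_mult[OF Bm_const[of "inverse c"] b] False by (simp add: field_simps)
     then show ?thesis using lin[OF Bm_const[of 0] _ P0, of u c] mult by auto
    qed
   qed
  next
   case (add u v)
   show ?case
   proof
    assume b: "(%x. v x + u x) \<in> Bm"
    obtain C where C: "!!x. \<bar>v x + u x\<bar> <= C" using b by (metis BmE)
    have "\<bar>u x\<bar> <= C" "\<bar>v x\<bar> <= C" for x
     using add.hyps(2)[of x] add.hyps(4)[of x] C[of x] by (auto simp: abs_le_iff)
    then have "u \<in> Bm" "v \<in> Bm" using BmI[OF add.hyps(1), of C] BmI[OF add.hyps(3), of C] by blast+
    then show "P (%x. v x + u x)" using lin[of v u 1] add by auto
   qed
  next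
   case (seq U)
   show ?case
   proof
    assume b: "u \<in> Bm"
    obtain C where C: "!!x. \<bar>u x\<bar> <= C" using b by (metis BmE)
    have le: "U i x <= u x" for i x
    proof (rule incseq_le)
     show "incseq (%i. U i x)" using seq.hyps(3) by (simp add: incseq_def le_fun_def)
     show "(%i. U i x) \<longlonglongrightarrow> u x" by (rule seq.hyps(4)) simp
    qed
    have bd: "\<bar>U i x\<bar> <= C" for i x using seq.hyps(2)[of i x] C[of x] le[of i x] by linarith
    then have UB: "U i \<in> Bm" for i using BmI[OF seq.hyps(1)] by blast
    show "P u"
    proof (rule lim[of U C])
     show "U n \<in> Bm" for n by (rule UB)
     show "P (U n)" for n using seq.IH UB by blast
     show "\<bar>U n x\<bar> <= C" for n x by (rule bd)
     show "(%n. U n x) \<longlonglongrightarrow> u x" for x by (rule seq.hyps(4)) simp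
    qed
   qed
  qed
  then show ?thesis using u by simp
 qed
 obtain C where C: "!!x. \<bar>f x\<bar> <= C" using f by (metis BmE)
 have fC: "(%x. f x + C) \<in> Bm" using Bm_add[OF f Bm_const] .
 have "P (%x. f x + C)" 
 proof (rule P_pos[OF fC])
  show "0 <= f x + C" for x using C[of x] by linarith
 qed
 from lin[OF fC Bm_const[of 1] this P1, of "- C"] show ?thesis by simp
qed


section \<open>Kernels\<close>

text \<open>The integral is the mean of the image measure \<open>distr (L w) borel (g w)\<close>,
  and forming image measures is measurable in the parameter.\<close>

lemma integral_measurable_kernel:
 assumes g[measurable]: "(%(w, x). g w x) \<in> borel_measurable (N \<Otimes>\<^sub>M B)"
  and L[measurable]: "L \<in> measurable N (subprob_algebra B)"
 shows "(%w. \<integral>x. (g w x :: real) \<partial>L w) \<in> borel_measurable N"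
proof -
 have [measurable]: "(%w. distr (L w) borel (g w)) \<in> measurable N (subprob_algebra borel)"
  by (rule measurable_distr2[OF g L])
 have "(%w. \<integral>y. y \<partial>(distr (L w) borel (g w))) \<in> borel_measurable N"
  by measurable
 moreover have "(LINT y|(distr (L w) borel (g w)). y) = (LINT x|L w. g w x)" if w: "w \<in> space N" for w
 proof (rule integral_distr)
  have "sets (L w) = sets B" using measurable_space[OF L w] by (simp add: space_subprob_algebra)
  moreover have "g w \<in> borel_measurable B"
   using measurable_Pair2[OF g w] by simp
  ultimately show "g w \<in> measurable (L w) borel"
   by (simp cong: measurable_cong_sets)
 qed simp
 ultimately show ?thesis by (simp cong: measurable_cong)
qed

text \<open>A measurable family of finite measures, tested against bounded continuous functions
  only: this is what evaluation of a path in the weak topology provides, and it involves no bound on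
  the total mass.\<close>

definition mkernel :: "'w measure => ('w => real measure) => bool" where
 "mkernel N X \<longleftrightarrow> (\<forall>w\<in>space N. finite_borel_measure (X w)) \<and>
   (\<forall>f\<in>Cb UNIV. (%w. \<integral>x. f x \<partial>X w) \<in> borel_measurable N)"

abbreviation mass :: "real measure => real" where
 "mass \<nu> \<equiv> measure \<nu> UNIV"

lemma fbm_sets: "finite_borel_measure M ==> sets M = sets borel"
 by (simp add: finite_borel_measure.M_is_borel)

lemma fbm_space: "finite_borel_measure M ==> space M = UNIV"
 using sets_eq_imp_space_eq[OF fbm_sets] by simp

lemma fbm_finite: "finite_borel_measure M ==> finite_measure M"
 by (simp add: finite_borel_measure_def)

lemma fbm_integrable: "finite_borel_measure M ==> f \<in> Bm ==> integrable M f"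
 by (intro Bm_integrable fbm_finite fbm_sets)

lemma fbm_integral_1: "finite_borel_measure M ==> (LINT x|M. c) = c * mass M"
 by (simp add: fbm_space)

lemma fbm_integral_bound:
 assumes M: "finite_borel_measure M" and f: "f \<in> Bm" "!!x. \<bar>f x\<bar> <= C"
 shows "\<bar>\<integral>x. f x \<partial>M\<bar> <= C * mass M"
proof -
 have "\<bar>\<integral>x. f x \<partial>M\<bar> <= (LINT x|M. \<bar>f x\<bar>)" by simp
 also have "\<dots> <= (LINT x|M. C)"
  using f fbm_integrable[OF M f(1)] fbm_integrable[OF M Bm_const]
  by (intro integral_mono) auto
 finally show ?thesis using fbm_integral_1[OF M, of C] by (simp only:)
qed

lemma mkernel_Bm:
 assumes X: "mkernel N X" and f: "f \<in> Bm"
 shows "(%w. \<integral>x. f x \<partial>X w) \<in> borel_measurable N"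
 using f
proof (induction rule: Bm_induct)
 case (Chat f)
 then show ?case using X Chat_Cb by (auto simp: mkernel_def)
next
 case (lin f g c)
 have "(LINT x|X w. f x + c * g x) = (LINT x|X w. f x) + c * (LINT x|X w. g x)" if "w \<in> space N" for w
  using X that fbm_integrable[OF _ lin(1), of "X w"] fbm_integrable[OF _ lin(2), of "X w"] by (auto simp: mkernel_def)
 then show ?case using lin by (simp cong: measurable_cong)
next
 case (lim F f C)
 show ?case
 proof (rule borel_measurable_LIMSEQ_real[OF _ lim.IH])
  fix w assume "w \<in> space N"
  then have w: "finite_borel_measure (X w)" using X by (auto simp: mkernel_def)
  have m: "F n \<in> borel_measurable (X w)" for n
   using Bm_measurable[OF lim.hyps(1)] by (simp add: measurable_cong_sets[OF fbm_sets[OF w] refl])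
  have mf: "f \<in> borel_measurable (X w)" 
   by (rule borel_measurable_LIMSEQ_real[where u = F, OF lim.hyps(3) m])
  show "(%n. \<integral>x. F n x \<partial>X w) \<longlonglongrightarrow> (LINT x|X w. f x)"
   by (rule integral_dominated_convergence[where w = "%x. C"])
    (use m mf lim.hyps(2,3) fbm_integrable[OF w Bm_const] in auto)
 qed
qed

lemma mkernel_mass: "mkernel N X ==> (%w. mass (X w)) \<in> borel_measurable N"
proof -
 assume X: "mkernel N X"
 have "mass (X w) = (LINT x|X w. 1)" if "w \<in> space N" for w
  using X that by (simp add: mkernel_def fbm_integral_1[of _ 1, simplified])
 then show ?thesis using mkernel_Bm[OF X Bm_const[of 1]] by (simp cong: measurable_cong)
qed

text \<open>Dividing by 1 + mass, rather than by the mass, also works for the zero measure. The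
  result is a subprobability kernel, for which measurability of parametrised integrals is
  available.\<close>

lemma mkernel_subprob:
 assumes X: "mkernel N X"
 shows "(%w. density (X w) (%_. ennreal (1 / (1 + mass (X w))))) \<in> measurable N (subprob_algebra borel)"
proof (rule measurable_subprob_algebra)
 note mkernel_mass[OF X, measurable]
 fix w assume "w \<in> space N"
 then have w: "finite_borel_measure (X w)" using X by (auto simp: mkernel_def)
 let ?c = "1 / (1 + mass (X w))"
 have sp: "space (density (X w) (%_. ennreal ?c)) = UNIV" using fbm_space[OF w] by simp
 have m: "emeasure (X w) UNIV = ennreal (mass (X w))"
  by (rule finite_measure.emeasure_eq_measure[OF fbm_finite[OF w]])
 have "emeasure (density (X w) (%_. ennreal ?c)) UNIV = ennreal ?c * emeasure (X w) UNIV"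
  by (rule emeasure_density_const) (simp add: fbm_sets[OF w])
 also have "\<dots> = ennreal (?c * mass (X w))"
  unfolding m by (rule ennreal_mult[symmetric]) (simp_all add: add_nonneg_nonneg)
 also have "\<dots> <= ennreal 1"
 proof (rule ennreal_leI)
  have "0 < 1 + mass (X w)" by (simp add: add_pos_nonneg)
  then show "?c * mass (X w) <= 1" by (simp add: field_simps)
 qed
 finally have "emeasure (density (X w) (%_. ennreal ?c)) UNIV <= 1" by simp
 then show "subprob_space (density (X w) (%_. ennreal ?c))"
  by (intro subprob_spaceI) (simp_all only: sp UNIV_not_empty not_False_eq_True)
 show "sets (density (X w) (%_. ennreal ?c)) = sets borel"
  using fbm_sets[OF w] by simp
next
 note mkernel_mass[OF X, measurable]
 fix A :: "real set" assume A[measurable]: "A \<in> sets borel"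
 have iA: "(indicator A :: real => real) \<in> Bm" by (rule BmI[where C=1]) (auto simp: indicator_def)
 have "emeasure (density (X w) (%_. ennreal (1 / (1 + mass (X w))))) A
   = ennreal (1 / (1 + mass (X w))) * ennreal (LINT x|X w. indicator A x)" if "w \<in> space N" for w
 proof -
  have w: "finite_borel_measure (X w)" using X that by (auto simp: mkernel_def)
  have "(LINT x|X w. indicator A x) = measure (X w) A"
   using fbm_space[OF w] by simp
  moreover have "emeasure (X w) A = ennreal (measure (X w) A)"
   by (rule finite_measure.emeasure_eq_measure[OF fbm_finite[OF w]])
  ultimately show ?thesis
   by (subst emeasure_density_const) (use A fbm_sets[OF w] in simp_all)
 qed
 moreover have [measurable]: "(%w. \<integral>x. indicator A x \<partial>X w :: real) \<in> borel_measurable N"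
  by (rule mkernel_Bm[OF X iA])
 have "(%w. ennreal (1 / (1 + mass (X w))) * ennreal (LINT x|X w. indicator A x)) \<in> borel_measurable N"
  by measurable
 ultimately show "(%w. emeasure (density (X w) (%_. ennreal (1 / (1 + mass (X w))))) A) \<in> borel_measurable N"
  by (simp cong: measurable_cong)
qed

text \<open>The normalisation of \<open>mkernel_subprob\<close> is undone by the factor
  \<open>1 + mass (X w)\<close>, which is itself measurable.\<close>

lemma mkernel_integral:
 assumes X: "mkernel N X" and g[measurable]: "(%(w, x). g w x) \<in> borel_measurable (N \<Otimes>\<^sub>M borel)"
 shows "(%w. \<integral>x. (g w x :: real) \<partial>X w) \<in> borel_measurable N"
proof -
 note mkernel_mass[OF X, measurable]
 have "(%w. (1 + mass (X w)) * (LINT x|density (X w) (%_. ennreal (1 / (1 + mass (X w)))). g w x))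
   \<in> borel_measurable N"
  by (intro borel_measurable_times integral_measurable_kernel[OF g mkernel_subprob[OF X]]) measurable
 moreover have "(1 + mass (X w)) * (LINT x|density (X w) (%_. ennreal (1 / (1 + mass (X w)))). g w x)
   = (LINT x|X w. g w x)" if "w \<in> space N" for w
 proof -
  have w: "finite_borel_measure (X w)" using X that by (auto simp: mkernel_def)
  have "g w \<in> borel_measurable borel" using measurable_Pair2[OF g that] by simp
  then have "g w \<in> borel_measurable (X w)" by (simp add: measurable_cong_sets[OF fbm_sets[OF w] refl])
  then have "(LINT x|density (X w) (%_. ennreal (1 / (1 + mass (X w)))). g w x)
    = (LINT x|X w. 1 / (1 + mass (X w)) * g w x)"
   by (subst integral_density) (auto simp: add_nonneg_nonneg)
  moreover have "1 + mass (X w) > 0" by (simp add: add_pos_nonneg)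
  ultimately show ?thesis by simp
 qed
 ultimately show ?thesis by (simp cong: measurable_cong)
qed

lemma fbm_pair:
 assumes M: "finite_borel_measure M" and h: "h \<in> Bm"
 shows "integrable (M \<Otimes>\<^sub>M M) h"
  and "(LINT z|(M \<Otimes>\<^sub>M M). h z) = (LINT x|M. (LINT y|M. h (x, y)))"
proof -
 interpret finite_measure M using M by (rule fbm_finite)
 interpret pair_sigma_finite M M ..
 have s: "sets (M \<Otimes>\<^sub>M M) = sets borel"
  using sets_pair_measure_cong[OF fbm_sets[OF M] fbm_sets[OF M]] borel_prod by metis
 have "finite_measure (M \<Otimes>\<^sub>M M)"
  by (rule finite_measure_pair_measure) (auto intro: finite_measure_axioms)
 then show i: "integrable (M \<Otimes>\<^sub>M M) h" by (rule Bm_integrable[OF _ s h])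
 show "(LINT z|(M \<Otimes>\<^sub>M M). h z) = (LINT x|M. (LINT y|M. h (x, y)))"
  using integral_fst'[OF i] by simp
qed

text \<open>The product integral is an iterated one; \<open>mkernel_integral\<close> is used twice,
  the first time with the outer variable as an additional parameter.\<close>

lemma mkernel_pair:
 assumes X: "mkernel N X" and h: "h \<in> Bm"
 shows "(%w. \<integral>z. h z \<partial>(X w \<Otimes>\<^sub>M X w)) \<in> borel_measurable N"
proof -
 have h'[measurable]: "h \<in> borel_measurable (borel \<Otimes>\<^sub>M borel)" using Bm_measurable[OF h] by (simp add: borel_prod)
 have "mkernel (N \<Otimes>\<^sub>M borel) (%(w, x::real). X w)"
  using X by (fastforce simp: mkernel_def space_pair_measure split_beta' intro: measurable_compose[OF measurable_fst])
 then have "(%z. \<integral>y. h (snd z, y) \<partial>((%(w, x::real). X w) z)) \<in> borel_measurable (N \<Otimes>\<^sub>M borel)"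
  by (rule mkernel_integral) measurable
 then have "(%(w, x). \<integral>y. h (x, y) \<partial>X w) \<in> borel_measurable (N \<Otimes>\<^sub>M borel)"
  by (simp add: split_beta')
 from mkernel_integral[OF X this]
 have "(%w. \<integral>x. (LINT y|X w. h (x, y)) \<partial>X w) \<in> borel_measurable N" by simp
 moreover have "(LINT z|(X w \<Otimes>\<^sub>M X w). h z) = (LINT x|X w. (LINT y|X w. h (x, y)))" if "w \<in> space N" for w
  using X that by (intro fbm_pair(2) h) (auto simp: mkernel_def)
 ultimately show ?thesis by (simp cong: measurable_cong)
qed


section \<open>Measure-valued paths\<close>

lemma topspace_weak_top: "topspace weak_top = {\<nu>. finite_borel_measure \<nu>}"
proof -
 \<comment> \<open>The zero function with the open set \<open>UNIV\<close> gives a generating set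
   that contains every finite Borel measure.\<close>
 have 0: "(%x. 0) \<in> Cb UNIV" by (auto simp: Cb_def)
 show ?thesis
  unfolding weak_top_def topology_generated_by_topspace
 proof (intro equalityI subsetI)
  fix \<nu> assume "\<nu> \<in> {\<nu>. finite_borel_measure \<nu>}"
  then have "\<nu> \<in> {\<nu>. finite_borel_measure \<nu> \<and> (LINT x|\<nu>. 0) \<in> (UNIV :: real set)}" by simp
  then show "\<nu> \<in> \<Union> {{\<mu>. finite_borel_measure \<mu> \<and> (LINT x|\<mu>. f x) \<in> U} | f U. f \<in> Cb UNIV \<and> open U}"
   using 0 open_UNIV by blast
 qed auto
qed

lemma openin_weak_top:
 assumes "f \<in> Cb UNIV" "open U"
 shows "openin weak_top {\<nu>. finite_borel_measure \<nu> \<and> (LINT x|\<nu>. f x) \<in> U}"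
 unfolding weak_top_def using assms by (intro topology_generated_by_Basis) blast

lemma space_path_filt[simp]: "space (path_filt t) = cadlag_paths"
 unfolding path_filt_def by (rule space_measure_of) auto

lemma sets_path_filt:
 "sets (path_filt t) = sigma_sets cadlag_paths
   {(%om. om s) -` A \<inter> cadlag_paths | s A. 0 <= s \<and> ennreal s <= t \<and> A \<in> sets MR}"
 unfolding path_filt_def by (rule sets_measure_of) auto

lemma path_filt_mono: "s <= t ==> sets (path_filt s) \<subseteq> sets (path_filt t)"
 unfolding sets_path_filt by (rule sigma_sets_mono') (use order_trans in blast)

lemma cadlag_fbm: "om \<in> cadlag_paths ==> 0 <= s ==> finite_borel_measure (om s)"
 by (auto simp: cadlag_paths_def topspace_weak_top PiE_def Pi_def)

lemma path_filt_coord: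
 assumes f: "f \<in> Cb UNIV" and s: "0 <= s" "ennreal s <= t"
 shows "(%om. \<integral>x. f x \<partial>om s) \<in> borel_measurable (path_filt t)"
proof (rule borel_measurableI)
 fix S :: "real set" assume S: "open S"
 let ?A = "{\<nu>. finite_borel_measure \<nu> \<and> (LINT x|\<nu>. f x) \<in> S}"
 have "?A \<in> {U. openin weak_top U}" using openin_weak_top[OF f S] by simp
 then have A: "?A \<in> sets MR"
  unfolding MR_def by (subst sets_measure_of) (auto dest: openin_subset)
 have "(%om. \<integral>x. f x \<partial>om s) -` S \<inter> space (path_filt t) = (%om. om s) -` ?A \<inter> cadlag_paths"
  using cadlag_fbm[OF _ s(1)] by auto
 then show "(%om. \<integral>x. f x \<partial>om s) -` S \<inter> space (path_filt t) \<in> sets (path_filt t)"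
  unfolding sets_path_filt using s A by (intro sigma_sets.Basic CollectI exI[of _ s] exI[of _ ?A]) simp
qed

lemma limitin_weak_top:
 assumes "limitin weak_top X l F" "f \<in> Cb UNIV"
 shows "((%s. \<integral>x. f x \<partial>X s) \<longlongrightarrow> (LINT x|l. f x)) F"
proof (rule topological_tendstoI)
 fix S :: "real set" assume S: "open S" "(LINT x|l. f x) \<in> S"
 let ?A = "{\<nu>. finite_borel_measure \<nu> \<and> (LINT x|\<nu>. f x) \<in> S}"
 have "l \<in> ?A" using assms(1) S by (auto simp: limitin_def topspace_weak_top)
 then have "eventually (%s. X s \<in> ?A) F"
  using assms(1) openin_weak_top[OF assms(2) S(1)] by (auto simp: limitin_def)
 then show "eventually (%s. (LINT x|X s. f x) \<in> S) F" by (rule eventually_mono) auto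
qed

lemma cadlag_right:
 assumes "om \<in> cadlag_paths" "0 <= t" "f \<in> Cb UNIV"
 shows "((%s. \<integral>x. f x \<partial>om s) \<longlongrightarrow> (LINT x|om t. f x)) (at_right t)"
 using assms by (intro limitin_weak_top) (auto simp: cadlag_paths_def)

lemma one_Cb[simp]: "(%x. c) \<in> Cb UNIV"
 by (auto simp: Cb_def)

text \<open>Right continuity at a point and the left limit there bound the mass near that point;
  bisection makes this uniform on a compact interval. The predicate \<open>P\<close> speaks of times
  \<open>0 <= s\<close> only, so neighbourhoods may reach below 0.\<close>

lemma cadlag_mass_bounded:
 assumes om: "om \<in> cadlag_paths"
 obtains K where "0 <= K" "!!s. 0 <= s ==> s <= T ==> mass (om s) <= K"
proof -
 define m where "m s = (LINT x|om s. (1::real))" for s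
 define P where "P a b \<longleftrightarrow> (\<exists>K. \<forall>s. a <= s \<and> s <= b \<and> 0 <= s \<longrightarrow> m s <= K)" for a b :: real
 have "P 0 (max 0 T)"
 proof (rule Bolzano)
  show "(0::real) <= max 0 T" by simp
 next
  fix a b c assume "P a b" "P b c"
  then obtain K L where K: "!!s. a <= s \<and> s <= b \<and> 0 <= s \<longrightarrow> m s <= K"
   and L: "!!s. b <= s \<and> s <= c \<and> 0 <= s \<longrightarrow> m s <= L" unfolding P_def by blast
  have "m s <= max K L" if "a <= s \<and> s <= c \<and> 0 <= s" for s
   using K[of s] L[of s] that by (cases "s <= b") auto
  then show "P a c" unfolding P_def by blast
 next
  fix x assume x: "0 <= x" "x <= max 0 T"
  have "(m \<longlongrightarrow> m x) (at_right x)"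
   unfolding m_def[abs_def] by (rule cadlag_right[OF om x(1) one_Cb])
  then have "eventually (%s. m s < m x + 1) (at_right x)"
   by (rule order_tendstoD) simp
  then obtain d where d: "x < d" "!!s. x < s ==> s < d ==> m s < m x + 1"
   using eventually_at_right[of x "x + 1" "%s. m s < m x + 1"] by auto
  have "\<exists>e<x. \<exists>L. \<forall>s. e < s \<and> s < x \<and> 0 <= s \<longrightarrow> m s <= L"
  proof (cases "x = 0")
   case True
   then show ?thesis by (intro exI[of _ "-1"]) auto
  next
   case False
   then have "0 < x" using x by simp
   then obtain l where "limitin weak_top om l (at_left x)"
    using om by (auto simp: cadlag_paths_def)
   then have "(m \<longlongrightarrow> (LINT x|l. 1)) (at_left x)"
    unfolding m_def[abs_def] by (rule limitin_weak_top[OF _ one_Cb])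
   then have "eventually (%s. m s < (LINT x|l. 1) + 1) (at_left x)"
    by (rule order_tendstoD) simp
   then obtain e where "e < x" "!!s. e < s ==> s < x ==> m s < (LINT x|l. 1) + 1"
    using eventually_at_left[of "x - 1" x "%s. m s < (LINT x|l. 1) + 1"] by auto
   then show ?thesis by (intro exI[of _ e] conjI exI[of _ "(LINT x|l. 1) + 1"]) (auto intro: less_imp_le)
  qed
  then obtain e L where e: "e < x" "!!s. e < s ==> s < x ==> 0 <= s ==> m s <= L" by blast
  show "\<exists>\<delta>>0. \<forall>a b. a <= x \<and> x <= b \<and> b - a < \<delta> \<longrightarrow> P a b"
  proof (intro exI[of _ "min (d - x) (x - e)"] conjI allI impI)
   show "0 < min (d - x) (x - e)" using d e by simp
   fix a b assume ab: "a <= x \<and> x <= b \<and> b - a < min (d - x) (x - e)"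
   have "m s <= max L (m x + 1)" if s: "a <= s \<and> s <= b \<and> 0 <= s" for s
   proof (cases s x rule: linorder_cases)
    case less
    then show ?thesis using e(2)[of s] ab s by auto
   next
    case greater
    then show ?thesis using d(2)[of s] ab s by auto
   qed auto
   then show "P a b" unfolding P_def by blast
  qed
 qed
 then obtain K where K: "!!s. 0 <= s ==> s <= max 0 T ==> m s <= K" unfolding P_def by auto
 have m: "m s = mass (om s)" if "0 <= s" for s
  unfolding m_def using fbm_integral_1[OF cadlag_fbm[OF om that], of 1] by simp
 show thesis
 proof (rule that[of "max 0 K"])
  show "mass (om s) <= max 0 K" if "0 <= s" "s <= T" for s
   using K[of s] m[of s] that by auto
 qed simp
qed

text \<open>Clamping the time index makes a path a function on the whole line that depends only on
  its restriction to [0, T]. Joint measurability of the clamped evaluation with respect to the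
  filtration at T is progressive measurability.\<close>

definition clip :: "real => real => real" where
 "clip T r = max 0 (min r T)"

lemma clip_nonneg[simp]: "0 <= clip T r" by (simp add: clip_def)
lemma clip_le: "0 <= T ==> clip T r <= T" by (simp add: clip_def)
lemma clip_eq: "0 <= r ==> r <= T ==> clip T r = r" by (simp add: clip_def)

text \<open>The grid point is the next one to the right of \<open>r\<close>, at distance at most
  1/(n + 1), so that right continuity suffices for convergence along it.\<close>

lemma clip_approx:
 assumes "0 <= T"
 defines "u \<equiv> %n r. clip T ((of_int \<lfloor>r * real (Suc n)\<rfloor> + 1) / real (Suc n))"
 shows "clip T r <= u n r" "(%n. u n r) \<longlonglongrightarrow> clip T r"
proof -
 define v where "v n = (of_int \<lfloor>r * real (Suc n)\<rfloor> + 1) / real (Suc n)" for n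
 have v: "r <= v n" "v n <= r + 1 / real (Suc n)" for n
  unfolding v_def using floor_correct[of "r * real (Suc n)"]
  by (auto simp: field_simps simp del: of_nat_Suc)
 then show "clip T r <= u n r" unfolding u_def v_def[symmetric] clip_def
  by (intro max.mono min.mono) auto
 have "v \<longlonglongrightarrow> r"
 proof (rule tendsto_sandwich[where f = "%n. r" and h = "%n. r + 1 / real (Suc n)"])
  show "(%n. r + 1 / real (Suc n)) \<longlonglongrightarrow> r"
   using tendsto_add[OF tendsto_const LIMSEQ_inverse_real_of_nat, of r] by (simp add: inverse_eq_divide)
 qed (use v in auto)
 then show "(%n. u n r) \<longlonglongrightarrow> clip T r"
  unfolding u_def v_def[symmetric] clip_def by (intro tendsto_intros)
qed

text \<open>Right-continuous paths are approximated from the right by step functions on a grid.\<close>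

lemma mkernel_path:
 assumes T: "0 <= T"
 shows "mkernel (borel \<Otimes>\<^sub>M path_filt (ennreal T)) (%z. snd z (clip T (fst z)))"
proof -
 have "finite_borel_measure (snd z (clip T (fst z)))"
  if "z \<in> space (borel \<Otimes>\<^sub>M path_filt (ennreal T))" for z :: "real \<times> (real => real measure)"
  using that by (auto simp: space_pair_measure intro!: cadlag_fbm)
 moreover have "(%z. \<integral>x. f x \<partial>(snd z (clip T (fst z)))) \<in> borel_measurable (borel \<Otimes>\<^sub>M path_filt (ennreal T))"
  if f: "f \<in> Cb UNIV" for f :: "real => real"
 proof -
 define u where "u n r = clip T ((of_int \<lfloor>r * real (Suc n)\<rfloor> + 1) / real (Suc n))" for n r
 have "(%z. \<integral>x. f x \<partial>(snd z (u n (fst z)))) \<in> borel_measurable (borel \<Otimes>\<^sub>M path_filt (ennreal T))" for n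
 proof -
  have "(%z. (%i z. \<integral>x. f x \<partial>(snd z (clip T ((of_int i + 1) / real (Suc n))))) \<lfloor>fst z * real (Suc n)\<rfloor> z)
    \<in> borel_measurable (borel \<Otimes>\<^sub>M path_filt (ennreal T))"
  proof (rule measurable_compose_countable[where g = "%z. \<lfloor>fst z * real (Suc n)\<rfloor>"
    and f = "%i z. \<integral>x. f x \<partial>(snd z (clip T ((of_int i + 1) / real (Suc n))))"])
   fix i :: int
   have "(%om. \<integral>x. f x \<partial>om (clip T ((of_int i + 1) / real (Suc n)))) \<in> borel_measurable (path_filt (ennreal T))"
    using T by (intro path_filt_coord f) (auto intro!: ennreal_leI clip_le)
   from measurable_compose[OF measurable_snd this]
   show "(%z. \<integral>x. f x \<partial>(snd z (clip T ((of_int i + 1) / real (Suc n))))) \<in> borel_measurable ((borel :: real measure) \<Otimes>\<^sub>M path_filt (ennreal T))" .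
   show "(%z. \<lfloor>fst z * real (Suc n)\<rfloor>) \<in> measurable (borel \<Otimes>\<^sub>M path_filt (ennreal T)) (count_space UNIV)"
    by measurable
  qed
  then show ?thesis by (simp add: u_def)
 qed
 moreover have "(%n. \<integral>x. f x \<partial>(snd z (u n (fst z)))) \<longlonglongrightarrow> (LINT x|(snd z (clip T (fst z))). f x)"
  if "z \<in> space (borel \<Otimes>\<^sub>M path_filt (ennreal T))" for z
 proof -
  obtain r om where z: "z = (r, om)" "om \<in> cadlag_paths" using \<open>z \<in> _\<close> by (auto simp: space_pair_measure)
  have "((%s. \<integral>x. f x \<partial>om s) \<longlongrightarrow> (LINT x|om (clip T r). f x)) (at_right (clip T r))"
   by (rule cadlag_right[OF z(2) clip_nonneg f])
  \<comment> \<open>Clamping may make \<open>u n r\<close> equal to \<open>clip T r\<close>, so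
    continuity within the closed half-line is needed rather than the limit along
    \<open>at_right\<close>.\<close>
  then have "continuous (at (clip T r) within {clip T r..}) (%s. \<integral>x. f x \<partial>om s)"
   by (simp add: continuous_within at_within_Ici_at_right)
  then have "(%n. \<integral>x. f x \<partial>om (u n r)) \<longlonglongrightarrow> (LINT x|om (clip T r). f x)"
   by (rule continuous_within_tendsto_compose) (use clip_approx[OF T, of r] in \<open>auto simp: u_def\<close>)
  then show ?thesis by (simp add: z)
 qed
 ultimately show ?thesis
  by (rule borel_measurable_LIMSEQ_real[rotated])
 qed
 ultimately show ?thesis by (simp add: mkernel_def)
qed

section \<open>Exponential clocks\<close>

text \<open>Quadratically small increments force derivative 0 everywhere. This stands in for the
  product and chain rules below, where the rate \<open>v\<close> is only bounded and measurable and
  its primitive need not be differentiable at every point.\<close>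

lemma quadratic_increments_const:
 fixes G :: "real => real"
 assumes G: "!!s t. 0 <= s ==> s <= t ==> t <= T ==> \<bar>G t - G s\<bar> <= K * (t - s)\<^sup>2"
  and st: "0 <= s" "s <= t" "t <= T"
 shows "G t = G s"
proof -
 have "(G has_field_derivative 0) (at x within {0..T})" if x: "x \<in> {0..T}" for x
  unfolding has_field_derivative_iff
 proof (rule Lim_null_comparison[where g = "%y. K * \<bar>y - x\<bar>"])
  have "norm ((G y - G x) / (y - x)) <= K * \<bar>y - x\<bar>" if "y \<in> {0..T}" "y \<noteq> x" for y
  proof -
   have "\<bar>G y - G x\<bar> <= K * (y - x)\<^sup>2"
    using G[of x y] G[of y x] x that(1) by (cases "x <= y") (auto simp: abs_minus_commute power2_commute)
   also have "\<dots> = K * \<bar>y - x\<bar> * \<bar>y - x\<bar>" by (simp add: power2_eq_square)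
   finally show ?thesis using that(2) by (simp add: divide_le_eq)
  qed
  then show "\<forall>\<^sub>F y in at x within {0..T}. norm ((G y - G x) / (y - x)) <= K * \<bar>y - x\<bar>"
   by (auto simp: eventually_at_filter)
  have "((%y. K * \<bar>y - x\<bar>) \<longlongrightarrow> K * \<bar>x - x\<bar>) (at x within {0..T})"
   by (intro tendsto_intros)
  then show "((%y. K * \<bar>y - x\<bar>) \<longlongrightarrow> 0) (at x within {0..T})" by simp
 qed
 then obtain c where "\<forall>x\<in>{0..T}. G x = c"
  using has_field_derivative_zero_constant[of "{0..T}" G] by auto
 then show ?thesis using st by auto
qed

lemma set_integrable_bounded:
 fixes f :: "real => real"
 assumes "f \<in> borel_measurable borel" "!!r. \<bar>f r\<bar> <= K"
 shows "set_integrable lborel {a..b} f"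
proof -
 have "integrable lborel (%r. indicator {a..b} r * K)"
  by (rule integrable_mult_left) (auto intro!: integrable_real_indicator simp: emeasure_lborel_Icc_eq)
 then show ?thesis
  unfolding set_integrable_def
  using assms by (elim Bochner_Integration.integrable_bound)
   (auto simp: indicator_def intro!: AE_I2 order_trans[OF assms(2) abs_ge_self])
qed

lemma set_integral_bound_Icc:
 fixes f :: "real => real"
 assumes "set_integrable lborel {a..b} f" "!!r. a <= r ==> r <= b ==> \<bar>f r\<bar> <= K" "a <= b"
 shows "\<bar>LINT r:{a..b}|lborel. f r\<bar> <= K * (b - a)"
proof -
 have i: "set_integrable lborel {a..b} (%r. K)"
  by (rule set_integrable_bounded[where K = "\<bar>K\<bar>"]) auto
 have "(LINT r:{a..b}|lborel. f r) <= (LINT r:{a..b}|lborel. K)"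
  by (rule set_integral_mono[OF assms(1) i]) (use assms(2) in \<open>auto simp: abs_le_iff\<close>)
 moreover have "(LINT r:{a..b}|lborel. - K) <= (LINT r:{a..b}|lborel. f r)"
 proof (rule set_integral_mono[OF _ assms(1)])
  show "set_integrable lborel {a..b} (%r. - K)"
   by (rule set_integrable_bounded[where K = "\<bar>K\<bar>"]) auto
  show "- K <= f r" if "r \<in> {a..b}" for r using assms(2)[of r] that by (auto simp: abs_le_iff)
 qed
 moreover have "(LINT r:{a..b}|lborel. K) = K * (b - a)" "(LINT r:{a..b}|lborel. - K) = - (K * (b - a))"
  using assms(3) by (simp_all add: set_lebesgue_integral_def)
 ultimately show ?thesis by linarith
qed

lemma set_integral_Icc_split:
 fixes f :: "real => real"
 assumes f: "set_integrable lborel {a..c} f" and abc: "a <= b" "b <= c"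
 shows "(LINT r:{a..c}|lborel. f r) = (LINT r:{a..b}|lborel. f r) + (LINT r:{b..c}|lborel. f r)"
proof -
 have "(LINT r:{a..b} \<union> {b..c}|lborel. f r) = (LINT r:{a..b}|lborel. f r) + (LINT r:{b..c}|lborel. f r)"
 proof (rule set_integral_Un_AE)
  have "AE r in lborel. r \<noteq> b" by (rule AE_lborel_singleton)
  then show "AE r in lborel. \<not> (r \<in> {a..b} \<and> r \<in> {b..c})" by eventually_elim auto
  show "set_integrable lborel {a..b} f" "set_integrable lborel {b..c} f"
   using abc by (auto intro: set_integrable_subset[OF f])
 qed auto
 moreover have "{a..b} \<union> {b..c} = {a..c}" using abc by auto
 ultimately show ?thesis by simp
qed

lemma exp_minus_quadratic:
 fixes x :: real assumes "0 <= x"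
 shows "\<bar>exp (- x) - 1 + x\<bar> <= x\<^sup>2"
proof -
 have "exp (-x) <= 1 / (1 + x)"
  using exp_ge_add_one_self[of x] assms by (simp add: exp_minus inverse_eq_divide field_simps)
 moreover have "1 / (1 + x) - 1 + x <= x\<^sup>2"
  using assms by (simp add: field_simps power2_eq_square)
 moreover have "exp (-x) - 1 + x \<ge> 0" using exp_ge_add_one_self[of "-x"] by simp
 ultimately show ?thesis by auto
qed

definition prim :: "(real => real) => real => real" where
 "prim f r = (LINT u:{0..r}|lborel. f u)"

text \<open>A discount factor: the probability that an exponential clock with hazard rate
  \<open>\<theta> * v\<close> has not rung by time \<open>r\<close>.\<close>

definition clockA :: "real => (real => real) => real => real" where
 "clockA \<theta> v r = exp (- \<theta> * prim v r)"

text \<open>Moving the upper limit of integration into an indicator makes it an ordinary parameter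
  of the integrand.\<close>

lemma prim_measurable_pair:
 assumes g[measurable]: "(%z. g (fst z) (snd z)) \<in> borel_measurable (borel \<Otimes>\<^sub>M N)"
 shows "(%z. prim (%u. g u (snd z)) (fst z)) \<in> borel_measurable (borel \<Otimes>\<^sub>M N)"
proof -
 have "(%z. prim (%u. g u (snd z)) (fst z))
   = (%z. \<integral>u. (if 0 <= u \<and> u <= fst z then g u (snd z) else 0) \<partial>lborel)"
  unfolding prim_def set_lebesgue_integral_def
  by (intro ext Bochner_Integration.integral_cong) (auto simp: indicator_def)
 moreover have "(%(z, u). (if 0 <= u \<and> u <= fst z then g u (snd z) else 0))
   \<in> borel_measurable ((borel \<Otimes>\<^sub>M N) \<Otimes>\<^sub>M lborel)"
 proof -
  have [measurable]: "(%q. g (snd q) (snd (fst q))) \<in> borel_measurable ((borel \<Otimes>\<^sub>M N) \<Otimes>\<^sub>M (lborel :: real measure))"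
   using measurable_compose[OF _ g, of "%q. (snd q, snd (fst q))" "(borel \<Otimes>\<^sub>M N) \<Otimes>\<^sub>M lborel"]
   by simp
  show ?thesis by (simp add: split_beta')
 qed
 ultimately show ?thesis
  using lborel.borel_measurable_lebesgue_integral by simp
qed

lemma prim_measurable:
 assumes g[measurable]: "g \<in> borel_measurable borel"
 shows "prim g \<in> borel_measurable borel"
proof -
 have "(%z. prim (%u. g u) (fst z)) \<in> borel_measurable (borel \<Otimes>\<^sub>M (borel :: real measure))"
  by (rule prim_measurable_pair[where g = "%u z. g u"]) measurable
 from measurable_compose[OF _ this, of "%x. (x, 0)" borel] show ?thesis by simp
qed

text \<open>The bound \<open>K\<close> belongs to one path and guarantees integrability; the
  estimates that matter later, such as \<theta> v A having integral at most 1, are free of it and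
  therefore uniform over paths.\<close>

locale clock =
 fixes v :: "real => real" and K \<theta> :: real
 assumes v_meas[measurable]: "v \<in> borel_measurable borel"
  and v_bd: "!!r. 0 <= v r" "!!r. v r <= K"
  and theta: "0 <= \<theta>"
begin

abbreviation Y where "Y \<equiv> prim v"
abbreviation A where "A \<equiv> clockA \<theta> v"

lemma K_nonneg: "0 <= K" using v_bd[of 0] by linarith

lemma v_int: "set_integrable lborel {a..b} v"
 by (rule set_integrable_bounded[OF v_meas, of K]) (use v_bd in \<open>auto simp: abs_le_iff intro: order_trans[of _ 0]\<close>)

lemma Y_meas[measurable]: "Y \<in> borel_measurable borel"
 by (rule prim_measurable[OF v_meas])

lemma A_meas[measurable]: "A \<in> borel_measurable borel"
 unfolding clockA_def[abs_def] by measurable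

lemma Y_diff:
 assumes "0 <= s" "s <= t"
 shows "0 <= Y t - Y s" "Y t - Y s <= K * (t - s)"
proof -
 have "Y t - Y s = (LINT u:{s..t}|lborel. v u)"
  unfolding prim_def using set_integral_Icc_split[OF v_int assms] by simp
 moreover have "0 <= (LINT u:{s..t}|lborel. v u)"
  unfolding set_lebesgue_integral_def
  by (rule Bochner_Integration.integral_nonneg) (simp add: v_bd)
 moreover have "\<bar>LINT u:{s..t}|lborel. v u\<bar> <= K * (t - s)"
  by (rule set_integral_bound_Icc[OF v_int _ assms(2)]) (use v_bd in \<open>auto simp: abs_le_iff intro: order_trans[of _ 0]\<close>)
 ultimately show "0 <= Y t - Y s" "Y t - Y s <= K * (t - s)" by auto
qed

lemma Y_nonneg: "0 <= Y r"
 unfolding prim_def set_lebesgue_integral_def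
  by (rule Bochner_Integration.integral_nonneg) (simp add: v_bd)

lemma A_bd: "0 < A r" "A r <= 1"
 unfolding clockA_def using theta Y_nonneg[of r] by auto

lemma A_diff:
 assumes "0 <= s" "s <= t"
 shows "\<bar>A t - A s\<bar> <= \<theta> * K * (t - s)"
proof -
 define d where "d = \<theta> * (Y t - Y s)"
 have d: "0 <= d" "d <= \<theta> * K * (t - s)"
  using Y_diff[OF assms] theta by (auto simp: d_def mult.assoc intro: mult_left_mono)
 have "A t = A s * exp (- d)" by (simp add: clockA_def d_def exp_add[symmetric] algebra_simps)
 then have "A s - A t = A s * (1 - exp (- d))" by (simp add: algebra_simps)
 moreover have "0 <= 1 - exp (-d)" "1 - exp (-d) <= d" using d exp_ge_add_one_self[of "-d"] by auto
 ultimately have "0 <= A s - A t" "A s - A t <= 1 * d"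
  using A_bd[of s] mult_mono[of "A s" 1 "1 - exp (- d)" d] by auto
 then show ?thesis using d by auto
qed

lemma bounded_int:
 fixes f :: "real => real"
 assumes "f \<in> borel_measurable borel" "!!r. \<bar>f r\<bar> <= L"
 shows "set_integrable lborel {a..b} f"
 by (rule set_integrable_bounded[OF assms])

lemma vA_bd: "\<bar>\<theta> * v r * A r\<bar> <= \<theta> * K"
proof -
 have "\<bar>\<theta> * v r * A r\<bar> = \<theta> * v r * A r" using theta v_bd[of r] A_bd[of r] by (simp add: abs_mult)
 also have "\<dots> <= \<theta> * K * 1" using theta v_bd[of r] A_bd[of r] by (intro mult_mono) auto
 finally show ?thesis by simp
qed

lemma vA_int: "set_integrable lborel {a..b} (%r. \<theta> * v r * A r)"
 by (rule bounded_int[OF _ vA_bd]) measurable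

text \<open>This is A' = -\<theta> v A in integrated form. The difference \<open>G\<close> of both
  sides has quadratic increments, since \<open>A\<close> is Lipschitz and \<open>exp (- d)\<close>
  differs from \<open>1 - d\<close> by at most the square of \<open>d\<close>.\<close>

lemma A_eq:
 assumes st: "0 <= s" "s <= t"
 shows "(LINT r:{s..t}|lborel. \<theta> * v r * A r) = A s - A t"
proof -
 have int: "set_integrable lborel {a..b} (%r. \<theta> * v r * A r)" for a b
  by (rule bounded_int[OF _ vA_bd]) measurable
 define G where "G r = A r + (LINT u:{0..r}|lborel. \<theta> * v u * A u)" for r
 have "G t = G s"
 \<comment> \<open>Half of the constant comes from replacing \<open>A r\<close> by
   \<open>A s\<close> under the integral, half from the second-order remainder of the
   exponential.\<close>
 proof (rule quadratic_increments_const[where G = G and s = s and t = t and T = t and K = "2 * (\<theta> * K)\<^sup>2"])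
  fix s t :: real assume st: "0 <= s" "s <= t"
  define d where "d = \<theta> * (Y t - Y s)"
  have d: "0 <= d" "d <= \<theta> * K * (t - s)"
   using Y_diff[OF st] theta by (auto simp: d_def mult.assoc intro: mult_left_mono)
  have i2: "set_integrable lborel {s..t} (%r. \<theta> * v r * A s)"
  proof (rule bounded_int[where L = "\<theta> * K"])
   show "\<bar>\<theta> * v r * A s\<bar> <= \<theta> * K" for r
   proof -
    have "\<bar>\<theta> * v r * A s\<bar> = \<theta> * v r * A s" using theta v_bd[of r] A_bd[of s] by (simp add: abs_mult)
    also have "\<dots> <= \<theta> * K * 1" using theta v_bd[of r] A_bd[of s] by (intro mult_mono) auto
    finally show ?thesis by simp
   qed
  qed measurable
  have 1: "(LINT r:{s..t}|lborel. \<theta> * v r * A s) = A s * d"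
   unfolding d_def prim_def using set_integral_Icc_split[OF v_int st] by (simp add: algebra_simps)
  have 2: "\<bar>(LINT r:{s..t}|lborel. \<theta> * v r * A r) - (LINT r:{s..t}|lborel. \<theta> * v r * A s)\<bar>
    <= (\<theta> * K * (\<theta> * K * (t - s))) * (t - s)"
   unfolding set_integral_diff(2)[OF int i2, symmetric]
  proof (rule set_integral_bound_Icc[OF set_integral_diff(1)[OF int i2] _ st(2)])
   fix r assume r: "s <= r" "r <= t"
   have "\<bar>A r - A s\<bar> <= \<theta> * K * (t - s)"
    using A_diff[OF st(1) r(1)] r theta K_nonneg
    by (elim order_trans) (auto intro!: mult_left_mono)
   then have "\<bar>\<theta> * v r\<bar> * \<bar>A r - A s\<bar> <= \<theta> * K * (\<theta> * K * (t - s))"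
    using theta v_bd[of r] K_nonneg by (intro mult_mono) (auto simp: abs_mult intro: mult_left_mono)
   then show "\<bar>\<theta> * v r * A r - \<theta> * v r * A s\<bar> <= \<theta> * K * (\<theta> * K * (t - s))"
    by (simp add: abs_mult[symmetric] right_diff_distrib)
  qed
  have "A t = A s * exp (- d)" by (simp add: clockA_def d_def exp_add[symmetric] algebra_simps)
  then have "A t - A s + A s * d = A s * (exp (-d) - 1 + d)" by (simp add: algebra_simps)
  then have "\<bar>A t - A s + A s * d\<bar> <= 1 * d\<^sup>2"
   using A_bd[of s] exp_minus_quadratic[OF d(1)] mult_mono[of "A s" 1 "\<bar>exp (-d) - 1 + d\<bar>" "d\<^sup>2"]
   by (simp add: abs_mult)
  also have "1 * d\<^sup>2 <= (\<theta> * K * (t - s))\<^sup>2" using d by (simp add: power_mono)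
  finally have 3: "\<bar>A t - A s + A s * d\<bar> <= (\<theta> * K * (t - s))\<^sup>2" .
  have "G t - G s = A t - A s + (LINT r:{s..t}|lborel. \<theta> * v r * A r)"
   unfolding G_def using set_integral_Icc_split[OF int st] by simp
  then have "\<bar>G t - G s\<bar> <= (\<theta> * K * (t - s))\<^sup>2 + (\<theta> * K * (\<theta> * K * (t - s))) * (t - s)"
   using 1 2 3 by linarith
  then show "\<bar>G t - G s\<bar> <= (2 * (\<theta> * K)\<^sup>2) * (t - s)\<^sup>2"
   by (simp add: power2_eq_square algebra_simps)
 qed (use st in auto)
 moreover have "G t - G s = A t - A s + (LINT r:{s..t}|lborel. \<theta> * v r * A r)"
  unfolding G_def using set_integral_Icc_split[OF int st] by simp
 ultimately show ?thesis by simp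
qed

context
 fixes l :: "real => real" and L :: real
 assumes l[measurable]: "l \<in> borel_measurable borel" "!!r. \<bar>l r\<bar> <= L"
begin

abbreviation (input) I where "I \<equiv> prim l"

lemma L0: "0 <= L" using l(2)[of 0] by linarith

lemma l_int: "set_integrable lborel {a..b} l" by (rule bounded_int[OF l])

lemma prim_l_meas[measurable]: "prim l \<in> borel_measurable borel"
 by (rule prim_measurable[OF l(1)])

lemma Idiff:
 assumes that: "0 <= s" "s <= t"
 shows "\<bar>I t - I s\<bar> <= L * (t - s)" "I t - I s = (LINT r:{s..t}|lborel. l r)"
proof -
  show *: "I t - I s = (LINT r:{s..t}|lborel. l r)"
   unfolding prim_def using set_integral_Icc_split[OF l_int that] by simp
  show "\<bar>I t - I s\<bar> <= L * (t - s)" unfolding *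
   by (rule set_integral_bound_Icc[OF l_int l(2) that(2)])
qed

lemma lA_int: "set_integrable lborel {a..b} (%r. l r * A r)"
 proof (rule bounded_int[where L = L])
  show "\<bar>l r * A r\<bar> <= L" for r
   using mult_mono[OF l(2)[of r] A_bd(2)[of r] L0] A_bd(1)[of r] by (auto simp: abs_mult)
 qed measurable

lemma vAI_int:
 assumes that: "0 <= a"
 shows "set_integrable lborel {a..b} (%r. \<theta> * v r * A r * I r)"
 proof -
  have "set_integrable lborel {a..b} (%r. \<theta> * v r * A r * I (clip b r))"
  proof (rule bounded_int[where L = "\<theta> * K * (L * \<bar>b\<bar>)"])
   have "\<bar>I (clip b r)\<bar> <= L * \<bar>b\<bar>" for r
   proof -
    have "\<bar>I (clip b r)\<bar> <= L * clip b r + \<bar>I 0\<bar>" 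
     using Idiff(1)[of 0 "clip b r", OF order_refl clip_nonneg] by (simp only: diff_zero)
    moreover have "I 0 = 0"
    proof -
     have "\<bar>I 0\<bar> <= L * (0 - 0)" unfolding prim_def by (rule set_integral_bound_Icc[OF l_int l(2)]) simp
     then show ?thesis by simp
    qed
    moreover have "clip b r <= \<bar>b\<bar>" by (auto simp: clip_def)
    ultimately show ?thesis using mult_left_mono[OF _ L0, of "clip b r" "\<bar>b\<bar>"] by simp
   qed
   then show "\<bar>\<theta> * v r * A r * I (clip b r)\<bar> <= \<theta> * K * (L * \<bar>b\<bar>)" for r
    unfolding abs_mult[of "\<theta> * v r * A r"] using vA_bd theta K_nonneg by (intro mult_mono) auto
  qed (unfold clip_def, measurable)
  then show ?thesis unfolding set_integrable_def
   by (rule Bochner_Integration.integrable_cong[THEN iffD1, rotated 2])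
    (use that in \<open>auto simp: indicator_def clip_def\<close>)
 qed

text \<open>Integration by parts for the discount factor and the primitive \<open>I\<close>, again
  by quadratic increments: both factors are Lipschitz on bounded intervals, but neither need be
  differentiable everywhere.\<close>

lemma A_parts:
 assumes st: "0 <= s" "s <= t"
 shows "A t * I t - A s * I s + (LINT r:{s..t}|lborel. \<theta> * v r * A r * I r) = (LINT r:{s..t}|lborel. l r * A r)"
proof -
 have int: "set_integrable lborel {a..b} (%r. \<theta> * v r * A r)" for a b
  by (rule vA_int)
 define G where "G r = A r * I r + (LINT u:{0..r}|lborel. \<theta> * v u * A u * I u) - (LINT u:{0..r}|lborel. l u * A u)" for r
 have "G t = G s"
 proof (rule quadratic_increments_const[where G = G and s = s and t = t and T = t and K = "2 * L * \<theta> * K"])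
  fix s t :: real assume st: "0 <= s" "s <= t"
  \<comment> \<open>The increment of the product is A_t (I_t - I_s) + (A_t - A_s) I_s; each part
    matches one of the two integrals up to freezing a Lipschitz factor at an endpoint.\<close>
  have eq: "G t - G s = ((LINT r:{s..t}|lborel. l r * A t) - (LINT r:{s..t}|lborel. l r * A r))
    + ((LINT r:{s..t}|lborel. \<theta> * v r * A r * I r) - (LINT r:{s..t}|lborel. \<theta> * v r * A r * I s))"
  proof -
   have "(LINT r:{s..t}|lborel. l r * A t) = (I t - I s) * A t" using Idiff(2)[OF st] by simp
   moreover have "(LINT r:{s..t}|lborel. \<theta> * v r * A r * I s) = (A s - A t) * I s"
    using A_eq[OF st] by simp
   ultimately show ?thesis
    unfolding G_def using set_integral_Icc_split[OF lA_int st] set_integral_Icc_split[OF vAI_int st]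
    by (simp add: algebra_simps)
  qed
  have b1: "\<bar>LINT r:{s..t}|lborel. l r * A t - l r * A r\<bar> <= L * (\<theta> * K * (t - s)) * (t - s)"
  proof (rule set_integral_bound_Icc[OF set_integral_diff(1)[OF _ lA_int] _ st(2)])
   show "set_integrable lborel {s..t} (%r. l r * A t)" using l_int by simp
   fix r assume r: "s <= r" "r <= t"
   have "\<bar>A t - A r\<bar> <= \<theta> * K * (t - s)"
    using A_diff[OF order_trans[OF st(1) r(1)] r(2)] r theta K_nonneg
    by (elim order_trans) (auto intro!: mult_left_mono)
   then have "\<bar>l r\<bar> * \<bar>A t - A r\<bar> <= L * (\<theta> * K * (t - s))" using l(2)[of r] L0 by (intro mult_mono) auto
   then show "\<bar>l r * A t - l r * A r\<bar> <= L * (\<theta> * K * (t - s))"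
    by (simp add: abs_mult[symmetric] right_diff_distrib)
  qed
  have b2: "\<bar>LINT r:{s..t}|lborel. \<theta> * v r * A r * I r - \<theta> * v r * A r * I s\<bar> <= \<theta> * K * (L * (t - s)) * (t - s)"
  proof (rule set_integral_bound_Icc[OF set_integral_diff(1)[OF vAI_int[OF st(1)]] _ st(2)])
   show "set_integrable lborel {s..t} (%r. \<theta> * v r * A r * I s)" using int by simp
   fix r assume r: "s <= r" "r <= t"
   have "\<bar>I r - I s\<bar> <= L * (t - s)"
    using Idiff(1)[OF st(1) r(1)] r L0
    by (elim order_trans) (auto intro!: mult_left_mono)
   then have "\<bar>\<theta> * v r * A r\<bar> * \<bar>I r - I s\<bar> <= \<theta> * K * (L * (t - s))"
    using vA_bd[of r] theta K_nonneg by (intro mult_mono) auto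
   then show "\<bar>\<theta> * v r * A r * I r - \<theta> * v r * A r * I s\<bar> <= \<theta> * K * (L * (t - s))"
    by (simp add: abs_mult[symmetric] right_diff_distrib)
  qed
  have "G t - G s = (LINT r:{s..t}|lborel. l r * A t - l r * A r)
   + (LINT r:{s..t}|lborel. \<theta> * v r * A r * I r - \<theta> * v r * A r * I s)"
   unfolding eq using l_int lA_int vAI_int[OF st(1)] int
   by (subst (1 2) set_integral_diff(2)) auto
  then have "\<bar>G t - G s\<bar> <= L * (\<theta> * K * (t - s)) * (t - s) + \<theta> * K * (L * (t - s)) * (t - s)"
   using b1 b2 by linarith
  then show "\<bar>G t - G s\<bar> <= (2 * L * \<theta> * K) * (t - s)\<^sup>2"
   by (simp add: power2_eq_square algebra_simps)
 qed (use st in auto)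
 then show ?thesis
  unfolding G_def using set_integral_Icc_split[OF lA_int st] set_integral_Icc_split[OF vAI_int st]
  by (simp add: algebra_simps)
qed

end

end

section \<open>Feller semigroups and the forward equation\<close>

lemma eq_0_by_eps:
 fixes x :: real
 assumes "!!e. 0 < e ==> \<bar>x\<bar> <= C * e"
 shows "x = 0"
proof (rule ccontr)
 assume "x \<noteq> 0"
 then have "0 < \<bar>x\<bar> / (2 * (\<bar>C\<bar> + 1))" by simp
 from assms[OF this] have "\<bar>x\<bar> <= C * (\<bar>x\<bar> / (2 * (\<bar>C\<bar> + 1)))" .
 also have "\<dots> <= (\<bar>C\<bar> + 1) * (\<bar>x\<bar> / (2 * (\<bar>C\<bar> + 1)))" by (intro mult_right_mono) auto
 also have "\<dots> = \<bar>x\<bar> / 2" by (simp add: field_simps)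
 finally show False using \<open>x \<noteq> 0\<close> by simp
qed

lemma Chat_uniform:
 fixes f :: "'a::euclidean_space => real"
 assumes "!!e. 0 < e ==> \<exists>g\<in>Chat UNIV. \<forall>x. \<bar>f x - g x\<bar> <= e"
 shows "f \<in> Chat UNIV"
proof -
 have "continuous_on UNIV f" unfolding continuous_on_iff
 proof (intro ballI allI impI)
  fix x :: 'a and e :: real assume e: "0 < e"
  obtain g where g: "g \<in> Chat UNIV" "!!x. \<bar>f x - g x\<bar> <= e/5" using assms[of "e/5"] e by auto
  have "continuous_on UNIV g" using g(1) by (simp add: Chat_def)
  then obtain d where d: "0 < d" "!!x'. dist x' x < d ==> dist (g x') (g x) < e/2"
   unfolding continuous_on_iff using e by (metis UNIV_I half_gt_zero)
  show "\<exists>d>0. \<forall>x'\<in>UNIV. dist x' x < d \<longrightarrow> dist (f x') (f x) < e"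
  proof (intro exI[of _ d] conjI ballI impI d(1))
   fix x' assume "dist x' x < d"
   then show "dist (f x') (f x) < e" using d(2)[of x'] g(2)[of x] g(2)[of x'] e unfolding dist_real_def by linarith
  qed
 qed
 moreover have "\<exists>K. compact K \<and> K \<subseteq> UNIV \<and> (\<forall>x\<in>UNIV - K. \<bar>f x\<bar> < e)" if e: "0 < e" for e
 proof -
  obtain g where g: "g \<in> Chat UNIV" "!!x. \<bar>f x - g x\<bar> <= e/2" using assms[of "e/2"] e by auto
  have "0 < e/2" using e by simp
  then have "\<exists>K. compact K \<and> K \<subseteq> UNIV \<and> (\<forall>x\<in>UNIV - K. \<bar>g x\<bar> < e/2)" using g(1) unfolding Chat_def by blast
  then obtain K where K: "compact K" "!!x. x \<notin> K ==> \<bar>g x\<bar> < e/2" by auto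
  have "\<bar>f x\<bar> < e" if "x \<notin> K" for x using K(2)[OF that] g(2)[of x] by linarith
  then show ?thesis using K(1) by blast
 qed
 ultimately show ?thesis by (simp add: Chat_def)
qed

text \<open>Integrals of semigroup orbits are taken pointwise in the space variable. As the error
  depends on the oscillation \<open>e\<close> only, such sums converge uniformly in space, and
  operators can be moved under the integral.\<close>

lemma riemann_sum:
 fixes q :: "real => real"
 assumes q: "continuous_on {0..} q" and d: "0 <= d"
  and osc: "!!s s'. 0 <= s ==> s <= s' ==> s' - s <= d ==> \<bar>q s' - q s\<bar> <= e"
 shows "\<bar>(LINT s:{0..real m * d}|lborel. q s) - (\<Sum>k<m. d * q (real k * d))\<bar> <= e * (real m * d)"
proof (induction m)
 case 0
 have "set_integrable lborel {0..0} q" by (rule borel_integrable_atLeastAtMost') (simp add: continuous_on_sing)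
 from set_integral_bound_Icc[OF this, of "\<bar>q 0\<bar>"] show ?case by simp
next
 case (Suc m)
 have i: "set_integrable lborel {a..b} q" if "0 <= a" for a b
  using q that by (intro borel_integrable_atLeastAtMost' continuous_on_subset[OF q]) auto
 have le: "0 <= real m * d" "real m * d <= real (Suc m) * d" using d by (auto simp: algebra_simps)
 have "(LINT s:{0..real (Suc m) * d}|lborel. q s) = (LINT s:{0..real m * d}|lborel. q s) + (LINT s:{real m * d..real (Suc m) * d}|lborel. q s)"
  by (rule set_integral_Icc_split[OF i le]) simp
 moreover have "\<bar>LINT s:{real m * d..real (Suc m) * d}|lborel. q s - q (real m * d)\<bar> <= e * (real (Suc m) * d - real m * d)"
 proof (rule set_integral_bound_Icc[OF _ _ le(2)])
  show "set_integrable lborel {real m * d..real (Suc m) * d} (%s. q s - q (real m * d))"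
   by (rule set_integral_diff(1)[OF i[OF le(1)]]) (rule borel_integrable_atLeastAtMost', rule continuous_on_const)
  show "\<bar>q s - q (real m * d)\<bar> <= e" if "real m * d <= s" "s <= real (Suc m) * d" for s
   using that le(1) by (intro osc) (auto simp: algebra_simps)
 qed
 moreover have "(LINT s:{real m * d..real (Suc m) * d}|lborel. q s - q (real m * d))
   = (LINT s:{real m * d..real (Suc m) * d}|lborel. q s) - d * q (real m * d)"
 proof -
  have "(LINT s:{real m * d..real (Suc m) * d}|lborel. q s - q (real m * d))
   = (LINT s:{real m * d..real (Suc m) * d}|lborel. q s) - (LINT s:{real m * d..real (Suc m) * d}|lborel. q (real m * d))"
   by (rule set_integral_diff(2)[OF i[OF le(1)]]) (rule borel_integrable_atLeastAtMost', rule continuous_on_const)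
  also have "(LINT s:{real m * d..real (Suc m) * d}|lborel. q (real m * d)) = (real (Suc m) * d - real m * d) * q (real m * d)"
   using le(2) by (simp add: set_lebesgue_integral_def)
  finally show ?thesis by (simp add: algebra_simps)
 qed
 moreover have "e * (real (Suc m) * d - real m * d) + e * (real m * d) = e * (real (Suc m) * d)" by (simp add: algebra_simps)
 ultimately show ?case using Suc by (simp only: sum.lessThan_Suc)
qed

lemma set_integral_LIMSEQ:
 fixes h :: "nat => real => real" and K :: real
 assumes "!!j. set_integrable lborel {s..t} (h j)" "!!r. s <= r ==> r <= t ==> (%j. h j r) \<longlonglongrightarrow> l r"
  "!!j r. s <= r ==> r <= t ==> \<bar>h j r\<bar> <= K" 
 shows "(%j. LINT r:{s..t}|lborel. h j r) \<longlonglongrightarrow> (LINT r:{s..t}|lborel. l r)"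
 unfolding set_lebesgue_integral_def
proof (rule integral_dominated_convergence[where w = "%r. indicator {s..t} r * K"])
 show m: "(%r. indicator {s..t} r *\<^sub>R h j r) \<in> borel_measurable lborel" for j
  using assms(1)[of j] unfolding set_integrable_def by auto
 have l: "(%j. indicator {s..t} r *\<^sub>R h j r) \<longlonglongrightarrow> indicator {s..t} r *\<^sub>R l r" for r
  using assms(2)[of r] by (cases "r \<in> {s..t}") auto
 then show "AE r in lborel. (%j. indicator {s..t} r *\<^sub>R h j r) \<longlonglongrightarrow> indicator {s..t} r *\<^sub>R l r" by simp
 show "(%r. indicator {s..t} r *\<^sub>R l r) \<in> borel_measurable lborel"
  by (rule borel_measurable_LIMSEQ_real[where u = "%j r. indicator {s..t} r *\<^sub>R h j r"]) (rule l, rule m)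
 show "integrable lborel (%r. indicator {s..t} r * K)"
  by (rule integrable_mult_left) (auto intro!: integrable_real_indicator simp: emeasure_lborel_Icc_eq)
 show "AE r in lborel. norm (indicator {s..t} r *\<^sub>R h j r) <= indicator {s..t} r * K" for j
  using assms(3) by (intro AE_I2) (auto simp: indicator_def)
qed

lemma set_integral_shift:
 fixes q :: "real => real"
 shows "(LINT s:{a..b}|lborel. q (\<tau> + s)) = (LINT s:{\<tau> + a..\<tau> + b}|lborel. q s)"
 unfolding set_lebesgue_integral_def
 by (subst (2) lborel_integral_real_affine[where c = 1 and t = \<tau>])
  (auto intro!: Bochner_Integration.integral_cong simp: indicator_def)

section \<open>Feller semigroups: orbits, generator and the density of its domain\<close>

locale feller =
 fixes a \<rho> :: "real => real" and P :: "real => ('a::euclidean_space => real) => 'a => real"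
 assumes semigroup: "G_semigroup a \<rho> P"
begin

lemma feller: "feller_semigroup P" and extended: "extended_to_Bm P" and generator_eq: "generator P = Gclosure a \<rho>"
 using semigroup by (simp_all add: G_semigroup_def)

lemma P_Chat: "0 <= t ==> f \<in> Chat UNIV ==> P t f \<in> Chat UNIV"
 using feller by (simp add: feller_semigroup_def)

lemma P_0: "f \<in> Chat UNIV ==> P 0 f = f"
 using feller by (simp add: feller_semigroup_def)

lemma P_add: "0 <= s ==> 0 <= t ==> f \<in> Chat UNIV ==> P (s + t) f = P s (P t f)"
 using feller by (simp add: feller_semigroup_def)

lemma P_cont: "f \<in> Chat UNIV ==> uniform_limit UNIV (%t. P t f) f (at_right 0)"
 using feller by (simp add: feller_semigroup_def)

lemma P_rep: "0 <= t ==> \<exists>\<nu>. subprob_space \<nu> \<and> sets \<nu> = sets borel \<and> (\<forall>f\<in>Bm. P t f x = (LINT y|\<nu>. f y))"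
 using extended by (simp add: extended_to_Bm_def)

lemma kernel_integrable: "subprob_space \<nu> ==> sets \<nu> = sets borel ==> f \<in> Bm ==> integrable \<nu> f"
 by (intro Bm_integrable) (auto simp: subprob_space_def)

lemma P_lin:
 assumes "0 <= t" "f \<in> Bm" "g \<in> Bm"
 shows "P t (%x. f x + k * g x) x = P t f x + k * P t g x"
proof -
 obtain \<nu> where n: "subprob_space \<nu>" "sets \<nu> = sets borel" "!!f. f \<in> Bm ==> P t f x = (LINT y|\<nu>. f y)"
  using P_rep[OF assms(1), of x] by blast
 note i = kernel_integrable[OF n(1,2)]
 have "(%x. f x + k * g x) \<in> Bm" using assms by (intro Bm_add Bm_mult Bm_const)
 then show ?thesis using i[OF assms(2)] i[OF assms(3)] by (simp add: n(3) assms)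
qed

lemma P_bound:
 assumes "0 <= t" "f \<in> Bm" "!!x. \<bar>f x\<bar> <= C"
 shows "\<bar>P t f x\<bar> <= C"
proof -
 obtain \<nu> where n: "subprob_space \<nu>" "sets \<nu> = sets borel" "!!f. f \<in> Bm ==> P t f x = (LINT y|\<nu>. f y)"
  using P_rep[OF assms(1), of x] by blast
 interpret subprob_space \<nu> by fact
 have C: "0 <= C" using order_trans[OF abs_ge_zero assms(3)] .
 have "\<bar>\<integral>y. f y \<partial>\<nu>\<bar> <= (LINT y|\<nu>. \<bar>f y\<bar>)" using integral_abs_bound by blast
 also have "\<dots> <= (LINT y|\<nu>. C)" using assms(3) kernel_integrable[OF n(1,2) assms(2)] by (intro integral_mono) auto
 also have "\<dots> <= C" using C subprob_measure_le_1[of "space \<nu>"] mult_left_mono[of "measure \<nu> (space \<nu>)" 1 C] by (simp add: mult.commute)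
 finally show ?thesis using n(3)[OF assms(2)] by simp
qed

text \<open>Dominated convergence for the representing subprobability. This is the mode of
  continuity that the monotone class theorem asks for.\<close>

lemma P_conv:
 fixes F :: "nat => 'a => real"
 assumes t: "0 <= t" and F: "!!n. F n \<in> Bm" "!!n x. \<bar>F n x\<bar> <= C" "!!x. (%n. F n x) \<longlonglongrightarrow> f x" and f: "f \<in> Bm"
 shows "(%n. P t (F n) x) \<longlonglongrightarrow> P t f x"
proof -
 obtain \<nu> where n: "subprob_space \<nu>" "sets \<nu> = sets borel" "!!f. f \<in> Bm ==> P t f x = (LINT y|\<nu>. f y)"
  using P_rep[OF t, of x] by blast
 interpret subprob_space \<nu> by fact
 have m: "f \<in> borel_measurable \<nu>" if "f \<in> Bm" for f using Bm_measurable[OF that] measurable_cong_sets[OF n(2) refl] by blast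
 have "(%n. \<integral>y. F n y \<partial>\<nu>) \<longlonglongrightarrow> (LINT y|\<nu>. f y)"
  by (rule integral_dominated_convergence[where w = "%_. C"]) (use m F f in auto)
 then show ?thesis using n(3) F(1) f by simp
qed

lemma Bm_lim:
 fixes F :: "nat => 'b::euclidean_space => real"
 assumes F: "!!n. F n \<in> Bm" "!!n x. \<bar>F n x\<bar> <= C" "!!x. (%n. F n x) \<longlonglongrightarrow> f x"
 shows "f \<in> Bm"
proof (rule BmI)
 show "f \<in> borel_measurable borel"
  by (rule borel_measurable_LIMSEQ_real[where u = F]) (rule F(3), rule Bm_measurable[OF F(1)])
 have "(%n. \<bar>F n x\<bar>) \<longlonglongrightarrow> \<bar>f x\<bar>" for x by (intro tendsto_rabs F(3))
 from LIMSEQ_le_const2[OF this] show "\<bar>f x\<bar> <= C" for x using F(2) by blast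
qed

lemma P_Bm:
 assumes t: "0 <= t" and f: "f \<in> Bm" shows "P t f \<in> Bm"
 using f
proof (induction f rule: Bm_induct)
 case (Chat f) then show ?case using P_Chat[OF t] Chat_Bm by blast
next
 case (lin f g c)
 then have "P t (%x. f x + c * g x) = (%x. P t f x + c * P t g x)" using P_lin[OF t] by auto
 then show ?case using lin by (simp add: Bm_add Bm_mult)
next
 case (lim F f C)
 have "(%n. P t (F n) x) \<longlonglongrightarrow> P t f x" for x by (rule P_conv[OF t lim(1-3) Bm_lim[OF lim(1-3)]])
 then show ?case by (rule Bm_lim[OF lim(4) P_bound[OF t lim(1,2)]])
qed

lemma P_diff_bound:
 assumes "0 <= t" "f \<in> Bm" "g \<in> Bm" "!!x. \<bar>f x - g x\<bar> <= e"
 shows "\<bar>P t f x - P t g x\<bar> <= e"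
 using P_lin[OF assms(1-3), of "-1" x] P_bound[OF assms(1) Bm_diff[OF assms(2,3)] assms(4), of x] by simp

lemma P_small:
 assumes "\<phi> \<in> Chat UNIV" "0 < e"
 obtains d where "0 < d" "!!v x. 0 <= v ==> v <= d ==> \<bar>P v \<phi> x - \<phi> x\<bar> <= e"
proof -
 have "eventually (%v. \<forall>x\<in>UNIV. dist (P v \<phi> x) (\<phi> x) < e) (at_right 0)"
  using P_cont[OF assms(1)] assms(2) unfolding uniform_limit_iff by blast
 then obtain b where b: "0 < b" "!!v. 0 < v ==> v < b ==> \<forall>x\<in>UNIV. dist (P v \<phi> x) (\<phi> x) < e"
  unfolding eventually_at_right_field by blast
 show thesis
 proof (rule that[of "b/2"])
  show "\<bar>P v \<phi> x - \<phi> x\<bar> <= e" if "0 <= v" "v <= b/2" for v x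
  proof (cases "v = 0")
   case True then show ?thesis using P_0[OF assms(1)] assms(2) by simp
  next
   case False
   then have "dist (P v \<phi> x) (\<phi> x) < e" using b that by auto
   then show ?thesis by (simp add: dist_real_def)
  qed
 qed (use b in simp)
qed

text \<open>By P_s' - P_s = P_s (P_(s'-s) - 1) and contractivity, the modulus of continuity at time
  0 serves at all times.\<close>

lemma P_unif:
 assumes "\<phi> \<in> Chat UNIV" "0 < e"
 obtains d where "0 < d" "!!s s' x. 0 <= s ==> s <= s' ==> s' - s <= d ==> \<bar>P s' \<phi> x - P s \<phi> x\<bar> <= e"
proof -
 obtain d where d: "0 < d" "!!v x. 0 <= v ==> v <= d ==> \<bar>P v \<phi> x - \<phi> x\<bar> <= e" using P_small[OF assms] by metis
 show thesis
 proof (rule that[OF d(1)])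
  fix s s' x assume s: "0 <= s" "s <= s'" "s' - s <= d"
  have "P s' \<phi> = P s (P (s' - s) \<phi>)" using P_add[of s "s' - s" \<phi>] s assms(1) by simp
  then show "\<bar>P s' \<phi> x - P s \<phi> x\<bar> <= e"
   using P_diff_bound[OF s(1) Chat_Bm[OF P_Chat[OF _ assms(1)]] Chat_Bm[OF assms(1)], of "s' - s" e x] d(2)[of "s' - s"] s by simp
 qed
qed

lemma P_continuous:
 assumes "\<phi> \<in> Chat UNIV" shows "continuous_on {0..} (%s. P s \<phi> x)"
 unfolding continuous_on_iff
proof (intro ballI allI impI)
 fix s e :: real assume s: "s \<in> {0..}" and e: "0 < e"
 then have "0 < e/2" by simp
 then obtain d where d: "0 < d" "!!s s' x. 0 <= s ==> s <= s' ==> s' - s <= d ==> \<bar>P s' \<phi> x - P s \<phi> x\<bar> <= e/2"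
  using P_unif[OF assms] by metis
 show "\<exists>d>0. \<forall>x'\<in>{0..}. dist x' s < d \<longrightarrow> dist (P x' \<phi> x) (P s \<phi> x) < e"
 proof (intro exI[of _ d] conjI ballI impI d(1))
  fix s' assume s': "s' \<in> {0..}" "dist s' s < d"
  show "dist (P s' \<phi> x) (P s \<phi> x) < e"
  proof (cases "s <= s'")
   case True then show ?thesis using d(2)[of s s' x] s s' e by (auto simp: dist_real_def)
  next
   case False then show ?thesis using d(2)[of s' s x] s s' e unfolding dist_real_def abs_le_iff abs_less_iff by auto
  qed
 qed
qed

lemma gen_Chat: "(f, g) \<in> generator P ==> f \<in> Chat UNIV" "(f, g) \<in> generator P ==> g \<in> Chat UNIV"
 by (auto simp: generator_def)

lemma gen_bound:
 assumes "(f, g) \<in> generator P" "0 < e"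
 obtains d where "0 < d" "!!\<tau> x. 0 <= \<tau> ==> \<tau> <= d ==> \<bar>P \<tau> f x - (f x + \<tau> * g x)\<bar> <= e * \<tau>"
proof -
 have "eventually (%v. \<forall>x\<in>UNIV. dist ((P v f x - f x) / v) (g x) < e) (at_right 0)"
  using assms unfolding generator_def uniform_limit_iff by blast
 then obtain b where b: "0 < b" "!!v. 0 < v ==> v < b ==> \<forall>x\<in>UNIV. dist ((P v f x - f x) / v) (g x) < e"
  unfolding eventually_at_right_field by blast
 show thesis
 proof (rule that[of "b/2"])
  show "\<bar>P v f x - (f x + v * g x)\<bar> <= e * v" if "0 <= v" "v <= b/2" for v x
  proof (cases "v = 0")
   case True then show ?thesis using P_0[OF gen_Chat(1)[OF assms(1)]] by simp
  next
   case False
   then have v: "0 < v" "\<bar>(P v f x - f x) / v - g x\<bar> <= e" using b that by (auto simp: dist_real_def less_imp_le)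
   have "P v f x - (f x + v * g x) = ((P v f x - f x) / v - g x) * v" using v(1) by (simp add: field_simps)
   then show ?thesis using mult_right_mono[OF v(2), of v] v(1) by (simp add: abs_mult)
  qed
 qed (use b in simp)
qed

lemma genI:
 assumes "f \<in> Chat UNIV" "g \<in> Chat UNIV"
  and "!!e. 0 < e ==> \<exists>d>0. \<forall>\<tau> x. 0 < \<tau> \<and> \<tau> <= d \<longrightarrow> \<bar>P \<tau> f x - (f x + \<tau> * g x)\<bar> <= e * \<tau>"
 shows "(f, g) \<in> generator P"
proof -
 have "eventually (%v. \<forall>x\<in>UNIV. dist ((P v f x - f x) / v) (g x) < e) (at_right 0)" if e: "0 < e" for e
 proof -
  obtain d where d: "0 < d" "!!\<tau> x. 0 < \<tau> ==> \<tau> <= d ==> \<bar>P \<tau> f x - (f x + \<tau> * g x)\<bar> <= e/2 * \<tau>"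
   using assms(3)[of "e/2"] e by auto
  have "dist ((P v f x - f x) / v) (g x) < e" if v: "0 < v" "v < d" for v x
  proof -
   have "(P v f x - f x) / v - g x = (P v f x - (f x + v * g x)) / v" using v by (simp add: field_simps)
   moreover have "\<bar>P v f x - (f x + v * g x)\<bar> / v <= e/2" using d(2)[of v x] v by (simp add: divide_le_eq)
   ultimately have "dist ((P v f x - f x) / v) (g x) <= e/2" using v by (simp add: dist_real_def)
   then show ?thesis using e by linarith
  qed
  then show ?thesis unfolding eventually_at_right_field using d(1) by blast
 qed
 then show ?thesis using assms(1,2) by (simp add: generator_def uniform_limit_iff)
qed

text \<open>\<open>P u\<close> commutes with \<open>P \<tau>\<close> and is a contraction, so the
  first-order expansion of (f, g) is inherited by the image pair with the same step size.\<close>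

lemma gen_P:
 assumes fg: "(f, g) \<in> generator P" and u: "0 <= u"
 shows "(P u f, P u g) \<in> generator P"
proof (rule genI)
 note c = gen_Chat[OF fg]
 show "P u f \<in> Chat UNIV" "P u g \<in> Chat UNIV" using c P_Chat[OF u] by blast+
 fix e :: real assume "0 < e"
 then obtain d where d: "0 < d" "!!\<tau> x. 0 <= \<tau> ==> \<tau> <= d ==> \<bar>P \<tau> f x - (f x + \<tau> * g x)\<bar> <= e * \<tau>" using gen_bound[OF fg] by metis
 have "\<bar>P \<tau> (P u f) x - (P u f x + \<tau> * P u g x)\<bar> <= e * \<tau>" if t: "0 < \<tau>" "\<tau> <= d" for \<tau> x
 proof -
  have "P \<tau> (P u f) = P u (P \<tau> f)" using P_add[of \<tau> u f] P_add[of u \<tau> f] t u c(1) by (simp add: add.commute)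
  moreover have t0: "0 <= \<tau>" using t by simp
  have "\<bar>P u (P \<tau> f) x - P u (%x. f x + \<tau> * g x) x\<bar> <= e * \<tau>"
   by (rule P_diff_bound[OF u P_Bm[OF t0 Chat_Bm[OF c(1)]] Bm_add[OF Chat_Bm[OF c(1)] Bm_mult[OF Bm_const Chat_Bm[OF c(2)]]] d(2)[OF t0 t(2)]])
  ultimately show ?thesis using P_lin[OF u Chat_Bm[OF c(1)] Chat_Bm[OF c(2)]] by simp
 qed
 then show "\<exists>d>0. \<forall>\<tau> x. 0 < \<tau> \<and> \<tau> <= d \<longrightarrow> \<bar>P \<tau> (P u f) x - (P u f x + \<tau> * P u g x)\<bar> <= e * \<tau>" using d(1) by blast
qed

lemma P_sum:
 assumes "0 <= t" "!!k. k < (m::nat) ==> f k \<in> Chat UNIV"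
 shows "(%x. \<Sum>k<m. c * f k x) \<in> Chat UNIV" "P t (%x. \<Sum>k<m. c * f k x) x = (\<Sum>k<m. c * P t (f k) x)"
proof -
 have "(%x. \<Sum>k<m. c * f k x) \<in> Chat UNIV \<and> P t (%x. \<Sum>k<m. c * f k x) x = (\<Sum>k<m. c * P t (f k) x)"
  using assms(2)
 proof (induction m)
  case 0
  have "(%x::'a. 0::real) \<in> Chat UNIV" by (rule ChatI[of _ "{}"]) auto
  moreover have "P t (%x. 0) x = 0" using P_bound[OF assms(1) Bm_const, of 0 0 x] by simp
  ultimately show ?case by simp
 next
  case (Suc m)
  have s: "(%x. \<Sum>k<m. c * f k x) \<in> Chat UNIV" "f m \<in> Chat UNIV" using Suc by auto
  show ?case using Chat_lin[OF s, of 1 c] P_lin[OF assms(1) Chat_Bm[OF s(1)] Chat_Bm[OF s(2)], of c x] Suc by simp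
 qed
 then show "(%x. \<Sum>k<m. c * f k x) \<in> Chat UNIV" "P t (%x. \<Sum>k<m. c * f k x) x = (\<Sum>k<m. c * P t (f k) x)" by auto
qed

text \<open>The averages (1/h) \<integral>_0^h P_s \<phi> ds lie in the domain, with generator value
  (P_h \<phi> - \<phi>)/h, and are uniformly close to \<phi> for small h.\<close>

lemma gen_dense:
 assumes \<phi>: "\<phi> \<in> Chat UNIV" and e: "0 < e"
 obtains f g where "(f, g) \<in> generator P" "!!x. \<bar>\<phi> x - f x\<bar> <= e"
proof -
 obtain h where h: "0 < h" "!!v x. 0 <= v ==> v <= h ==> \<bar>P v \<phi> x - \<phi> x\<bar> <= e" using P_small[OF \<phi> e] by metis
 note c = P_continuous[OF \<phi>]
 have i: "set_integrable lborel {a..b} (%s. P s \<phi> x)" if "0 <= a" for a b x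
  using that by (intro borel_integrable_atLeastAtMost' continuous_on_subset[OF c]) auto
 define \<psi> where "\<psi> x = (LINT s:{0..h}|lborel. P s \<phi> x)" for x
 \<comment> \<open>A single Riemann sum approximates the integral and at the same time its image
   under every \<open>P \<tau>\<close>; this yields both \<open>\<psi> \<in> Chat UNIV\<close> and
   the exchange of \<open>P \<tau>\<close> with the integral.\<close>
 have approx: "\<exists>S\<in>Chat UNIV. (\<forall>x. \<bar>\<psi> x - S x\<bar> <= \<eta> * h) \<and> (\<forall>\<tau> x. 0 <= \<tau> \<longrightarrow> \<bar>(LINT s:{0..h}|lborel. P (\<tau> + s) \<phi> x) - P \<tau> S x\<bar> <= \<eta> * h)"
  if \<eta>: "0 < \<eta>" for \<eta>
 proof -
  obtain d where d: "0 < d" "!!s s' x. 0 <= s ==> s <= s' ==> s' - s <= d ==> \<bar>P s' \<phi> x - P s \<phi> x\<bar> <= \<eta>" using P_unif[OF \<phi> \<eta>] by metis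
  obtain n :: nat where n: "h / d < real n" using reals_Archimedean2 by blast
  then have n0: "0 < real n" using h(1) d(1) by (meson divide_pos_pos less_trans)
  define l where "l = h / real n"
  have l: "0 <= l" "l <= d" "real n * l = h" using n n0 h(1) d(1) by (auto simp: l_def field_simps)
  define S where "S = (%x. \<Sum>k<n. l * P (real k * l) \<phi> x)"
  have kc: "!!k. k < n ==> P (real k * l) \<phi> \<in> Chat UNIV" using P_Chat \<phi> l(1) by simp
  have S: "S \<in> Chat UNIV" unfolding S_def by (rule P_sum(1)[OF order_refl kc])
  have main: "\<bar>(LINT s:{0..h}|lborel. P (\<tau> + s) \<phi> x) - P \<tau> S x\<bar> <= \<eta> * h" if t: "0 <= \<tau>" for \<tau> x
  proof -
   have "P \<tau> S x = (\<Sum>k<n. l * P \<tau> (P (real k * l) \<phi>) x)" unfolding S_def by (rule P_sum(2)[OF t kc])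
   also have "\<dots> = (\<Sum>k<n. l * P (\<tau> + real k * l) \<phi> x)" using P_add[OF t _ \<phi>] l(1) by simp
   finally have "P \<tau> S x = \<dots>" .
   moreover have "continuous_on {0..} (%s. P (\<tau> + s) \<phi> x)"
    by (rule continuous_on_compose2[OF c]) (use t in \<open>auto intro!: continuous_intros\<close>)
   then have "\<bar>(LINT s:{0..real n * l}|lborel. P (\<tau> + s) \<phi> x) - (\<Sum>k<n. l * P (\<tau> + real k * l) \<phi> x)\<bar> <= \<eta> * (real n * l)"
    by (rule riemann_sum) (use l t in \<open>auto intro!: d(2)\<close>)
   ultimately show ?thesis using l(3) by simp
  qed
  have "\<bar>\<psi> x - S x\<bar> <= \<eta> * h" for x using main[of 0 x] P_0[OF S] by (simp add: \<psi>_def)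
  then show ?thesis using S main by blast
 qed
 have \<psi>: "\<psi> \<in> Chat UNIV"
 proof (rule Chat_uniform)
  fix \<eta> :: real assume "0 < \<eta>"
  then have "0 < \<eta> / h" using h(1) by simp
  from approx[OF this] obtain S where "S \<in> Chat UNIV" "!!x. \<bar>\<psi> x - S x\<bar> <= \<eta> / h * h" by blast
  then show "\<exists>g\<in>Chat UNIV. \<forall>x. \<bar>\<psi> x - g x\<bar> <= \<eta>" using h(1) by (intro bexI[of _ S]) auto
 qed
 have P\<psi>: "P \<tau> \<psi> x = (LINT s:{0..h}|lborel. P (\<tau> + s) \<phi> x)" if t: "0 <= \<tau>" for \<tau> x
 proof -
  have "P \<tau> \<psi> x - (LINT s:{0..h}|lborel. P (\<tau> + s) \<phi> x) = 0"
  proof (rule eq_0_by_eps[where C = "2 * h"])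
   fix \<eta> :: real assume "0 < \<eta>"
   from approx[OF this] obtain S where S: "S \<in> Chat UNIV" "!!x. \<bar>\<psi> x - S x\<bar> <= \<eta> * h"
    "\<bar>(LINT s:{0..h}|lborel. P (\<tau> + s) \<phi> x) - P \<tau> S x\<bar> <= \<eta> * h" using t by blast
   then show "\<bar>P \<tau> \<psi> x - (LINT s:{0..h}|lborel. P (\<tau> + s) \<phi> x)\<bar> <= 2 * h * \<eta>"
    using P_diff_bound[OF t Chat_Bm[OF \<psi>] Chat_Bm[OF S(1)] S(2), of x] by (simp add: abs_le_iff algebra_simps)
  qed
  then show ?thesis by simp
 qed
 \<comment> \<open>The vanishing summand gives \<open>f\<close> the shape of
   \<open>Chat_lin\<close>.\<close>
 define f where "f x = 0 * \<psi> x + 1/h * \<psi> x" for x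
 define g where "g x = 1/h * P h \<phi> x + (- (1/h)) * \<phi> x" for x
 have f: "f \<in> Chat UNIV" unfolding f_def[abs_def] by (rule Chat_lin[OF \<psi> \<psi>])
 have g: "g \<in> Chat UNIV" unfolding g_def[abs_def] by (rule Chat_lin[OF P_Chat \<phi>]) (use h \<phi> in auto)
 have Pf: "P \<tau> f x = 1/h * P \<tau> \<psi> x" if "0 <= \<tau>" for \<tau> x
  using P_lin[OF that Bm_const[of 0] Chat_Bm[OF \<psi>], of "1/h" x] P_bound[OF that Bm_const[of 0], of 0 x] by (simp add: f_def[abs_def])
 have "(f, g) \<in> generator P"
 proof (rule genI[OF f g])
  fix \<eta> :: real assume \<eta>: "0 < \<eta>"
  then have "0 < h * \<eta> / 2" using h(1) by simp
  then obtain d where d: "0 < d" "!!s s' x. 0 <= s ==> s <= s' ==> s' - s <= d ==> \<bar>P s' \<phi> x - P s \<phi> x\<bar> <= h * \<eta> / 2" using P_unif[OF \<phi>] by metis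
  have "\<bar>P \<tau> f x - (f x + \<tau> * g x)\<bar> <= \<eta> * \<tau>" if t: "0 < \<tau>" "\<tau> <= d" for \<tau> x
  proof -
   let ?q = "%s. P s \<phi> x"
   have e1: "P \<tau> \<psi> x = (LINT s:{\<tau>..\<tau> + h}|lborel. ?q s)" using P\<psi>[of \<tau> x] t set_integral_shift[of 0 h ?q \<tau>] by simp
   have e2: "(LINT s:{0..\<tau> + h}|lborel. ?q s) = (LINT s:{0..\<tau>}|lborel. ?q s) + (LINT s:{\<tau>..\<tau> + h}|lborel. ?q s)"
    "(LINT s:{0..\<tau> + h}|lborel. ?q s) = (LINT s:{0..h}|lborel. ?q s) + (LINT s:{h..\<tau> + h}|lborel. ?q s)"
    using t h(1) by (intro set_integral_Icc_split i; simp)+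
   have b: "\<bar>(LINT s:{r..\<tau> + r}|lborel. ?q s) - \<tau> * ?q r\<bar> <= h * \<eta> / 2 * \<tau>" if r: "0 <= r" for r
   proof -
    have ci: "set_integrable lborel {r..\<tau> + r} (%s. ?q r)" by (rule borel_integrable_atLeastAtMost', rule continuous_on_const)
    have "\<bar>LINT s:{r..\<tau> + r}|lborel. ?q s - ?q r\<bar> <= h * \<eta> / 2 * (\<tau> + r - r)"
    proof (rule set_integral_bound_Icc[OF set_integral_diff(1)[OF i[OF r] ci]])
     show "\<bar>?q s - ?q r\<bar> <= h * \<eta> / 2" if "r <= s" "s <= \<tau> + r" for s using d(2)[OF r that(1)] that t by simp
    qed (use t in simp)
    moreover have "(LINT s:{r..\<tau> + r}|lborel. ?q s - ?q r) = (LINT s:{r..\<tau> + r}|lborel. ?q s) - \<tau> * ?q r"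
     unfolding set_integral_diff(2)[OF i[OF r] ci] using t by (simp add: set_lebesgue_integral_def)
    ultimately show ?thesis by simp
   qed
   \<comment> \<open>Shifting the window [0, h] by \<tau> changes the integral at its two ends only,
     each of length \<tau>; the difference quotient therefore tends to the difference of the orbit
     at h and at 0.\<close>
   have "P \<tau> \<psi> x - \<psi> x = (LINT s:{h..\<tau> + h}|lborel. ?q s) - (LINT s:{0..\<tau>}|lborel. ?q s)" using e1 e2 by (simp add: \<psi>_def)
   moreover have hh: "h * \<eta> * \<tau> = h * \<eta> / 2 * \<tau> + h * \<eta> / 2 * \<tau>" by (simp add: field_simps)
   ultimately have X: "\<bar>P \<tau> \<psi> x - \<psi> x - \<tau> * (?q h - ?q 0)\<bar> <= h * \<eta> * \<tau>"
    using b[OF less_imp_le[OF h(1)]] b[OF order_refl, unfolded add_0_right] unfolding hh right_diff_distrib by linarith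
   have eq: "P \<tau> f x - (f x + \<tau> * g x) = 1/h * (P \<tau> \<psi> x - \<psi> x - \<tau> * (?q h - ?q 0))"
    using t h(1) P_0[OF \<phi>] by (simp add: Pf f_def g_def field_simps)
   have "1/h * \<bar>P \<tau> \<psi> x - \<psi> x - \<tau> * (?q h - ?q 0)\<bar> <= 1/h * (h * \<eta> * \<tau>)" using X h(1) by (intro mult_left_mono) auto
   then show ?thesis unfolding eq abs_mult using h(1) by simp
  qed
  then show "\<exists>d>0. \<forall>\<tau> x. 0 < \<tau> \<and> \<tau> <= d \<longrightarrow> \<bar>P \<tau> f x - (f x + \<tau> * g x)\<bar> <= \<eta> * \<tau>" using d(1) by blast
 qed
 moreover have "\<bar>\<phi> x - f x\<bar> <= e" for x
 proof -
  have ci: "set_integrable lborel {0..h} (%s. \<phi> x)" by (rule borel_integrable_atLeastAtMost', rule continuous_on_const)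
  have "\<bar>LINT s:{0..h}|lborel. P s \<phi> x - \<phi> x\<bar> <= e * (h - 0)"
   by (rule set_integral_bound_Icc[OF set_integral_diff(1)[OF i ci]]) (use h in auto)
  moreover have "(LINT s:{0..h}|lborel. P s \<phi> x - \<phi> x) = \<psi> x - h * \<phi> x"
   unfolding \<psi>_def set_integral_diff(2)[OF i[OF order_refl] ci] using h(1) by (simp add: set_lebesgue_integral_def)
  ultimately have "\<bar>\<psi> x - h * \<phi> x\<bar> <= e * h" by simp
  then have "1/h * \<bar>\<psi> x - h * \<phi> x\<bar> <= 1/h * (e * h)" using h(1) by (intro mult_left_mono) auto
  moreover have "\<phi> x - f x = - (1/h * (\<psi> x - h * \<phi> x))" using h(1) by (simp add: f_def field_simps)
  ultimately show ?thesis using h(1) by (simp only: abs_minus_cancel abs_mult) simp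
 qed
 ultimately show thesis by (rule that)
qed

end

section \<open>Inhomogeneous forward equations and Duhamel's formula\<close>

lemma Ccinf_cont: "F \<in> Ccinf ==> set bs \<subseteq> Basis ==> continuous_on UNIV (foldr pde bs F)"
 by (simp add: Ccinf_def)

lemma Ccinf_Chat:
 fixes F :: "'a::euclidean_space => real"
 assumes "F \<in> Ccinf" shows "F \<in> Chat UNIV"
proof -
 obtain K where K: "compact K" "!!x. x \<notin> K ==> F x = 0" using assms unfolding Ccinf_def by blast
 have "continuous_on UNIV F" using Ccinf_cont[OF assms, of "[]"] by simp
 then show ?thesis using K by (rule ChatI)
qed

text \<open>\<open>D r\<close> is the inhomogeneity at time r. The axioms make it behave like
  integration against a signed measure: linear, bounded in sup norm and continuous under bounded
  pointwise convergence. The constant \<open>M\<close> is shared with the unknown of the locale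
  \<open>forward\<close>.\<close>

locale source = feller a \<rho> P for a \<rho> and P :: "real => ('a::euclidean_space => real) => 'a => real" +
 fixes D :: "real => ('a => real) => real" and M T :: real
 assumes T: "0 <= T" and M: "0 <= M"
  and D_lin: "!!r f g k. 0 <= r ==> r <= T ==> f \<in> Bm ==> g \<in> Bm ==> D r (%x. f x + k * g x) = D r f + k * D r g"
  and D_bound: "!!r f c. 0 <= r ==> r <= T ==> f \<in> Bm ==> (!!x. \<bar>f x\<bar> <= c) ==> \<bar>D r f\<bar> <= M * c"
  and D_conv: "!!r F f c. 0 <= r ==> r <= T ==> (!!n::nat. F n \<in> Bm) ==> (!!n x. \<bar>F n x\<bar> <= c) ==>
   (!!x. (%n. F n x) \<longlonglongrightarrow> f x) ==> f \<in> Bm ==> (%n. D r (F n)) \<longlonglongrightarrow> D r f"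
  and D_int: "!!f. f \<in> Bm ==> set_integrable lborel {0..T} (%r. D r f)"
begin

lemma D_diff: "0 <= r ==> r <= T ==> f \<in> Bm ==> g \<in> Bm ==> (!!x. \<bar>f x - g x\<bar> <= c) ==> \<bar>D r f - D r g\<bar> <= M * c"
 using D_lin[of r f g "-1"] D_bound[of r "%x. f x - g x" c] Bm_diff[of f g] by simp

text \<open>Functional and argument both move with \<open>r\<close>. Freezing the argument at
  countably many grid times leaves functions that are measurable by \<open>D_int\<close>, and the
  uniform modulus of \<open>P_unif\<close> makes them converge.\<close>

lemma D_step_meas:
 assumes h: "h \<in> Chat UNIV"
 shows "(%r. indicator {0..T} r * D r (P (T - r) h)) \<in> borel_measurable borel"
proof (rule borel_measurable_LIMSEQ_real)
 note hB = Chat_Bm[OF h]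
 have m: "(%r. indicator {0..T} r * D r f) \<in> borel_measurable borel" if "f \<in> Bm" for f
  using D_int[OF that] unfolding set_integrable_def by auto
 define i where "i n r = nat \<lfloor>r * real (Suc n)\<rfloor>" for n and r :: real
 \<comment> \<open>\<open>max 0\<close> keeps the semigroup time nonnegative: in the countable case
   distinction every index \<open>j\<close> has to be admissible, also those whose grid time exceeds
   T.\<close>
 let ?u = "%n r. indicator {0..T} r * D r (P (max 0 (T - real (i n r) / real (Suc n))) h)"
 show "?u n \<in> borel_measurable borel" for n
 proof -
  have "(%r. (%j r. indicator {0..T} r * D r (P (max 0 (T - real j / real (Suc n))) h)) (i n r) r) \<in> borel_measurable borel"
   by (rule measurable_compose_countable) (auto intro!: m P_Bm hB simp: i_def)
  then show ?thesis by simp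
 qed
 show "(%n. ?u n r) \<longlonglongrightarrow> indicator {0..T} r * D r (P (T - r) h)" for r
 proof (cases "r \<in> {0..T}")
  case True
  then have r: "0 <= r" "r <= T" by auto
  have "(%n. ?u n r) \<longlonglongrightarrow> D r (P (T - r) h)"
  proof (rule LIMSEQ_I)
   fix e :: real assume e: "0 < e"
   define K where "K = M + 1"
   define \<eta> where "\<eta> = e / 2 / K"
   have K: "0 < K" using M by (simp add: K_def)
   have \<eta>: "0 < \<eta>" using e K by (simp add: \<eta>_def)
   have "K * \<eta> = e / 2" using K by (simp add: \<eta>_def)
   then have \<eta>M: "M * \<eta> < e" using \<eta> e by (simp add: K_def distrib_right)
   obtain d where d: "0 < d" "!!s s' x. 0 <= s ==> s <= s' ==> s' - s <= d ==> \<bar>P s' h x - P s h x\<bar> <= \<eta>" using P_unif[OF h \<eta>] by metis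
   obtain N :: nat where N: "1 / d < real N" using reals_Archimedean2 by blast
   have "norm (?u n r - D r (P (T - r) h)) < e" if n: "n \<ge> N" for n
   proof -
    define q where "q = real (i n r) / real (Suc n)"
    have p: "real (i n r) <= r * real (Suc n)" "r * real (Suc n) < real (i n r) + 1"
     using r(1) by (auto simp: i_def)
    have q1: "q <= r" "r < q + 1 / real (Suc n)" using p unfolding q_def by (auto simp: field_simps)
    have "1 / d < real (Suc n)" using N n by linarith
    then have "1 / real (Suc n) <= d" using d(1) by (simp add: field_simps)
    then have "r - q <= d" using q1 by linarith
    then have "\<bar>P (T - q) h x - P (T - r) h x\<bar> <= \<eta>" for x using q1 r by (intro d(2)) auto
    then have "\<bar>D r (P (T - q) h) - D r (P (T - r) h)\<bar> <= M * \<eta>" using q1 r hB by (intro D_diff P_Bm) auto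
    moreover have "max 0 (T - q) = T - q" using q1 r by simp
    ultimately show ?thesis using True \<eta>M by (simp add: q_def)
   qed
   then show "\<exists>no. \<forall>n\<ge>no. norm (?u n r - D r (P (T - r) h)) < e" by blast
  qed
  then show ?thesis using True by simp
 qed simp
qed

lemma D_path_int:
 assumes m: "(%r. indicator {0..T} r * D r (P (T - r) h)) \<in> borel_measurable borel" and h: "h \<in> Bm"
  and st: "0 <= s" "t <= T"
 shows "set_integrable lborel {s..t} (%r. D r (P (T - r) h))"
proof -
 obtain C where C: "0 <= C" "!!x. \<bar>h x\<bar> <= C" using BmE[OF h] by metis
 have "\<bar>indicator {0..T} r * D r (P (T - r) h)\<bar> <= M * C" for r
 proof (cases "r \<in> {0..T}")
  case True
  then have r: "0 <= r" "r <= T" "0 <= T - r" by auto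
  show ?thesis using D_bound[OF r(1,2) P_Bm[OF r(3) h] P_bound[OF r(3) h C(2)]] True by simp
 qed (use M C in simp)
 then have "set_integrable lborel {s..t} (%r. indicator {0..T} r * D r (P (T - r) h))"
  by (rule set_integrable_bounded[OF m])
 moreover have "(%r. indicator {s..t} r *\<^sub>R (indicator {0..T} r * D r (P (T - r) h))) = (%r. indicator {s..t} r *\<^sub>R D r (P (T - r) h))"
  using st by (auto simp: indicator_def fun_eq_iff)
 ultimately show ?thesis by (simp add: set_integrable_def)
qed

text \<open>Monotone class extension of \<open>D_step_meas\<close>: bounded pointwise limits pass
  through \<open>P (T - r)\<close> and then through \<open>D r\<close>.\<close>

lemma D_path:
 assumes "h \<in> Bm"
 shows "(%r. indicator {0..T} r * D r (P (T - r) h)) \<in> borel_measurable borel"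
  and "0 <= s ==> t <= T ==> set_integrable lborel {s..t} (%r. D r (P (T - r) h))"
proof -
 show "(%r. indicator {0..T} r * D r (P (T - r) h)) \<in> borel_measurable borel"
  using assms
 proof (induction h rule: Bm_induct)
  case (Chat h)
  then show ?case by (rule D_step_meas)
 next
  case (lin f g c)
  have e: "P t (%x. f x + c * g x) = (%x. P t f x + c * P t g x)" if "0 <= t" for t using P_lin[OF that lin(1,2)] by blast
  have Dl: "D r (P (T - r) (%x. f x + c * g x)) = D r (P (T - r) f) + c * D r (P (T - r) g)" if "r \<in> {0..T}" for r
   using that e[of "T - r"] by (simp add: D_lin P_Bm lin(1,2))
  have "(%r. indicator {0..T} r * D r (P (T - r) (%x. f x + c * g x)))
    = (%r. indicator {0..T} r * D r (P (T - r) f) + c * (indicator {0..T} r * D r (P (T - r) g)))"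
   using Dl by (auto simp: indicator_def fun_eq_iff)
  then show ?case using borel_measurable_add[OF lin(3) borel_measurable_times[OF borel_measurable_const lin(4)]] by simp
 next
  case (lim F f C)
  have fB: "f \<in> Bm" by (rule Bm_lim[OF lim(1-3)])
  show ?case
  proof (rule borel_measurable_LIMSEQ_real)
   show "(%r. indicator {0..T} r * D r (P (T - r) (F n))) \<in> borel_measurable borel" for n using lim(4)[of n] .
   show "(%n. indicator {0..T} r * D r (P (T - r) (F n))) \<longlonglongrightarrow> indicator {0..T} r * D r (P (T - r) f)" for r
   proof (cases "r \<in> {0..T}")
    case True
    then have r: "0 <= r" "r <= T" "0 <= T - r" by auto
    show ?thesis
     by (intro tendsto_mult tendsto_const D_conv[OF r(1,2) P_Bm[OF r(3) lim(1)] P_bound[OF r(3) lim(1,2)] P_conv[OF r(3) lim(1-3) fB] P_Bm[OF r(3) fB]])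
   qed simp
  qed
 qed
 from D_path_int[OF this assms] show "0 <= s ==> t <= T ==> set_integrable lborel {s..t} (%r. D r (P (T - r) h))" .
qed

end

text \<open>\<open>L r\<close> is the unknown. The forward equation \<open>ident\<close> is demanded
  on smooth compactly supported functions only; these are a core of the generator, and everything
  beyond them is derived.\<close>

locale forward = source a \<rho> P D M T for a \<rho> and P :: "real => ('a::euclidean_space => real) => 'a => real" and D M T +
 fixes L :: "real => ('a => real) => real"
 assumes L_lin: "!!r f g k. 0 <= r ==> r <= T ==> f \<in> Bm ==> g \<in> Bm ==> L r (%x. f x + k * g x) = L r f + k * L r g"
  and L_bound: "!!r f c. 0 <= r ==> r <= T ==> f \<in> Bm ==> (!!x. \<bar>f x\<bar> <= c) ==> \<bar>L r f\<bar> <= M * c"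
  and L_conv: "!!r F f c. 0 <= r ==> r <= T ==> (!!n::nat. F n \<in> Bm) ==> (!!n x. \<bar>F n x\<bar> <= c) ==>
   (!!x. (%n. F n x) \<longlonglongrightarrow> f x) ==> f \<in> Bm ==> (%n. L r (F n)) \<longlonglongrightarrow> L r f"
  and L_int: "!!f. f \<in> Bm ==> set_integrable lborel {0..T} (%r. L r f)"
  and Gop_Bm: "!!F :: 'a => real. F \<in> Ccinf ==> Gop a \<rho> F \<in> Bm"
  and ident: "!!F s t. F \<in> Ccinf ==> 0 <= s ==> s <= t ==> t <= T ==>
   L t F - L s F = (LINT r:{s..t}|lborel. L r (Gop a \<rho> F) + D r F)"
begin

lemma L_diff: "0 <= r ==> r <= T ==> f \<in> Bm ==> g \<in> Bm ==> (!!x. \<bar>f x - g x\<bar> <= c) ==> \<bar>L r f - L r g\<bar> <= M * c"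
 using L_lin[of r f g "-1"] L_bound[of r "%x. f x - g x" c] Bm_diff[of f g] by simp

lemma int_sub:
 assumes "f \<in> Bm" "0 <= s" "t <= T"
 shows "set_integrable lborel {s..t} (%r. L r f)" "set_integrable lborel {s..t} (%r. D r f)"
 using L_int[OF assms(1)] D_int[OF assms(1)] assms(2,3) by (auto intro: set_integrable_subset)

text \<open>The generator is the closure of \<open>Gop\<close> on \<open>Ccinf\<close>, so (f, g) is
  a uniform limit of pairs that satisfy the identity, and all functionals in it are bounded in sup
  norm.\<close>

lemma ident_gen:
 assumes fg: "(f, g) \<in> generator P" and st: "0 <= s" "s <= t" "t <= T"
 shows "L t f - L s f = (LINT r:{s..t}|lborel. L r g + D r f)"
proof -
 obtain F :: "nat => 'a => real" where F: "!!n. F n \<in> Ccinf" "uniform_limit UNIV F f sequentially"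
  "uniform_limit UNIV (%n. Gop a \<rho> (F n)) g sequentially"
  using fg unfolding generator_eq Gclosure_def by blast
 note B = gen_Chat[OF fg, THEN Chat_Bm]
 have "L t f - L s f - (LINT r:{s..t}|lborel. L r g + D r f) = 0"
 proof (rule eq_0_by_eps[where C = "2 * M + 2 * M * (t - s)"])
  fix e :: real assume e: "0 < e"
  have "eventually (%n. (\<forall>x\<in>UNIV. dist (F n x) (f x) < e) \<and> (\<forall>x\<in>UNIV. dist (Gop a \<rho> (F n) x) (g x) < e)) sequentially"
   using F(2,3) e unfolding uniform_limit_iff by (intro eventually_conj) blast+
  then obtain n where n: "!!x. \<bar>f x - F n x\<bar> <= e" "!!x. \<bar>g x - Gop a \<rho> (F n) x\<bar> <= e"
   unfolding eventually_sequentially dist_real_def by (metis UNIV_I abs_minus_commute le_refl less_imp_le)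
  note FB = Chat_Bm[OF Ccinf_Chat[OF F(1)[of n]]] and GB = Gop_Bm[OF F(1)[of n]]
  have i1: "set_integrable lborel {s..t} (%r. L r g + D r f)" "set_integrable lborel {s..t} (%r. L r (Gop a \<rho> (F n)) + D r (F n))"
   using int_sub[OF B(1) st(1,3)] int_sub[OF B(2) st(1,3)] int_sub[OF FB st(1,3)] int_sub[OF GB st(1,3)] by (auto intro!: set_integral_add(1))
  have "\<bar>LINT r:{s..t}|lborel. (L r g + D r f) - (L r (Gop a \<rho> (F n)) + D r (F n))\<bar> <= (M * e + M * e) * (t - s)"
  proof (rule set_integral_bound_Icc[OF set_integral_diff(1)[OF i1] _ st(2)])
   fix r assume "s <= r" "r <= t"
   then have r: "0 <= r" "r <= T" using st by auto
   show "\<bar>(L r g + D r f) - (L r (Gop a \<rho> (F n)) + D r (F n))\<bar> <= M * e + M * e"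
    using L_diff[OF r B(2) GB n(2)] D_diff[OF r B(1) FB n(1)] by linarith
  qed
  then have "\<bar>(LINT r:{s..t}|lborel. L r g + D r f) - (L t (F n) - L s (F n))\<bar> <= 2 * M * (t - s) * e"
   unfolding set_integral_diff(2)[OF i1] ident[OF F(1) st] by (simp add: algebra_simps)
  moreover have "\<bar>L t f - L t (F n)\<bar> <= M * e" "\<bar>L s f - L s (F n)\<bar> <= M * e"
   using L_diff[OF _ _ B(1) FB n(1)] st by auto
  ultimately show "\<bar>L t f - L s f - (LINT r:{s..t}|lborel. L r g + D r f)\<bar> <= (2 * M + 2 * M * (t - s)) * e"
   unfolding distrib_right by linarith
 qed
 then show ?thesis by simp
qed

text \<open>The modulus must not depend on \<open>u\<close>, since the telescoping meets all
  \<open>P u g\<close>. For \<open>f\<close> in the domain, \<open>P u f\<close> stays there with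
  image bounded uniformly in \<open>u\<close>, so \<open>ident_gen\<close> gives a Lipschitz bound;
  density transfers it to \<open>g\<close>.\<close>

lemma L_equicontinuous:
 assumes g: "g \<in> Chat UNIV" and \<eta>: "0 < \<eta>"
 obtains d where "0 < d" "!!u r r'. 0 <= u ==> 0 <= r ==> r <= r' ==> r' <= T ==> r' - r <= d ==> \<bar>L r' (P u g) - L r (P u g)\<bar> <= \<eta>"
proof -
 define e where "e = \<eta> / (4 * (M + 1))"
 have e: "0 < e" "M * e <= \<eta> / 4" using \<eta> M by (auto simp: e_def field_simps)
 obtain f g1 where f: "(f, g1) \<in> generator P" "!!x. \<bar>g x - f x\<bar> <= e" using gen_dense[OF g e(1)] by metis
 obtain C1 where C1: "0 <= C1" "!!x. \<bar>f x\<bar> <= C1" using Chat_bounded[OF gen_Chat(1)[OF f(1)]] by metis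
 obtain C2 where C2: "0 <= C2" "!!x. \<bar>g1 x\<bar> <= C2" using Chat_bounded[OF gen_Chat(2)[OF f(1)]] by metis
 \<comment> \<open>The increment over a time step is at most \<open>M * C2 + M * C1\<close> times
   its length; the added 1 avoids a division by zero.\<close>
 define d where "d = \<eta> / (2 * (M * C2 + M * C1 + 1))"
 have C0: "0 <= M * C2 + M * C1" using M C1(1) C2(1) by simp
 have d: "0 < d" "(M * C2 + M * C1) * d <= \<eta> / 2" using \<eta> C0 by (auto simp: d_def field_simps)
 show thesis
 proof (rule that[OF d(1)])
  fix u r r' :: real assume u: "0 <= u" and r: "0 <= r" "r <= r'" "r' <= T" "r' - r <= d"
  note B = gen_Chat[OF f(1), THEN Chat_Bm] Chat_Bm[OF g]
  note PB = P_Bm[OF u B(1)] P_Bm[OF u B(2)] P_Bm[OF u B(3)]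
  have "\<bar>LINT v:{r..r'}|lborel. L v (P u g1) + D v (P u f)\<bar> <= (M * C2 + M * C1) * (r' - r)"
  proof (rule set_integral_bound_Icc[OF _ _ r(2)])
   show "set_integrable lborel {r..r'} (%v. L v (P u g1) + D v (P u f))"
    using int_sub[OF PB(1) r(1,3)] int_sub[OF PB(2) r(1,3)] by (auto intro!: set_integral_add(1))
   fix v assume "r <= v" "v <= r'"
   then have v: "0 <= v" "v <= T" using r by auto
   show "\<bar>L v (P u g1) + D v (P u f)\<bar> <= M * C2 + M * C1"
    using L_bound[OF v PB(2) P_bound[OF u B(2) C2(2)]] D_bound[OF v PB(1) P_bound[OF u B(1) C1(2)]] by linarith
  qed
  then have "\<bar>L r' (P u f) - L r (P u f)\<bar> <= (M * C2 + M * C1) * (r' - r)" using ident_gen[OF gen_P[OF f(1) u] r(1-3)] by simp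
  also have "\<dots> <= (M * C2 + M * C1) * d" by (rule mult_left_mono[OF r(4) C0])
  finally have 1: "\<bar>L r' (P u f) - L r (P u f)\<bar> <= \<eta> / 2" using d(2) by simp
  have 2: "\<bar>L v (P u g) - L v (P u f)\<bar> <= \<eta> / 4" if "0 <= v" "v <= T" for v
   using L_diff[OF that PB(3) PB(1) P_diff_bound[OF u B(3,1) f(2)]] e(2) by linarith
  show "\<bar>L r' (P u g) - L r (P u g)\<bar> <= \<eta>" using 1 2[of r] 2[of r'] r by linarith
 qed
qed

text \<open>Along \<open>r \<mapsto> L r (P (T - r) h)\<close> the drift of \<open>L\<close> and the
  derivative of the semigroup cancel to first order, and the source remains. The error of each step
  is a multiple of \<eta> times its length, so the errors add up to a multiple of \<eta> T.\<close>

lemma forward_gen: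
 assumes hg: "(h, g) \<in> generator P"
 shows "L T h - L 0 (P T h) - (LINT r:{0..T}|lborel. D r (P (T - r) h)) = 0"
proof (rule eq_0_by_eps[where C = "(2 * M + 1) * T"])
 fix \<eta> :: real assume \<eta>: "0 < \<eta>"
 note c = gen_Chat[OF hg] and B = gen_Chat[OF hg, THEN Chat_Bm]
 obtain d1 where d1: "0 < d1" "!!\<tau> x. 0 <= \<tau> ==> \<tau> <= d1 ==> \<bar>P \<tau> h x - (h x + \<tau> * g x)\<bar> <= \<eta> * \<tau>" using gen_bound[OF hg \<eta>] by metis
 obtain d2 where d2: "0 < d2" "!!u r r'. 0 <= u ==> 0 <= r ==> r <= r' ==> r' <= T ==> r' - r <= d2 ==> \<bar>L r' (P u g) - L r (P u g)\<bar> <= \<eta>"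
  using L_equicontinuous[OF c(2) \<eta>] by metis
 obtain d3 where d3: "0 < d3" "!!s s' x. 0 <= s ==> s <= s' ==> s' - s <= d3 ==> \<bar>P s' h x - P s h x\<bar> <= \<eta>" using P_unif[OF c(1) \<eta>] by metis
 define d where "d = min d1 (min d2 d3)"
 have d: "0 < d" using d1(1) d2(1) d3(1) by (simp add: d_def)
 note Di = D_path_int[OF D_step_meas[OF c(1)] B(1)]
 \<comment> \<open>The factor 2M + 1 collects M for the first-order expansion of the semigroup, 1
   for freezing \<open>L\<close> in time, and M for freezing the argument of
   \<open>D\<close>.\<close>
 have step: "\<bar>L r1 (P (T - r1) h) - L r0 (P (T - r0) h) - (LINT r:{r0..r1}|lborel. D r (P (T - r) h))\<bar> <= (2 * M + 1) * \<eta> * (r1 - r0)"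
  if r: "0 <= r0" "r0 <= r1" "r1 <= T" "r1 - r0 <= d" for r0 r1
 proof -
  define \<tau> where "\<tau> = r1 - r0"
  define u where "u = T - r1"
  have u: "0 <= u" and \<tau>: "0 <= \<tau>" "\<tau> <= d1" "\<tau> <= d2" "\<tau> <= d3" using r by (auto simp: u_def \<tau>_def d_def)
  have r0: "0 <= r0" "r0 <= T" using r by auto
  note PB = P_Bm[OF u B(1)] P_Bm[OF u B(2)]
  have e1: "L r1 (P u h) - L r0 (P u h) = (LINT v:{r0..r1}|lborel. L v (P u g)) + (LINT v:{r0..r1}|lborel. D v (P u h))"
   using ident_gen[OF gen_P[OF hg u] r(1-3)] set_integral_add(2)[OF int_sub(1)[OF PB(2) r(1,3)] int_sub(2)[OF PB(1) r(1,3)]] by simp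
  have "P (T - r0) h = P u (P \<tau> h)" using P_add[OF u \<tau>(1) c(1)] by (simp add: u_def \<tau>_def)
  moreover have "\<bar>P u (P \<tau> h) x - P u (%x. h x + \<tau> * g x) x\<bar> <= \<eta> * \<tau>" for x
   by (rule P_diff_bound[OF u]) (use \<tau> d1(2) B P_Bm in \<open>auto intro!: Bm_add Bm_mult\<close>)
  ultimately have "\<bar>P (T - r0) h x - (P u h x + \<tau> * P u g x)\<bar> <= \<eta> * \<tau>" for x using P_lin[OF u B] by simp
  then have "\<bar>L r0 (P (T - r0) h) - L r0 (%x. P u h x + \<tau> * P u g x)\<bar> <= M * (\<eta> * \<tau>)"
   using r0 B PB u by (intro L_diff P_Bm Bm_add Bm_mult Bm_const) auto
  then have e2: "\<bar>L r0 (P (T - r0) h) - (L r0 (P u h) + \<tau> * L r0 (P u g))\<bar> <= M * \<eta> * \<tau>"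
   using L_lin[OF r0 PB] by (simp add: mult.assoc)
  have ci: "set_integrable lborel {r0..r1} (%v. L r0 (P u g))" by (rule borel_integrable_atLeastAtMost', rule continuous_on_const)
  note i1 = int_sub(1)[OF PB(2) r(1,3)]
  have "\<bar>LINT v:{r0..r1}|lborel. L v (P u g) - L r0 (P u g)\<bar> <= \<eta> * (r1 - r0)"
   by (rule set_integral_bound_Icc[OF set_integral_diff(1)[OF i1 ci] _ r(2)]) (use r u \<tau> in \<open>auto simp: \<tau>_def intro!: d2(2)\<close>)
  then have e3: "\<bar>(LINT v:{r0..r1}|lborel. L v (P u g)) - \<tau> * L r0 (P u g)\<bar> <= \<eta> * \<tau>"
   unfolding set_integral_diff(2)[OF i1 ci] using r(2) by (simp add: set_lebesgue_integral_def \<tau>_def)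
  note i2 = int_sub(2)[OF PB(1) r(1,3)] Di[OF r(1,3)]
  have "\<bar>LINT v:{r0..r1}|lborel. D v (P u h) - D v (P (T - v) h)\<bar> <= M * \<eta> * (r1 - r0)"
  proof (rule set_integral_bound_Icc[OF set_integral_diff(1)[OF i2] _ r(2)])
   fix v assume v: "r0 <= v" "v <= r1"
   have "\<bar>P (T - v) h x - P u h x\<bar> <= \<eta>" for x using v u \<tau> by (intro d3(2)) (auto simp: u_def \<tau>_def)
   then show "\<bar>D v (P u h) - D v (P (T - v) h)\<bar> <= M * \<eta>"
    using v r PB B u by (intro D_diff P_Bm) (auto simp: abs_minus_commute)
  qed
  then have e4: "\<bar>(LINT v:{r0..r1}|lborel. D v (P u h)) - (LINT v:{r0..r1}|lborel. D v (P (T - v) h))\<bar> <= M * \<eta> * \<tau>"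
   unfolding set_integral_diff(2)[OF i2] by (simp add: \<tau>_def)
  have "(2 * M + 1) * \<eta> * (r1 - r0) = M * \<eta> * \<tau> + \<eta> * \<tau> + M * \<eta> * \<tau>" by (simp add: \<tau>_def algebra_simps)
  then show ?thesis using e1 e2 e3 e4 unfolding u_def[symmetric] by linarith
 qed
 obtain n :: nat where n: "T / d < real n" using reals_Archimedean2 by blast
 then have n0: "0 < real n" using T d by (meson divide_nonneg_pos le_less_trans)
 define l where "l = T / real n"
 have l: "0 <= l" "l <= d" "real n * l = T" using n n0 T d by (auto simp: l_def field_simps)
 have "\<bar>L (real k * l) (P (T - real k * l) h) - L 0 (P T h) - (LINT r:{0..real k * l}|lborel. D r (P (T - r) h))\<bar> <= (2 * M + 1) * \<eta> * (real k * l)"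
  if "k <= n" for k
  using that
 proof (induction k)
  case 0
  have "(LINT r:{0..0::real}|lborel. D r (P (T - r) h)) = 0"
   using set_integral_bound_Icc[OF Di[of 0 0] _ order_refl, of "\<bar>D 0 (P (T - 0) h)\<bar>"] T by simp
  then show ?case by simp
 next
  case (Suc k)
  have le: "0 <= real k * l" "real k * l <= real (Suc k) * l" "real (Suc k) * l <= T"
   using l mult_right_mono[of "real (Suc k)" "real n" l] Suc(2) by (auto simp: mult_right_mono)
  have "real (Suc k) * l - real k * l = l" by (simp add: algebra_simps)
  with step[OF le] l(2)
  have "\<bar>L (real (Suc k) * l) (P (T - real (Suc k) * l) h) - L (real k * l) (P (T - real k * l) h)
    - (LINT r:{real k * l..real (Suc k) * l}|lborel. D r (P (T - r) h))\<bar> <= (2 * M + 1) * \<eta> * (real (Suc k) * l - real k * l)" by simp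
  moreover have "(LINT r:{0..real (Suc k) * l}|lborel. D r (P (T - r) h)) = (LINT r:{0..real k * l}|lborel. D r (P (T - r) h))
    + (LINT r:{real k * l..real (Suc k) * l}|lborel. D r (P (T - r) h))"
   by (rule set_integral_Icc_split[OF Di le(1,2)]) (use le in auto)
  moreover have "(2 * M + 1) * \<eta> * (real (Suc k) * l) = (2 * M + 1) * \<eta> * (real (Suc k) * l - real k * l) + (2 * M + 1) * \<eta> * (real k * l)"
   by (simp only: distrib_left[symmetric] diff_add_cancel)
  ultimately show ?case using Suc by linarith
 qed
 from this[OF order_refl, unfolded l(3)] show "\<bar>L T h - L 0 (P T h) - (LINT r:{0..T}|lborel. D r (P (T - r) h))\<bar> <= (2 * M + 1) * T * \<eta>"
  using P_0[OF c(1)] by (simp add: mult.commute mult.left_commute)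
qed

lemma forward_Chat:
 assumes h: "h \<in> Chat UNIV"
 shows "L T h - L 0 (P T h) - (LINT r:{0..T}|lborel. D r (P (T - r) h)) = 0"
proof (rule eq_0_by_eps[where C = "2 * M + M * T"])
 fix e :: real assume e: "0 < e"
 obtain f g where f: "(f, g) \<in> generator P" "!!x. \<bar>h x - f x\<bar> <= e" using gen_dense[OF h e] by metis
 note B = Chat_Bm[OF h] Chat_Bm[OF gen_Chat(1)[OF f(1)]]
 have z: "0 <= (0::real)" by simp
 have i: "set_integrable lborel {0..T} (%r. D r (P (T - r) h))" "set_integrable lborel {0..T} (%r. D r (P (T - r) f))"
  using D_path_int[OF D_step_meas] B h gen_Chat(1)[OF f(1)] by auto
 have "\<bar>LINT r:{0..T}|lborel. D r (P (T - r) h) - D r (P (T - r) f)\<bar> <= M * e * (T - 0)"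
  by (rule set_integral_bound_Icc[OF set_integral_diff(1)[OF i] _ T]) (auto intro!: D_diff P_Bm P_diff_bound B f(2))
 then have "\<bar>(LINT r:{0..T}|lborel. D r (P (T - r) h)) - (LINT r:{0..T}|lborel. D r (P (T - r) f))\<bar> <= M * T * e"
  unfolding set_integral_diff(2)[OF i] by (simp add: algebra_simps)
 moreover have "\<bar>L T h - L T f\<bar> <= M * e" by (rule L_diff[OF T order_refl B f(2)])
 moreover have "\<bar>L 0 (P T h) - L 0 (P T f)\<bar> <= M * e" by (rule L_diff[OF z T P_Bm[OF T B(1)] P_Bm[OF T B(2)] P_diff_bound[OF T B f(2)]])
 ultimately show "\<bar>L T h - L 0 (P T h) - (LINT r:{0..T}|lborel. D r (P (T - r) h))\<bar> <= (2 * M + M * T) * e"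
  using forward_gen[OF f(1)] unfolding distrib_right by linarith
qed

text \<open>Both sides are continuous under bounded pointwise convergence, so the monotone class
  theorem extends what density of the domain has given on \<open>Chat UNIV\<close>.\<close>

theorem forward_solution:
 assumes "h \<in> Bm"
 shows "L T h = L 0 (P T h) + (LINT r:{0..T}|lborel. D r (P (T - r) h))"
 using assms
proof (induction h rule: Bm_induct)
 case (Chat h)
 then show ?case using forward_Chat by fastforce
next
 case (lin f g c)
 have e: "P t (%x. f x + c * g x) = (%x. P t f x + c * P t g x)" if "0 <= t" for t using P_lin[OF that lin(1,2)] by blast
 have Dl: "D r (P (T - r) (%x. f x + c * g x)) = D r (P (T - r) f) + c * D r (P (T - r) g)" if "r \<in> {0..T}" for r
  using that e[of "T - r"] by (simp add: D_lin P_Bm lin(1,2))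
 have i: "set_integrable lborel {0..T} (%r. D r (P (T - r) f))" "set_integrable lborel {0..T} (%r. D r (P (T - r) g))"
  using lin D_path(2) by auto
 have "(LINT r:{0..T}|lborel. D r (P (T - r) (%x. f x + c * g x))) = (LINT r:{0..T}|lborel. D r (P (T - r) f) + c * D r (P (T - r) g))"
  by (rule set_lebesgue_integral_cong) (use Dl in auto)
 also have "\<dots> = (LINT r:{0..T}|lborel. D r (P (T - r) f)) + c * (LINT r:{0..T}|lborel. D r (P (T - r) g))"
  using i by (simp add: set_integral_add(2))
 finally show ?case using lin T by (simp add: e L_lin P_Bm algebra_simps)
next
 case (lim F f C)
 have z: "0 <= (0::real)" by simp
 have fB: "f \<in> Bm" by (rule Bm_lim[OF lim(1-3)])
 have Pc: "(%n. P t (F n) x) \<longlonglongrightarrow> P t f x" if "0 <= t" for t x by (rule P_conv[OF that lim(1-3) fB])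
 have 1: "(%n. LINT r:{0..T}|lborel. D r (P (T - r) (F n))) \<longlonglongrightarrow> (LINT r:{0..T}|lborel. D r (P (T - r) f))"
 proof (rule set_integral_LIMSEQ[where K = "M * C"])
  show "set_integrable lborel {0..T} (%r. D r (P (T - r) (F n)))" for n by (rule D_path(2)[OF lim(1)]) auto
  fix r assume r: "0 <= r" "r <= T"
  then have q: "0 <= T - r" by simp
  show "\<bar>D r (P (T - r) (F n))\<bar> <= M * C" for n by (rule D_bound[OF r P_Bm[OF q lim(1)] P_bound[OF q lim(1,2)]])
  show "(%n. D r (P (T - r) (F n))) \<longlonglongrightarrow> D r (P (T - r) f)"
   by (rule D_conv[OF r P_Bm[OF q lim(1)] P_bound[OF q lim(1,2)] Pc[OF q] P_Bm[OF q fB]])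
 qed
 have 2: "(%n. L T (F n)) \<longlonglongrightarrow> L T f" by (rule L_conv[OF T order_refl lim(1-3) fB])
 have 3: "(%n. L 0 (P T (F n))) \<longlonglongrightarrow> L 0 (P T f)"
  by (rule L_conv[OF z T P_Bm[OF T lim(1)] P_bound[OF T lim(1,2)] Pc[OF T] P_Bm[OF T fB]])
 have "(%n. L T (F n)) = (%n. L 0 (P T (F n)) + (LINT r:{0..T}|lborel. D r (P (T - r) (F n))))" using lim(4) by blast
 then have "(%n. L 0 (P T (F n)) + (LINT r:{0..T}|lborel. D r (P (T - r) (F n)))) \<longlonglongrightarrow> L T f" using 2 by simp
 from LIMSEQ_unique[OF this tendsto_add[OF 3 1]] show ?case .
qed

end

section \<open>Local martingales stopped softly\<close>

lemma measurable_pair_subalgebra: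
 assumes sub: "subalgebra Q G" and f: "f \<in> borel_measurable (M \<Otimes>\<^sub>M G)"
 shows "f \<in> borel_measurable (M \<Otimes>\<^sub>M Q)"
proof -
 have "(%z. z) \<in> measurable Q G" 
 proof (rule measurableI)
  show "z \<in> space G" if "z \<in> space Q" for z using that sub by (simp add: subalgebra_def)
  show "(%z. z) -` A \<inter> space Q \<in> sets Q" if "A \<in> sets G" for A
  proof -
   have "A \<in> sets Q" using that sub by (auto simp: subalgebra_def)
   then show ?thesis using sets.sets_into_space[of A Q] by (simp add: Int_absorb2)
  qed
 qed
 from measurable_compose[OF measurable_snd this]
 have "(%z. (fst z, snd z)) \<in> measurable (M \<Otimes>\<^sub>M Q) (M \<Otimes>\<^sub>M G)"
  by (intro measurable_Pair measurable_fst)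
 from measurable_compose[OF this f] show ?thesis by simp
qed

text \<open>Half of the exponent is spent on the linear factor, by y exp(-\<theta> y / 2) \<le>
  2/\<theta>; the other half is kept, because the remaining decay is integrated against the clock
  once more.\<close>

lemma mult_exp_minus_le:
 fixes y :: real assumes "0 <= y" "0 < \<theta>" "0 <= b" "0 <= c"
 shows "(b + c * y) * exp (- \<theta> * y) <= (b + 2 * c / \<theta>) * exp (- (\<theta> / 2) * y)"
proof -
 have e: "exp (- \<theta> * y) = exp (- (\<theta> / 2) * y) * exp (- (\<theta> / 2) * y)"
  by (simp add: exp_add[symmetric])
 have "y * (\<theta> / 2) <= exp (\<theta> / 2 * y)" 
  using exp_ge_add_one_self[of "\<theta> / 2 * y"] by (simp only: mult.commute[of y])
 then have "y * exp (- (\<theta> / 2) * y) <= 2 / \<theta>"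
  using assms by (simp add: exp_minus field_simps)
 then have "c * (y * exp (- (\<theta> / 2) * y)) <= c * (2 / \<theta>)" using assms by (intro mult_left_mono)
 moreover have "b * exp (- (\<theta> / 2) * y) <= b" using assms by (simp add: mult_left_le)
 ultimately have "(b + c * y) * exp (- (\<theta> / 2) * y) <= b + 2 * c / \<theta>" by (simp add: algebra_simps)
 then have "(b + c * y) * exp (- (\<theta> / 2) * y) * exp (- (\<theta> / 2) * y) <= (b + 2 * c / \<theta>) * exp (- (\<theta> / 2) * y)"
  by (intro mult_right_mono) auto
 then show ?thesis by (simp only: e mult.assoc)
qed

text \<open>\<open>V\<close> is the clock rate and dominates the drift \<open>L\<close>; the three
  joint measurability axioms express progressive measurability. The bound on \<open>V\<close> in
  \<open>V_loc\<close> is random, so no constant derived below may involve it.\<close>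

locale soft_martingale = prob_space Q for Q :: "'w measure" +
 fixes F :: "ennreal => 'w measure" and \<Phi> L V :: "real => 'w => real" and B C T \<theta> :: real
 assumes sub: "!!t. subalgebra Q (F t)"
  and F_mono: "!!s t. s <= t ==> sets (F s) \<subseteq> sets (F t)"
  and T: "0 <= T" and th: "0 < \<theta>" and BC: "0 <= B" "0 <= C"
  and \<Phi>_joint: "!!s. 0 <= s ==> (%z. \<Phi> (clip s (fst z)) (snd z)) \<in> borel_measurable (borel \<Otimes>\<^sub>M F (ennreal s))"
  and l_joint: "!!s. 0 <= s ==> (%z. L (clip s (fst z)) (snd z)) \<in> borel_measurable (borel \<Otimes>\<^sub>M F (ennreal s))"
  and V_joint: "!!s. 0 <= s ==> (%z. V (clip s (fst z)) (snd z)) \<in> borel_measurable (borel \<Otimes>\<^sub>M F (ennreal s))"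
  and \<Phi>_bd: "!!r om. om \<in> space Q ==> 0 <= r ==> \<bar>\<Phi> r om\<bar> <= B"
  and V_nonneg: "!!r om. om \<in> space Q ==> 0 <= r ==> 0 <= V r om"
  and l_bd: "!!r om. om \<in> space Q ==> 0 <= r ==> \<bar>L r om\<bar> <= C * V r om"
  and V_loc: "!!om. om \<in> space Q ==> \<exists>K. \<forall>r. 0 <= r \<and> r <= T \<longrightarrow> V r om <= K"
  and lm: "local_martingale Q F (%t om. \<Phi> t om - \<Phi> 0 om - (LINT r:{0..t}|lborel. L r om))"
begin

text \<open>Clipping at T freezes the processes after the horizon, so that they are defined at all
  real times and one pathwise bound serves the whole line.\<close>

definition v where "v om r = V (clip T r) om"
definition l where "l om r = L (clip T r) om"
definition A where "A r om = clockA \<theta> (v om) r"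
definition N where "N r om = \<Phi> (clip T r) om - \<Phi> 0 om - prim (l om) (clip T r)"

lemma section_meas:
 assumes "(%z. f (fst z) (snd z)) \<in> borel_measurable (borel \<Otimes>\<^sub>M G)" "om \<in> space G"
 shows "(%r. f r om) \<in> borel_measurable borel"
 using measurable_compose[OF _ assms(1), of "%r. (r, om)" borel] assms(2) by simp

lemma space_F: "space (F t) = space Q" using sub[of t] by (simp add: subalgebra_def)

lemma v_pair[measurable]: "(%z. v (snd z) (fst z)) \<in> borel_measurable (borel \<Otimes>\<^sub>M Q)"
 unfolding v_def by (rule measurable_pair_subalgebra[OF sub V_joint[OF T]])

lemma l_pair[measurable]: "(%z. l (snd z) (fst z)) \<in> borel_measurable (borel \<Otimes>\<^sub>M Q)"
 unfolding l_def by (rule measurable_pair_subalgebra[OF sub l_joint[OF T]])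

lemma \<Phi>_pair[measurable]: "(%z. \<Phi> (clip T (fst z)) (snd z)) \<in> borel_measurable (borel \<Otimes>\<^sub>M Q)"
 by (rule measurable_pair_subalgebra[OF sub \<Phi>_joint[OF T]])

lemma A_pair[measurable]: "(%z. A (fst z) (snd z)) \<in> borel_measurable (borel \<Otimes>\<^sub>M Q)"
proof -
 note prim_measurable_pair[OF v_pair, measurable]
 show ?thesis unfolding A_def clockA_def by measurable
qed

lemma \<Phi>0_meas[measurable]: "\<Phi> 0 \<in> borel_measurable Q"
proof -
 have "(%om. (0::real, om)) \<in> measurable Q (borel \<Otimes>\<^sub>M Q)" by measurable
 from measurable_compose[OF this \<Phi>_pair] T show ?thesis by (simp add: clip_def)
qed

lemma N_pair[measurable]: "(%z. N (fst z) (snd z)) \<in> borel_measurable (borel \<Otimes>\<^sub>M Q)"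
proof -
 have "(%z. (clip T (fst z), snd z)) \<in> measurable (borel \<Otimes>\<^sub>M Q) (borel \<Otimes>\<^sub>M Q)"
  unfolding clip_def by measurable
 from measurable_compose[OF this prim_measurable_pair[OF l_pair]]
 have [measurable]: "(%z. prim (l (snd z)) (clip T (fst z))) \<in> borel_measurable (borel \<Otimes>\<^sub>M Q)" by simp
 show ?thesis unfolding N_def by measurable
qed

lemma pathwise:
 assumes om: "om \<in> space Q"
 obtains K where "clock (v om) K \<theta>" "clock (v om) K (\<theta> / 2)" "!!r. \<bar>l om r\<bar> <= C * K" "0 <= K"
  "!!r. \<bar>l om r\<bar> <= C * v om r" "l om \<in> borel_measurable borel"
proof -
 obtain K where K: "!!r. 0 <= r ==> r <= T ==> V r om <= K" using V_loc[OF om] by blast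
 have v: "0 <= v om r" "v om r <= K" for r
  using V_nonneg[OF om] K clip_le[OF T] by (auto simp: v_def)
 have vm: "v om \<in> borel_measurable borel" using section_meas[OF v_pair om] .
 have lm: "l om \<in> borel_measurable borel" using section_meas[OF l_pair om] .
 have lv: "\<bar>l om r\<bar> <= C * v om r" for r unfolding l_def v_def by (rule l_bd[OF om clip_nonneg])
 show thesis
 proof (rule that[of K])
  show "clock (v om) K \<theta>" "clock (v om) K (\<theta> / 2)" using v vm th by (unfold_locales; simp)+
  show "\<bar>l om r\<bar> <= C * K" for r using lv[of r] mult_left_mono[OF v(2)[of r] BC(2)] by linarith
  show "0 <= K" using v[of 0] by linarith
 qed (fact lv lm)+
qed

text \<open>\<open>2 * B\<close> bounds the two values of \<Phi> in \<open>N\<close>, and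
  \<open>2 * C / \<theta>\<close> is what \<open>mult_exp_minus_le\<close> makes of the accumulated
  drift.\<close>

definition D where "D = 2 * B + 2 * C / \<theta>"

lemma D_nonneg: "0 <= D" unfolding D_def using BC th by simp

lemma N_bd:
 assumes om: "om \<in> space Q"
 shows "\<bar>N r om\<bar> <= 2 * B + C * prim (v om) (clip T r)"
proof -
 from pathwise[OF om] obtain K where K: "clock (v om) K \<theta>" "!!r. \<bar>l om r\<bar> <= C * K"
  "!!r. \<bar>l om r\<bar> <= C * v om r" "l om \<in> borel_measurable borel" by metis
 interpret k: clock "v om" K \<theta> by fact
 have i1: "set_integrable lborel {0..clip T r} (l om)" by (rule k.bounded_int[OF K(4) K(2)])
 have i2: "set_integrable lborel {0..clip T r} (%u. C * v om u)" using k.v_int by simp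
 have "\<bar>prim (l om) (clip T r)\<bar> <= (LINT u:{0..clip T r}|lborel. \<bar>l om u\<bar>)"
  unfolding prim_def using set_integral_norm_bound[OF i1] by simp
 also have "\<dots> <= (LINT u:{0..clip T r}|lborel. C * v om u)"
  by (rule set_integral_mono[OF set_integrable_abs[OF i1] i2]) (rule K(3))
 also have "\<dots> = C * prim (v om) (clip T r)" by (simp add: prim_def)
 finally show ?thesis
  unfolding N_def using \<Phi>_bd[OF om clip_nonneg[of T r]] \<Phi>_bd[OF om, of 0] by linarith
qed

text \<open>\<open>N\<close> is evaluated at an earlier time than the discount factor. As the clock
  is increasing, the bound does not see \<open>u\<close>, and it therefore applies to every stopped
  version of \<open>N\<close>.\<close>

lemma N_A_bd:
 assumes om: "om \<in> space Q" and u: "0 <= u" "u <= r"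
 shows "\<bar>N u om\<bar> * A r om <= D * clockA (\<theta> / 2) (v om) r"
proof -
 from pathwise[OF om] obtain K where K: "clock (v om) K \<theta>" by metis
 interpret k: clock "v om" K \<theta> by fact
 have "prim (v om) (clip T u) <= prim (v om) r"
  using k.Y_diff(1)[of "clip T u" r] u by (auto simp: clip_def)
 then have "\<bar>N u om\<bar> <= 2 * B + C * prim (v om) r"
  using N_bd[OF om, of u] mult_left_mono[OF _ BC(2), of "prim (v om) (clip T u)" "prim (v om) r"] by linarith
 then have "\<bar>N u om\<bar> * A r om <= (2 * B + C * prim (v om) r) * exp (- \<theta> * prim (v om) r)"
  unfolding A_def clockA_def by (intro mult_right_mono) auto
 also have "\<dots> <= D * exp (- (\<theta> / 2) * prim (v om) r)"
  unfolding D_def using BC th by (intro mult_exp_minus_le k.Y_nonneg) auto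
 finally show ?thesis by (simp add: clockA_def)
qed

text \<open>The pathwise bound that makes all stopped quantities uniformly bounded.\<close>

lemma vAN_bd:
 assumes om: "om \<in> space Q" and st: "0 <= s" "s <= t"
  and u: "!!r. s <= r ==> r <= t ==> 0 <= u r \<and> u r <= r"
  and m: "(%r. N (u r) om) \<in> borel_measurable borel"
 shows "set_integrable lborel {s..t} (%r. \<theta> * v om r * A r om * N (u r) om)"
  and "(LINT r:{s..t}|lborel. \<bar>\<theta> * v om r * A r om * N (u r) om\<bar>) <= 2 * D"
proof -
 from pathwise[OF om] obtain K where K: "clock (v om) K \<theta>" "clock (v om) K (\<theta> / 2)" by metis
 interpret k: clock "v om" K \<theta> by fact
 interpret h: clock "v om" K "\<theta> / 2" by fact
 \<comment> \<open>The right-hand side is 2D times (\<theta>/2) v A at damping \<theta>/2, whose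
   integral telescopes by \<open>A_eq\<close> to at most 1.\<close>
 have le: "\<bar>\<theta> * v om r * A r om * N (u r) om\<bar> <= 2 * D * (\<theta> / 2 * v om r * clockA (\<theta> / 2) (v om) r)"
  if r: "s <= r" "r <= t" for r
 proof -
  have "\<bar>\<theta> * v om r * A r om * N (u r) om\<bar> = \<theta> * v om r * (\<bar>N (u r) om\<bar> * A r om)"
   using th k.v_bd(1)[of r] k.A_bd(1)[of r] by (simp add: abs_mult A_def)
  also have "\<dots> <= \<theta> * v om r * (D * clockA (\<theta> / 2) (v om) r)"
   using th k.v_bd(1)[of r] u[OF r] by (intro mult_left_mono N_A_bd om) auto
  finally show ?thesis by (simp add: algebra_simps)
 qed
 have i2: "set_integrable lborel {s..t} (%r. 2 * D * (\<theta> / 2 * v om r * clockA (\<theta> / 2) (v om) r))"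
  by (intro set_integrable_mult_right h.vA_int)
 have mA: "(%r. A r om) \<in> borel_measurable borel" unfolding A_def by (rule k.A_meas)
 show i: "set_integrable lborel {s..t} (%r. \<theta> * v om r * A r om * N (u r) om)"
  by (rule set_integrable_bound[OF i2]) 
   (use le m mA in \<open>auto simp: set_borel_measurable_def intro!: AE_I2 order_trans[OF _ abs_ge_self]\<close>)
 have "(LINT r:{s..t}|lborel. \<bar>\<theta> * v om r * A r om * N (u r) om\<bar>)
   <= (LINT r:{s..t}|lborel. 2 * D * (\<theta> / 2 * v om r * clockA (\<theta> / 2) (v om) r))"
  by (rule set_integral_mono[OF set_integrable_abs[OF i] i2]) (use le in auto)
 also have "\<dots> = 2 * D * (clockA (\<theta> / 2) (v om) s - clockA (\<theta> / 2) (v om) t)"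
  by (simp only: set_integral_mult_right h.A_eq[OF st])
 also have "\<dots> <= 2 * D * 1"
  using D_nonneg h.A_bd(1)[of t] h.A_bd(2)[of s] by (intro mult_left_mono) auto
 finally show "(LINT r:{s..t}|lborel. \<bar>\<theta> * v om r * A r om * N (u r) om\<bar>) <= 2 * D" by simp
qed

text \<open>Up to time \<open>r\<close> the rates clipped at \<open>r\<close> and at T agree, and
  the former are measurable at time \<open>r\<close>.\<close>

lemma A_adapted:
 assumes r: "0 <= r" "r <= T"
 shows "A r \<in> borel_measurable (F (ennreal r))" "(%om. v om r) \<in> borel_measurable (F (ennreal r))"
proof -
 have m: "(%om. (r, om)) \<in> measurable (F (ennreal r)) (borel \<Otimes>\<^sub>M F (ennreal r))" by measurable
 from measurable_compose[OF m prim_measurable_pair[OF V_joint[OF r(1)]]]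
 have "(%om. prim (%u. V (clip r u) om) r) \<in> borel_measurable (F (ennreal r))" by simp
 moreover have "prim (%u. V (clip r u) om) r = prim (v om) r" for om
  unfolding prim_def v_def using r by (intro set_lebesgue_integral_cong) (auto simp: clip_eq)
 ultimately have "(%om. prim (v om) r) \<in> borel_measurable (F (ennreal r))" by simp
 then show "A r \<in> borel_measurable (F (ennreal r))" unfolding A_def[abs_def] clockA_def by measurable
 from measurable_compose[OF m V_joint[OF r(1)]]
 show "(%om. v om r) \<in> borel_measurable (F (ennreal r))" using r by (simp add: v_def clip_eq)
qed

end

section \<open>Discounted martingales and the removal of the localising times\<close>

lemma martingale_mult:
 assumes Q: "prob_space Q" and sub: "subalgebra Q (F (ennreal r))" and M: "martingale Q F M"
  and r: "0 <= r" "r <= t" and Z: "Z \<in> borel_measurable (F (ennreal r))"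
  and i: "integrable Q (%om. Z om * M t om)"
 shows "(LINT om|Q. Z om * M t om) = (LINT om|Q. Z om * M r om)" 
proof -
 interpret prob_space Q by fact
 interpret finite_measure_subalgebra Q "F (ennreal r)" by unfold_locales (rule sub)
 have it: "integrable Q (M t)" "integrable Q (M r)" using M r by (auto simp: martingale_def)
 then have mt: "M t \<in> borel_measurable Q" "M r \<in> borel_measurable Q" by auto
 have "(LINT om|Q. Z om * M t om) = (LINT om|Q. Z om * real_cond_exp Q (F (ennreal r)) (M t) om)"
  by (rule real_cond_exp_intg(2)[OF i Z mt(1), symmetric])
 also have "\<dots> = (LINT om|Q. Z om * M r om)"
 proof (rule integral_cong_AE)
  have "AE om in Q. real_cond_exp Q (F (ennreal r)) (M t) om = M r om" using M r by (auto simp: martingale_def)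
  then show "AE om in Q. Z om * real_cond_exp Q (F (ennreal r)) (M t) om = Z om * M r om" by eventually_elim simp
  show "(%om. Z om * real_cond_exp Q (F (ennreal r)) (M t) om) \<in> borel_measurable Q"
   "(%om. Z om * M r om) \<in> borel_measurable Q"
   using measurable_from_subalg[OF sub Z] mt by (auto intro!: borel_measurable_times borel_measurable_cond_exp2)
 qed
 finally show ?thesis .
qed


context soft_martingale
begin

text \<open>Integration by parts for a martingale and the discount factor, without stochastic
  integrals. If Z is measurable at time r, then E(Z M_t) = E(Z M_r). With Z = Y \<theta> v_r A_r and
  Fubini in r this gives E(Y (A_s - A_t) M_t) = E(Y \<integral> \<theta> v A M), and Z = Y A_s
  replaces M_t by M_s in the first term.\<close>

lemma stopped_identity:
 fixes \<tau> :: "'w => ennreal"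
 assumes st: "0 <= s" "s <= t" "t <= T"
  and Y: "Y \<in> borel_measurable (F (ennreal s))" "!!om. om \<in> space Q ==> \<bar>Y om\<bar> <= E"
  and \<tau>[measurable]: "\<tau> \<in> borel_measurable Q"
  and mart: "martingale Q F (%r om. \<Phi> (enn2real (min (ennreal r) (\<tau> om))) om - \<Phi> 0 om
   - (LINT u:{0..enn2real (min (ennreal r) (\<tau> om))}|lborel. L u om))"
 defines "M \<equiv> %r om. N (enn2real (min (ennreal r) (\<tau> om))) om"
 defines "Z \<equiv> %om. Y om * (A t om * M t om - A s om * M s om + (LINT r:{s..t}|lborel. \<theta> * v om r * A r om * M r om))"
 shows "Z \<in> borel_measurable Q" "(LINT om|Q. Z om) = 0" "!!om. om \<in> space Q ==> \<bar>Z om\<bar> <= E * (4 * D)"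
proof -
 define u where "u r om = enn2real (min (ennreal r) (\<tau> om))" for r om
 have u: "0 <= u r om" "u r om <= r" if "0 <= r" for r om
  unfolding u_def using that by (auto intro: enn2real_leI)
 have M: "M r om = N (u r om) om" for r om by (simp add: M_def u_def)
 have N_eq: "\<Phi> r om - \<Phi> 0 om - (LINT u:{0..r}|lborel. L u om) = N r om" if "0 <= r" "r <= T" for r om
 proof -
  have "(LINT u:{0..r}|lborel. L u om) = prim (l om) r"
   unfolding prim_def l_def using that by (intro set_lebesgue_integral_cong) (auto simp: clip_eq)
  then show ?thesis using that by (simp add: N_def clip_eq)
 qed
 have M_eq: "\<Phi> (u r om) om - \<Phi> 0 om - (LINT x:{0..u r om}|lborel. L x om) = M r om" if "0 <= r" "r <= T" for r om
  unfolding M using u[OF that(1), of om] that by (intro N_eq) auto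
 have Em: "E \<ge> 0" using Y(2) not_empty by (metis abs_ge_zero order_trans ex_in_conv)
 have mart_mult: "(LINT om|Q. W om * M t om) = (LINT om|Q. W om * M r om)"
  if "0 <= r" "r <= t" "W \<in> borel_measurable (F (ennreal r))" "integrable Q (%om. W om * M t om)" for r W
  using martingale_mult[OF prob_space_axioms sub mart, of r t W] that st M_eq[of r] M_eq[of t]
  by (simp add: u_def)
 have M_int: "integrable Q (M r)" if "0 <= r" "r <= T" for r
  using mart M_eq[OF that] that by (auto simp: martingale_def u_def)
 have [measurable]: "(%z. M (fst z) (snd z)) \<in> borel_measurable (borel \<Otimes>\<^sub>M Q)"
 proof -
  have "(%z. (u (fst z) (snd z), snd z)) \<in> measurable (borel \<Otimes>\<^sub>M Q) (borel \<Otimes>\<^sub>M Q)"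
   unfolding u_def by measurable
  from measurable_compose[OF this N_pair] show ?thesis by (simp add: M)
 qed
 have swap: "(%z. f (snd z) (fst z)) \<in> borel_measurable (Q \<Otimes>\<^sub>M lborel)"
  if "(%z. f (fst z) (snd z)) \<in> borel_measurable (borel \<Otimes>\<^sub>M Q)" for f :: "real => 'w => real"
 proof -
  have "(%z. (snd z, fst z)) \<in> measurable (Q \<Otimes>\<^sub>M lborel) (borel \<Otimes>\<^sub>M Q)" by measurable
  from measurable_compose[OF this that] show ?thesis by simp
 qed
 have [measurable]: "(%z. M (snd z) (fst z)) \<in> borel_measurable (Q \<Otimes>\<^sub>M lborel)"
  "(%z. A (snd z) (fst z)) \<in> borel_measurable (Q \<Otimes>\<^sub>M lborel)"
  "(%z. v (fst z) (snd z)) \<in> borel_measurable (Q \<Otimes>\<^sub>M lborel)"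
  by (rule swap; measurable)+
 have Ym[measurable]: "Y \<in> borel_measurable Q" by (rule measurable_from_subalg[OF sub Y(1)])
 have [measurable]: "A r \<in> borel_measurable Q" "M r \<in> borel_measurable Q" for r
 proof -
  have m: "(%om. (r, om)) \<in> measurable Q (borel \<Otimes>\<^sub>M Q)" by measurable
  show "A r \<in> borel_measurable Q" using measurable_compose[OF m A_pair] by simp
  have "(%z. M (fst z) (snd z)) \<in> borel_measurable (borel \<Otimes>\<^sub>M Q)" by measurable
  from measurable_compose[OF m this] show "M r \<in> borel_measurable Q" by simp
 qed
 interpret p: pair_sigma_finite Q lborel
  by (rule pair_sigma_finite.intro[OF sigma_finite_measure_axioms sigma_finite_lborel])
 \<comment> \<open>The density of -dA on [s, t]; its total mass \<open>A s om - A t om\<close> is at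
   most 1.\<close>
 define g where "g om r = indicator {s..t} r * (\<theta> * v om r * A r om)" for om r
 have g_meas[measurable]: "(%z. g (fst z) (snd z)) \<in> borel_measurable (Q \<Otimes>\<^sub>M lborel)"
  unfolding g_def by measurable
 have path: "(LINT r|lborel. g om r) = A s om - A t om" "integrable lborel (g om)" "!!r. 0 <= g om r"
   "!!r. 0 < A r om" "!!r. A r om <= 1" "A t om <= A s om"
   "integrable lborel (%r. g om r * M r om)" "(LINT r|lborel. \<bar>g om r * M r om\<bar>) <= 2 * D"
   "(LINT r|lborel. g om r * M r om) = (LINT r:{s..t}|lborel. \<theta> * v om r * A r om * M r om)"
   "!!r. 0 <= r ==> \<bar>A r om * M r om\<bar> <= D"
  if om: "om \<in> space Q" for om
 proof -
  from pathwise[OF om] obtain K where K: "clock (v om) K \<theta>" "clock (v om) K (\<theta> / 2)" by metis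
  interpret k: clock "v om" K \<theta> by fact
  interpret h: clock "v om" K "\<theta> / 2" by fact
  show 1: "(LINT r|lborel. g om r) = A s om - A t om"
   using k.A_eq[OF st(1,2)] by (simp only: g_def A_def set_lebesgue_integral_def real_scaleR_def)
  show "integrable lborel (g om)"
   using k.vA_int[of s t] by (simp add: g_def[abs_def] A_def set_integrable_def mult.assoc)
  show gp: "0 <= g om r" for r
   unfolding g_def A_def using th k.v_bd(1)[of r] k.A_bd(1)[of r] by (auto simp: indicator_def)
  have "0 <= (LINT r|lborel. g om r)" using gp by simp
  then show "A t om <= A s om" using 1 by simp
  show Ab: "0 < A r om" "A r om <= 1" for r unfolding A_def by (rule k.A_bd)+
  have um: "(%r. N (u r om) om) \<in> borel_measurable borel"
  proof -
   have "(%z. M (fst z) (snd z)) \<in> borel_measurable (borel \<Otimes>\<^sub>M Q)" by measurable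
   from section_meas[OF this om] show ?thesis by (simp add: M)
  qed
  note vb = vAN_bd[OF om st(1,2) _ um]
  show "integrable lborel (%r. g om r * M r om)"
   using vb(1) u st by (auto simp: g_def[abs_def] M set_integrable_def mult.assoc)
  have "(LINT r|lborel. \<bar>g om r * M r om\<bar>) = (LINT r:{s..t}|lborel. \<bar>\<theta> * v om r * A r om * N (u r om) om\<bar>)"
   unfolding set_lebesgue_integral_def
   by (intro Bochner_Integration.integral_cong) (auto simp: g_def M indicator_def)
  then show "(LINT r|lborel. \<bar>g om r * M r om\<bar>) <= 2 * D" using vb(2) u st by simp
  show "(LINT r|lborel. g om r * M r om) = (LINT r:{s..t}|lborel. \<theta> * v om r * A r om * M r om)"
   unfolding set_lebesgue_integral_def
   by (intro Bochner_Integration.integral_cong) (auto simp: g_def indicator_def)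
  show "\<bar>A r om * M r om\<bar> <= D" if "0 <= r" for r
  proof -
   have "\<bar>M r om\<bar> * A r om <= D * clockA (\<theta> / 2) (v om) r"
    unfolding M using u[OF that, of om] by (intro N_A_bd om) auto
   also have "\<dots> <= D * 1" using D_nonneg h.A_bd(2)[of r] by (intro mult_left_mono) auto
   finally show ?thesis using Ab[of r] by (simp add: abs_mult mult.commute)
  qed
 qed
 have p9: "(LINT r|lborel. Y om * g om r * M r om) = Y om * (LINT r:{s..t}|lborel. \<theta> * v om r * A r om * M r om)"
  if "om \<in> space Q" for om
 proof -
  have "(LINT r|lborel. Y om * g om r * M r om) = Y om * (LINT r|lborel. g om r * M r om)"
   by (simp add: mult.assoc)
  also have "\<dots> = Y om * (LINT r:{s..t}|lborel. \<theta> * v om r * A r om * M r om)"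
   by (simp only: path(9)[OF that])
  finally show ?thesis .
 qed
 \<comment> \<open>Fubini is needed twice: with \<open>M t\<close> fixed, integrability of the
   martingale at time t suffices; with \<open>M r\<close> moving, the pathwise bound
   \<open>path(8)\<close> is used.\<close>
 define f1 where "f1 = (%(om, r). Y om * g om r * M t om)"
 have int1: "integrable (Q \<Otimes>\<^sub>M lborel) (%(om, r). Y om * g om r * M t om)"
  unfolding f1_def[symmetric]
 proof (rule p.Fubini_integrable)
  show "f1 \<in> borel_measurable (Q \<Otimes>\<^sub>M lborel)" 
   unfolding f1_def split_beta' by measurable
  have "(LINT r|lborel. norm (f1 (om, r)))
    = \<bar>Y om\<bar> * (A s om - A t om) * \<bar>M t om\<bar>" if "om \<in> space Q" for om
   using path(1,3)[OF that] by (simp add: f1_def abs_mult)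
  moreover have "integrable Q (%om. \<bar>Y om\<bar> * (A s om - A t om) * \<bar>M t om\<bar>)"
  proof (rule Bochner_Integration.integrable_bound)
   show "integrable Q (%om. E * \<bar>M t om\<bar>)" using M_int[of t] st by simp
   show "AE om in Q. norm (\<bar>Y om\<bar> * (A s om - A t om) * \<bar>M t om\<bar>) <= norm (E * \<bar>M t om\<bar>)"
   proof (rule AE_I2)
    fix om assume om: "om \<in> space Q"
    have "\<bar>Y om\<bar> * (A s om - A t om) <= E * 1"
     using Y(2)[OF om] path(4)[OF om, of t] path(5)[OF om, of s] path(6)[OF om] Em by (intro mult_mono) auto
    then have "\<bar>Y om\<bar> * (A s om - A t om) * \<bar>M t om\<bar> <= E * \<bar>M t om\<bar>" by (intro mult_right_mono) auto
    then show "norm (\<bar>Y om\<bar> * (A s om - A t om) * \<bar>M t om\<bar>) <= norm (E * \<bar>M t om\<bar>)"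
     using path(6)[OF om] Em by (simp add: f1_def abs_mult)
   qed
  qed measurable
  ultimately show "integrable Q (%om. \<integral>r. norm (f1 (om, r)) \<partial>lborel)"
   by (simp cong: Bochner_Integration.integrable_cong)
  show "AE om in Q. integrable lborel (%r. f1 (om, r))"
   using path(2) by (intro AE_I2) (simp add: f1_def)
 qed
 define f2 where "f2 = (%(om, r). Y om * g om r * M r om)"
 have int2: "integrable (Q \<Otimes>\<^sub>M lborel) (%(om, r). Y om * g om r * M r om)"
  unfolding f2_def[symmetric]
 proof (rule p.Fubini_integrable)
  show m: "f2 \<in> borel_measurable (Q \<Otimes>\<^sub>M lborel)" 
   unfolding f2_def split_beta' by measurable
  show "integrable Q (%om. \<integral>r. norm (f2 (om, r)) \<partial>lborel)"
  proof (rule integrable_const_bound[where B = "E * (2 * D)"])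
   show "AE om in Q. norm (LINT r|lborel. norm (f2 (om, r))) <= E * (2 * D)"
   proof (rule AE_I2)
    fix om assume om: "om \<in> space Q"
    have "(LINT r|lborel. norm (f2 (om, r)))
     = \<bar>Y om\<bar> * (LINT r|lborel. \<bar>g om r * M r om\<bar>)" by (simp add: f2_def abs_mult mult.assoc)
    also have "\<dots> <= E * (2 * D)" using Y(2)[OF om] path(8)[OF om] Em by (intro mult_mono) auto
    finally show "norm (LINT r|lborel. norm (f2 (om, r))) <= E * (2 * D)"
     by simp
   qed
   show "(%om. \<integral>r. norm (f2 (om, r)) \<partial>lborel) \<in> borel_measurable Q"
   proof -
    have "(%z. norm (f2 z)) \<in> borel_measurable (Q \<Otimes>\<^sub>M lborel)" by (rule measurable_compose[OF m borel_measurable_norm])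
    then have "(%(om, r). norm (f2 (om, r))) \<in> borel_measurable (Q \<Otimes>\<^sub>M lborel)" by (simp add: split_beta')
    from lborel.borel_measurable_lebesgue_integral[OF this] show ?thesis .
   qed
  qed
  show "AE om in Q. integrable lborel (%r. f2 (om, r))"
   using path(7) by (intro AE_I2) (simp add: f2_def mult.assoc)
 qed
 \<comment> \<open>At a fixed \<open>r\<close> integrability of the product is known from Fubini for
   almost every \<open>r\<close>, which is enough under the outer integral.\<close>
 have "AE r in lborel. (LINT om|Q. Y om * g om r * M t om) = (LINT om|Q. Y om * g om r * M r om)"
  using p.AE_integrable_snd[OF int1]
 proof eventually_elim
  case (elim r)
  show ?case
  proof (cases "r \<in> {s..t}")
   case True
   have "Y \<in> borel_measurable (F (ennreal r))"
   proof -
    have "sets (F (ennreal s)) \<subseteq> sets (F (ennreal r))" using True by (intro F_mono ennreal_leI) auto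
    then show ?thesis using Y(1) space_F
     by (auto intro!: measurable_from_subalg[of "F (ennreal r)" "F (ennreal s)"] simp: subalgebra_def)
   qed
   then have "(%om. Y om * g om r) \<in> borel_measurable (F (ennreal r))"
    unfolding g_def using A_adapted[of r] True st by auto
   from mart_mult[OF _ _ this elim] True st show ?thesis by auto
  qed (simp add: g_def)
 qed
 then have "(LINT r|lborel. (LINT om|Q. Y om * g om r * M t om)) = (LINT r|lborel. (LINT om|Q. Y om * g om r * M r om))"
  using p.integrable_snd[OF int1] p.integrable_snd[OF int2] by (intro integral_cong_AE) auto
 then have "(LINT om|Q. (LINT r|lborel. Y om * g om r * M t om)) = (LINT om|Q. (LINT r|lborel. Y om * g om r * M r om))"
  using p.Fubini_integral[OF int1] p.Fubini_integral[OF int2] by simp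
 also have "(LINT om|Q. (LINT r|lborel. Y om * g om r * M t om)) = (LINT om|Q. Y om * A s om * M t om - Y om * A t om * M t om)"
  by (rule Bochner_Integration.integral_cong[OF refl]) (simp add: path(1), simp add: algebra_simps)
 also have "(LINT om|Q. (LINT r|lborel. Y om * g om r * M r om))
   = (LINT om|Q. Y om * (LINT r:{s..t}|lborel. \<theta> * v om r * A r om * M r om))"
  by (rule Bochner_Integration.integral_cong[OF refl]) (rule p9)
 finally have eq: "(LINT om|Q. Y om * A s om * M t om - Y om * A t om * M t om)
   = (LINT om|Q. Y om * (LINT r:{s..t}|lborel. \<theta> * v om r * A r om * M r om))" .
 have i3: "integrable Q (%om. Y om * A r om * M q om)" if "0 <= q" "q <= T" for r q
 proof (rule Bochner_Integration.integrable_bound)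
  show "integrable Q (%om. E * M q om)" using M_int[OF that] by simp
  show "AE om in Q. norm (Y om * A r om * M q om) <= norm (E * M q om)"
  proof (rule AE_I2)
   fix om assume om: "om \<in> space Q"
   have "\<bar>Y om\<bar> * A r om <= E * 1"
    using Y(2)[OF om] path(4,5)[OF om, of r] Em by (intro mult_mono) auto
   then have "\<bar>Y om\<bar> * A r om * \<bar>M q om\<bar> <= E * \<bar>M q om\<bar>" by (intro mult_right_mono) auto
   then show "norm (Y om * A r om * M q om) <= norm (E * M q om)"
    using path(4)[OF om, of r] Em by (simp add: abs_mult)
  qed
 qed measurable
 have i4: "integrable Q (%om. Y om * (LINT r:{s..t}|lborel. \<theta> * v om r * A r om * M r om))"
 proof -
  have "integrable Q (%om. \<integral>r. Y om * g om r * M r om \<partial>lborel)"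
   using p.integrable_fst[OF int2] .
  moreover have "integrable Q (%om. \<integral>r. Y om * g om r * M r om \<partial>lborel)
    \<longleftrightarrow> integrable Q (%om. Y om * (LINT r:{s..t}|lborel. \<theta> * v om r * A r om * M r om))"
   by (rule Bochner_Integration.integrable_cong[OF refl p9])
  ultimately show ?thesis by blast
 qed
 have Z: "Z = (%om. Y om * A t om * M t om - Y om * A s om * M s om
   + Y om * (LINT r:{s..t}|lborel. \<theta> * v om r * A r om * M r om))"
  unfolding Z_def by (simp only: distrib_left right_diff_distrib mult.assoc)
 show "Z \<in> borel_measurable Q" unfolding Z using i3[of t t] i3[of s s] i4 st by auto
 have "(LINT om|Q. Y om * A s om * M t om) = (LINT om|Q. Y om * A s om * M s om)"
  using st A_adapted(1)[of s] Y(1) i3[of t s] by (intro mart_mult) auto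
 then show "(LINT om|Q. Z om) = 0"
  unfolding Z using i3[of t t] i3[of s s] i3[of t s] i4 st eq by simp
 \<comment> \<open>\<open>D\<close> for each endpoint and \<open>2 * D\<close> for the integral,
   independently of the stopping time.\<close>
 show "\<bar>Z om\<bar> <= E * (4 * D)" if om: "om \<in> space Q" for om
 proof -
  have "\<bar>LINT r:{s..t}|lborel. \<theta> * v om r * A r om * M r om\<bar> <= (LINT r|lborel. \<bar>g om r * M r om\<bar>)"
   unfolding path(9)[OF om, symmetric] by (rule integral_abs_bound)
  also have "\<dots> <= 2 * D" by (rule path(8)[OF om])
  finally have "\<bar>A t om * M t om - A s om * M s om + (LINT r:{s..t}|lborel. \<theta> * v om r * A r om * M r om)\<bar> <= 4 * D"
   using path(10)[OF om, of t] path(10)[OF om, of s] st by linarith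
  then show ?thesis unfolding Z_def abs_mult using Y(2)[OF om] Em by (intro mult_mono) auto
 qed
qed

text \<open>Almost surely the localising times eventually exceed t, and from then on the stopped
  expression equals the unstopped one. The bound of \<open>stopped_identity\<close> is uniform in n,
  so expectations converge. Pathwise integration by parts then replaces the compensated process by
  \<Phi> itself, with the drift corrected for the damping.\<close>

theorem soft_stopping:
 assumes st: "0 <= s" "s <= t" "t <= T"
  and Y: "Y \<in> borel_measurable (F (ennreal s))" "!!om. om \<in> space Q ==> \<bar>Y om\<bar> <= E"
 shows "(LINT om|Q. Y om * (\<Phi> t om * A t om - \<Phi> s om * A s om))
  = (LINT om|Q. Y om * (LINT r:{s..t}|lborel. (L r om - \<theta> * \<Phi> r om * V r om) * A r om))"
  and "!!om. om \<in> space Q ==> \<bar>LINT r:{s..t}|lborel. (L r om - \<theta> * \<Phi> r om * V r om) * A r om\<bar> <= C / \<theta> + B"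
  and "(%om. LINT r:{s..t}|lborel. (L r om - \<theta> * \<Phi> r om * V r om) * A r om) \<in> borel_measurable Q"
proof -
 have tm: "(%z. f (snd z) (fst z)) \<in> borel_measurable (Q \<Otimes>\<^sub>M lborel)"
  if "(%z. f (fst z) (snd z)) \<in> borel_measurable (borel \<Otimes>\<^sub>M Q)" for f :: "real => 'w => real"
 proof -
  have "(%z. (snd z, fst z)) \<in> measurable (Q \<Otimes>\<^sub>M lborel) (borel \<Otimes>\<^sub>M Q)" by measurable
  from measurable_compose[OF this that] show ?thesis by simp
 qed
 define W where "W om = (LINT r:{s..t}|lborel. (L r om - \<theta> * \<Phi> r om * V r om) * A r om)" for om
 have W_alt: "W om = (LINT r:{s..t}|lborel. (l om r - \<theta> * \<Phi> (clip T r) om * v om r) * A r om)" for om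
  unfolding W_def l_def v_def using st by (intro set_lebesgue_integral_cong) (auto simp: clip_eq)
 have [measurable]: "(%z. l (fst z) (snd z)) \<in> borel_measurable (Q \<Otimes>\<^sub>M lborel)"
  "(%z. v (fst z) (snd z)) \<in> borel_measurable (Q \<Otimes>\<^sub>M lborel)"
  "(%z. \<Phi> (clip T (snd z)) (fst z)) \<in> borel_measurable (Q \<Otimes>\<^sub>M lborel)"
  "(%z. A (snd z) (fst z)) \<in> borel_measurable (Q \<Otimes>\<^sub>M lborel)"
  by (rule tm; measurable)+
 have "(%(om, r). indicator {s..t} r *\<^sub>R ((l om r - \<theta> * \<Phi> (clip T r) om * v om r) * A r om)) \<in> borel_measurable (Q \<Otimes>\<^sub>M lborel)"
  unfolding split_beta' by measurable
 from lborel.borel_measurable_lebesgue_integral[OF this]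
 show Wm: "(%om. LINT r:{s..t}|lborel. (L r om - \<theta> * \<Phi> r om * V r om) * A r om) \<in> borel_measurable Q"
  using W_alt unfolding W_def set_lebesgue_integral_def by simp
 \<comment> \<open>The terms with \<open>\<Phi> 0\<close> cancel by \<open>A_eq\<close>, those with
   the primitive of the drift combine by \<open>A_parts\<close>. For the bound, |drift| is at most
   C/\<theta> times \<theta> V, and \<theta> V A integrates to at most 1.\<close>
 have path: "A t om * N t om - A s om * N s om + (LINT r:{s..t}|lborel. \<theta> * v om r * A r om * N r om)
    = \<Phi> t om * A t om - \<Phi> s om * A s om - W om" "\<bar>W om\<bar> <= C / \<theta> + B"
  if om: "om \<in> space Q" for om
 proof -
  from pathwise[OF om] obtain K where K: "clock (v om) K \<theta>" "!!r. \<bar>l om r\<bar> <= C * K" 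
   "!!r. \<bar>l om r\<bar> <= C * v om r" "l om \<in> borel_measurable borel" "0 <= K" by metis
  interpret k: clock "v om" K \<theta> by fact
  define \<phi> where "\<phi> r = \<Phi> (clip T r) om" for r
  have \<phi>b: "\<bar>\<phi> r\<bar> <= B" for r unfolding \<phi>_def by (rule \<Phi>_bd[OF om clip_nonneg])
  have \<phi>m[measurable]: "\<phi> \<in> borel_measurable borel"
   using section_meas[OF \<Phi>_pair om] by (simp add: \<phi>_def[abs_def])
  note K(4)[measurable]
  have A: "A r om = k.A r" for r by (simp add: A_def)
  have ia: "set_integrable lborel {a..b} (%r. \<theta> * v om r * k.A r * \<phi> r)" for a b
  proof (rule k.bounded_int[where L = "\<theta> * K * B"])
   show "\<bar>\<theta> * v om r * k.A r * \<phi> r\<bar> <= \<theta> * K * B" for r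
    unfolding abs_mult[of _ "\<phi> r"] using k.vA_bd[of r] \<phi>b[of r] th K(5) by (intro mult_mono) auto
  qed measurable
  have ib: "set_integrable lborel {a..b} (%r. \<theta> * v om r * k.A r * \<Phi> 0 om)" for a b
   by (intro set_integrable_mult_left k.vA_int)
  have ic: "set_integrable lborel {s..t} (%r. \<theta> * v om r * k.A r * prim (l om) r)"
   by (rule k.vAI_int[OF K(4,2) st(1)])
  have "(LINT r:{s..t}|lborel. \<theta> * v om r * A r om * N r om)
   = (LINT r:{s..t}|lborel. (\<theta> * v om r * k.A r * \<phi> r - \<theta> * v om r * k.A r * \<Phi> 0 om) - \<theta> * v om r * k.A r * prim (l om) r)"
   using st by (intro set_lebesgue_integral_cong) (auto simp: A N_def \<phi>_def clip_eq algebra_simps)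
  also have "\<dots> = (LINT r:{s..t}|lborel. \<theta> * v om r * k.A r * \<phi> r) - (k.A s - k.A t) * \<Phi> 0 om
    - (LINT r:{s..t}|lborel. \<theta> * v om r * k.A r * prim (l om) r)"
   using set_integral_diff(2)[OF set_integral_diff(1)[OF ia ib] ic] set_integral_diff(2)[OF ia ib, of s t]
    k.A_eq[OF st(1,2)] by simp
  finally have 1: "(LINT r:{s..t}|lborel. \<theta> * v om r * A r om * N r om) = \<dots>" .
  have 2: "k.A t * prim (l om) t - k.A s * prim (l om) s + (LINT r:{s..t}|lborel. \<theta> * v om r * k.A r * prim (l om) r)
    = (LINT r:{s..t}|lborel. l om r * k.A r)"
   by (rule k.A_parts[OF K(4,2) st(1,2)])
  have ilA: "set_integrable lborel {s..t} (%r. l om r * k.A r)" by (rule k.lA_int[OF K(4,2)])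
  have W2: "W om = (LINT r:{s..t}|lborel. l om r * k.A r - \<theta> * v om r * k.A r * \<phi> r)"
   unfolding W_alt by (intro set_lebesgue_integral_cong) (auto simp: A \<phi>_def algebra_simps)
  then have 3: "W om = (LINT r:{s..t}|lborel. l om r * k.A r) - (LINT r:{s..t}|lborel. \<theta> * v om r * k.A r * \<phi> r)"
   using set_integral_diff(2)[OF ilA ia] by simp
  have 4: "N r om = \<phi> r - \<Phi> 0 om - prim (l om) r" "\<phi> r = \<Phi> r om" if "0 <= r" "r <= T" for r
   using that by (auto simp: N_def \<phi>_def clip_eq)
  show "A t om * N t om - A s om * N s om + (LINT r:{s..t}|lborel. \<theta> * v om r * A r om * N r om)
    = \<Phi> t om * A t om - \<Phi> s om * A s om - W om"
  proof -
   have 5: "A q om * N q om = k.A q * \<Phi> q om - k.A q * \<Phi> 0 om - k.A q * prim (l om) q" if "0 <= q" "q <= T" for q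
    using 4[OF that] by (simp add: A right_diff_distrib)
   have "A t om * N t om = k.A t * \<Phi> t om - k.A t * \<Phi> 0 om - k.A t * prim (l om) t"
    "A s om * N s om = k.A s * \<Phi> s om - k.A s * \<Phi> 0 om - k.A s * prim (l om) s"
    using 5[of t] 5[of s] st by auto
   moreover have "(k.A s - k.A t) * \<Phi> 0 om = k.A s * \<Phi> 0 om - k.A t * \<Phi> 0 om" by (simp add: left_diff_distrib)
   moreover have "\<Phi> t om * A t om = k.A t * \<Phi> t om" "\<Phi> s om * A s om = k.A s * \<Phi> s om" by (simp_all add: A)
   ultimately show ?thesis unfolding 1 3 using 2 by linarith
  qed
  have iW: "set_integrable lborel {s..t} (%r. l om r * k.A r - \<theta> * v om r * k.A r * \<phi> r)"
   by (rule set_integral_diff(1)[OF ilA ia])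
  have "\<bar>W om\<bar> <= (LINT r:{s..t}|lborel. \<bar>l om r * k.A r - \<theta> * v om r * k.A r * \<phi> r\<bar>)"
   unfolding W2 using set_integral_norm_bound[OF iW] by simp
  also have "\<dots> <= (LINT r:{s..t}|lborel. (C / \<theta> + B) * (\<theta> * v om r * k.A r))"
  proof (rule set_integral_mono[OF set_integrable_abs[OF iW]])
   show "set_integrable lborel {s..t} (%r. (C / \<theta> + B) * (\<theta> * v om r * k.A r))"
    by (intro set_integrable_mult_right k.vA_int)
   fix r
   have nn: "0 <= \<theta> * v om r * k.A r" "0 <= k.A r" using th k.v_bd(1)[of r] k.A_bd(1)[of r] by auto
   have "\<bar>l om r * k.A r\<bar> <= C * v om r * k.A r"
    unfolding abs_mult using K(3)[of r] nn by (intro mult_mono) auto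
   also have "\<dots> = C / \<theta> * (\<theta> * v om r * k.A r)" using th by simp
   finally have a: "\<bar>l om r * k.A r\<bar> <= C / \<theta> * (\<theta> * v om r * k.A r)" .
   have b: "\<bar>\<theta> * v om r * k.A r * \<phi> r\<bar> <= \<theta> * v om r * k.A r * B"
    unfolding abs_mult[of _ "\<phi> r"] using \<phi>b[of r] nn by (intro mult_mono) auto
   have "\<bar>l om r * k.A r - \<theta> * v om r * k.A r * \<phi> r\<bar> <= C / \<theta> * (\<theta> * v om r * k.A r) + \<theta> * v om r * k.A r * B"
    using a b by linarith
   then show "\<bar>l om r * k.A r - \<theta> * v om r * k.A r * \<phi> r\<bar> <= (C / \<theta> + B) * (\<theta> * v om r * k.A r)"
    by (simp add: algebra_simps)
  qed
  also have "\<dots> = (C / \<theta> + B) * (k.A s - k.A t)" using k.A_eq[OF st(1,2)] by simp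
  also have "\<dots> <= (C / \<theta> + B) * 1"
   using k.A_bd(1)[of t] k.A_bd(2)[of s] BC th by (intro mult_left_mono) auto
  finally show "\<bar>W om\<bar> <= C / \<theta> + B" by simp
 qed
 show "\<bar>LINT r:{s..t}|lborel. (L r om - \<theta> * \<Phi> r om * V r om) * A r om\<bar> <= C / \<theta> + B" if "om \<in> space Q" for om
  using path(2)[OF that] by (simp add: W_def)
 obtain \<tau> :: "nat => 'w => ennreal" where \<tau>: "!!n. stopping_time F (\<tau> n)"
  and \<tau>_lim: "AE om in Q. (%n. \<tau> n om) \<longlonglongrightarrow> \<infinity>"
  and mart: "!!n. martingale Q F (%r om. \<Phi> (enn2real (min (ennreal r) (\<tau> n om))) om - \<Phi> 0 om
   - (LINT u:{0..enn2real (min (ennreal r) (\<tau> n om))}|lborel. L u om))"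
  using lm unfolding local_martingale_def by (auto elim: eventually_mono)
 have \<tau>m[measurable]: "\<tau> n \<in> borel_measurable Q" for n
 proof (rule borel_measurableI_le)
  fix y
  have "{x \<in> space (F y). \<tau> n x <= y} \<in> sets (F y)"
   using \<tau>[of n] by (simp add: stopping_time_def pred_def)
  then show "{x \<in> space Q. \<tau> n x <= y} \<in> sets Q" using sub[of y] by (auto simp: subalgebra_def)
 qed
 define M where "M n r om = N (enn2real (min (ennreal r) (\<tau> n om))) om" for n r om
 define Z where "Z n om = Y om * (A t om * M n t om - A s om * M n s om
  + (LINT r:{s..t}|lborel. \<theta> * v om r * A r om * M n r om))" for n om
 note Zn = stopped_identity[OF st Y \<tau>m mart, folded M_def, folded Z_def]
 have [measurable]: "A r \<in> borel_measurable Q" "\<Phi> (clip T r) \<in> borel_measurable Q" for r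
 proof -
  have m: "(%om. (r, om)) \<in> measurable Q (borel \<Otimes>\<^sub>M Q)" by measurable
  show "A r \<in> borel_measurable Q" using measurable_compose[OF m A_pair] by simp
  show "\<Phi> (clip T r) \<in> borel_measurable Q" using measurable_compose[OF m \<Phi>_pair] by simp
 qed
 then have [measurable]: "\<Phi> t \<in> borel_measurable Q" "\<Phi> s \<in> borel_measurable Q"
  using st clip_eq[of t T] clip_eq[of s T] by (metis order_trans)+
 have Ym[measurable]: "Y \<in> borel_measurable Q" by (rule measurable_from_subalg[OF sub Y(1)])
 have Wm'[measurable]: "W \<in> borel_measurable Q" using Wm by (simp add: W_def[abs_def])
 define Z' where "Z' om = Y om * (\<Phi> t om * A t om - \<Phi> s om * A s om) - Y om * W om" for om
 have "(%n. \<integral>om. Z n om \<partial>Q) \<longlonglongrightarrow> (LINT om|Q. Z' om)"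
 proof (rule integral_dominated_convergence[where w = "%om. E * (4 * D)"])
  show "Z' \<in> borel_measurable Q" unfolding Z'_def by measurable
  show "Z n \<in> borel_measurable Q" for n by (rule Zn(1))
  show "AE om in Q. norm (Z n om) <= E * (4 * D)" for n using Zn(3) by (intro AE_I2) simp
  show "AE om in Q. (%n. Z n om) \<longlonglongrightarrow> Z' om"
   using \<tau>_lim AE_space
  proof eventually_elim
   case (elim om)
   \<comment> \<open>Beyond this index stopping has no effect on [0, t], so the sequence is
     eventually constant and no continuity of the processes in time is involved.\<close>
   have "eventually (%n. ennreal t < \<tau> n om) sequentially"
    using elim(1) by (rule order_tendstoD) simp
   then have "eventually (%n. Z n om = Z' om) sequentially"
   proof eventually_elim
    case (elim n)
    have *: "M n r om = N r om" if "0 <= r" "r <= t" for r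
    proof -
     have "ennreal r <= \<tau> n om" using elim that by (metis ennreal_leI less_imp_le order_trans)
     then show ?thesis using that by (simp add: M_def min_absorb1)
    qed
    have "(LINT r:{s..t}|lborel. \<theta> * v om r * A r om * M n r om) = (LINT r:{s..t}|lborel. \<theta> * v om r * A r om * N r om)"
     using st by (intro set_lebesgue_integral_cong) (auto simp: *)
    then have "Z n om = Y om * (A t om * N t om - A s om * N s om + (LINT r:{s..t}|lborel. \<theta> * v om r * A r om * N r om))"
     unfolding Z_def using *[of t] *[of s] st by simp
    also have "\<dots> = Z' om" unfolding path(1)[OF \<open>om \<in> space Q\<close>] Z'_def by (simp only: right_diff_distrib)
    finally show ?case .
   qed
   then show ?case by (rule tendsto_eventually)
  qed
 qed simp
 then have 0: "(LINT om|Q. Z' om) = 0" using Zn(2) LIMSEQ_unique[OF _ tendsto_const] by simp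
 have Ab: "0 < A r om" "A r om <= 1" if "om \<in> space Q" for r om
  using pathwise[OF that] clock.A_bd unfolding A_def by metis+
 have i1: "integrable Q (%om. Y om * (\<Phi> t om * A t om - \<Phi> s om * A s om))"
 proof (rule integrable_const_bound[where B = "E * (B + B)"])
  show "AE om in Q. norm (Y om * (\<Phi> t om * A t om - \<Phi> s om * A s om)) <= E * (B + B)"
  proof (rule AE_I2)
   fix om assume om: "om \<in> space Q"
   have "\<bar>\<Phi> r om * A r om\<bar> <= B * 1" if "0 <= r" for r
    unfolding abs_mult using \<Phi>_bd[OF om that] Ab[OF om, of r] BC by (intro mult_mono) auto
   from this[of t] this[of s] st have "\<bar>\<Phi> t om * A t om - \<Phi> s om * A s om\<bar> <= B + B" by simp
   then show "norm (Y om * (\<Phi> t om * A t om - \<Phi> s om * A s om)) <= E * (B + B)"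
    unfolding real_norm_def abs_mult using Y(2)[OF om] by (intro mult_mono) auto
  qed
 qed measurable
 have i2: "integrable Q (%om. Y om * W om)"
 proof (rule integrable_const_bound[where B = "E * (C / \<theta> + B)"])
  show "AE om in Q. norm (Y om * W om) <= E * (C / \<theta> + B)"
  proof (rule AE_I2)
   fix om assume om: "om \<in> space Q"
   show "norm (Y om * W om) <= E * (C / \<theta> + B)"
    unfolding real_norm_def abs_mult using Y(2)[OF om] path(2)[OF om] by (intro mult_mono) auto
  qed
 qed measurable
 show "(LINT om|Q. Y om * (\<Phi> t om * A t om - \<Phi> s om * A s om))
  = (LINT om|Q. Y om * (LINT r:{s..t}|lborel. (L r om - \<theta> * \<Phi> r om * V r om) * A r om))"
  using 0 i1 i2 by (simp add: Z'_def W_def)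
qed

end

section \<open>Test functions\<close>

text \<open>A one-variable criterion for membership in \<open>C20 1\<close> that is easy to check:
  the factor 1 + |x| turns a uniform bound into vanishing at infinity, and the derivatives are
  carried along as explicit functions.\<close>

definition C20fun :: "(real => real) => (real => real) => (real => real) => bool" where
 "C20fun g g' g'' \<longleftrightarrow> (\<forall>z. (g has_real_derivative g' z) (at z)) \<and> (\<forall>z. (g' has_real_derivative g'' z) (at z)) \<and>
   continuous_on UNIV g'' \<and> (\<exists>k C. \<forall>x. \<bar>g x - k\<bar> * (1 + \<bar>x\<bar>) <= C \<and>
    \<bar>g' x\<bar> * (1 + x\<^sup>2) * (1 + \<bar>x\<bar>) <= C \<and> \<bar>g'' x\<bar> * (1 + x\<^sup>2) * (1 + \<bar>x\<bar>) <= C)"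

definition C2cfun :: "(real => real) => (real => real) => (real => real) => bool" where
 "C2cfun f f' f'' \<longleftrightarrow> (\<forall>z. (f has_real_derivative f' z) (at z)) \<and> (\<forall>z. (f' has_real_derivative f'' z) (at z)) \<and>
   continuous_on UNIV f'' \<and> (\<exists>R. \<forall>x. R < \<bar>x\<bar> \<longrightarrow> f x = 0 \<and> f' x = 0 \<and> f'' x = 0)"

text \<open>The set is the image of an interval under the embedding that puts \<open>r\<close> at
  index 0 and \<open>undefined\<close> elsewhere, as extensionality of \<open>Rn 1\<close>
  requires.\<close>

lemma Rn_1_nth: "compact {v \<in> Rn 1. \<bar>v 0\<bar> <= R}"
proof -
 have "continuous_on {- R..R} (%r i. if i \<in> {..<1::nat} then r else (undefined :: real))"
 proof (rule continuous_on_coordinatewise_then_product)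
  show "continuous_on {- R..R} (%r. if i \<in> {..<1::nat} then r else (undefined :: real))" for i
   by (cases "i \<in> {..<1::nat}") (simp_all add: continuous_on_id)
 qed
 then have "compact ((%r i. if i \<in> {..<1::nat} then r else undefined) ` {- R..R})"
  by (rule compact_continuous_image) simp
 moreover have "(%r i. if i \<in> {..<1::nat} then r else undefined) ` {- R..R} = {v \<in> Rn 1. \<bar>v 0\<bar> <= R}"
 proof (intro equalityI subsetI)
  fix v assume "v \<in> {v \<in> Rn 1. \<bar>v 0\<bar> <= R}"
  then have "v = (%i. if i \<in> {..<1::nat} then v 0 else undefined)" "v 0 \<in> {- R..R}"
   by (auto simp: Rn_def PiE_def extensional_def fun_eq_iff)
  then show "v \<in> (%r i. if i \<in> {..<1::nat} then r else undefined) ` {- R..R}" by blast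
 qed (auto simp: Rn_def PiE_def extensional_def)
 ultimately show ?thesis by simp
qed

lemma Cb_Rn_1:
 assumes "continuous_on UNIV (h :: real => real)" "!!x. \<bar>h x\<bar> <= C"
 shows "(%v. h (v 0)) \<in> Cb (Rn 1)"
proof -
 have "continuous_on (Rn 1) (%v :: nat => real. v 0)"
  by (rule continuous_on_product_then_coordinatewise[OF continuous_on_id])
 then have "continuous_on (Rn 1) (%v. h (v 0))"
  using continuous_on_compose2[OF assms(1)] by blast
 then show ?thesis using assms(2) by (auto simp: Cb_def bounded_iff)
qed

lemma Chat_Rn_1:
 assumes h: "continuous_on UNIV (h :: real => real)" "!!x. \<bar>h x\<bar> * (1 + \<bar>x\<bar>) <= C"
 shows "(%v. h (v 0)) \<in> Chat (Rn 1)" "(%v. h (v 0)) \<in> Cb (Rn 1)"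
proof -
 have b: "\<bar>h x\<bar> <= C" for x
 proof -
  have "\<bar>h x\<bar> * 1 <= \<bar>h x\<bar> * (1 + \<bar>x\<bar>)" by (intro mult_left_mono) auto
  then show ?thesis using h(2)[of x] by simp
 qed
 then show 1: "(%v. h (v 0)) \<in> Cb (Rn 1)" by (rule Cb_Rn_1[OF h(1)])
 have C0: "0 <= C" using b[of 0] by linarith
 have "\<exists>K. compact K \<and> K \<subseteq> Rn 1 \<and> (\<forall>v\<in>Rn 1 - K. \<bar>h (v 0)\<bar> < e)" if e: "0 < e" for e
 proof (intro exI[of _ "{v \<in> Rn 1. \<bar>v 0\<bar> <= C / e}"] conjI ballI)
  show "compact {v \<in> Rn 1. \<bar>v 0\<bar> <= C / e}" by (rule Rn_1_nth)
  fix v assume "v \<in> Rn 1 - {v \<in> Rn 1. \<bar>v 0\<bar> <= C / e}"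
  then have "C / e < \<bar>v 0\<bar>" by auto
  then have "C < e * \<bar>v 0\<bar>" using e by (simp add: field_simps)
  moreover have "\<bar>h (v 0)\<bar> * \<bar>v 0\<bar> <= C"
   using h(2)[of "v 0"] by (simp add: distrib_left)
  ultimately have "\<bar>h (v 0)\<bar> * \<bar>v 0\<bar> < e * \<bar>v 0\<bar>" by linarith
  then show "\<bar>h (v 0)\<bar> < e" by (simp add: mult_less_cancel_right)
 qed auto
 then show "(%v. h (v 0)) \<in> Chat (Rn 1)" using 1 by (auto simp: Chat_def Cb_def)
qed

lemma pd_on_real:
 assumes "!!z. (g has_real_derivative g' z) (at z)"
 shows "pd 0 (%v. g (v 0)) = (%v. g' (v 0))"
 unfolding pd_def using assms by (auto intro!: DERIV_imp_deriv)

lemma has_pd_on_real: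
 assumes "!!z. (g has_real_derivative g' z) (at z)"
 shows "has_pd 1 0 (%v. g (v 0))"
 unfolding has_pd_def real_differentiable_def
proof (intro ballI exI)
 show "((%r. g ((x(0 := r)) 0)) has_real_derivative g' (x 0)) (at (x 0))" for x using assms by simp
qed

lemma deriv_cont:
 assumes "!!z. (g has_real_derivative g' z) (at z)"
 shows "continuous_on UNIV (g :: real => real)"
 using assms DERIV_isCont by (intro continuous_at_imp_continuous_on) blast

lemma C20fun_C20:
 assumes "C20fun g g' g''"
 shows "(%v. g (v 0)) \<in> C20 1"
proof -
 from assms obtain k C where d: "!!z. (g has_real_derivative g' z) (at z)" "!!z. (g' has_real_derivative g'' z) (at z)"
  and c: "continuous_on UNIV g''" and b: "!!x. \<bar>g x - k\<bar> * (1 + \<bar>x\<bar>) <= C"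
    "!!x. \<bar>g' x\<bar> * (1 + x\<^sup>2) * (1 + \<bar>x\<bar>) <= C" "!!x. \<bar>g'' x\<bar> * (1 + x\<^sup>2) * (1 + \<bar>x\<bar>) <= C"
  unfolding C20fun_def by blast
 have d0: "((%x. g x - k) has_real_derivative g' z) (at z)" for z
  using DERIV_diff[OF d(1)[of z] DERIV_const[of k]] by simp
 note cg = deriv_cont[OF d0] and cg' = deriv_cont[OF d(2)]
 have le: "\<bar>f x\<bar> * (1 + \<bar>x\<bar>) <= C" if "!!x. \<bar>f x\<bar> * (1 + x\<^sup>2) * (1 + \<bar>x\<bar>) <= C" for f :: "real => real" and x
 proof -
  have "\<bar>f x\<bar> * 1 * (1 + \<bar>x\<bar>) <= \<bar>f x\<bar> * (1 + x\<^sup>2) * (1 + \<bar>x\<bar>)"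
   by (intro mult_right_mono mult_left_mono) auto
  then show ?thesis using that[of x] by simp
 qed
 note h0 = Chat_Rn_1[OF cg b(1)] and h1 = Chat_Rn_1[OF cg' le[OF b(2)]] and h2 = Chat_Rn_1[OF c le[OF b(3)]]
 note p1 = pd_on_real[OF d(1)] and p2 = pd_on_real[OF d(2)]
 have "(%v. g (v 0) - k) \<in> C2hat 1"
  unfolding C2hat_def C2_def
  using h0 h1 h2 pd_on_real[OF d0] p2 has_pd_on_real[OF d0] has_pd_on_real[OF d(2)] by auto
 moreover have "(%v. (1 + (v 0)\<^sup>2) * \<bar>g' (v 0)\<bar>) \<in> Chat (Rn 1)" "(%v. (1 + (v 0)\<^sup>2) * \<bar>g'' (v 0)\<bar>) \<in> Chat (Rn 1)"
  using b(2,3) by (intro Chat_Rn_1(1)[where C = C]; 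
   auto intro!: continuous_intros cg' c simp: abs_mult mult.commute mult.left_commute)+
 ultimately show ?thesis unfolding C20_def C2del_def by (auto simp: p1 p2)
qed

lemma C2cfun_cont:
 assumes "C2cfun f f' f''"
 shows "continuous_on UNIV f" "continuous_on UNIV f'" "continuous_on UNIV f''"
  "!!z. (f has_real_derivative f' z) (at z)" "!!z. (f' has_real_derivative f'' z) (at z)"
 using assms deriv_cont unfolding C2cfun_def by blast+

lemma C2cfun_supp:
 assumes "C2cfun f f' f''"
 obtains R where "0 <= R" "!!x. R < \<bar>x\<bar> ==> f x = 0 \<and> f' x = 0 \<and> f'' x = 0"
proof -
 from assms obtain R where "!!x. R < \<bar>x\<bar> ==> f x = 0 \<and> f' x = 0 \<and> f'' x = 0" unfolding C2cfun_def by blast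
 then show thesis using that[of "max 0 R"] by auto
qed

lemma compact_support_Chat:
 assumes "continuous_on UNIV (f :: real => real)" "!!x. R < \<bar>x\<bar> ==> f x = 0"
 shows "f \<in> Chat UNIV"
 by (rule ChatI[OF assms(1), of "{- R..R}"]) (use assms(2) in \<open>auto simp: abs_le_iff not_le\<close>)

lemma C2cfun_Chat:
 assumes "C2cfun f f' f''"
 shows "f \<in> Chat UNIV" "f' \<in> Chat UNIV" "f'' \<in> Chat UNIV"
proof -
 obtain R where "!!x. R < \<bar>x\<bar> ==> f x = 0 \<and> f' x = 0 \<and> f'' x = 0" using C2cfun_supp[OF assms] by blast
 then show "f \<in> Chat UNIV" "f' \<in> Chat UNIV" "f'' \<in> Chat UNIV"
  using C2cfun_cont[OF assms] compact_support_Chat by blast+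
qed

lemma C2cfun_bounds:
 assumes "C2cfun f f' f''"
 obtains D where "0 <= D" "!!x. \<bar>f x\<bar> <= D" "!!x. \<bar>f' x\<bar> <= D" "!!x. \<bar>f'' x\<bar> <= D"
proof -
 obtain D0 where D0: "0 <= D0" "!!x. \<bar>f x\<bar> <= D0" using Chat_bounded[OF C2cfun_Chat(1)[OF assms]] by metis
 obtain D1 where D1: "!!x. \<bar>f' x\<bar> <= D1" using Chat_bounded[OF C2cfun_Chat(2)[OF assms]] by metis
 obtain D2 where D2: "!!x. \<bar>f'' x\<bar> <= D2" using Chat_bounded[OF C2cfun_Chat(3)[OF assms]] by metis
 show thesis
  by (rule that[of "max D0 (max D1 D2)"]) (use D0 D1 D2 in \<open>auto simp: le_max_iff_disj\<close>)
qed

lemma C2cfun_C2c: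
 assumes f: "C2cfun f f' f''" and nn: "!!x. 0 <= f x"
 shows "f \<in> nonneg (on_real (C2c 1))"
proof -
 obtain R where R: "!!x. R < \<bar>x\<bar> ==> f x = 0 \<and> f' x = 0 \<and> f'' x = 0" using C2cfun_supp[OF f] by blast
 obtain D where D: "0 <= D" "!!x. \<bar>f x\<bar> <= D" "!!x. \<bar>f' x\<bar> <= D" "!!x. \<bar>f'' x\<bar> <= D" using C2cfun_bounds[OF f] by blast
 note c = C2cfun_cont[OF f]
 have "(%v. f (v 0)) \<in> C2 1"
  unfolding C2_def
  using Cb_Rn_1[OF c(1) D(2)] Cb_Rn_1[OF c(2) D(3)] Cb_Rn_1[OF c(3) D(4)]
   pd_on_real[OF c(4)] pd_on_real[OF c(5)] has_pd_on_real[OF c(4)] has_pd_on_real[OF c(5)] by auto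
 moreover have "compact {v \<in> Rn 1. \<bar>v 0\<bar> <= R}" by (rule Rn_1_nth)
 moreover have "f (v 0) = 0" if "v \<in> Rn 1 - {v \<in> Rn 1. \<bar>v 0\<bar> <= R}" for v
  using R[of "v 0"] that by auto
 moreover have "{v \<in> Rn 1. \<bar>v 0\<bar> <= R} \<subseteq> Rn 1" by auto
 ultimately show ?thesis
  using nn unfolding nonneg_def on_real_def C2c_def by blast
qed

section \<open>A compactly supported bump with two continuous derivatives\<close>

lemma max_power_deriv:
 assumes n: "2 <= n"
 shows "((%y. (max 0 y) ^ n) has_real_derivative real n * (max 0 y) ^ (n - 1)) (at y)"
proof (cases y "0 :: real" rule: linorder_cases)
 case less
 have "((%y::real. 0) has_real_derivative 0) (at y)" by simp
 then have "((%y. (max 0 y) ^ n) has_real_derivative 0) (at y)"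
  by (rule DERIV_cong_ev[THEN iffD1, rotated -1])
   (use less n in \<open>auto intro!: eventually_mono[OF eventually_nhds_in_open[of "{..<0}" y]]\<close>)
 moreover have "real n * (max 0 y) ^ (n - 1) = 0" using less n by (cases n) auto
 ultimately show ?thesis by (simp only:)
next
 case greater
 have "((%y. y ^ n) has_real_derivative real n * y ^ (n - 1)) (at y)"
  by (auto intro!: derivative_eq_intros)
 then have "((%y. (max 0 y) ^ n) has_real_derivative real n * y ^ (n - 1)) (at y)"
  by (rule DERIV_cong_ev[THEN iffD1, rotated -1])
   (use greater in \<open>auto intro!: eventually_mono[OF eventually_nhds_in_open[of "{0<..}" y]]\<close>)
 moreover have "max 0 y = y" using greater by simp
 ultimately show ?thesis by simp
next
 case equal
 have "((%h. ((max 0 h) ^ n - (max 0 0) ^ n) / (h - 0)) \<longlongrightarrow> (0::real)) (at 0)"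
 proof (rule Lim_null_comparison[where g = "%h. \<bar>h\<bar> ^ (n - 1)"])
  have "norm (((max 0 h) ^ n - (max 0 0) ^ n) / (h - 0)) <= \<bar>h\<bar> ^ (n - 1)" if "h \<noteq> 0" for h :: real
  proof (cases "0 < h")
   case True
   then show ?thesis using n by (cases n) (auto simp: max_def)
  next
   case False
   then show ?thesis using n by (simp add: max_def)
  qed
  then show "\<forall>\<^sub>F h in at 0. norm (((max 0 h) ^ n - (max 0 (0::real)) ^ n) / (h - 0)) <= \<bar>h\<bar> ^ (n - 1)"
   by (simp add: eventually_at_filter)
  have "((%h. \<bar>h\<bar> ^ (n - 1)) \<longlongrightarrow> \<bar>0::real\<bar> ^ (n - 1)) (at 0)" by (intro tendsto_intros)
  moreover have "\<bar>0::real\<bar> ^ (n - 1) = 0" using n by (cases n) auto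
  ultimately show "((%h::real. \<bar>h\<bar> ^ (n - 1)) \<longlongrightarrow> 0) (at 0)" by (simp only:)
 qed
 moreover have "real n * (max 0 (0 :: real)) ^ (n - 1) = 0" using n by (cases n) auto
 ultimately show ?thesis unfolding equal has_field_derivative_iff by (simp only:)
qed

text \<open>The third power of a positive part has two continuous derivatives across the boundary of
  the support, and all of them are explicit piecewise polynomials.\<close>

definition bump :: "real => real" where "bump x = (max 0 (1 - x\<^sup>2)) ^ 3"
definition bump' :: "real => real" where "bump' x = - 6 * x * (max 0 (1 - x\<^sup>2))\<^sup>2"
definition bump'' :: "real => real" where "bump'' x = 24 * x\<^sup>2 * max 0 (1 - x\<^sup>2) - 6 * (max 0 (1 - x\<^sup>2))\<^sup>2"

lemma C2cfun_bump: "C2cfun bump bump' bump''"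
 unfolding C2cfun_def
proof (intro conjI allI exI[of _ 1] impI)
 fix z
 have i: "((%x::real. 1 - x\<^sup>2) has_real_derivative - 2 * z) (at z)" by (auto intro!: derivative_eq_intros)
 have 3: "((%x. (max 0 (1 - x\<^sup>2)) ^ 3) has_real_derivative (3 * (max 0 (1 - z\<^sup>2))\<^sup>2) * (- 2 * z)) (at z)"
  using DERIV_chain2[OF max_power_deriv[of 3] i] by simp
 then show "(bump has_real_derivative bump' z) (at z)"
  unfolding bump_def[abs_def] bump'_def by (rule DERIV_cong) simp
 have 2: "((%x. (max 0 (1 - x\<^sup>2))\<^sup>2) has_real_derivative (2 * (max 0 (1 - z\<^sup>2))) * (- 2 * z)) (at z)"
  using DERIV_chain2[OF max_power_deriv[of 2] i] by simp
 have "((%x. - 6 * x * (max 0 (1 - x\<^sup>2))\<^sup>2) has_real_derivative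
   - 6 * (max 0 (1 - z\<^sup>2))\<^sup>2 + ((2 * (max 0 (1 - z\<^sup>2))) * (- 2 * z)) * (- 6 * z)) (at z)"
  by (rule DERIV_mult[OF _ 2, THEN DERIV_cong]) (auto intro!: derivative_eq_intros)
 then show "(bump' has_real_derivative bump'' z) (at z)"
  unfolding bump'_def[abs_def] bump''_def by (rule DERIV_cong) (simp add: power2_eq_square)
next
 show "continuous_on UNIV bump''" unfolding bump''_def[abs_def] by (intro continuous_intros)
next
 fix x :: real assume "1 < \<bar>x\<bar>"
 then have "1 <= x\<^sup>2" using abs_le_square_iff[of 1 x] by simp
 then show "bump x = 0" "bump' x = 0" "bump'' x = 0" by (auto simp: bump_def bump'_def bump''_def)
qed

lemma bump_range: "0 <= bump x" "bump x <= 1"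
 unfolding bump_def by (auto intro!: power_le_one)

lemma C2cfun_affine:
 assumes f: "C2cfun f f' f''" and m: "m \<noteq> 0"
 shows "C2cfun (%x. k * f (m * x + b)) (%x. k * m * f' (m * x + b)) (%x. k * m\<^sup>2 * f'' (m * x + b))"
proof -
 note c = C2cfun_cont[OF f]
 obtain R where R: "0 <= R" "!!x. R < \<bar>x\<bar> ==> f x = 0 \<and> f' x = 0 \<and> f'' x = 0" using C2cfun_supp[OF f] by blast
 have i: "((%x. m * x + b) has_real_derivative m) (at z)" for z
  by (auto intro!: derivative_eq_intros)
 have "((%x. k * f (m * x + b)) has_real_derivative k * m * f' (m * z + b)) (at z)" for z
  using DERIV_cmult[OF DERIV_chain2[OF c(4) i], of k z] by (simp add: ac_simps)
 moreover have "((%x. k * m * f' (m * x + b)) has_real_derivative k * m\<^sup>2 * f'' (m * z + b)) (at z)" for z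
  using DERIV_cmult[OF DERIV_chain2[OF c(5) i], of "k * m" z] by (simp add: ac_simps power2_eq_square)
 moreover have "continuous_on UNIV (%x. k * m\<^sup>2 * f'' (m * x + b))"
  by (intro continuous_intros continuous_on_compose2[OF c(3)]) auto
 moreover have "R < \<bar>m * x + b\<bar>" if "(R + \<bar>b\<bar>) / \<bar>m\<bar> < \<bar>x\<bar>" for x
 proof -
  have "R + \<bar>b\<bar> < \<bar>m * x\<bar>" using that m by (simp add: divide_less_eq abs_mult mult.commute)
  then show ?thesis by linarith
 qed
 then have "\<exists>R'. \<forall>x. R' < \<bar>x\<bar> \<longrightarrow> k * f (m * x + b) = 0 \<and> k * m * f' (m * x + b) = 0 \<and> k * m\<^sup>2 * f'' (m * x + b) = 0"
  using R(2) by (intro exI[of _ "(R + \<bar>b\<bar>) / \<bar>m\<bar>"]) auto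
 ultimately show ?thesis unfolding C2cfun_def by blast
qed

lemma C2cfun_lin:
 assumes f: "C2cfun f f' f''" and g: "C2cfun g g' g''"
 shows "C2cfun (%x. f x + k * g x) (%x. f' x + k * g' x) (%x. f'' x + k * g'' x)"
proof -
 note c = C2cfun_cont[OF f] and d = C2cfun_cont[OF g]
 obtain R where R: "0 <= R" "!!x. R < \<bar>x\<bar> ==> f x = 0 \<and> f' x = 0 \<and> f'' x = 0" using C2cfun_supp[OF f] by blast
 obtain S where S: "0 <= S" "!!x. S < \<bar>x\<bar> ==> g x = 0 \<and> g' x = 0 \<and> g'' x = 0" using C2cfun_supp[OF g] by blast
 have "((%x. f x + k * g x) has_real_derivative f' z + k * g' z) (at z)"
  "((%x. f' x + k * g' x) has_real_derivative f'' z + k * g'' z) (at z)" for z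
  by (intro DERIV_add DERIV_cmult c d)+
 moreover have "continuous_on UNIV (%x. f'' x + k * g'' x)" by (intro continuous_intros c d)
 moreover have "\<exists>R. \<forall>x. R < \<bar>x\<bar> \<longrightarrow> f x + k * g x = 0 \<and> f' x + k * g' x = 0 \<and> f'' x + k * g'' x = 0"
  using R(2) S(2) by (intro exI[of _ "max R S"]) simp
 ultimately show ?thesis unfolding C2cfun_def by blast
qed

text \<open>Truncations of the identity and of the square: \<open>k * Gid (z / k)\<close> and \<open>k\<^sup>2 * Gsq (z / k)\<close>.\<close>

definition rec :: "real => real" where "rec w = 1 / (1 + w\<^sup>2)"

text \<open>The square of \<open>rec\<close> matters: the plain quotient w / (1 + w^2) has a
  derivative of order 1 / w^2, and (1 + w^2) times it does not vanish at infinity, as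
  \<open>C20\<close> requires.\<close>

definition Gid :: "real => real" where "Gid w = w * (rec w)\<^sup>2"
definition Gid' :: "real => real" where "Gid' w = (rec w)\<^sup>2 - 4 * w\<^sup>2 * rec w ^ 3"
definition Gid'' :: "real => real" where "Gid'' w = 24 * w ^ 3 * rec w ^ 4 - 12 * w * rec w ^ 3"
definition Gsq :: "real => real" where "Gsq w = 1 - rec w"
definition Gsq' :: "real => real" where "Gsq' w = 2 * w * (rec w)\<^sup>2"
definition Gsq'' :: "real => real" where "Gsq'' w = 2 * (rec w)\<^sup>2 - 8 * w\<^sup>2 * rec w ^ 3"

lemma rec_pos: "0 < rec w" unfolding rec_def by (simp add: add_pos_nonneg)

lemma rec_mult: "rec w * (1 + w\<^sup>2) = 1"
proof -
 have "1 + w\<^sup>2 \<noteq> 0" by (metis add_pos_nonneg less_irrefl zero_le_power2 zero_less_one)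
 then show ?thesis by (simp add: rec_def)
qed

lemma rec_bounds: "rec w <= 1" "w\<^sup>2 * rec w <= 1" "\<bar>w\<bar> * rec w <= 1"
proof -
 have e: "rec w + w\<^sup>2 * rec w = 1" using rec_mult[of w] by (simp add: algebra_simps)
 have nn: "0 <= w\<^sup>2 * rec w" using rec_pos[of w] by simp
 show "rec w <= 1" "w\<^sup>2 * rec w <= 1" using e nn rec_pos[of w] by linarith+
 have "\<bar>w\<bar> <= 1 + w\<^sup>2"
  using sum_squares_ge_zero[of "\<bar>w\<bar> - 1" 0] by (simp add: power2_eq_square algebra_simps)
 then have "\<bar>w\<bar> * rec w <= (1 + w\<^sup>2) * rec w" using rec_pos[of w] by (intro mult_right_mono) auto
 then show "\<bar>w\<bar> * rec w <= 1" using rec_mult[of w] by (simp add: mult.commute)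
qed

lemma rec_DERIV: "(rec has_real_derivative - 2 * w * (rec w)\<^sup>2) (at w)"
proof -
 have "1 + w\<^sup>2 \<noteq> 0" by (metis add_pos_nonneg less_irrefl zero_le_power2 zero_less_one)
 then show ?thesis
  unfolding rec_def[abs_def] by (auto intro!: derivative_eq_intros simp: power2_eq_square)
qed

lemma rec_power_DERIV: "((%w. rec w ^ n) has_real_derivative real n * rec w ^ (n - 1) * (- 2 * w * (rec w)\<^sup>2)) (at w)"
 using DERIV_chain2[OF DERIV_pow rec_DERIV, of n w] by simp

lemma rec_cont: "continuous_on UNIV rec"
 using rec_DERIV by (rule deriv_cont)

lemma Gid_DERIV: "(Gid has_real_derivative Gid' w) (at w)" "(Gid' has_real_derivative Gid'' w) (at w)"
proof -
 show "(Gid has_real_derivative Gid' w) (at w)"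
  unfolding Gid_def[abs_def] Gid'_def
  by (rule DERIV_mult[OF DERIV_ident rec_power_DERIV, THEN DERIV_cong]) (simp add: power2_eq_square power3_eq_cube)
 have "((%w. 4 * w\<^sup>2 * rec w ^ 3) has_real_derivative
   (8 * w) * rec w ^ 3 + (real 3 * rec w ^ (3 - 1) * (- 2 * w * (rec w)\<^sup>2)) * (4 * w\<^sup>2)) (at w)"
  by (rule DERIV_mult[OF _ rec_power_DERIV]) (auto intro!: derivative_eq_intros)
 from DERIV_diff[OF rec_power_DERIV[of 2 w] this]
 show "(Gid' has_real_derivative Gid'' w) (at w)"
  unfolding Gid'_def[abs_def] Gid''_def
  by (rule DERIV_cong) (simp add: power2_eq_square power3_eq_cube power4_eq_xxxx algebra_simps)
qed

lemma Gsq_DERIV: "(Gsq has_real_derivative Gsq' w) (at w)" "(Gsq' has_real_derivative Gsq'' w) (at w)"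
proof -
 show "(Gsq has_real_derivative Gsq' w) (at w)"
  unfolding Gsq_def[abs_def] Gsq'_def
  by (rule DERIV_diff[OF DERIV_const rec_DERIV, THEN DERIV_cong]) simp
 have "((%w. 2 * w * (rec w)\<^sup>2) has_real_derivative
   2 * (rec w)\<^sup>2 + (real 2 * rec w ^ (2 - 1) * (- 2 * w * (rec w)\<^sup>2)) * (2 * w)) (at w)"
  by (rule DERIV_mult[OF _ rec_power_DERIV]) (auto intro!: derivative_eq_intros)
 then show "(Gsq' has_real_derivative Gsq'' w) (at w)"
  unfolding Gsq'_def[abs_def] Gsq''_def
  by (rule DERIV_cong) (simp add: power2_eq_square power3_eq_cube algebra_simps)
qed

text \<open>Measuring in powers of \<open>rec\<close> gives decay and boundedness at once. The
  constant 36 = 24 + 12 stems from the two terms of \<open>Gid''\<close>; the second derivative of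
  \<open>Gsq\<close> satisfies the bound with 10 and is given the same constant for
  uniformity.\<close>

lemma G_bounds:
 "\<bar>Gid' w\<bar> <= 5 * (rec w)\<^sup>2" "\<bar>Gid'' w\<bar> <= 36 * (rec w)\<^sup>2" "\<bar>Gsq'' w\<bar> <= 36 * (rec w)\<^sup>2"
 "\<bar>Gsq' w\<bar> <= 2 * rec w" "\<bar>Gsq' w\<bar> <= 2 * \<bar>w\<bar>" "\<bar>Gid w\<bar> <= \<bar>w\<bar>" "0 <= Gsq w" "Gsq w <= w\<^sup>2"
 "\<bar>Gid w\<bar> <= rec w"
proof -
 let ?r = "rec w" and ?a = "\<bar>w\<bar>"
 note b = rec_bounds[of w] and p = rec_pos[of w]
 have r2: "?r\<^sup>2 <= 1" using b p by (simp add: power_le_one)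
 have w2: "w\<^sup>2 * ?r ^ 3 <= ?r\<^sup>2"
  using mult_right_mono[OF b(2), of "?r\<^sup>2"] by (simp add: power2_eq_square power3_eq_cube mult.assoc)
 have w2p: "0 <= w\<^sup>2 * ?r ^ 3" using p by simp
 show "\<bar>Gid' w\<bar> <= 5 * ?r\<^sup>2" unfolding Gid'_def using w2 w2p zero_le_power2[of ?r] by (simp only: mult.assoc; linarith)
 have "\<bar>Gsq'' w\<bar> <= 10 * ?r\<^sup>2" unfolding Gsq''_def using w2 w2p zero_le_power2[of ?r] by (simp only: mult.assoc; linarith)
 then show "\<bar>Gsq'' w\<bar> <= 36 * ?r\<^sup>2" using zero_le_power2[of ?r] by linarith
 have w1: "?a * ?r ^ 3 <= ?r\<^sup>2"
  using mult_right_mono[OF b(3), of "?r\<^sup>2"] by (simp add: power2_eq_square power3_eq_cube mult.assoc)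
 have "?a ^ 3 * ?r ^ 4 = (w\<^sup>2 * ?r) * (?a * ?r ^ 3)"
  by (simp add: power2_eq_square power3_eq_cube power4_eq_xxxx) 
 also have "\<dots> <= 1 * (?a * ?r ^ 3)" using b(2) p by (intro mult_right_mono) auto
 finally have w3: "?a ^ 3 * ?r ^ 4 <= ?r\<^sup>2" using w1 by simp
 have "\<bar>Gid'' w\<bar> <= \<bar>24 * w ^ 3 * ?r ^ 4\<bar> + \<bar>12 * w * ?r ^ 3\<bar>" unfolding Gid''_def by (rule abs_triangle_ineq4)
 also have "\<dots> = 24 * (?a ^ 3 * ?r ^ 4) + 12 * (?a * ?r ^ 3)" using p by (simp add: abs_mult power_abs)
 finally show "\<bar>Gid'' w\<bar> <= 36 * ?r\<^sup>2" using w1 w3 by linarith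
 have "\<bar>Gsq' w\<bar> = 2 * (?a * ?r) * ?r" using p by (simp add: Gsq'_def abs_mult power2_eq_square)
 also have "\<dots> <= 2 * 1 * ?r" using b p by (intro mult_right_mono) auto
 finally show "\<bar>Gsq' w\<bar> <= 2 * ?r" by simp
 have "\<bar>Gsq' w\<bar> = 2 * ?a * ?r\<^sup>2" using p by (simp add: Gsq'_def abs_mult)
 also have "\<dots> <= 2 * ?a * 1" using r2 by (intro mult_left_mono) auto
 finally show "\<bar>Gsq' w\<bar> <= 2 * ?a" by simp
 have "\<bar>Gid w\<bar> = ?a * ?r\<^sup>2" using p by (simp add: Gid_def abs_mult)
 also have "\<dots> <= ?a * 1" using r2 by (intro mult_left_mono) auto
 finally show "\<bar>Gid w\<bar> <= ?a" by simp
 have "\<bar>Gid w\<bar> = (?a * ?r) * ?r" using p by (simp add: Gid_def abs_mult power2_eq_square)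
 also have "\<dots> <= 1 * ?r" using b p by (intro mult_right_mono) auto
 finally show "\<bar>Gid w\<bar> <= ?r" by simp
 show "0 <= Gsq w" using b by (simp add: Gsq_def)
 have "Gsq w = w\<^sup>2 * ?r" using rec_mult[of w] by (simp add: Gsq_def algebra_simps)
 also have "\<dots> <= w\<^sup>2 * 1" using b by (intro mult_left_mono) auto
 finally show "Gsq w <= w\<^sup>2" by simp
qed

lemma rec_decay: "rec w * (1 + \<bar>w\<bar>) <= 2"
 using rec_bounds[of w] by (simp add: algebra_simps)

lemma rec2_decay: "(rec w)\<^sup>2 * (1 + w\<^sup>2) * (1 + \<bar>w\<bar>) <= 2"
proof -
 have "(rec w)\<^sup>2 * (1 + w\<^sup>2) * (1 + \<bar>w\<bar>) = rec w * (1 + \<bar>w\<bar>) * (rec w * (1 + w\<^sup>2))" by (simp add: power2_eq_square)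
 also have "\<dots> = rec w * (1 + \<bar>w\<bar>)" by (simp only: rec_mult mult_1_right)
 also have "\<dots> <= 2" by (rule rec_decay)
 finally show ?thesis .
qed

lemma C20fun_G: "C20fun Gid Gid' Gid''" "C20fun Gsq Gsq' Gsq''"
proof -
 have c: "continuous_on UNIV Gid''" "continuous_on UNIV Gsq''"
  unfolding Gid''_def[abs_def] Gsq''_def[abs_def] by (intro continuous_intros rec_cont)+
 have dec: "\<bar>f\<bar> * (1 + x\<^sup>2) * (1 + \<bar>x\<bar>) <= 72" if "\<bar>f\<bar> <= 36 * (rec x)\<^sup>2" for f x
 proof -
  have "\<bar>f\<bar> * (1 + x\<^sup>2) * (1 + \<bar>x\<bar>) <= 36 * (rec x)\<^sup>2 * (1 + x\<^sup>2) * (1 + \<bar>x\<bar>)"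
   using that by (intro mult_right_mono) auto
  then show ?thesis using rec2_decay[of x] by linarith
 qed
 have dec1: "\<bar>f\<bar> * (1 + \<bar>x\<bar>) <= 72" if "\<bar>f\<bar> <= rec x" for f x
  using mult_right_mono[OF that, of "1 + \<bar>x\<bar>"] rec_decay[of x] by linarith
 have d1: "\<bar>Gid' x\<bar> <= 36 * (rec x)\<^sup>2" for x using G_bounds(1)[of x] zero_le_power2[of "rec x"] by linarith
 have "\<bar>Gsq' x\<bar> * (1 + x\<^sup>2) * (1 + \<bar>x\<bar>) <= 72" for x
 proof -
  have "\<bar>Gsq' x\<bar> = 2 * \<bar>x\<bar> * (rec x)\<^sup>2" using rec_pos[of x] by (simp add: Gsq'_def abs_mult)
  then have "\<bar>Gsq' x\<bar> * (1 + x\<^sup>2) * (1 + \<bar>x\<bar>) = 2 * (\<bar>x\<bar> * rec x) * (rec x * (1 + x\<^sup>2)) * (1 + \<bar>x\<bar>)"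
   by (simp add: power2_eq_square)
  also have "\<dots> = 2 * (\<bar>x\<bar> * rec x) * 1 * (1 + \<bar>x\<bar>)" by (simp only: rec_mult)
  also have "\<dots> = 2 * (\<bar>x\<bar> * rec x) + 2 * (x\<^sup>2 * rec x)" by (simp add: algebra_simps power2_eq_square)
  also have "\<dots> <= 72" using rec_bounds[of x] by linarith
  finally show ?thesis .
 qed
 moreover have "\<bar>Gsq x - 1\<bar> <= rec x" for x using rec_pos[of x] by (simp add: Gsq_def)
 ultimately show "C20fun Gsq Gsq' Gsq''" unfolding C20fun_def
  using Gsq_DERIV c dec[OF G_bounds(3)] dec1 by blast
 have "\<bar>Gid x - 0\<bar> <= rec x" for x using G_bounds(9)[of x] by simp
 then show "C20fun Gid Gid' Gid''" unfolding C20fun_def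
  using Gid_DERIV c dec[OF G_bounds(2)] dec[OF d1] dec1 by blast
qed

text \<open>For K \<ge> 1 the weights 1 + |z| and 1 + z^2 grow by at most K and K^2 under scaling.
  The resulting constants may depend on K, since membership alone is at stake here.\<close>

lemma C20fun_scale:
 assumes g: "C20fun g g' g''" and K: "1 <= K"
 shows "C20fun (%z. b * g (z / K)) (%z. b / K * g' (z / K)) (%z. b / K\<^sup>2 * g'' (z / K))"
proof -
 from g obtain k C where d: "!!z. (g has_real_derivative g' z) (at z)" "!!z. (g' has_real_derivative g'' z) (at z)"
  and c: "continuous_on UNIV g''" and bd: "!!x. \<bar>g x - k\<bar> * (1 + \<bar>x\<bar>) <= C"
    "!!x. \<bar>g' x\<bar> * (1 + x\<^sup>2) * (1 + \<bar>x\<bar>) <= C" "!!x. \<bar>g'' x\<bar> * (1 + x\<^sup>2) * (1 + \<bar>x\<bar>) <= C"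
  unfolding C20fun_def by blast
 have i: "((%z. z / K) has_real_derivative 1 / K) (at z)" for z
  using K by (auto intro!: derivative_eq_intros)
 have 1: "((%z. b * g (z / K)) has_real_derivative b / K * g' (z / K)) (at z)" for z
  using DERIV_cmult[OF DERIV_chain2[OF d(1) i], of b z] by (simp add: ac_simps)
 have 2: "((%z. b / K * g' (z / K)) has_real_derivative b / K\<^sup>2 * g'' (z / K)) (at z)" for z
  using DERIV_cmult[OF DERIV_chain2[OF d(2) i], of "b / K" z] by (simp add: ac_simps power2_eq_square)
 have 3: "continuous_on UNIV (%z. b / K\<^sup>2 * g'' (z / K))"
  using K by (intro continuous_intros continuous_on_compose2[OF c]) auto
 have z1: "1 + \<bar>z\<bar> <= K * (1 + \<bar>z / K\<bar>)" for z using K by (simp add: distrib_left)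
 have z2: "1 + z\<^sup>2 <= K\<^sup>2 * (1 + (z / K)\<^sup>2)" for z
  using K one_le_power[of K 2] by (simp add: distrib_left power_divide)
 have C0: "0 <= C" using bd(1)[of 0] by (meson abs_ge_zero add_nonneg_nonneg mult_nonneg_nonneg order_trans zero_le_one)
 have A: "\<bar>b * g (z / K) - b * k\<bar> * (1 + \<bar>z\<bar>) <= \<bar>b\<bar> * (K * C)" for z
 proof -
  have "\<bar>b * g (z / K) - b * k\<bar> * (1 + \<bar>z\<bar>) <= \<bar>b\<bar> * \<bar>g (z / K) - k\<bar> * (K * (1 + \<bar>z / K\<bar>))"
   unfolding right_diff_distrib[symmetric] abs_mult by (intro mult_left_mono z1) auto
  also have "\<dots> = \<bar>b\<bar> * (K * (\<bar>g (z / K) - k\<bar> * (1 + \<bar>z / K\<bar>)))" by (simp only: ac_simps)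
  also have "\<dots> <= \<bar>b\<bar> * (K * C)" using K by (intro mult_left_mono bd) auto
  finally show ?thesis .
 qed
 have B: "\<bar>e * h (z / K)\<bar> * (1 + z\<^sup>2) * (1 + \<bar>z\<bar>) <= \<bar>e\<bar> * (K ^ 3 * C)"
  if "!!x. \<bar>h x\<bar> * (1 + x\<^sup>2) * (1 + \<bar>x\<bar>) <= C" for e h z
 proof -
  have "\<bar>e * h (z / K)\<bar> * (1 + z\<^sup>2) * (1 + \<bar>z\<bar>) <= \<bar>e\<bar> * \<bar>h (z / K)\<bar> * (K\<^sup>2 * (1 + (z / K)\<^sup>2)) * (K * (1 + \<bar>z / K\<bar>))"
   unfolding abs_mult by (intro mult_mono z1 z2) auto
  also have "\<dots> = \<bar>e\<bar> * (K ^ 3 * (\<bar>h (z / K)\<bar> * (1 + (z / K)\<^sup>2) * (1 + \<bar>z / K\<bar>)))"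
   by (simp only: power2_eq_square power3_eq_cube ac_simps)
  also have "\<dots> <= \<bar>e\<bar> * (K ^ 3 * C)" using K by (intro mult_left_mono that) auto
  finally show ?thesis .
 qed
 let ?M = "max (\<bar>b\<bar> * (K * C)) (max (\<bar>b / K\<bar> * (K ^ 3 * C)) (\<bar>b / K\<^sup>2\<bar> * (K ^ 3 * C)))"
 have "\<bar>b * g (z / K) - b * k\<bar> * (1 + \<bar>z\<bar>) <= ?M" for z
  by (rule max.coboundedI1[OF A])
 moreover have "\<bar>b / K * g' (z / K)\<bar> * (1 + z\<^sup>2) * (1 + \<bar>z\<bar>) <= ?M" for z
  by (rule max.coboundedI2[OF max.coboundedI1[OF B[OF bd(2)]]])
 moreover have "\<bar>b / K\<^sup>2 * g'' (z / K)\<bar> * (1 + z\<^sup>2) * (1 + \<bar>z\<bar>) <= ?M" for z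
  by (rule max.coboundedI2[OF max.coboundedI2[OF B[OF bd(3)]]])
 ultimately show ?thesis unfolding C20fun_def using 1 2 3 by blast
qed


section \<open>The generator on functions of one linear functional\<close>

definition jmp :: "(real => real) => (real => real) => real => real => real => real" where
 "jmp g g' z u \<xi> = g (z + \<xi> * u) - g z - \<xi> * (g' z * u)"

text \<open>The generator on functions of one linear functional, with all derivatives as independent
  arguments. It thus makes sense for the identity and the square, which are limits of admissible
  functions without being admissible.\<close>

definition Lg :: "(real => real) => (real => real) => (real => real) => (real => real measure) =>
  (real => real) => (real => real) => (real => real) =>
  (real => real) => (real => real) => (real => real) => real measure => real" where
 "Lg a \<rho> \<sigma> \<gamma> g g' g'' f f' f'' \<nu> =
   1/2 * (g' (LINT x|\<nu>. f x) * (LINT x|\<nu>. a x * f'' x)) +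
   1/2 * (g'' (LINT x|\<nu>. f x) * (LINT z|(\<nu> \<Otimes>\<^sub>M \<nu>). \<rho> (fst z - snd z) * f' (fst z) * f' (snd z))) +
   1/2 * (g'' (LINT x|\<nu>. f x) * (LINT x|\<nu>. \<sigma> x * f x * f x)) +
   (LINT x|\<nu>. (LINT \<xi>|\<gamma> x. jmp g g' (LINT x|\<nu>. f x) (f x) \<xi>))"

lemma Lop_eq_Lg:
 assumes g: "!!z. (g has_real_derivative g' z) (at z)" "!!z. (g' has_real_derivative g'' z) (at z)"
  and f: "!!z. (f has_real_derivative f' z) (at z)" "!!z. (f' has_real_derivative f'' z) (at z)"
 shows "Lop a \<rho> \<sigma> \<gamma> 1 (%v. g (v 0)) (%_. f) \<nu> = Lg a \<rho> \<sigma> \<gamma> g g' g'' f f' f'' \<nu>"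
proof -
 have d: "deriv f = f'" "deriv f' = f''" using f by (auto intro!: ext DERIV_imp_deriv)
 show ?thesis
  unfolding Lop_def Aop_def Bop_def Lg_def jmp_def
  by (simp add: pd_on_real[OF g(1)] pd_on_real[OF g(2)] phivec_def d split_beta' algebra_simps)
qed

text \<open>Two mean value estimates in a row; the factor 1/2 of Taylor's formula is given
  up.\<close>

lemma taylor_bound:
 fixes g :: "real => real"
 assumes g: "!!z. (g has_real_derivative g' z) (at z)" "!!z. (g' has_real_derivative g'' z) (at z)"
  and b: "!!z. \<bar>g'' z\<bar> <= c"
 shows "\<bar>g (z + h) - g z - h * g' z\<bar> <= c * h\<^sup>2"
proof -
 have c0: "0 <= c" using b[of 0] by linarith
 have lip: "\<bar>g' x - g' y\<bar> <= c * \<bar>x - y\<bar>" for x y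
  using field_differentiable_bound[of UNIV g' g'' c x y] g(2) b by (auto simp: has_field_derivative_at_within)
 have "\<bar>(g (z + h) - (z + h) * g' z) - (g z - z * g' z)\<bar> <= (c * \<bar>h\<bar>) * \<bar>(z + h) - z\<bar>"
 proof -
  have "norm ((%y. g y - y * g' z) (z + h) - (%y. g y - y * g' z) z) <= (c * \<bar>h\<bar>) * norm ((z + h) - z)"
  proof (rule field_differentiable_bound[of "closed_segment z (z + h)" _ "%y. g' y - g' z"])
   show "((%y. g y - y * g' z) has_field_derivative g' y - g' z) (at y within closed_segment z (z + h))" for y
    by (rule has_field_derivative_at_within, rule DERIV_diff[OF g(1)]) (auto intro!: derivative_eq_intros)
   show "norm (g' y - g' z) <= c * \<bar>h\<bar>" if "y \<in> closed_segment z (z + h)" for y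
   proof -
    have "\<bar>y - z\<bar> <= \<bar>h\<bar>" using that by (auto simp: closed_segment_eq_real_ivl split: if_splits)
    then show ?thesis using lip[of y z] mult_left_mono[OF _ c0, of "\<bar>y - z\<bar>" "\<bar>h\<bar>"] by auto
   qed
  qed auto
  then show ?thesis by simp
 qed
 then show ?thesis by (simp add: power2_eq_square algebra_simps abs_mult_self_eq)
qed

lemma jmp_bound:
 fixes g :: "real => real"
 assumes "!!z. (g has_real_derivative g' z) (at z)" "!!z. (g' has_real_derivative g'' z) (at z)" "!!z. \<bar>g'' z\<bar> <= c"
 shows "\<bar>jmp g g' z u \<xi>\<bar> <= c * u\<^sup>2 * \<xi>\<^sup>2"
 using taylor_bound[OF assms, of z "\<xi> * u"] by (simp add: jmp_def power_mult_distrib ac_simps)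

locale coefficients =
 fixes a \<rho> \<sigma> :: "real => real" and \<gamma> :: "real => real measure" and Ca C\<rho> C\<sigma> \<Gamma> :: real
 assumes a: "continuous_on UNIV a" "!!x. \<bar>a x\<bar> <= Ca"
  and \<rho>: "continuous_on UNIV \<rho>" "!!x. \<bar>\<rho> x\<bar> <= C\<rho>"
  and \<sigma>: "continuous_on UNIV \<sigma>" "!!x. \<bar>\<sigma> x\<bar> <= C\<sigma>"
  and \<gamma>: "kernel_pos \<gamma>" "!!x. (\<integral>\<^sup>+\<xi>. ennreal (\<xi>\<^sup>2) \<partial>\<gamma> x) <= ennreal \<Gamma>" and \<Gamma>: "0 <= \<Gamma>"
begin

abbreviation "Rp \<equiv> restrict_space borel {0<..} :: real measure"

lemma a_Bm: "a \<in> Bm" and \<rho>_Bm: "\<rho> \<in> Bm" and \<sigma>_Bm: "\<sigma> \<in> Bm"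
 using a \<rho> \<sigma> by (auto intro!: BmI borel_measurable_continuous_onI)

lemma bounds_nonneg: "0 <= Ca" "0 <= C\<rho>" "0 <= C\<sigma>"
 using a(2)[of 0] \<rho>(2)[of 0] \<sigma>(2)[of 0] by linarith+

lemma sets_\<gamma>[measurable_cong]: "sets (\<gamma> x) = sets Rp"
 using \<gamma>(1) by (simp add: kernel_pos_def)

lemma space_\<gamma>: "space (\<gamma> x) = {0<..}"
 using sets_eq_imp_space_eq[OF sets_\<gamma>[of x]] by (simp add: space_restrict_space)

text \<open>The measures \<open>\<gamma> x\<close> may be infinite, so measurability in x is
  obtained by induction on the integrand, starting from the sets in
  \<open>kernel_pos\<close>.\<close>

lemma kernel_nn_integral:
 assumes "f \<in> borel_measurable Rp"
 shows "(%x. \<integral>\<^sup>+\<xi>. f \<xi> \<partial>\<gamma> x) \<in> borel_measurable borel"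
 using assms
proof (induction rule: borel_measurable_induct)
 case (cong f g)
 then have "(\<integral>\<^sup>+\<xi>. f \<xi> \<partial>\<gamma> x) = (\<integral>\<^sup>+\<xi>. g \<xi> \<partial>\<gamma> x)" for x
  by (intro nn_integral_cong) (simp add: space_\<gamma> space_restrict_space)
 then show ?case using cong by simp
next
 case (set A)
 then show ?case using \<gamma>(1) by (simp add: kernel_pos_def sets_\<gamma>)
next
 case (mult u c)
 then have "(\<integral>\<^sup>+\<xi>. c * u \<xi> \<partial>\<gamma> x) = c * (\<integral>\<^sup>+\<xi>. u \<xi> \<partial>\<gamma> x)" for x
  by (intro nn_integral_cmult) (simp add: measurable_cong_sets[OF sets_\<gamma> refl])
 then show ?case using mult by simp
next
 case (add u v)
 then have "(\<integral>\<^sup>+\<xi>. v \<xi> + u \<xi> \<partial>\<gamma> x) = (\<integral>\<^sup>+\<xi>. v \<xi> \<partial>\<gamma> x) + (\<integral>\<^sup>+\<xi>. u \<xi> \<partial>\<gamma> x)" for x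
  by (intro nn_integral_add) (simp_all add: measurable_cong_sets[OF sets_\<gamma> refl])
 then show ?case using add by simp
next
 case (seq U)
 have "(\<integral>\<^sup>+\<xi>. (SUP i. U i) \<xi> \<partial>\<gamma> x) = (SUP i. \<integral>\<^sup>+\<xi>. U i \<xi> \<partial>\<gamma> x)" for x
  unfolding SUP_apply using seq by (intro nn_integral_monotone_convergence_SUP) (auto cong: measurable_cong_sets)
 then show ?case using seq by simp
qed

text \<open>Jump measures may be infinite near 0. The weight \<xi>^2 makes them finite, and \<Gamma>
  + 1 in place of \<Gamma> makes them subprobabilities without a division by zero.\<close>

definition K where "K x = density (\<gamma> x) (%\<xi>. ennreal (\<xi>\<^sup>2 / (\<Gamma> + 1)))"

lemma sq_meas[measurable]: "(%\<xi>. \<xi>\<^sup>2) \<in> borel_measurable Rp"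
 by (rule measurable_restrict_space1) measurable

lemma K_subprob: "K \<in> measurable borel (subprob_algebra Rp)"
proof (rule measurable_subprob_algebra)
 have m: "(%\<xi>. ennreal (\<xi>\<^sup>2 / (\<Gamma> + 1))) \<in> borel_measurable (\<gamma> x)" for x by measurable
 show "sets (K x) = sets Rp" for x by (simp add: K_def sets_\<gamma>)
 fix x :: real
 have "emeasure (K x) (space (K x)) = (\<integral>\<^sup>+\<xi>. ennreal (\<xi>\<^sup>2 / (\<Gamma> + 1)) * indicator (space (\<gamma> x)) \<xi> \<partial>\<gamma> x)"
  unfolding K_def by (subst emeasure_density[OF m]) auto
 also have "\<dots> = (\<integral>\<^sup>+\<xi>. ennreal (1 / (\<Gamma> + 1)) * ennreal (\<xi>\<^sup>2) \<partial>\<gamma> x)"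
  by (intro nn_integral_cong) (use \<Gamma> in \<open>auto simp: ennreal_mult[symmetric]\<close>)
 also have "\<dots> = ennreal (1 / (\<Gamma> + 1)) * (\<integral>\<^sup>+\<xi>. ennreal (\<xi>\<^sup>2) \<partial>\<gamma> x)"
  by (rule nn_integral_cmult) measurable
 also have "\<dots> <= ennreal (1 / (\<Gamma> + 1)) * ennreal \<Gamma>" by (intro mult_left_mono \<gamma>(2)) auto
 also have "\<dots> <= 1"
  using \<Gamma> by (subst ennreal_mult[symmetric]) (auto simp: ennreal_le_1 field_simps)
 finally show "subprob_space (K x)" by (intro subprob_spaceI) (auto simp: K_def space_\<gamma>)
next
 fix A assume A: "A \<in> sets Rp"
 have m: "(%\<xi>. ennreal (\<xi>\<^sup>2 / (\<Gamma> + 1))) \<in> borel_measurable (\<gamma> x)" for x by measurable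
 have "emeasure (K x) A = (\<integral>\<^sup>+\<xi>. ennreal (\<xi>\<^sup>2 / (\<Gamma> + 1)) * indicator A \<xi> \<partial>\<gamma> x)" for x
  unfolding K_def using A by (subst emeasure_density[OF m]) (auto simp: sets_\<gamma>)
 moreover have "(%\<xi>. ennreal (\<xi>\<^sup>2 / (\<Gamma> + 1)) * indicator A \<xi>) \<in> borel_measurable Rp" using A by measurable
 ultimately show "(%x. emeasure (K x) A) \<in> borel_measurable borel" using kernel_nn_integral by simp
qed

text \<open>The weight of \<open>K\<close> is divided out again, which is possible because \<xi> > 0
  on the space of every \<open>\<gamma> x\<close>.\<close>

lemma kernel_integral:
 assumes p[measurable]: "(%(w, \<xi>). p w \<xi>) \<in> borel_measurable (N \<Otimes>\<^sub>M Rp)" and X[measurable]: "X \<in> borel_measurable N"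
 shows "(%w. \<integral>\<xi>. (p w \<xi> :: real) \<partial>\<gamma> (X w)) \<in> borel_measurable N"
proof -
 have [measurable]: "(%z. (snd z)\<^sup>2) \<in> borel_measurable (N \<Otimes>\<^sub>M Rp)"
  using measurable_compose[OF measurable_snd sq_meas] .
 have "(%w. \<integral>\<xi>. (\<Gamma> + 1) * (p w \<xi> / \<xi>\<^sup>2) \<partial>K (X w)) \<in> borel_measurable N"
 proof (rule integral_measurable_kernel)
  show "(%w. K (X w)) \<in> measurable N (subprob_algebra Rp)"
   by (rule measurable_compose[OF X K_subprob])
  show "(%(w, \<xi>). (\<Gamma> + 1) * (p w \<xi> / \<xi>\<^sup>2)) \<in> borel_measurable (N \<Otimes>\<^sub>M Rp)"
   using p unfolding split_beta' by measurable
 qed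
 moreover have "(LINT \<xi>|K (X w). (\<Gamma> + 1) * (p w \<xi> / \<xi>\<^sup>2)) = (LINT \<xi>|\<gamma> (X w). p w \<xi>)" if w: "w \<in> space N" for w
 proof -
  have pw[measurable]: "p w \<in> borel_measurable Rp" using measurable_Pair2[OF p w] by simp
  have "(LINT \<xi>|K (X w). (\<Gamma> + 1) * (p w \<xi> / \<xi>\<^sup>2)) = (LINT \<xi>|\<gamma> (X w). \<xi>\<^sup>2 / (\<Gamma> + 1) * ((\<Gamma> + 1) * (p w \<xi> / \<xi>\<^sup>2)))"
   unfolding K_def using \<Gamma> by (subst integral_density) auto
  also have "\<dots> = (LINT \<xi>|\<gamma> (X w). p w \<xi>)"
   using \<Gamma> by (intro Bochner_Integration.integral_cong) (auto simp: space_\<gamma>)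
  finally show ?thesis .
 qed
 ultimately show ?thesis by (simp cong: measurable_cong)
qed

definition \<kappa>\<^sub>2 where "\<kappa>\<^sub>2 x = (LINT \<xi>|\<gamma> x. \<xi>\<^sup>2)"

lemma sq_integrable: "integrable (\<gamma> x) (%\<xi>. \<xi>\<^sup>2)"
proof (rule integrableI_bounded)
 show "(\<integral>\<^sup>+ \<xi>. ennreal (norm (\<xi>\<^sup>2)) \<partial>\<gamma> x) < \<infinity>"
  using \<gamma>(2)[of x] by (simp add: order_le_less_trans)
qed measurable

lemma \<kappa>\<^sub>2_bounds: "0 <= \<kappa>\<^sub>2 x" "\<kappa>\<^sub>2 x <= \<Gamma>"
proof -
 show "0 <= \<kappa>\<^sub>2 x" unfolding \<kappa>\<^sub>2_def by simp
 have "ennreal (\<kappa>\<^sub>2 x) = (\<integral>\<^sup>+\<xi>. ennreal (\<xi>\<^sup>2) \<partial>\<gamma> x)"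
  unfolding \<kappa>\<^sub>2_def by (rule nn_integral_eq_integral[symmetric, OF sq_integrable]) simp
 then show "\<kappa>\<^sub>2 x <= \<Gamma>" using \<gamma>(2)[of x] \<Gamma> by (metis ennreal_le_iff)
qed

lemma \<kappa>\<^sub>2_Bm: "\<kappa>\<^sub>2 \<in> Bm"
proof (rule BmI[where C = \<Gamma>])
 have "(%x. \<integral>\<xi>. \<xi>\<^sup>2 \<partial>\<gamma> (id x)) \<in> borel_measurable borel"
  by (rule kernel_integral) (auto simp: split_beta' intro!: measurable_compose[OF measurable_snd sq_meas])
 then show "\<kappa>\<^sub>2 \<in> borel_measurable borel" by (simp add: \<kappa>\<^sub>2_def[abs_def])
 show "\<bar>\<kappa>\<^sub>2 x\<bar> <= \<Gamma>" for x using \<kappa>\<^sub>2_bounds[of x] by simp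
qed

lemma jmp_integral_bound:
 assumes "!!z. (g has_real_derivative g' z) (at z)" "!!z. (g' has_real_derivative g'' z) (at z)" "!!z. \<bar>g'' z\<bar> <= c"
 shows "integrable (\<gamma> x) (jmp g g' z u)" "\<bar>\<integral>\<xi>. jmp g g' z u \<xi> \<partial>\<gamma> x\<bar> <= c * u\<^sup>2 * \<Gamma>"
proof -
 have c0: "0 <= c" using assms(3)[of 0] by linarith
 have [measurable]: "g \<in> borel_measurable borel" using deriv_cont[OF assms(1)] by (rule borel_measurable_continuous_onI)
 have id: "(%\<xi>. \<xi>) \<in> borel_measurable Rp" by (rule measurable_restrict_space1) measurable
 have [measurable]: "jmp g g' z u \<in> borel_measurable (\<gamma> x)"
  using id unfolding jmp_def[abs_def] by measurable
 show i: "integrable (\<gamma> x) (jmp g g' z u)"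
 proof (rule Bochner_Integration.integrable_bound)
  show "integrable (\<gamma> x) (%\<xi>. c * u\<^sup>2 * \<xi>\<^sup>2)" using sq_integrable by simp
  show "AE \<xi> in \<gamma> x. norm (jmp g g' z u \<xi>) <= norm (c * u\<^sup>2 * \<xi>\<^sup>2)"
   using jmp_bound[OF assms] by (intro AE_I2) (auto intro!: order_trans[OF _ abs_ge_self])
 qed measurable
 have "\<bar>\<integral>\<xi>. jmp g g' z u \<xi> \<partial>\<gamma> x\<bar> <= (LINT \<xi>|\<gamma> x. \<bar>jmp g g' z u \<xi>\<bar>)" by simp
 also have "\<dots> <= (LINT \<xi>|\<gamma> x. c * u\<^sup>2 * \<xi>\<^sup>2)"
  using i jmp_bound[OF assms] sq_integrable by (intro integral_mono) auto
 also have "\<dots> = c * u\<^sup>2 * \<kappa>\<^sub>2 x" by (simp add: \<kappa>\<^sub>2_def)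
 also have "\<dots> <= c * u\<^sup>2 * \<Gamma>" using \<kappa>\<^sub>2_bounds c0 by (intro mult_left_mono) auto
 finally show "\<bar>\<integral>\<xi>. jmp g g' z u \<xi> \<partial>\<gamma> x\<bar> <= c * u\<^sup>2 * \<Gamma>" .
qed

lemma jmp_measurable:
 assumes [measurable]: "g \<in> borel_measurable borel" "g' \<in> borel_measurable borel" "f \<in> borel_measurable borel"
  and [measurable]: "Z \<in> borel_measurable N"
 shows "(%(w, x). \<integral>\<xi>. jmp g g' (Z w) (f x) \<xi> \<partial>\<gamma> x) \<in> borel_measurable (N \<Otimes>\<^sub>M borel)"
proof -
 have "(%\<xi>. \<xi>) \<in> borel_measurable Rp" by (rule measurable_restrict_space1) measurable
 then have [measurable]: "(%z. snd z) \<in> borel_measurable ((N \<Otimes>\<^sub>M (borel :: real measure)) \<Otimes>\<^sub>M Rp)"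
  by (rule measurable_compose[OF measurable_snd])
 have "(%q. \<integral>\<xi>. jmp g g' (Z (fst q)) (f (snd q)) \<xi> \<partial>\<gamma> (snd q)) \<in> borel_measurable (N \<Otimes>\<^sub>M borel)"
  by (rule kernel_integral) (unfold jmp_def split_beta', measurable)
 then show ?thesis by (simp add: split_beta')
qed

end

section \<open>Measurability, bounds and limits of the generator\<close>

lemma fbm_pair_bound:
 assumes M: "finite_borel_measure M" and h: "h \<in> Bm" "!!z. \<bar>h z\<bar> <= C"
 shows "\<bar>\<integral>z. h z \<partial>(M \<Otimes>\<^sub>M M)\<bar> <= C * (mass M)\<^sup>2"
proof -
 have "\<bar>\<integral>z. h z \<partial>(M \<Otimes>\<^sub>M M)\<bar> <= (LINT z|(M \<Otimes>\<^sub>M M). \<bar>h z\<bar>)" by simp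
 also have "\<dots> <= (LINT z|(M \<Otimes>\<^sub>M M). C)"
  using h(2) fbm_pair(1)[OF M h(1)] fbm_pair(1)[OF M Bm_const] by (intro integral_mono) auto
 also have "\<dots> = C * (mass M)\<^sup>2"
  unfolding fbm_pair(2)[OF M Bm_const] fbm_integral_1[OF M] by (simp add: power2_eq_square)
 finally show ?thesis .
qed

context coefficients
begin

abbreviation "LL \<equiv> Lg a \<rho> \<sigma> \<gamma>"

lemma pair_term_Bm:
 assumes "f \<in> Bm" "g \<in> Bm"
 shows "(%z. \<rho> (fst z - snd z) * f (fst z) * g (snd z)) \<in> Bm"
proof -
 have [measurable]: "fst \<in> borel_measurable (borel :: (real \<times> real) measure)"
  "snd \<in> borel_measurable (borel :: (real \<times> real) measure)"
  by (auto simp: borel_prod[symmetric])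
 show ?thesis
  by (rule Bm_mult[OF Bm_mult[OF Bm_compose[OF \<rho>_Bm] Bm_compose[OF assms(1)]] Bm_compose[OF assms(2)]]) measurable
qed

lemma C2cfun_Bm: "C2cfun f f' f'' ==> f \<in> Bm" "C2cfun f f' f'' ==> f' \<in> Bm" "C2cfun f f' f'' ==> f'' \<in> Bm"
 using C2cfun_Chat Chat_Bm by blast+

lemma Lg_measurable:
 assumes X: "mkernel N X" and g: "!!z. (g has_real_derivative g' z) (at z)" "!!z. (g' has_real_derivative g'' z) (at z)"
  "continuous_on UNIV g''" and f: "C2cfun f f' f''"
 shows "(%w. LL g g' g'' f f' f'' (X w)) \<in> borel_measurable N"
proof -
 have [measurable]: "g \<in> borel_measurable borel" "g' \<in> borel_measurable borel" "g'' \<in> borel_measurable borel"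
  using deriv_cont[OF g(1)] deriv_cont[OF g(2)] g(3) by (auto intro: borel_measurable_continuous_onI)
 note Bm = C2cfun_Bm[OF f]
 have [measurable]: "f \<in> borel_measurable borel" using Bm by auto
 have Z[measurable]: "(%w. \<integral>x. f x \<partial>X w) \<in> borel_measurable N" by (rule mkernel_Bm[OF X Bm(1)])
 have [measurable]: "(%w. \<integral>x. a x * f'' x \<partial>X w) \<in> borel_measurable N"
  "(%w. \<integral>x. \<sigma> x * f x * f x \<partial>X w) \<in> borel_measurable N"
  by (intro mkernel_Bm[OF X] Bm_mult a_Bm \<sigma>_Bm Bm)+
 have [measurable]: "(%w. \<integral>z. \<rho> (fst z - snd z) * f' (fst z) * f' (snd z) \<partial>(X w \<Otimes>\<^sub>M X w)) \<in> borel_measurable N"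
  by (intro mkernel_pair[OF X] pair_term_Bm Bm)
 have [measurable]: "(%w. \<integral>x. (LINT \<xi>|\<gamma> x. jmp g g' (LINT x|X w. f x) (f x) \<xi>) \<partial>X w) \<in> borel_measurable N"
  by (intro mkernel_integral[OF X] jmp_measurable) measurable
 show ?thesis unfolding Lg_def by measurable
qed

lemma jmp_Bm:
 assumes g: "!!z. (g has_real_derivative g' z) (at z)" "!!z. (g' has_real_derivative g'' z) (at z)"
  "!!z. \<bar>g'' z\<bar> <= c" and f: "f \<in> Bm" "!!x. \<bar>f x\<bar> <= d"
 shows "(%x. \<integral>\<xi>. jmp g g' z (f x) \<xi> \<partial>\<gamma> x) \<in> Bm" "\<bar>\<integral>\<xi>. jmp g g' z (f x) \<xi> \<partial>\<gamma> x\<bar> <= c * d\<^sup>2 * \<Gamma>"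
proof -
 have c0: "0 <= c" using g(3)[of 0] by linarith
 have *: "\<bar>\<integral>\<xi>. jmp g g' z (f x) \<xi> \<partial>\<gamma> x\<bar> <= c * d\<^sup>2 * \<Gamma>" for x
 proof -
  have "(f x)\<^sup>2 <= d\<^sup>2" using power_mono[OF f(2)[of x] abs_ge_zero, of 2] by simp
  then have "c * (f x)\<^sup>2 * \<Gamma> <= c * d\<^sup>2 * \<Gamma>" using c0 \<Gamma> by (intro mult_right_mono mult_left_mono)
  then show ?thesis using jmp_integral_bound(2)[OF g, where z = z and u = "f x" and x = x] by linarith
 qed
 then show "\<bar>\<integral>\<xi>. jmp g g' z (f x) \<xi> \<partial>\<gamma> x\<bar> <= c * d\<^sup>2 * \<Gamma>" .
 have "g \<in> borel_measurable borel" "g' \<in> borel_measurable borel"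
  using deriv_cont[OF g(1)] deriv_cont[OF g(2)] by (auto intro: borel_measurable_continuous_onI)
 from jmp_measurable[OF this Bm_measurable[OF f(1)], of "%w. z" "borel :: real measure"]
 have "(%(w :: real, x). \<integral>\<xi>. jmp g g' z (f x) \<xi> \<partial>\<gamma> x) \<in> borel_measurable (borel \<Otimes>\<^sub>M borel)" by simp
 from measurable_Pair2[OF this, of 0]
 show "(%x. \<integral>\<xi>. jmp g g' z (f x) \<xi> \<partial>\<gamma> x) \<in> Bm"
  using * by (intro BmI[where C = "c * d\<^sup>2 * \<Gamma>"]) auto
qed

text \<open>Second derivatives, branching and jumps are integrated against \<nu> once, the
  interaction twice, whence the square of the mass. The constants \<open>b\<close>,
  \<open>c\<close>, \<open>d0\<close>, \<open>d1\<close>, \<open>d2\<close> are kept apart because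
  they scale differently under truncation.\<close>

lemma Lg_bound:
 assumes \<nu>: "finite_borel_measure \<nu>"
  and g: "!!z. (g has_real_derivative g' z) (at z)" "!!z. (g' has_real_derivative g'' z) (at z)" "!!z. \<bar>g'' z\<bar> <= c"
  and b: "\<bar>g' (LINT x|\<nu>. f x)\<bar> <= b"
  and f: "f \<in> Bm" "f' \<in> Bm" "f'' \<in> Bm" "!!x. \<bar>f x\<bar> <= d0" "!!x. \<bar>f' x\<bar> <= d1" "!!x. \<bar>f'' x\<bar> <= d2"
 shows "\<bar>LL g g' g'' f f' f'' \<nu>\<bar> <= b * (Ca * d2 * mass \<nu>) + c * (C\<rho> * d1\<^sup>2 * (mass \<nu>)\<^sup>2) + c * ((C\<sigma> + \<Gamma>) * d0\<^sup>2 * mass \<nu>)"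
proof -
 define z where "z = (LINT x|\<nu>. f x)"
 have c0: "0 <= c" using g(3)[of 0] by linarith
 have d: "0 <= d0" "0 <= d1" "0 <= d2" using f(4)[of 0] f(5)[of 0] f(6)[of 0] by linarith+
 have m0: "0 <= mass \<nu>" by simp
 have b0: "0 <= b" using b by linarith
 have 1: "\<bar>\<integral>x. a x * f'' x \<partial>\<nu>\<bar> <= Ca * d2 * mass \<nu>"
  by (intro fbm_integral_bound[OF \<nu>] Bm_mult a_Bm f(3)) (auto simp: abs_mult intro!: mult_mono a f(6) d bounds_nonneg)
 have "\<bar>\<rho> (fst q - snd q) * f' (fst q) * f' (snd q)\<bar> <= C\<rho> * d1\<^sup>2" for q
  unfolding abs_mult power2_eq_square mult.assoc
  by (intro mult_mono \<rho> f(5)) (auto intro: d bounds_nonneg)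
 then have 2: "\<bar>\<integral>z. \<rho> (fst z - snd z) * f' (fst z) * f' (snd z) \<partial>(\<nu> \<Otimes>\<^sub>M \<nu>)\<bar> <= C\<rho> * d1\<^sup>2 * (mass \<nu>)\<^sup>2"
  by (intro fbm_pair_bound[OF \<nu>] pair_term_Bm f(2))
 have "\<bar>\<sigma> x * f x * f x\<bar> <= C\<sigma> * d0\<^sup>2" for x
  unfolding abs_mult power2_eq_square mult.assoc
  by (intro mult_mono \<sigma> f(4)) (auto intro: d bounds_nonneg)
 then have 3: "\<bar>\<integral>x. \<sigma> x * f x * f x \<partial>\<nu>\<bar> <= C\<sigma> * d0\<^sup>2 * mass \<nu>"
  by (intro fbm_integral_bound[OF \<nu>] Bm_mult \<sigma>_Bm f(1))
 have 4: "\<bar>\<integral>x. (LINT \<xi>|\<gamma> x. jmp g g' z (f x) \<xi>) \<partial>\<nu>\<bar> <= c * d0\<^sup>2 * \<Gamma> * mass \<nu>"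
  by (intro fbm_integral_bound[OF \<nu>] jmp_Bm[OF g f(1,4)])
 have q1: "\<bar>g' z * (LINT x|\<nu>. a x * f'' x)\<bar> <= b * (Ca * d2 * mass \<nu>)"
  unfolding abs_mult using 1 b by (intro mult_mono) (auto simp: z_def intro: b0)
 have q2: "\<bar>g'' z * (LINT z|(\<nu> \<Otimes>\<^sub>M \<nu>). \<rho> (fst z - snd z) * f' (fst z) * f' (snd z))\<bar> <= c * (C\<rho> * d1\<^sup>2 * (mass \<nu>)\<^sup>2)"
  unfolding abs_mult using 2 g(3) by (intro mult_mono) (auto intro: c0)
 have q3: "\<bar>g'' z * (LINT x|\<nu>. \<sigma> x * f x * f x)\<bar> <= c * (C\<sigma> * d0\<^sup>2 * mass \<nu>)"
  unfolding abs_mult using 3 g(3) by (intro mult_mono) (auto intro: c0)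
 have nn: "0 <= b * (Ca * d2 * mass \<nu>)" "0 <= c * (C\<rho> * d1\<^sup>2 * (mass \<nu>)\<^sup>2)" "0 <= c * (C\<sigma> * d0\<^sup>2 * mass \<nu>)"
  using b0 c0 d bounds_nonneg by auto
 have "\<bar>LL g g' g'' f f' f'' \<nu>\<bar> <= b * (Ca * d2 * mass \<nu>) + c * (C\<rho> * d1\<^sup>2 * (mass \<nu>)\<^sup>2) + c * (C\<sigma> * d0\<^sup>2 * mass \<nu>)
   + c * d0\<^sup>2 * \<Gamma> * mass \<nu>"
  unfolding Lg_def z_def[symmetric] using q1 q2 q3 4 nn by (simp only: abs_le_iff) linarith
 then show ?thesis by (simp add: algebra_simps)
qed

text \<open>A bound on the second derivatives that is uniform in n dominates the jump integrands by
  c u^2 \<xi>^2, which is integrable; the outer integrals are then bounded by a constant.\<close>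

lemma Lg_limit:
 assumes \<nu>: "finite_borel_measure \<nu>"
  and G: "!!n z. (G n has_real_derivative G' n z) (at z)" "!!n z. (G' n has_real_derivative G'' n z) (at z)"
   "!!n z. \<bar>G'' n z\<bar> <= c"
  and lim: "!!z. (%n. G n z) \<longlonglongrightarrow> g z" "!!z. (%n. G' n z) \<longlonglongrightarrow> g' z" "!!z. (%n :: nat. G'' n z) \<longlonglongrightarrow> g'' z"
  and f: "C2cfun f f' f''"
 shows "(%n. LL (G n) (G' n) (G'' n) f f' f'' \<nu>) \<longlonglongrightarrow> LL g g' g'' f f' f'' \<nu>"
proof -
 define z where "z = (LINT x|\<nu>. f x)"
 note Bm = C2cfun_Bm[OF f]
 obtain D where D: "!!x. \<bar>f x\<bar> <= D" using C2cfun_bounds[OF f] by metis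
 have jl: "(%n. jmp (G n) (G' n) z u \<xi>) \<longlonglongrightarrow> jmp g g' z u \<xi>" for u \<xi>
  unfolding jmp_def by (intro tendsto_intros lim)
 have jm: "jmp (G n) (G' n) z u \<in> borel_measurable (\<gamma> x)" for n u x
  using jmp_integral_bound(1)[OF G(1,2,3)] by (rule borel_measurable_integrable)
 have inner: "(%n. \<integral>\<xi>. jmp (G n) (G' n) z u \<xi> \<partial>\<gamma> x) \<longlonglongrightarrow> (LINT \<xi>|\<gamma> x. jmp g g' z u \<xi>)" for u x
 proof (rule integral_dominated_convergence[where w = "%\<xi>. c * u\<^sup>2 * \<xi>\<^sup>2"])
  show "jmp g g' z u \<in> borel_measurable (\<gamma> x)"
   by (rule borel_measurable_LIMSEQ_real[where u = "%n. jmp (G n) (G' n) z u"]) (rule jl, rule jm)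
  show "integrable (\<gamma> x) (%\<xi>. c * u\<^sup>2 * \<xi>\<^sup>2)" using sq_integrable by simp
  show "AE \<xi> in \<gamma> x. norm (jmp (G n) (G' n) z u \<xi>) <= c * u\<^sup>2 * \<xi>\<^sup>2" for n
   using jmp_bound[OF G(1,2,3)] by simp
 qed (use jl jm in auto)
 have jB: "(%x. \<integral>\<xi>. jmp (G n) (G' n) z (f x) \<xi> \<partial>\<gamma> x) \<in> Bm" for n by (rule jmp_Bm(1)[OF G(1,2,3) Bm(1) D])
 have mm: "h \<in> borel_measurable \<nu>" if "h \<in> Bm" for h
  using Bm_measurable[OF that] by (simp add: measurable_cong_sets[OF fbm_sets[OF \<nu>] refl])
 have outer: "(%n. \<integral>x. (LINT \<xi>|\<gamma> x. jmp (G n) (G' n) z (f x) \<xi>) \<partial>\<nu>) \<longlonglongrightarrow> (LINT x|\<nu>. (LINT \<xi>|\<gamma> x. jmp g g' z (f x) \<xi>))"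
 proof (rule integral_dominated_convergence[where w = "%x. c * D\<^sup>2 * \<Gamma>"])
  show "(%x. \<integral>\<xi>. jmp g g' z (f x) \<xi> \<partial>\<gamma> x) \<in> borel_measurable \<nu>"
   by (rule borel_measurable_LIMSEQ_real[where u = "%n x. \<integral>\<xi>. jmp (G n) (G' n) z (f x) \<xi> \<partial>\<gamma> x"])
    (rule inner, rule mm[OF jB])
  show "integrable \<nu> (%x. c * D\<^sup>2 * \<Gamma>)" by (rule fbm_integrable[OF \<nu> Bm_const])
  show "AE x in \<nu>. norm (LINT \<xi>|\<gamma> x. jmp (G n) (G' n) z (f x) \<xi>) <= c * D\<^sup>2 * \<Gamma>" for n
   using jmp_Bm(2)[OF G(1,2,3) Bm(1) D] by simp
 qed (use inner mm[OF jB] in auto)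
 show ?thesis unfolding Lg_def z_def[symmetric] by (intro tendsto_intros lim outer)
qed

end

section \<open>Moment bounds for the martingale problem\<close>

locale sdsm = coefficients +
 fixes \<mu> :: "real measure" and Q :: "(real => real measure) measure"
 assumes \<mu>: "finite_borel_measure \<mu>" and Q: "SDSM a \<rho> \<sigma> \<gamma> \<mu> Q"
begin

sublocale prob_space Q using Q by (simp add: SDSM_def)

lemma sets_Q: "sets Q = sets (path_filt \<infinity>)" using Q by (simp add: SDSM_def)
lemma space_Q[simp]: "space Q = cadlag_paths" using sets_eq_imp_space_eq[OF sets_Q] by simp
lemma prob_paths[simp]: "prob cadlag_paths = 1" using prob_space by simp
lemma Q_init: "AE om in Q. om 0 = \<mu>" using Q by (simp add: SDSM_def)

lemma sub_Q: "subalgebra Q (path_filt t)"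
 unfolding subalgebra_def using path_filt_mono[of t \<infinity>] sets_Q by simp

lemma mkernel_at: "0 <= r ==> ennreal r <= t ==> mkernel (path_filt t) (%om. om r)"
 unfolding mkernel_def using path_filt_coord cadlag_fbm by auto

lemma mkernel_sub:
 assumes "mkernel (M \<Otimes>\<^sub>M path_filt t) X" shows "mkernel (M \<Otimes>\<^sub>M Q) X"
 unfolding mkernel_def
proof (intro conjI ballI)
 show "finite_borel_measure (X w)" if "w \<in> space (M \<Otimes>\<^sub>M Q)" for w
  using assms that by (auto simp: mkernel_def space_pair_measure)
 show "(%w. \<integral>x. f x \<partial>X w) \<in> borel_measurable (M \<Otimes>\<^sub>M Q)" if "f \<in> Cb UNIV" for f
  by (rule measurable_pair_subalgebra[OF sub_Q[of t]]) (use assms that in \<open>simp add: mkernel_def\<close>)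
qed

lemma mkernel_Q: "0 <= r ==> mkernel Q (%om. om r)"
 unfolding mkernel_def
proof (intro conjI ballI)
 assume r: "0 <= r"
 show "finite_borel_measure (om r)" if "om \<in> space Q" for om using that r by (auto intro: cadlag_fbm)
 show "(%om. \<integral>x. f x \<partial>om r) \<in> borel_measurable Q" if "f \<in> Cb UNIV" for f
  by (rule measurable_from_subalg[OF sub_Q[of \<infinity>]]) (use path_filt_coord[OF that r] in simp)
qed

lemma mkernel_joint: "0 <= T ==> mkernel (borel \<Otimes>\<^sub>M Q) (%z. snd z (clip T (fst z)))"
 by (rule mkernel_sub[OF mkernel_path])

definition V :: "real => (real => real measure) => real" where "V r om = (1 + mass (om r))\<^sup>2"

lemma V_ge: "1 <= V r om" "mass (om r) <= V r om" "(mass (om r))\<^sup>2 <= V r om"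
proof -
 have "V r om = 1 + 2 * mass (om r) + (mass (om r))\<^sup>2" by (simp add: V_def power2_eq_square algebra_simps)
 moreover have "0 <= mass (om r)" "0 <= (mass (om r))\<^sup>2" by auto
 ultimately show "1 <= V r om" "mass (om r) <= V r om" "(mass (om r))\<^sup>2 <= V r om" by linarith+
qed

text \<open>The martingale problem for one linear functional meets the axioms of soft stopping;
  boundedness of the mass on compact time intervals supplies the random bound on
  \<open>V\<close>.\<close>

lemma soft:
 assumes g: "C20fun g g' g''" and f: "C2cfun f f' f''" "!!x. 0 <= f x" and T: "0 <= T" and \<theta>: "0 < \<theta>"
  and B: "!!z. \<bar>g z\<bar> <= B" and C: "0 <= C" "!!\<nu>. finite_borel_measure \<nu> ==> \<bar>LL g g' g'' f f' f'' \<nu>\<bar> <= C * (1 + mass \<nu>)\<^sup>2"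
 shows "soft_martingale Q path_filt (%r om. g (LINT x|om r. f x)) (%r om. LL g g' g'' f f' f'' (om r)) V B C T \<theta>"
proof
 have d: "!!z. (g has_real_derivative g' z) (at z)" "!!z. (g' has_real_derivative g'' z) (at z)" "continuous_on UNIV g''"
  using g unfolding C20fun_def by blast+
 note fd = C2cfun_cont(4,5)[OF f(1)]
 show "subalgebra Q (path_filt t)" for t by (rule sub_Q)
 show "sets (path_filt s) \<subseteq> sets (path_filt t)" if "s <= t" for s t by (rule path_filt_mono[OF that])
 show "0 <= T" "0 < \<theta>" "0 <= C" by fact+
 show "0 <= B" using B[of 0] by linarith
 have [measurable]: "g \<in> borel_measurable borel"
  using deriv_cont[OF d(1)] by (auto intro: borel_measurable_continuous_onI)
 show "(%z. g (LINT x|snd z (clip s (fst z)). f x)) \<in> borel_measurable (borel \<Otimes>\<^sub>M path_filt (ennreal s))" if "0 <= s" for s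
  using mkernel_Bm[OF mkernel_path[OF that] C2cfun_Bm(1)[OF f(1)]] by measurable
 show "(%z. LL g g' g'' f f' f'' (snd z (clip s (fst z)))) \<in> borel_measurable (borel \<Otimes>\<^sub>M path_filt (ennreal s))" if "0 <= s" for s
  by (rule Lg_measurable[OF mkernel_path[OF that] d f(1)])
 show "(%z. V (clip s (fst z)) (snd z)) \<in> borel_measurable (borel \<Otimes>\<^sub>M path_filt (ennreal s))" if "0 <= s" for s
  using mkernel_mass[OF mkernel_path[OF that]] unfolding V_def by measurable
 show "\<bar>g (LINT x|om r. f x)\<bar> <= B" for r om by (rule B)
 show "0 <= V r om" for r om by (simp add: V_def)
 show "\<bar>LL g g' g'' f f' f'' (om r)\<bar> <= C * V r om" if "om \<in> space Q" "0 <= r" for r om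
  unfolding V_def using that by (intro C cadlag_fbm) auto
 show "\<exists>K. \<forall>r. 0 <= r \<and> r <= T \<longrightarrow> V r om <= K" if "om \<in> space Q" for om
 proof -
  have "om \<in> cadlag_paths" using that by simp
  then obtain K where K: "0 <= K" "!!s. 0 <= s ==> s <= T ==> mass (om s) <= K"
   by (rule cadlag_mass_bounded[of _ T]) blast
  then show ?thesis unfolding V_def by (intro exI[of _ "(1 + K)\<^sup>2"]) (auto intro!: power_mono add_nonneg_nonneg)
 qed
 have "local_martingale Q path_filt (%t om. cyl 1 (%v. g (v 0)) (%_. f) (om t) - cyl 1 (%v. g (v 0)) (%_. f) (om 0) -
     (LINT s:{0..t}|lborel. Lop a \<rho> \<sigma> \<gamma> 1 (%v. g (v 0)) (%_. f) (om s)))"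
 proof -
  have "\<forall>m f \<phi>. f \<in> C20 m \<and> (\<forall>i<m. \<phi> i \<in> nonneg (on_real (C2c 1))) \<longrightarrow>
    local_martingale Q path_filt (%t om. cyl m f \<phi> (om t) - cyl m f \<phi> (om 0) -
     (LINT s:{0..t}|lborel. Lop a \<rho> \<sigma> \<gamma> m f \<phi> (om s)))"
   using Q unfolding SDSM_def by simp
  from this[rule_format, of "%v. g (v 0)" 1 "%_. f"] show ?thesis
   using C20fun_C20[OF g] C2cfun_C2c[OF f] by simp
 qed
 then show "local_martingale Q path_filt (%t om. g (LINT x|om t. f x) - g (LINT x|om 0. f x) -
   (LINT r:{0..t}|lborel. LL g g' g'' f f' f'' (om r)))"
  by (simp del: One_nat_def add: Lop_eq_Lg[OF d(1,2) fd] cyl_def phivec_def)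
qed

text \<open>Agrees with \<open>A\<close> of \<open>soft_martingale\<close>, but without reference to
  a test function, so that all test functions share one damping.\<close>

definition AA :: "real => real => real => (real => real measure) => real" where
 "AA T \<theta> r om = clockA \<theta> (%u. V (clip T u) om) r"

lemma clock_V:
 assumes om: "om \<in> cadlag_paths" and T: "0 <= T" and \<theta>: "0 <= \<theta>"
 obtains K where "clock (%u. V (clip T u) om) K \<theta>" "1 <= K" "!!r. 0 <= r ==> r <= T ==> V r om <= K"
proof -
 obtain K where K: "0 <= K" "!!s. 0 <= s ==> s <= T ==> mass (om s) <= K"
  using cadlag_mass_bounded[OF om, of T] by auto
 have le: "V r om <= (1 + K)\<^sup>2" if "0 <= r" "r <= T" for r
  unfolding V_def using K(2)[OF that] by (auto intro!: power_mono add_nonneg_nonneg)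
 have "clock (%u. V (clip T u) om) ((1 + K)\<^sup>2) \<theta>"
 proof
  have "(%z. V (clip T (fst z)) (snd z)) \<in> borel_measurable (borel \<Otimes>\<^sub>M path_filt (ennreal T))"
   using mkernel_mass[OF mkernel_path[OF T]] unfolding V_def by measurable
  from measurable_compose[OF _ this, of "%u. (u, om)" borel]
  show "(%u. V (clip T u) om) \<in> borel_measurable borel" using om by simp
  show "0 <= V (clip T r) om" for r by (simp add: V_def)
  show "V (clip T r) om <= (1 + K)\<^sup>2" for r by (rule le[OF clip_nonneg clip_le[OF T]])
 qed fact
 then show thesis using le K(1) by (intro that[of "(1 + K)\<^sup>2"]) (auto simp: one_le_power)
qed

lemma V_meas: "0 <= T ==> (%z. V (clip T (fst z)) (snd z)) \<in> borel_measurable (borel \<Otimes>\<^sub>M Q)"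
 using mkernel_mass[OF mkernel_joint] unfolding V_def by measurable

lemma AA_meas[measurable]:
 assumes T: "0 <= T" shows "AA T \<theta> r \<in> borel_measurable Q"
proof -
 note prim_measurable_pair[OF V_meas[OF T], measurable]
 have "(%z. AA T \<theta> (fst z) (snd z)) \<in> borel_measurable (borel \<Otimes>\<^sub>M Q)"
  unfolding AA_def clockA_def by measurable
 from measurable_compose[OF _ this, of "%om. (r, om)" Q] show ?thesis by simp
qed

lemma AA_bounds: "om \<in> cadlag_paths ==> 0 <= T ==> 0 <= \<theta> ==> 0 < AA T \<theta> r om \<and> AA T \<theta> r om <= 1"
proof -
 assume *: "om \<in> cadlag_paths" "0 <= T" "0 <= \<theta>"
 obtain K where "clock (%u. V (clip T u) om) K \<theta>" using clock_V[OF *] by auto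
 then show ?thesis unfolding AA_def using clock.A_bd by blast
qed

lemma AA_0: "AA T \<theta> 0 om = 1"
proof -
 have "AE u in lborel. indicator {0..0::real} u *\<^sub>R V (clip T u) om = 0"
  using AE_lborel_singleton[of 0] by eventually_elim auto
 then have "(LINT u:{0..0}|lborel. V (clip T u) om) = 0"
  unfolding set_lebesgue_integral_def by (rule integral_eq_zero_AE)
 then show ?thesis by (simp add: AA_def clockA_def prim_def)
qed

text \<open>\<theta> V A is minus the derivative of a function with values in (0, 1]. The bound is
  uniform over paths although \<open>V\<close> is not.\<close>

lemma integral_V_A:
 assumes om: "om \<in> cadlag_paths" and t: "0 <= t" and \<theta>: "0 < \<theta>"
 shows "set_integrable lborel {0..t} (%r. V r om * AA t \<theta> r om)" "(LINT r:{0..t}|lborel. V r om * AA t \<theta> r om) <= 1 / \<theta>"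
proof -
 obtain K where "clock (%u. V (clip t u) om) K \<theta>" using clock_V[OF om t, of \<theta>] \<theta> by auto
 then interpret k: clock "%u. V (clip t u) om" K \<theta> .
 have eq: "indicator {0..t} r *\<^sub>R (V r om * AA t \<theta> r om) = 1 / \<theta> * (indicator {0..t} r *\<^sub>R (\<theta> * V (clip t r) om * k.A r))" for r
  using \<theta> by (auto simp: indicator_def AA_def clip_eq)
 show "set_integrable lborel {0..t} (%r. V r om * AA t \<theta> r om)"
  unfolding set_integrable_def eq using k.vA_int[of 0 t] unfolding set_integrable_def by (rule integrable_mult_right)
 have "(LINT r:{0..t}|lborel. V r om * AA t \<theta> r om) = 1 / \<theta> * (LINT r:{0..t}|lborel. \<theta> * V (clip t r) om * k.A r)"
  unfolding set_lebesgue_integral_def eq by (rule integral_mult_right_zero)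
 also have "\<dots> = 1 / \<theta> * (k.A 0 - k.A t)" using k.A_eq[OF order_refl t] by simp
 also have "\<dots> <= 1 / \<theta> * 1" using k.A_bd(1)[of t] k.A_bd(2)[of 0] \<theta> by (intro mult_left_mono) auto
 finally show "(LINT r:{0..t}|lborel. V r om * AA t \<theta> r om) <= 1 / \<theta>" by simp
qed


text \<open>Joint measurability is known for clamped times, and these coincide with the true times
  on \<open>{s..t}\<close>.\<close>

lemma LINT_Fubini:
 fixes h :: "real => (real => real measure) => real"
 assumes st: "0 <= s" "s <= t"
  and h: "(%z. h (clip t (fst z)) (snd z)) \<in> borel_measurable (borel \<Otimes>\<^sub>M Q)"
  and i: "!!r. 0 <= r ==> r <= t ==> integrable Q (h r)" "!!r. 0 <= r ==> r <= t ==> (LINT om|Q. \<bar>h r om\<bar>) <= M"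
 shows "integrable Q (%om. LINT r:{s..t}|lborel. h r om)"
  and "(LINT om|Q. (LINT r:{s..t}|lborel. h r om)) = (LINT r:{s..t}|lborel. (LINT om|Q. h r om))"
  and "set_integrable lborel {s..t} (%r. \<integral>om. h r om \<partial>Q)"
proof -
 interpret p: pair_sigma_finite lborel Q
  by (rule pair_sigma_finite.intro[OF sigma_finite_lborel sigma_finite_measure_axioms])
 define F where "F z = indicator {s..t} (fst z) * h (clip t (fst z)) (snd z)" for z
 have h': "(%z. h (clip t (fst z)) (snd z)) \<in> borel_measurable (lborel \<Otimes>\<^sub>M Q)"
  using h by (simp cong: measurable_cong_sets)
 have Fm[measurable]: "F \<in> borel_measurable (lborel \<Otimes>\<^sub>M Q)" unfolding F_def[abs_def] using h' by measurable
 have F: "F (r, om) = indicator {s..t} r *\<^sub>R h r om" for r om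
  using st by (auto simp: F_def indicator_def clip_eq)
 have int: "integrable (lborel \<Otimes>\<^sub>M Q) F"
 proof (rule p.Fubini_integrable[OF Fm])
  have "integrable lborel (%r. indicator {s..t} r * M)"
   by (rule integrable_mult_left) (auto intro!: integrable_real_indicator simp: emeasure_lborel_Icc_eq)
  then show "integrable lborel (%r. \<integral>om. norm (F (r, om)) \<partial>Q)"
  proof (rule Bochner_Integration.integrable_bound)
   have "(%z. norm (F z)) \<in> borel_measurable (lborel \<Otimes>\<^sub>M Q)" by measurable
   then have "(%(r, om). norm (F (r, om))) \<in> borel_measurable (lborel \<Otimes>\<^sub>M Q)" by (simp add: split_beta')
   from borel_measurable_lebesgue_integral[OF this]
   show "(%r. \<integral>om. norm (F (r, om)) \<partial>Q) \<in> borel_measurable lborel" .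
   show "AE r in lborel. norm (LINT om|Q. norm (F (r, om))) <= norm (indicator {s..t} r * M)"
    using i(2) st by (intro AE_I2) (auto simp: F indicator_def intro!: order_trans[OF _ abs_ge_self])
  qed
  show "AE r in lborel. integrable Q (%om. F (r, om))"
   using i(1) st by (intro AE_I2) (auto simp: F indicator_def)
 qed
 then have int': "integrable (lborel \<Otimes>\<^sub>M Q) (%(r, om). F (r, om))" by (simp add: split_beta')
 show "integrable Q (%om. LINT r:{s..t}|lborel. h r om)"
  using p.integrable_snd[OF int'] by (simp add: F set_lebesgue_integral_def)
 have e: "(LINT om|Q. F (r, om)) = indicator {s..t} r *\<^sub>R (LINT om|Q. h r om)" for r by (simp add: F)
 show "(LINT om|Q. (LINT r:{s..t}|lborel. h r om)) = (LINT r:{s..t}|lborel. (LINT om|Q. h r om))"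
  using p.Fubini_integral[OF int'] unfolding e by (simp add: F set_lebesgue_integral_def)
 show "set_integrable lborel {s..t} (%r. \<integral>om. h r om \<partial>Q)"
  using p.integrable_fst[OF int'] unfolding e set_integrable_def .
qed

text \<open>For g \<ge> 0 the damping drift has a favourable sign and is dropped. A drift bound c1 V
  costs c1/\<theta> by \<open>integral_V_A\<close>; a part c2 times the mass is charged to a known
  bound \<open>m0\<close> on the mean mass. The alternative \<open>c2 = 0\<close> lets the same
  inequality produce that first bound.\<close>

lemma key_ineq:
 assumes g: "C20fun g g' g''" and f: "C2cfun f f' f''" "!!x. 0 <= f x" and t: "0 <= t" and \<theta>: "0 < \<theta>"
  and B: "!!z. \<bar>g z\<bar> <= B" and C: "0 <= C" "!!\<nu>. finite_borel_measure \<nu> ==> \<bar>LL g g' g'' f f' f'' \<nu>\<bar> <= C * (1 + mass \<nu>)\<^sup>2"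
  and gnn: "!!z. 0 <= z ==> 0 <= g z"
  and c: "0 <= c1" "0 <= c2" "!!\<nu>. finite_borel_measure \<nu> ==> LL g g' g'' f f' f'' \<nu> <= c1 * (1 + mass \<nu>)\<^sup>2 + c2 * mass \<nu>"
  and m0: "c2 = 0 \<or> (\<forall>r. 0 <= r \<and> r <= t \<longrightarrow> integrable Q (%om. mass (om r)) \<and> (LINT om|Q. mass (om r)) <= m0)" "0 <= m0"
 shows "integrable Q (%om. g (LINT x|om t. f x) * AA t \<theta> t om)"
  and "(LINT om|Q. g (LINT x|om t. f x) * AA t \<theta> t om) <= g (LINT x|\<mu>. f x) + c1 / \<theta> + c2 * (m0 * t)"
proof -
 interpret S: soft_martingale Q path_filt "%r om. g (LINT x|om r. f x)" "%r om. LL g g' g'' f f' f'' (om r)" V B C t \<theta>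
  by (rule soft[OF g f t \<theta> B C])
 have A: "S.A = AA t \<theta>" by (intro ext) (simp add: S.A_def AA_def S.v_def[abs_def])
 define W where "W om = (LINT r:{0..t}|lborel. (LL g g' g'' f f' f'' (om r) - \<theta> * g (LINT x|om r. f x) * V r om) * AA t \<theta> r om)" for om
 have W_int: "integrable Q W"
  by (rule integrable_const_bound[where B = "C / \<theta> + B"])
   (use S.soft_stopping(2)[OF order_refl t order_refl, of "%_. 1" 1] S.soft_stopping(3)[OF order_refl t order_refl, of "%_. 1" 1] 
    in \<open>auto simp: W_def[abs_def] A intro!: AE_I2\<close>)
 have eq: "(LINT om|Q. g (LINT x|om t. f x) * AA t \<theta> t om - g (LINT x|om 0. f x) * AA t \<theta> 0 om) = (LINT om|Q. W om)"
  using S.soft_stopping(1)[OF order_refl t order_refl, of "%_. 1" 1] by (simp add: W_def A)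
 have [measurable]: "g \<in> borel_measurable borel"
  using g unfolding C20fun_def by (intro borel_measurable_continuous_onI deriv_cont) blast
 have zm[measurable]: "(%om. \<integral>x. f x \<partial>om r) \<in> borel_measurable Q" if "0 <= r" for r
  by (rule mkernel_Bm[OF mkernel_Q[OF that] C2cfun_Bm(1)[OF f(1)]])
 note AA_meas[OF t, measurable]
 have I: "integrable Q (%om. g (LINT x|om r. f x) * AA t \<theta> r om)" if "0 <= r" for r
 proof (rule integrable_const_bound[where B = B])
  show "AE om in Q. norm (g (LINT x|om r. f x) * AA t \<theta> r om) <= B"
  proof (rule AE_I2)
   fix om assume "om \<in> space Q"
   then have "0 < AA t \<theta> r om" "AA t \<theta> r om <= 1" using AA_bounds[of om t \<theta> r] t \<theta> by auto
   then have "\<bar>g (LINT x|om r. f x)\<bar> * AA t \<theta> r om <= B * 1" using B order_trans[OF abs_ge_zero B] by (intro mult_mono) auto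
   then show "norm (g (LINT x|om r. f x) * AA t \<theta> r om) <= B" using \<open>0 < AA t \<theta> r om\<close> by (simp add: abs_mult)
  qed
 qed (use zm[OF that] in measurable)
 show "integrable Q (%om. g (LINT x|om t. f x) * AA t \<theta> t om)" by (rule I[OF t])
 have "(LINT om|Q. g (LINT x|om 0. f x) * AA t \<theta> 0 om) = (LINT om|Q. g (LINT x|\<mu>. f x))"
  using Q_init I[of 0] by (intro integral_cong_AE) (auto simp: AA_0)
 then have 0: "(LINT om|Q. g (LINT x|om 0. f x) * AA t \<theta> 0 om) = g (LINT x|\<mu>. f x)" by (simp add: prob_space)
 define J where "J om = (LINT r:{0..t}|lborel. mass (om r))" for om
 have massj: "(%z. mass (snd z (clip t (fst z)))) \<in> borel_measurable (borel \<Otimes>\<^sub>M Q)"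
  by (rule mkernel_mass[OF mkernel_joint[OF t]])
 have path: "W om <= c1 / \<theta> + c2 * J om" if om: "om \<in> space Q" for om
 proof -
  have omc: "om \<in> cadlag_paths" using om by simp
  obtain K where K: "clock (%u. V (clip t u) om) K \<theta>" "!!r. 0 <= r ==> r <= t ==> V r om <= K"
   using clock_V[OF omc t, of \<theta>] \<theta> by auto
  interpret k: clock "%u. V (clip t u) om" K \<theta> by fact
  have mb: "set_integrable lborel {0..t} (%r. mass (om (clip t r)))"
  proof (rule set_integrable_bounded[where K = K])
   show "(%r. mass (om (clip t r))) \<in> borel_measurable borel"
    using measurable_compose[OF _ massj, of "%u. (u, om)" borel] om by simp
   show "\<bar>mass (om (clip t r))\<bar> <= K" for r
    using V_ge(2)[of om "clip t r"] K(2)[OF clip_nonneg clip_le[OF t], of r] by simp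
  qed
  have "set_integrable lborel {0..t} (%r. mass (om r))"
   using mb unfolding set_integrable_def
   by (rule Bochner_Integration.integrable_cong[THEN iffD1, rotated 2]) (auto simp: indicator_def clip_eq)
  note i1 = this and i2 = integral_V_A[OF omc t \<theta>]
  have i3: "set_integrable lborel {0..t} (%r. c1 * (V r om * AA t \<theta> r om) + c2 * mass (om r))"
   using i1 i2(1) by (intro set_integral_add(1) set_integrable_mult_right)
  have eq': "(LINT r:{0..t}|lborel. c1 * (V r om * AA t \<theta> r om) + c2 * mass (om r))
    = c1 * (LINT r:{0..t}|lborel. V r om * AA t \<theta> r om) + c2 * J om"
   using i1 i2(1) by (subst set_integral_add(2)) (auto simp: J_def intro!: set_integrable_mult_right)
  have "W om <= (LINT r:{0..t}|lborel. c1 * (V r om * AA t \<theta> r om) + c2 * mass (om r))"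
  proof (cases "set_integrable lborel {0..t} (%r. (LL g g' g'' f f' f'' (om r) - \<theta> * g (LINT x|om r. f x) * V r om) * AA t \<theta> r om)")
   case True
   show ?thesis unfolding W_def
   proof (rule set_integral_mono[OF True i3])
    fix r assume r: "r \<in> {0..t}"
    have fb: "finite_borel_measure (om r)" using r by (intro cadlag_fbm[OF omc]) auto
    have a: "0 < AA t \<theta> r om" "AA t \<theta> r om <= 1" using AA_bounds[OF omc t, of \<theta> r] \<theta> by auto
    have "0 <= \<theta> * g (LINT x|om r. f x) * V r om"
     using \<theta> f(2) by (intro mult_nonneg_nonneg gnn) (auto simp: V_def)
    then have "LL g g' g'' f f' f'' (om r) - \<theta> * g (LINT x|om r. f x) * V r om <= c1 * V r om + c2 * mass (om r)"
     using c(3)[OF fb] by (simp add: V_def)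
    then have "(LL g g' g'' f f' f'' (om r) - \<theta> * g (LINT x|om r. f x) * V r om) * AA t \<theta> r om
      <= (c1 * V r om + c2 * mass (om r)) * AA t \<theta> r om"
     using a by (intro mult_right_mono) auto
    also have "\<dots> = c1 * (V r om * AA t \<theta> r om) + c2 * mass (om r) * AA t \<theta> r om" by (simp add: algebra_simps)
    also have "c2 * mass (om r) * AA t \<theta> r om <= c2 * mass (om r) * 1" using a c by (intro mult_left_mono) auto
    finally show "(LL g g' g'' f f' f'' (om r) - \<theta> * g (LINT x|om r. f x) * V r om) * AA t \<theta> r om
      <= c1 * (V r om * AA t \<theta> r om) + c2 * mass (om r)" by simp
   qed
  next
   \<comment> \<open>A non-integrable integrand has integral 0 by convention, and the right-hand
     side is nonnegative.\<close>
   case False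
   then have "W om = 0" unfolding W_def set_integrable_def set_lebesgue_integral_def by (rule not_integrable_integral_eq)
   moreover have "0 <= (LINT r:{0..t}|lborel. c1 * (V r om * AA t \<theta> r om) + c2 * mass (om r))"
    unfolding set_lebesgue_integral_def
   proof (rule Bochner_Integration.integral_nonneg)
    fix r
    have "0 <= AA t \<theta> r om" using AA_bounds[OF omc t, of \<theta> r] \<theta> by simp
    then show "0 <= indicator {0..t} r *\<^sub>R (c1 * (V r om * AA t \<theta> r om) + c2 * mass (om r))"
     using c by (simp add: V_def)
   qed
   ultimately show ?thesis by simp
  qed
  also note eq'
  also have "c1 * (LINT r:{0..t}|lborel. V r om * AA t \<theta> r om) <= c1 * (1 / \<theta>)" by (intro mult_left_mono i2(2) c)
  finally show ?thesis by simp
 qed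
 have "(LINT om|Q. W om) <= c1 / \<theta> + c2 * (m0 * t)"
 proof (cases "c2 = 0")
  case True
  then have "(LINT om|Q. W om) <= (LINT om|Q. c1 / \<theta>)" using path by (intro integral_mono W_int) auto
  then show ?thesis using True by (simp add: prob_space)
 next
  case False
  then have m: "!!r. 0 <= r ==> r <= t ==> integrable Q (%om. mass (om r))" "!!r. 0 <= r ==> r <= t ==> (LINT om|Q. mass (om r)) <= m0"
   using m0 by auto
  have J: "integrable Q J" "(LINT om|Q. J om) = (LINT r:{0..t}|lborel. (LINT om|Q. mass (om r)))"
   "set_integrable lborel {0..t} (%r. \<integral>om. mass (om r) \<partial>Q)"
   unfolding J_def[abs_def] using LINT_Fubini[OF order_refl t massj, where M = m0] m by auto
  have "(LINT om|Q. J om) <= m0 * (t - 0)"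
   unfolding J(2) using set_integral_bound_Icc[OF J(3) _ t, of m0] m(2) by simp
  moreover have "(LINT om|Q. W om) <= (LINT om|Q. c1 / \<theta> + c2 * J om)" using path J by (intro integral_mono W_int) auto
  ultimately show ?thesis using J(1) c mult_left_mono[of "\<integral>om. J om \<partial>Q" "m0 * t" c2] by (simp add: prob_space)
 qed
 moreover have "(LINT om|Q. g (LINT x|om t. f x) * AA t \<theta> t om - g (LINT x|om 0. f x) * AA t \<theta> 0 om)
   = (LINT om|Q. g (LINT x|om t. f x) * AA t \<theta> t om) - (LINT om|Q. g (LINT x|om 0. f x) * AA t \<theta> 0 om)"
  using I[OF t] I[of 0] by simp
 ultimately show "(LINT om|Q. g (LINT x|om t. f x) * AA t \<theta> t om) <= g (LINT x|\<mu>. f x) + c1 / \<theta> + c2 * (m0 * t)"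
  using eq 0 by linarith
qed

end

text \<open>Fatou's lemma instead of dominated convergence: integrability of the limit is a
  conclusion here, so no dominating function is at hand.\<close>

lemma fatou_real:
 fixes X :: "nat => 'w => real"
 assumes X: "!!j. integrable Q (X j)" "!!j om. om \<in> space Q ==> 0 <= X j om"
  and lim: "!!om. om \<in> space Q ==> (%j. X j om) \<longlonglongrightarrow> Z om" and Mj: "!!j. (LINT om|Q. X j om) <= M j" "M \<longlonglongrightarrow> m"
 shows "integrable Q Z" "(LINT om|Q. Z om) <= m"
proof -
 have Z0: "0 <= Z om" if "om \<in> space Q" for om
  using LIMSEQ_le_const[OF lim[OF that], of 0] X(2)[OF that] by auto
 have Zm[measurable]: "Z \<in> borel_measurable Q"
  by (rule borel_measurable_LIMSEQ_real[OF lim]) (use X(1) in auto)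
 have M0: "0 <= M j" for j
 proof -
  have "0 <= (LINT om|Q. X j om)" by (rule Bochner_Integration.integral_nonneg) (rule X(2))
  then show ?thesis using Mj(1)[of j] by linarith
 qed
 have "(\<integral>\<^sup>+om. ennreal (Z om) \<partial>Q) = (\<integral>\<^sup>+om. liminf (%j. ennreal (X j om)) \<partial>Q)"
 proof (rule nn_integral_cong)
  fix om assume "om \<in> space Q"
  then have "(%j. ennreal (X j om)) \<longlonglongrightarrow> ennreal (Z om)" by (intro tendsto_ennrealI lim)
  then show "ennreal (Z om) = liminf (%j. ennreal (X j om))" by (simp add: lim_imp_Liminf)
 qed
 also have "\<dots> <= liminf (%j. \<integral>\<^sup>+om. ennreal (X j om) \<partial>Q)"
  by (rule nn_integral_liminf) (use X(1) in auto)
 also have "\<dots> <= liminf (%j. ennreal (M j))"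
 proof (rule Liminf_mono, rule always_eventually, rule allI)
  fix j
  have "(\<integral>\<^sup>+om. ennreal (X j om) \<partial>Q) = ennreal (LINT om|Q. X j om)"
   by (rule nn_integral_eq_integral[OF X(1)]) (use X(2) in auto)
  then show "(\<integral>\<^sup>+om. ennreal (X j om) \<partial>Q) <= ennreal (M j)" using Mj(1) by (simp add: ennreal_leI)
 qed
 also have "\<dots> = ennreal m"
  by (rule lim_imp_Liminf) (auto intro!: tendsto_ennrealI Mj(2))
 finally have le: "(\<integral>\<^sup>+om. ennreal (Z om) \<partial>Q) <= ennreal m" .
 show i: "integrable Q Z"
 proof (rule integrableI_nonneg)
  show "(\<integral>\<^sup>+om. ennreal (Z om) \<partial>Q) < \<infinity>" using le by (simp add: order_le_less_trans)
 qed (use Z0 in auto)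
 have "0 <= m" by (rule LIMSEQ_le_const[OF Mj(2)]) (use M0 in auto)
 moreover have "ennreal (LINT om|Q. Z om) <= ennreal m"
  using le nn_integral_eq_integral[OF i] Z0 by simp
 ultimately show "(LINT om|Q. Z om) <= m" by (simp add: ennreal_le_iff)
qed

text \<open>The truncation level. With damping \<theta> = 1/(j + 1), an error K/(NN j) divided by
  \<theta> is K/(j + 1) and still vanishes.\<close>

definition NN :: "nat => real" where "NN j = (real j + 1)\<^sup>2"
text \<open>Bumps of half-width \<open>NN j\<close> that increase to the constant 1; the inert
  factor and summand match the form of \<open>C2cfun_affine\<close>.\<close>

definition bmp :: "nat => real => real" where "bmp j = (%x. 1 * bump (1 / NN j * x + 0))"
definition bmp' :: "nat => real => real" where "bmp' j = (%x. 1 * (1 / NN j) * bump' (1 / NN j * x + 0))"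
definition bmp'' :: "nat => real => real" where "bmp'' j = (%x. 1 * (1 / NN j)\<^sup>2 * bump'' (1 / NN j * x + 0))"

lemma NN_ge: "1 <= NN j" unfolding NN_def by (simp add: one_le_power)

lemma NN_lim: "(%j. x / NN j) \<longlonglongrightarrow> 0"
proof -
 have "(%j. x * (inverse (real (Suc j)) * inverse (real (Suc j)))) \<longlonglongrightarrow> x * (0 * 0)"
  by (intro tendsto_intros LIMSEQ_inverse_real_of_nat)
 then show ?thesis by (simp add: NN_def power2_eq_square divide_inverse add.commute)
qed

lemma C2cfun_bmp: "C2cfun (bmp j) (bmp' j) (bmp'' j)"
 unfolding bmp_def bmp'_def bmp''_def by (rule C2cfun_affine[OF C2cfun_bump]) (use NN_ge[of j] in auto)

lemma bmp_range: "0 <= bmp j x" "bmp j x <= 1"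
 unfolding bmp_def using bump_range by auto

lemma bmp_lim: "(%j. bmp j x) \<longlonglongrightarrow> 1"
proof -
 have "isCont bump 0" using C2cfun_cont(4)[OF C2cfun_bump] by (rule DERIV_isCont)
 then have "(%j. bump (x / NN j)) \<longlonglongrightarrow> bump 0"
  by (rule isCont_tendsto_compose) (rule NN_lim)
 then show ?thesis by (simp add: bmp_def bump_def)
qed

lemma bmp_bounds:
 obtains D where "1 <= D" "!!j x. \<bar>bmp' j x\<bar> <= D / NN j" "!!j x. \<bar>bmp'' j x\<bar> <= D / (NN j)\<^sup>2"
proof -
 obtain D where D: "0 <= D" "!!x. \<bar>bump' x\<bar> <= D" "!!x. \<bar>bump'' x\<bar> <= D" using C2cfun_bounds[OF C2cfun_bump] by metis
 show thesis
 proof (rule that[of "max 1 D"])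
  show "\<bar>bmp' j x\<bar> <= max 1 D / NN j" "\<bar>bmp'' j x\<bar> <= max 1 D / (NN j)\<^sup>2" for j x
   using NN_ge[of j] D(2,3)[of "1 / NN j * x + 0"]
   by (auto simp: bmp'_def bmp''_def abs_mult power_divide divide_right_mono le_max_iff_disj)
 qed auto
qed

lemma bmp_integral_lim:
 assumes \<nu>: "finite_borel_measure \<nu>"
 shows "(%j. \<integral>x. bmp j x \<partial>\<nu>) \<longlonglongrightarrow> mass \<nu>" "0 <= (LINT x|\<nu>. bmp j x)" "(LINT x|\<nu>. bmp j x) <= mass \<nu>"
proof -
 have B: "bmp j \<in> Bm" for j using Chat_Bm[OF C2cfun_Chat(1)[OF C2cfun_bmp]] .
 have "(%j. \<integral>x. bmp j x \<partial>\<nu>) \<longlonglongrightarrow> (LINT x|\<nu>. 1)"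
 proof (rule integral_dominated_convergence[where w = "%x. 1"])
  show "bmp j \<in> borel_measurable \<nu>" for j using fbm_integrable[OF \<nu> B] by auto
  show "integrable \<nu> (%x. 1 :: real)" by (rule fbm_integrable[OF \<nu> Bm_const])
 qed (use bmp_lim bmp_range in auto)
 then show "(%j. \<integral>x. bmp j x \<partial>\<nu>) \<longlonglongrightarrow> mass \<nu>" using fbm_integral_1[OF \<nu>, of 1] by simp
 show "0 <= (LINT x|\<nu>. bmp j x)" using bmp_range by simp
 show "(LINT x|\<nu>. bmp j x) <= mass \<nu>"
 proof -
  have "\<bar>\<integral>x. bmp j x \<partial>\<nu>\<bar> <= 1 * mass \<nu>"
   by (rule fbm_integral_bound[OF \<nu> B]) (simp add: bmp_range)
  then show ?thesis by simp
 qed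
qed

lemma rec_lim: "z \<longlonglongrightarrow> m ==> (%j. rec (z j / NN j)) \<longlonglongrightarrow> 1"
proof -
 assume "z \<longlonglongrightarrow> m"
 then have "(%j. z j * (1 / NN j)) \<longlonglongrightarrow> m * 0" by (intro tendsto_mult NN_lim)
 then have "(%j. z j / NN j) \<longlonglongrightarrow> 0" by simp
 moreover have "isCont rec 0" using rec_DERIV by (rule DERIV_isCont)
 ultimately have "(%j. rec (z j / NN j)) \<longlonglongrightarrow> rec 0" using isCont_tendsto_compose by blast
 then show ?thesis by (simp add: rec_def)
qed

lemma Gid_lim: "z \<longlonglongrightarrow> m ==> (%j. NN j * Gid (z j / NN j)) \<longlonglongrightarrow> m"
proof -
 assume z: "z \<longlonglongrightarrow> m"
 have "(%j. z j * (rec (z j / NN j))\<^sup>2) \<longlonglongrightarrow> m * 1\<^sup>2" by (intro tendsto_intros rec_lim[OF z] z)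
 moreover have "NN j \<noteq> 0" for j using NN_ge[of j] by auto
 ultimately show ?thesis by (simp add: Gid_def)
qed

lemma Gsq_alt: "Gsq w = w\<^sup>2 * rec w"
 using rec_mult[of w] by (simp add: Gsq_def algebra_simps)

lemma Gsq_lim: "z \<longlonglongrightarrow> m ==> (%j. (NN j)\<^sup>2 * Gsq (z j / NN j)) \<longlonglongrightarrow> m\<^sup>2"
proof -
 assume z: "z \<longlonglongrightarrow> m"
 have "(%j. (z j)\<^sup>2 * rec (z j / NN j)) \<longlonglongrightarrow> m\<^sup>2 * 1" by (intro tendsto_intros rec_lim[OF z] z)
 moreover have "NN j \<noteq> 0" for j using NN_ge[of j] by auto
 ultimately show ?thesis by (simp add: Gsq_alt power_divide)
qed

lemma rec2_le: "(rec w)\<^sup>2 <= 1"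
 using rec_bounds(1)[of w] rec_pos[of w] by (intro power_le_one) auto

context sdsm
begin

lemma AA_lim:
 assumes "\<theta> \<longlonglongrightarrow> 0" shows "(%j. AA t (\<theta> j) r om) \<longlonglongrightarrow> 1"
proof -
 have "(%j. exp (- \<theta> j * prim (%u. V (clip t u) om) r)) \<longlonglongrightarrow> exp (- 0 * prim (%u. V (clip t u) om) r)"
  by (intro tendsto_intros assms)
 then show ?thesis by (simp add: AA_def clockA_def)
qed

lemma theta_lim: "(%j. 1 / (real j + 1)) \<longlonglongrightarrow> 0"
 using LIMSEQ_inverse_real_of_nat by (simp add: divide_inverse add.commute)

lemma V_mass: "finite_borel_measure \<nu> ==> mass \<nu> <= (1 + mass \<nu>)\<^sup>2" "(mass \<nu>)\<^sup>2 <= (1 + mass \<nu>)\<^sup>2"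
proof -
 have "(1 + mass \<nu>)\<^sup>2 = 1 + 2 * mass \<nu> + (mass \<nu>)\<^sup>2" by (simp add: power2_eq_square algebra_simps)
 moreover have "0 <= mass \<nu>" "0 <= (mass \<nu>)\<^sup>2" by auto
 ultimately show "mass \<nu> <= (1 + mass \<nu>)\<^sup>2" "(mass \<nu>)\<^sup>2 <= (1 + mass \<nu>)\<^sup>2" by linarith+
qed

text \<open>With \<open>bmp j\<close> as test function and \<open>g\<close> a truncated identity
  every term of the generator is O(1/NN j): through the derivatives of the bump in the motion terms,
  through \<open>g''\<close> in the branching terms. Nothing survives in the limit, so the mean mass
  does not grow.\<close>

lemma mass_first:
 assumes t: "0 <= t"
 shows "integrable Q (%om. mass (om t))" "(LINT om|Q. mass (om t)) <= mass \<mu>"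
proof -
 obtain D where D: "1 <= D" "!!j x. \<bar>bmp' j x\<bar> <= D / NN j" "!!j x. \<bar>bmp'' j x\<bar> <= D / (NN j)\<^sup>2" using bmp_bounds by metis
 \<comment> \<open>5 and 36 bound \<open>Gid'\<close> and \<open>Gid''\<close>, and \<open>D\<close>
   the scaled derivatives of the bump.\<close>
 define K1 where "K1 = 5 * (Ca * D) + 36 * (C\<rho> * D\<^sup>2) + 36 * (C\<sigma> + \<Gamma>)"
 have K1: "0 <= K1" unfolding K1_def using bounds_nonneg \<Gamma> D by (intro add_nonneg_nonneg mult_nonneg_nonneg) auto
 define g where "g j = (%z. NN j * Gid (z / NN j))" for j
 define g' where "g' j = (%z. NN j / NN j * Gid' (z / NN j))" for j
 define g'' where "g'' j = (%z. NN j / (NN j)\<^sup>2 * Gid'' (z / NN j))" for j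
 have gC: "C20fun (g j) (g' j) (g'' j)" for j
  unfolding g_def g'_def g''_def by (rule C20fun_scale[OF C20fun_G(1) NN_ge])
 have gd: "((g j) has_real_derivative g' j z) (at z)" "((g' j) has_real_derivative g'' j z) (at z)" for j z
  using gC[of j] unfolding C20fun_def by blast+
 have Np: "0 < NN j" for j using NN_ge[of j] by linarith
 have gb: "\<bar>g j z\<bar> <= NN j" "\<bar>g' j z\<bar> <= 5" "\<bar>g'' j z\<bar> <= 36 / NN j" "\<bar>g j z\<bar> <= \<bar>z\<bar>" for j z
 proof -
  note b = G_bounds[of "z / NN j"] and r = rec_bounds(1)[of "z / NN j"] rec2_le[of "z / NN j"]
  show "\<bar>g j z\<bar> <= NN j" using b(9) r Np[of j] mult_left_mono[of "\<bar>Gid (z / NN j)\<bar>" 1 "NN j"] by (simp add: g_def abs_mult)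
  show "\<bar>g' j z\<bar> <= 5" using b(1) r Np[of j] by (simp add: g'_def)
  have "\<bar>Gid'' (z / NN j)\<bar> <= 36" using b(2) r by linarith
  then show "\<bar>g'' j z\<bar> <= 36 / NN j"
   using Np[of j] by (simp add: g''_def abs_mult power2_eq_square divide_right_mono)
  have "NN j * \<bar>Gid (z / NN j)\<bar> <= NN j * \<bar>z / NN j\<bar>" using b(6) Np[of j] by (intro mult_left_mono) auto
  then show "\<bar>g j z\<bar> <= \<bar>z\<bar>" using Np[of j] by (simp add: g_def abs_mult)
 qed
 have Lb: "\<bar>LL (g j) (g' j) (g'' j) (bmp j) (bmp' j) (bmp'' j) \<nu>\<bar> <= K1 / NN j * (1 + mass \<nu>)\<^sup>2" if \<nu>: "finite_borel_measure \<nu>" for j \<nu>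
 proof -
  have d2: "\<bar>bmp'' j x\<bar> <= D / NN j" for x
  proof -
   have "D / (NN j)\<^sup>2 <= D / NN j" using D NN_ge[of j] by (intro divide_left_mono) (auto simp: power2_eq_square)
   then show ?thesis using D(3)[of j x] by linarith
  qed
  have d0: "\<bar>bmp j x\<bar> <= 1" for x using bmp_range[of j x] by simp
  have "\<bar>LL (g j) (g' j) (g'' j) (bmp j) (bmp' j) (bmp'' j) \<nu>\<bar> <= 5 * (Ca * (D / NN j) * mass \<nu>)
    + 36 / NN j * (C\<rho> * (D / NN j)\<^sup>2 * (mass \<nu>)\<^sup>2) + 36 / NN j * ((C\<sigma> + \<Gamma>) * 1\<^sup>2 * mass \<nu>)"
   by (rule Lg_bound[OF \<nu> gd gb(3) gb(2) C2cfun_Bm[OF C2cfun_bmp] d0 D(2) d2])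
  also have "5 * (Ca * (D / NN j) * mass \<nu>) <= 5 * (Ca * D) / NN j * (1 + mass \<nu>)\<^sup>2"
   using mult_left_mono[OF V_mass(1)[OF \<nu>], of "5 * (Ca * D) / NN j"] bounds_nonneg D Np[of j] by simp
  also have "36 / NN j * (C\<rho> * (D / NN j)\<^sup>2 * (mass \<nu>)\<^sup>2) <= 36 * (C\<rho> * D\<^sup>2) / NN j * (1 + mass \<nu>)\<^sup>2"
  proof -
   have "(D / NN j)\<^sup>2 <= D\<^sup>2" using D NN_ge[of j] by (intro power_mono) (auto simp: divide_le_eq mult_le_cancel_left1)
   then have "36 / NN j * (C\<rho> * (D / NN j)\<^sup>2 * (mass \<nu>)\<^sup>2) <= 36 / NN j * (C\<rho> * D\<^sup>2 * (1 + mass \<nu>)\<^sup>2)"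
    using bounds_nonneg Np[of j] V_mass(2)[of \<nu>] by (intro mult_left_mono mult_mono) auto
   then show ?thesis by simp
  qed
  also have "36 / NN j * ((C\<sigma> + \<Gamma>) * 1\<^sup>2 * mass \<nu>) <= 36 * (C\<sigma> + \<Gamma>) / NN j * (1 + mass \<nu>)\<^sup>2"
  proof -
   have "36 / NN j * ((C\<sigma> + \<Gamma>) * 1\<^sup>2 * mass \<nu>) = 36 * (C\<sigma> + \<Gamma>) / NN j * mass \<nu>"
    by (simp only: power_one mult_1_right times_divide_eq_left times_divide_eq_right mult.assoc)
   also have "\<dots> <= 36 * (C\<sigma> + \<Gamma>) / NN j * (1 + mass \<nu>)\<^sup>2"
    using bounds_nonneg \<Gamma> Np[of j] by (intro mult_left_mono V_mass(1) \<nu>) auto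
   finally show ?thesis .
  qed
  also have "5 * (Ca * D) / NN j * (1 + mass \<nu>)\<^sup>2 + 36 * (C\<rho> * D\<^sup>2) / NN j * (1 + mass \<nu>)\<^sup>2
    + 36 * (C\<sigma> + \<Gamma>) / NN j * (1 + mass \<nu>)\<^sup>2 = K1 / NN j * (1 + mass \<nu>)\<^sup>2"
   unfolding K1_def by (simp add: add_divide_distrib distrib_right)
  finally show ?thesis by simp
 qed
 have gnn: "0 <= g j z" if "0 <= z" for j z using that Np[of j] unfolding g_def Gid_def by simp
 have key: "integrable Q (%om. g j (LINT x|om t. bmp j x) * AA t (1 / (real j + 1)) t om)"
   "(LINT om|Q. g j (LINT x|om t. bmp j x) * AA t (1 / (real j + 1)) t om) <= mass \<mu> + K1 / (real j + 1)" for j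
 proof -
  have c1: "0 <= K1 / NN j" using K1 Np[of j] by simp
  have up: "LL (g j) (g' j) (g'' j) (bmp j) (bmp' j) (bmp'' j) \<nu> <= K1 / NN j * (1 + mass \<nu>)\<^sup>2 + 0 * mass \<nu>"
   if "finite_borel_measure \<nu>" for \<nu> using Lb[OF that, of j] by (simp add: abs_le_iff)
  have th: "0 < 1 / (real j + 1)" by simp
  have mm: "(0::real) = 0 \<or> (\<forall>r. 0 <= r \<and> r <= t \<longrightarrow> integrable Q (%om. mass (om r)) \<and> (LINT om|Q. mass (om r)) <= 0)"
   by simp
  note k = key_ineq[OF gC[of j] C2cfun_bmp bmp_range(1) t th gb(1) c1 Lb gnn c1 order_refl up mm order_refl]
  show "integrable Q (%om. g j (LINT x|om t. bmp j x) * AA t (1 / (real j + 1)) t om)"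
   by (rule k(1))
  have "(LINT om|Q. g j (LINT x|om t. bmp j x) * AA t (1 / (real j + 1)) t om)
    <= g j (LINT x|\<mu>. bmp j x) + K1 / NN j / (1 / (real j + 1)) + 0 * (0 * t)"
   by (rule k(2))
  also have "K1 / NN j / (1 / (real j + 1)) = K1 / (real j + 1)"
   by (simp add: NN_def power2_eq_square)
  also have "g j (LINT x|\<mu>. bmp j x) <= mass \<mu>"
   using gb(4)[of j "\<integral>x. bmp j x \<partial>\<mu>"] bmp_integral_lim(2,3)[OF \<mu>, of j] by linarith
  finally show "(LINT om|Q. g j (LINT x|om t. bmp j x) * AA t (1 / (real j + 1)) t om) <= mass \<mu> + K1 / (real j + 1)"
   by simp
 qed
 have lim: "(%j. g j (LINT x|om t. bmp j x) * AA t (1 / (real j + 1)) t om) \<longlonglongrightarrow> mass (om t)" if "om \<in> space Q" for om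
 proof -
  have fb: "finite_borel_measure (om t)" using that t by (auto intro: cadlag_fbm)
  have "(%j. g j (LINT x|om t. bmp j x) * AA t (1 / (real j + 1)) t om) \<longlonglongrightarrow> mass (om t) * 1"
   unfolding g_def by (intro tendsto_mult Gid_lim bmp_integral_lim fb AA_lim theta_lim)
  then show ?thesis by simp
 qed
 have Mlim: "(%j. mass \<mu> + K1 / (real j + 1)) \<longlonglongrightarrow> mass \<mu>"
  using tendsto_add[OF tendsto_const tendsto_mult[OF tendsto_const theta_lim], of "mass \<mu>" K1] by simp
 have nn: "0 <= g j (LINT x|om t. bmp j x) * AA t (1 / (real j + 1)) t om" if "om \<in> space Q" for j om
  using AA_bounds[of om t "1 / (real j + 1)" t] that t bmp_range(1) by (intro mult_nonneg_nonneg gnn) (auto intro: less_imp_le)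
 show "integrable Q (%om. mass (om t))" "(LINT om|Q. mass (om t)) <= mass \<mu>"
  using fatou_real[OF key(1) nn lim key(2) Mlim] by auto
qed


text \<open>For the square \<open>g''\<close> does not shrink, so branching leaves a drift of first
  order in the mass, the \<open>c2\<close> part of \<open>key_ineq\<close>, which
  \<open>mass_first\<close> pays for. The other terms vanish as before: \<open>g'\<close> grows like
  NN j, but the second derivative of the bump decays like the inverse square of NN j.\<close>

lemma mass_second:
 assumes t: "0 <= t"
 shows "integrable Q (%om. (mass (om t))\<^sup>2)" "(LINT om|Q. (mass (om t))\<^sup>2) <= (mass \<mu>)\<^sup>2 + 36 * (C\<sigma> + \<Gamma>) * (mass \<mu> * t)"
proof -
 obtain D where D: "1 <= D" "!!j x. \<bar>bmp' j x\<bar> <= D / NN j" "!!j x. \<bar>bmp'' j x\<bar> <= D / (NN j)\<^sup>2" using bmp_bounds by metis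
 define K2 where "K2 = 2 * (Ca * D) + 36 * (C\<rho> * D\<^sup>2)"
 define c2 where "c2 = 36 * (C\<sigma> + \<Gamma>)"
 have K2: "0 <= K2" "0 <= c2" unfolding K2_def c2_def using bounds_nonneg \<Gamma> D by (auto intro!: add_nonneg_nonneg mult_nonneg_nonneg)
 define g where "g j = (%z. (NN j)\<^sup>2 * Gsq (z / NN j))" for j
 define g' where "g' j = (%z. (NN j)\<^sup>2 / NN j * Gsq' (z / NN j))" for j
 define g'' where "g'' j = (%z. (NN j)\<^sup>2 / (NN j)\<^sup>2 * Gsq'' (z / NN j))" for j
 have gC: "C20fun (g j) (g' j) (g'' j)" for j
  unfolding g_def g'_def g''_def by (rule C20fun_scale[OF C20fun_G(2) NN_ge])
 have gd: "((g j) has_real_derivative g' j z) (at z)" "((g' j) has_real_derivative g'' j z) (at z)" for j z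
  using gC[of j] unfolding C20fun_def by blast+
 have Np: "0 < NN j" for j using NN_ge[of j] by linarith
 have gb: "\<bar>g j z\<bar> <= (NN j)\<^sup>2" "\<bar>g' j z\<bar> <= 2 * NN j" "\<bar>g'' j z\<bar> <= 36" "0 <= g j z" "g j z <= z\<^sup>2" for j z
 proof -
  note b = G_bounds[of "z / NN j"] and r = rec_bounds(1)[of "z / NN j"] rec2_le[of "z / NN j"]
  have "Gsq (z / NN j) <= 1" using rec_pos[of "z / NN j"] by (simp add: Gsq_def)
  then show "\<bar>g j z\<bar> <= (NN j)\<^sup>2" using b(7) mult_left_mono[of "Gsq (z / NN j)" 1 "(NN j)\<^sup>2"] by (simp add: g_def abs_mult)
  have "\<bar>Gsq' (z / NN j)\<bar> <= 2" using b(4) r by linarith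
  then have "NN j * \<bar>Gsq' (z / NN j)\<bar> <= NN j * 2" using Np[of j] by (intro mult_left_mono) auto
  then show "\<bar>g' j z\<bar> <= 2 * NN j" using Np[of j] by (simp add: g'_def abs_mult power2_eq_square)
  show "\<bar>g'' j z\<bar> <= 36" using b(3) r Np[of j] by (simp add: g''_def)
  show "0 <= g j z" using b(7) by (simp add: g_def)
  have "(NN j)\<^sup>2 * Gsq (z / NN j) <= (NN j)\<^sup>2 * (z / NN j)\<^sup>2" using b(8) by (intro mult_left_mono) auto
  then show "g j z <= z\<^sup>2" using Np[of j] by (simp add: g_def power_divide)
 qed
 have Lb: "\<bar>LL (g j) (g' j) (g'' j) (bmp j) (bmp' j) (bmp'' j) \<nu>\<bar> <= K2 / NN j * (1 + mass \<nu>)\<^sup>2 + c2 * mass \<nu>" if \<nu>: "finite_borel_measure \<nu>" for j \<nu>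
 proof -
  have d0: "\<bar>bmp j x\<bar> <= 1" for x using bmp_range[of j x] by simp
  have "\<bar>LL (g j) (g' j) (g'' j) (bmp j) (bmp' j) (bmp'' j) \<nu>\<bar> <= 2 * NN j * (Ca * (D / (NN j)\<^sup>2) * mass \<nu>)
    + 36 * (C\<rho> * (D / NN j)\<^sup>2 * (mass \<nu>)\<^sup>2) + 36 * ((C\<sigma> + \<Gamma>) * 1\<^sup>2 * mass \<nu>)"
   by (rule Lg_bound[OF \<nu> gd gb(3) gb(2) C2cfun_Bm[OF C2cfun_bmp] d0 D(2,3)])
  also have "2 * NN j * (Ca * (D / (NN j)\<^sup>2) * mass \<nu>) <= 2 * (Ca * D) / NN j * (1 + mass \<nu>)\<^sup>2"
   using mult_left_mono[OF V_mass(1)[OF \<nu>], of "2 * (Ca * D) / NN j"] bounds_nonneg D Np[of j] by (simp add: power2_eq_square)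
  also have "36 * (C\<rho> * (D / NN j)\<^sup>2 * (mass \<nu>)\<^sup>2) <= 36 * (C\<rho> * D\<^sup>2) / NN j * (1 + mass \<nu>)\<^sup>2"
  proof -
   have "(D / NN j)\<^sup>2 <= D\<^sup>2 / NN j" unfolding power_divide using D NN_ge[of j] by (intro divide_left_mono) (auto simp: power2_eq_square)
   then have "36 * (C\<rho> * (D / NN j)\<^sup>2 * (mass \<nu>)\<^sup>2) <= 36 * (C\<rho> * (D\<^sup>2 / NN j) * (1 + mass \<nu>)\<^sup>2)"
    using bounds_nonneg Np[of j] V_mass(2)[of \<nu>] by (intro mult_left_mono mult_mono) auto
   then show ?thesis by simp
  qed
  also have "36 * ((C\<sigma> + \<Gamma>) * 1\<^sup>2 * mass \<nu>) = c2 * mass \<nu>" by (simp add: c2_def)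
  also have "2 * (Ca * D) / NN j * (1 + mass \<nu>)\<^sup>2 + 36 * (C\<rho> * D\<^sup>2) / NN j * (1 + mass \<nu>)\<^sup>2 = K2 / NN j * (1 + mass \<nu>)\<^sup>2"
   unfolding K2_def by (simp add: add_divide_distrib distrib_right)
  finally show ?thesis by simp
 qed
 have Lb2: "\<bar>LL (g j) (g' j) (g'' j) (bmp j) (bmp' j) (bmp'' j) \<nu>\<bar> <= (K2 / NN j + c2) * (1 + mass \<nu>)\<^sup>2" if \<nu>: "finite_borel_measure \<nu>" for j \<nu>
  using Lb[OF \<nu>, of j] mult_left_mono[OF V_mass(1)[OF \<nu>] K2(2)] by (simp add: distrib_right)
 have key: "integrable Q (%om. g j (LINT x|om t. bmp j x) * AA t (1 / (real j + 1)) t om)"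
   "(LINT om|Q. g j (LINT x|om t. bmp j x) * AA t (1 / (real j + 1)) t om) <= (mass \<mu>)\<^sup>2 + K2 / (real j + 1) + c2 * (mass \<mu> * t)" for j
 proof -
  have c1: "0 <= K2 / NN j" using K2 Np[of j] by simp
  have up: "LL (g j) (g' j) (g'' j) (bmp j) (bmp' j) (bmp'' j) \<nu> <= K2 / NN j * (1 + mass \<nu>)\<^sup>2 + c2 * mass \<nu>"
   if "finite_borel_measure \<nu>" for \<nu> using Lb[OF that, of j] by (simp add: abs_le_iff)
  have c3: "0 <= K2 / NN j + c2" using c1 K2 by simp
  have th: "0 < 1 / (real j + 1)" by simp
  have mm: "c2 = 0 \<or> (\<forall>r. 0 <= r \<and> r <= t \<longrightarrow> integrable Q (%om. mass (om r)) \<and> (LINT om|Q. mass (om r)) <= mass \<mu>)"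
   using mass_first by auto
  have m0: "0 <= mass \<mu>" by simp
  note k = key_ineq[OF gC[of j] C2cfun_bmp bmp_range(1) t th gb(1) c3 Lb2 gb(4) c1 K2(2) up mm m0]
  show "integrable Q (%om. g j (LINT x|om t. bmp j x) * AA t (1 / (real j + 1)) t om)" by (rule k(1))
  have "(LINT om|Q. g j (LINT x|om t. bmp j x) * AA t (1 / (real j + 1)) t om)
    <= g j (LINT x|\<mu>. bmp j x) + K2 / NN j / (1 / (real j + 1)) + c2 * (mass \<mu> * t)" by (rule k(2))
  also have "K2 / NN j / (1 / (real j + 1)) = K2 / (real j + 1)"
   by (simp add: NN_def power2_eq_square)
  also have "g j (LINT x|\<mu>. bmp j x) <= (mass \<mu>)\<^sup>2"
   using gb(5)[of j "\<integral>x. bmp j x \<partial>\<mu>"] power_mono[OF bmp_integral_lim(3,2)[OF \<mu>, of j], of 2] by linarith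
  finally show "(LINT om|Q. g j (LINT x|om t. bmp j x) * AA t (1 / (real j + 1)) t om)
   <= (mass \<mu>)\<^sup>2 + K2 / (real j + 1) + c2 * (mass \<mu> * t)" by simp
 qed
 have lim: "(%j. g j (LINT x|om t. bmp j x) * AA t (1 / (real j + 1)) t om) \<longlonglongrightarrow> (mass (om t))\<^sup>2" if "om \<in> space Q" for om
 proof -
  have fb: "finite_borel_measure (om t)" using that t by (auto intro: cadlag_fbm)
  have "(%j. g j (LINT x|om t. bmp j x) * AA t (1 / (real j + 1)) t om) \<longlonglongrightarrow> (mass (om t))\<^sup>2 * 1"
   unfolding g_def by (intro tendsto_mult Gsq_lim bmp_integral_lim fb AA_lim theta_lim)
  then show ?thesis by simp
 qed
 have Mlim: "(%j. (mass \<mu>)\<^sup>2 + K2 / (real j + 1) + c2 * (mass \<mu> * t)) \<longlonglongrightarrow> (mass \<mu>)\<^sup>2 + c2 * (mass \<mu> * t)"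
  using tendsto_add[OF tendsto_add[OF tendsto_const tendsto_mult[OF tendsto_const theta_lim]] tendsto_const, of "(mass \<mu>)\<^sup>2" K2 "c2 * (mass \<mu> * t)"] by simp
 have nn: "0 <= g j (LINT x|om t. bmp j x) * AA t (1 / (real j + 1)) t om" if "om \<in> space Q" for j om
  using AA_bounds[of om t "1 / (real j + 1)" t] that t by (intro mult_nonneg_nonneg gb(4)) (auto intro: less_imp_le)
 show "integrable Q (%om. (mass (om t))\<^sup>2)" "(LINT om|Q. (mass (om t))\<^sup>2) <= (mass \<mu>)\<^sup>2 + 36 * (C\<sigma> + \<Gamma>) * (mass \<mu> * t)"
  using fatou_real[OF key(1) nn lim key(2) Mlim] by (auto simp: c2_def)
qed

text \<open>The expansion of (1 + mass)^2 with the bounds on the first two moments inserted; one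
  constant for all times up to T.\<close>

definition MV :: "real => real" where
 "MV T = 1 + 2 * mass \<mu> + ((mass \<mu>)\<^sup>2 + 36 * (C\<sigma> + \<Gamma>) * (mass \<mu> * T))"

lemma V_integrable:
 assumes r: "0 <= r"
 shows "integrable Q (V r)" "r <= T ==> (LINT om|Q. V r om) <= MV T"
proof -
 have V: "V r = (%om. 1 + 2 * mass (om r) + (mass (om r))\<^sup>2)" by (auto simp: V_def power2_eq_square algebra_simps)
 note m = mass_first[OF r] mass_second[OF r]
 show "integrable Q (V r)" unfolding V using m by auto
 assume T: "r <= T"
 have "(LINT om|Q. V r om) = 1 + 2 * (LINT om|Q. mass (om r)) + (LINT om|Q. (mass (om r))\<^sup>2)" unfolding V using m by simp
 moreover have "36 * (C\<sigma> + \<Gamma>) * (mass \<mu> * r) <= 36 * (C\<sigma> + \<Gamma>) * (mass \<mu> * T)"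
  using T bounds_nonneg \<Gamma> by (intro mult_left_mono) auto
 ultimately show "(LINT om|Q. V r om) <= MV T" unfolding MV_def using m by linarith
qed

lemma LINT_V:
 assumes "0 <= s" "s <= t"
 shows "integrable Q (%om. LINT r:{s..t}|lborel. V r om)"
proof (rule LINT_Fubini(1)[OF assms V_meas])
 show "0 <= t" using assms by simp
 show "integrable Q (V r)" if "0 <= r" for r by (rule V_integrable(1)[OF that])
 show "(LINT om|Q. \<bar>V r om\<bar>) <= MV t" if "0 <= r" "r <= t" for r
  using V_integrable(2)[OF that] by (simp add: V_def)
qed

text \<open>A bound by \<open>V\<close> gives pathwise integrability through the random bound on
  \<open>V\<close>, and a dominating function whose expectation \<open>LINT_V\<close>
  controls.\<close>

lemma path_bounded_int:
 assumes om: "om \<in> cadlag_paths" and st: "0 <= s" "s <= t"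
  and h: "(%z. h (clip t (fst z)) (snd z)) \<in> borel_measurable (borel \<Otimes>\<^sub>M Q)"
  and b: "!!r. 0 <= r ==> r <= t ==> \<bar>h r om\<bar> <= C * V r om" and C: "0 <= C"
 shows "set_integrable lborel {s..t} (%r. h r om)" "\<bar>LINT r:{s..t}|lborel. h r om\<bar> <= C * (LINT r:{s..t}|lborel. V r om)"
proof -
 have t: "0 <= t" using st by simp
 obtain K where K: "1 <= K" "!!r. 0 <= r ==> r <= t ==> V r om <= K" using clock_V[OF om t order_refl] by auto
 have si: "set_integrable lborel {s..t} (%r. k r om)" 
  if k: "(%z. k (clip t (fst z)) (snd z)) \<in> borel_measurable (borel \<Otimes>\<^sub>M Q)"
   "!!r. 0 <= r ==> r <= t ==> \<bar>k r om\<bar> <= D * V r om" "0 <= D" for k D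
 proof -
  have "set_integrable lborel {s..t} (%r. k (clip t r) om)"
  proof (rule set_integrable_bounded[where K = "D * K"])
   show "(%r. k (clip t r) om) \<in> borel_measurable borel"
    using measurable_compose[OF _ k(1), of "%u. (u, om)" borel] om by simp
   show "\<bar>k (clip t r) om\<bar> <= D * K" for r
    using k(2)[OF clip_nonneg clip_le[OF t], of r] mult_left_mono[OF K(2)[OF clip_nonneg clip_le[OF t], of r] k(3)] by linarith
  qed
  then show ?thesis unfolding set_integrable_def
   by (rule Bochner_Integration.integrable_cong[THEN iffD1, rotated 2]) (use st in \<open>auto simp: indicator_def clip_eq\<close>)
 qed
 show i: "set_integrable lborel {s..t} (%r. h r om)" by (rule si[OF h b C])
 have iV: "set_integrable lborel {s..t} (%r. V r om)" by (rule si[OF V_meas[OF t], of 1]) (auto simp: V_def)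
 have "\<bar>LINT r:{s..t}|lborel. h r om\<bar> <= (LINT r:{s..t}|lborel. \<bar>h r om\<bar>)" using set_integral_norm_bound[OF i] by simp
 also have "\<dots> <= (LINT r:{s..t}|lborel. C * V r om)"
  by (rule set_integral_mono[OF set_integrable_abs[OF i] set_integrable_mult_right[OF iV]]) (use b st in auto)
 finally show "\<bar>LINT r:{s..t}|lborel. h r om\<bar> <= C * (LINT r:{s..t}|lborel. V r om)" by simp
qed

section \<open>The martingale identities\<close>

text \<open>Now that \<open>V\<close> is integrable, its time integral dominates and the damping can
  go: the discount factors tend to 1, and the damping drift carries a factor \<theta>.\<close>

lemma mart_id:
 assumes g: "C20fun g g' g''" and f: "C2cfun f f' f''" "!!x. 0 <= f x" and st: "0 <= s" "s <= t"
  and B: "!!z. \<bar>g z\<bar> <= B" and C: "0 <= C" "!!\<nu>. finite_borel_measure \<nu> ==> \<bar>LL g g' g'' f f' f'' \<nu>\<bar> <= C * (1 + mass \<nu>)\<^sup>2"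
  and Y: "Y \<in> borel_measurable (path_filt (ennreal s))" "!!om. om \<in> space Q ==> \<bar>Y om\<bar> <= E"
 shows "(LINT om|Q. Y om * (g (LINT x|om t. f x) - g (LINT x|om s. f x)))
   = (LINT om|Q. Y om * (LINT r:{s..t}|lborel. LL g g' g'' f f' f'' (om r)))"
proof -
 have t: "0 <= t" using st by simp
 have B0: "0 <= B" using order_trans[OF abs_ge_zero B] .
 have E0: "0 <= E" using Y(2) not_empty order_trans[OF abs_ge_zero Y(2)] by blast
 define \<theta> where "\<theta> j = 1 / (real j + 1)" for j :: nat
 have th: "0 < \<theta> j" "\<theta> j <= 1" for j by (auto simp: \<theta>_def)
 have thl: "\<theta> \<longlonglongrightarrow> 0" using theta_lim by (simp add: \<theta>_def[abs_def])
 define z where "z r om = (LINT x|om r. f x)" for r and om :: "real => real measure"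
 define L where "L r om = LL g g' g'' f f' f'' (om r)" for r and om :: "real => real measure"
 define W where "W j om = (LINT r:{s..t}|lborel. (L r om - \<theta> j * g (z r om) * V r om) * AA t (\<theta> j) r om)" for j om
 have d: "!!z. (g has_real_derivative g' z) (at z)" "!!z. (g' has_real_derivative g'' z) (at z)" "continuous_on UNIV g''"
  using g unfolding C20fun_def by blast+
 have [measurable]: "g \<in> borel_measurable borel" using d(1) by (intro borel_measurable_continuous_onI deriv_cont)
 have zm[measurable]: "z r \<in> borel_measurable Q" if "0 <= r" for r
  unfolding z_def[abs_def] by (rule mkernel_Bm[OF mkernel_Q[OF that] C2cfun_Bm(1)[OF f(1)]])
 have Lm: "(%q. L (clip t (fst q)) (snd q)) \<in> borel_measurable (borel \<Otimes>\<^sub>M Q)"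
  unfolding L_def by (rule Lg_measurable[OF mkernel_joint[OF t] d f(1)])
 have Lb: "\<bar>L r om\<bar> <= C * V r om" if "om \<in> cadlag_paths" "0 <= r" for r om
  unfolding L_def V_def using that by (intro C cadlag_fbm)
 have zjm: "(%q. z (clip t (fst q)) (snd q)) \<in> borel_measurable (borel \<Otimes>\<^sub>M Q)"
  unfolding z_def by (rule mkernel_Bm[OF mkernel_joint[OF t] C2cfun_Bm(1)[OF f(1)]])
 note Vjm = V_meas[OF t]
 have AAj: "(%q. AA t (\<theta> j) (clip t (fst q)) (snd q)) \<in> borel_measurable (borel \<Otimes>\<^sub>M Q)" for j
 proof -
  note prim_measurable_pair[OF V_meas[OF t], measurable]
  have A: "(%q. AA t (\<theta> j) (fst q) (snd q)) \<in> borel_measurable (borel \<Otimes>\<^sub>M Q)" unfolding AA_def clockA_def by measurable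
  have "(%q. (clip t (fst q), snd q)) \<in> measurable (borel \<Otimes>\<^sub>M Q) (borel \<Otimes>\<^sub>M Q)" unfolding clip_def by measurable
  from measurable_compose[OF this A] show ?thesis by simp
 qed
 note AA_meas[OF t, measurable]
 note Ym[measurable] = measurable_from_subalg[OF sub_Q Y(1)]
 have W: "(LINT om|Q. Y om * (g (z t om) * AA t (\<theta> j) t om - g (z s om) * AA t (\<theta> j) s om)) = (LINT om|Q. Y om * W j om)"
  "W j \<in> borel_measurable Q" for j
 proof -
  interpret S: soft_martingale Q path_filt "%r om. g (LINT x|om r. f x)" "%r om. LL g g' g'' f f' f'' (om r)" V B C t "\<theta> j"
   by (rule soft[OF g f t th(1) B C])
  have A: "S.A = AA t (\<theta> j)" by (intro ext) (simp add: S.A_def AA_def S.v_def[abs_def])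
  note ss = S.soft_stopping[OF st order_refl Y]
  show "(LINT om|Q. Y om * (g (z t om) * AA t (\<theta> j) t om - g (z s om) * AA t (\<theta> j) s om)) = (LINT om|Q. Y om * W j om)"
   using ss(1) by (simp add: W_def z_def L_def A)
  show "W j \<in> borel_measurable Q" using ss(3) by (simp add: W_def[abs_def] z_def L_def A)
 qed
 have Ab: "0 < AA t (\<theta> j) r om" "AA t (\<theta> j) r om <= 1" if "om \<in> cadlag_paths" for j r om
  using AA_bounds[OF that t, of "\<theta> j" r] th[of j] by auto
 have "(%j. \<integral>om. Y om * (g (z t om) * AA t (\<theta> j) t om - g (z s om) * AA t (\<theta> j) s om) \<partial>Q)
   \<longlonglongrightarrow> (LINT om|Q. Y om * (g (z t om) * 1 - g (z s om) * 1))"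
 proof (rule integral_dominated_convergence[where w = "%om. E * (B + B)"])
  show "AE om in Q. (%j. Y om * (g (z t om) * AA t (\<theta> j) t om - g (z s om) * AA t (\<theta> j) s om))
   \<longlonglongrightarrow> Y om * (g (z t om) * 1 - g (z s om) * 1)"
   by (intro AE_I2 tendsto_intros AA_lim thl)
  show "AE om in Q. norm (Y om * (g (z t om) * AA t (\<theta> j) t om - g (z s om) * AA t (\<theta> j) s om)) <= E * (B + B)" for j
  proof (rule AE_I2)
   fix om assume om: "om \<in> space Q"
   have "\<bar>g (z r om) * AA t (\<theta> j) r om\<bar> <= B * 1" for r
    unfolding abs_mult using B Ab[of om j r] om B0 by (intro mult_mono) auto
   from this[of t] this[of s] have "\<bar>g (z t om) * AA t (\<theta> j) t om - g (z s om) * AA t (\<theta> j) s om\<bar> <= B + B" by simp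
   then show "norm (Y om * (g (z t om) * AA t (\<theta> j) t om - g (z s om) * AA t (\<theta> j) s om)) <= E * (B + B)"
    unfolding real_norm_def abs_mult using Y(2)[OF om] E0 by (intro mult_mono) auto
  qed
 qed (use zm[OF t] zm[OF st(1)] in \<open>measurable, simp?\<close>)
 moreover have "(%j. \<integral>om. Y om * W j om \<partial>Q) \<longlonglongrightarrow> (LINT om|Q. Y om * (LINT r:{s..t}|lborel. L r om))"
 proof (rule integral_dominated_convergence[where w = "%om. E * ((C + B) * (LINT r:{s..t}|lborel. V r om))"])
  have CB: "0 <= C + B" using C B0 by simp
  have hb: "\<bar>(L r om - \<theta> j * g (z r om) * V r om) * AA t (\<theta> j) r om\<bar> <= (C + B) * V r om"
   if "om \<in> cadlag_paths" "0 <= r" for r om j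
  proof -
   have V0: "0 <= V r om" by (simp add: V_def)
   have "\<bar>\<theta> j * g (z r om)\<bar> <= 1 * B" unfolding abs_mult using th[of j] B by (intro mult_mono) auto
   then have "\<bar>\<theta> j * g (z r om) * V r om\<bar> <= B * V r om"
    using V0 by (simp add: abs_mult[of _ "V r om"] mult_right_mono)
   then have "\<bar>L r om - \<theta> j * g (z r om) * V r om\<bar> <= (C + B) * V r om"
    using Lb[OF that] by (simp add: distrib_right)
   then have "\<bar>L r om - \<theta> j * g (z r om) * V r om\<bar> * \<bar>AA t (\<theta> j) r om\<bar> <= (C + B) * V r om * 1"
    using Ab[OF that(1), of j r] CB V0 by (intro mult_mono) auto
   then show ?thesis by (simp add: abs_mult)
  qed
  have hm: "(%q. (L (clip t (fst q)) (snd q) - \<theta> j * g (z (clip t (fst q)) (snd q)) * V (clip t (fst q)) (snd q)) * AA t (\<theta> j) (clip t (fst q)) (snd q))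
    \<in> borel_measurable (borel \<Otimes>\<^sub>M Q)" for j
   using Lm zjm Vjm AAj[of j] by measurable
  note pb = path_bounded_int[OF _ st hm hb CB, simplified]
  have Wl: "(%j. W j om) \<longlonglongrightarrow> (LINT r:{s..t}|lborel. L r om)" if om: "om \<in> cadlag_paths" for om
  proof -
   obtain K where K: "!!r. 0 <= r ==> r <= t ==> V r om <= K" using clock_V[OF om t order_refl] by metis
   show ?thesis unfolding W_def
   proof (rule set_integral_LIMSEQ[where K = "(C + B) * K"])
    show "set_integrable lborel {s..t} (%r. (L r om - \<theta> j * g (z r om) * V r om) * AA t (\<theta> j) r om)" for j
     using path_bounded_int(1)[OF om st hm hb[OF om] CB] .
    fix r assume r: "s <= r" "r <= t"
    have "(%j. (L r om - \<theta> j * g (z r om) * V r om) * AA t (\<theta> j) r om) \<longlonglongrightarrow> (L r om - 0 * g (z r om) * V r om) * 1"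
     by (intro tendsto_intros AA_lim thl)
    then show "(%j. (L r om - \<theta> j * g (z r om) * V r om) * AA t (\<theta> j) r om) \<longlonglongrightarrow> L r om" by simp
    show "\<bar>(L r om - \<theta> j * g (z r om) * V r om) * AA t (\<theta> j) r om\<bar> <= (C + B) * K" for j
     using hb[OF om, of r j] mult_left_mono[OF K[of r] CB] r st by linarith
   qed
  qed
  then show "AE om in Q. (%j. Y om * W j om) \<longlonglongrightarrow> Y om * (LINT r:{s..t}|lborel. L r om)"
   by (intro AE_I2 tendsto_intros) auto
  show "(%om. Y om * W j om) \<in> borel_measurable Q" for j using W(2)[of j] by measurable
  have "(%om. LINT r:{s..t}|lborel. L r om) \<in> borel_measurable Q"
   by (rule borel_measurable_LIMSEQ_real[where u = W]) (use Wl W(2) in auto)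
  then show "(%om. Y om * (LINT r:{s..t}|lborel. L r om)) \<in> borel_measurable Q" by measurable
  show "integrable Q (%om. E * ((C + B) * (LINT r:{s..t}|lborel. V r om)))"
   using LINT_V[OF st] by simp
  show "AE om in Q. norm (Y om * W j om) <= E * ((C + B) * (LINT r:{s..t}|lborel. V r om))" for j
  proof (rule AE_I2)
   fix om assume om: "om \<in> space Q"
   then have omc: "om \<in> cadlag_paths" by simp
   have "\<bar>W j om\<bar> <= (C + B) * (LINT r:{s..t}|lborel. V r om)"
    unfolding W_def by (rule path_bounded_int(2)[OF omc st hm hb[OF omc] CB])
   then show "norm (Y om * W j om) <= E * ((C + B) * (LINT r:{s..t}|lborel. V r om))"
    unfolding real_norm_def abs_mult using Y(2)[OF om] E0 by (intro mult_mono) auto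
  qed
 qed
 ultimately have "(LINT om|Q. Y om * (g (z t om) * 1 - g (z s om) * 1)) = (LINT om|Q. Y om * (LINT r:{s..t}|lborel. L r om))"
  unfolding W(1) by (rule LIMSEQ_unique)
 then show ?thesis by (simp add: z_def L_def)
qed

end

context sdsm
begin

text \<open>The truncation goes next. The bounds \<open>B n\<close> may grow with n; what dominates
  is the common quadratic growth \<open>c0 * (1 + z\<^sup>2)\<close> of the values and the common
  constant \<open>C\<close> for the generators.\<close>

lemma mart_id_lim:
 fixes G G' G'' :: "nat => real => real"
 assumes gC: "!!n. C20fun (G n) (G' n) (G'' n)" and c: "!!n z. \<bar>G'' n z\<bar> <= c"
  and lim: "!!z. (%n. G n z) \<longlonglongrightarrow> g z" "!!z. (%n. G' n z) \<longlonglongrightarrow> g' z" "!!z. (%n. G'' n z) \<longlonglongrightarrow> g'' z"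
  and B: "!!n z. \<bar>G n z\<bar> <= B n" and c0: "!!n z. \<bar>G n z\<bar> <= c0 * (1 + z\<^sup>2)"
  and C: "0 <= C" "!!n \<nu>. finite_borel_measure \<nu> ==> \<bar>LL (G n) (G' n) (G'' n) f f' f'' \<nu>\<bar> <= C * (1 + mass \<nu>)\<^sup>2"
  and f: "C2cfun f f' f''" "!!x. 0 <= f x" and st: "0 <= s" "s <= t"
  and Y: "Y \<in> borel_measurable (path_filt (ennreal s))" "!!om. om \<in> space Q ==> \<bar>Y om\<bar> <= E"
 shows "(LINT om|Q. Y om * (g (LINT x|om t. f x) - g (LINT x|om s. f x)))
   = (LINT om|Q. Y om * (LINT r:{s..t}|lborel. LL g g' g'' f f' f'' (om r)))"
proof -
 have t: "0 <= t" using st by simp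
 have E0: "0 <= E" using Y(2) not_empty order_trans[OF abs_ge_zero Y(2)] by blast
 have c00: "0 <= c0" using order_trans[OF abs_ge_zero c0[of 0 0]] by simp
 obtain D where D: "0 <= D" "!!x. \<bar>f x\<bar> <= D" using C2cfun_bounds[OF f(1)] by metis
 note fB = C2cfun_Bm[OF f(1)]
 define z where "z r om = (LINT x|om r. f x)" for r and om :: "real => real measure"
 have d: "!!z. (G n has_real_derivative G' n z) (at z)" "!!z. (G' n has_real_derivative G'' n z) (at z)" "continuous_on UNIV (G'' n)" for n
  using gC[of n] unfolding C20fun_def by blast+
 have Gm[measurable]: "G n \<in> borel_measurable borel" for n using d(1) by (intro borel_measurable_continuous_onI deriv_cont)
 have zm[measurable]: "z r \<in> borel_measurable Q" if "0 <= r" for r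
  unfolding z_def[abs_def] by (rule mkernel_Bm[OF mkernel_Q[OF that] fB(1)])
 have gm[measurable]: "g \<in> borel_measurable borel"
  by (rule borel_measurable_LIMSEQ_real[where u = G]) (rule lim, rule Gm)
 note Ym[measurable] = measurable_from_subalg[OF sub_Q Y(1)]
 have zb: "\<bar>G n (z r om)\<bar> <= c0 * (1 + D\<^sup>2) * V r om" if "om \<in> cadlag_paths" "0 <= r" for n r om
 proof -
  have "\<bar>z r om\<bar> <= D * mass (om r)"
   unfolding z_def by (rule fbm_integral_bound[OF cadlag_fbm[OF that] fB(1) D(2)])
  then have "(z r om)\<^sup>2 <= (D * mass (om r))\<^sup>2" by (metis abs_ge_zero power2_abs power_mono)
  also have "\<dots> <= D\<^sup>2 * V r om" unfolding power_mult_distrib by (intro mult_left_mono V_ge(3)) simp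
  finally have "1 + (z r om)\<^sup>2 <= (1 + D\<^sup>2) * V r om" using V_ge(1)[of r om] by (simp add: distrib_right)
  then have "c0 * (1 + (z r om)\<^sup>2) <= c0 * ((1 + D\<^sup>2) * V r om)" using c00 by (intro mult_left_mono)
  then show ?thesis using c0[of n "z r om"] by (simp add: mult.assoc)
 qed
 have conv1: "(%n. \<integral>om. Y om * (G n (z t om) - G n (z s om)) \<partial>Q) \<longlonglongrightarrow> (LINT om|Q. Y om * (g (z t om) - g (z s om)))"
 proof (rule integral_dominated_convergence[where w = "%om. E * (c0 * (1 + D\<^sup>2) * V t om + c0 * (1 + D\<^sup>2) * V s om)"])
  show "integrable Q (%om. E * (c0 * (1 + D\<^sup>2) * V t om + c0 * (1 + D\<^sup>2) * V s om))"
   using V_integrable(1)[OF t] V_integrable(1)[OF st(1)] by simp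
  show "AE om in Q. (%n. Y om * (G n (z t om) - G n (z s om))) \<longlonglongrightarrow> Y om * (g (z t om) - g (z s om))"
   by (intro AE_I2 tendsto_intros lim)
  show "AE om in Q. norm (Y om * (G n (z t om) - G n (z s om))) <= E * (c0 * (1 + D\<^sup>2) * V t om + c0 * (1 + D\<^sup>2) * V s om)" for n
  proof (rule AE_I2)
   fix om assume om: "om \<in> space Q"
   have "\<bar>G n (z t om) - G n (z s om)\<bar> <= c0 * (1 + D\<^sup>2) * V t om + c0 * (1 + D\<^sup>2) * V s om"
    using zb[of om t n] zb[of om s n] om t st(1) by simp
   then show "norm (Y om * (G n (z t om) - G n (z s om))) <= E * (c0 * (1 + D\<^sup>2) * V t om + c0 * (1 + D\<^sup>2) * V s om)"
    unfolding real_norm_def abs_mult using Y(2)[OF om] E0 by (intro mult_mono) auto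
  qed
 qed (use zm[OF t] zm[OF st(1)] in measurable)
 have eq: "(%n. \<integral>om. Y om * (G n (z t om) - G n (z s om)) \<partial>Q)
   = (%n. \<integral>om. Y om * (LINT r:{s..t}|lborel. LL (G n) (G' n) (G'' n) f f' f'' (om r)) \<partial>Q)"
  unfolding z_def by (intro ext mart_id[OF gC f st B C Y])
 have conv2: "(%n. \<integral>om. Y om * (LINT r:{s..t}|lborel. LL (G n) (G' n) (G'' n) f f' f'' (om r)) \<partial>Q)
   \<longlonglongrightarrow> (LINT om|Q. Y om * (LINT r:{s..t}|lborel. LL g g' g'' f f' f'' (om r)))"
 proof (rule integral_dominated_convergence[where w = "%om. E * (C * (LINT r:{s..t}|lborel. V r om))"])
  have Lm: "(%q. LL (G n) (G' n) (G'' n) f f' f'' (snd q (clip t (fst q)))) \<in> borel_measurable (borel \<Otimes>\<^sub>M Q)" for n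
   by (rule Lg_measurable[OF mkernel_joint[OF t] d f(1)])
  have Lb: "\<bar>LL (G n) (G' n) (G'' n) f f' f'' (om r)\<bar> <= C * V r om" if "om \<in> cadlag_paths" "0 <= r" for n om r
   unfolding V_def by (rule C(2)[OF cadlag_fbm[OF that]])
  have lim': "(%n. LINT r:{s..t}|lborel. LL (G n) (G' n) (G'' n) f f' f'' (om r))
    \<longlonglongrightarrow> (LINT r:{s..t}|lborel. LL g g' g'' f f' f'' (om r))" if om: "om \<in> cadlag_paths" for om
  proof -
   obtain K where K: "!!r. 0 <= r ==> r <= t ==> V r om <= K" using clock_V[OF om t order_refl] by metis
   show ?thesis
   proof (rule set_integral_LIMSEQ[where K = "C * K"])
    show "set_integrable lborel {s..t} (%r. LL (G n) (G' n) (G'' n) f f' f'' (om r))" for n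
     using path_bounded_int(1)[OF om st Lm Lb[OF om] C(1)] .
    fix r assume r: "s <= r" "r <= t"
    show "(%n. LL (G n) (G' n) (G'' n) f f' f'' (om r)) \<longlonglongrightarrow> LL g g' g'' f f' f'' (om r)"
     by (rule Lg_limit[OF cadlag_fbm[OF om] d(1,2) c lim f(1)]) (use r st in auto)
    show "\<bar>LL (G n) (G' n) (G'' n) f f' f'' (om r)\<bar> <= C * K" for n
     using Lb[OF om, of r n] mult_left_mono[OF K[of r] C(1)] r st by linarith
   qed
  qed
  have Wm: "(%om. LINT r:{s..t}|lborel. LL (G n) (G' n) (G'' n) f f' f'' (om r)) \<in> borel_measurable Q" for n
  proof (rule borel_measurable_integrable, rule LINT_Fubini(1)[OF st Lm])
   fix r assume r: "0 <= r" "r <= t"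
   show i: "integrable Q (%om. LL (G n) (G' n) (G'' n) f f' f'' (om r))"
   proof (rule Bochner_Integration.integrable_bound)
    show "integrable Q (%om. C * V r om)" using V_integrable(1)[OF r(1)] by simp
    show "AE om in Q. norm (LL (G n) (G' n) (G'' n) f f' f'' (om r)) <= norm (C * V r om)"
     using Lb r by (intro AE_I2) (auto intro!: order_trans[OF _ abs_ge_self])
   qed (rule Lg_measurable[OF mkernel_Q[OF r(1)] d f(1)])
   have "(LINT om|Q. \<bar>LL (G n) (G' n) (G'' n) f f' f'' (om r)\<bar>) <= (LINT om|Q. C * V r om)"
    using i V_integrable(1)[OF r(1)] Lb r by (intro integral_mono) auto
   also have "\<dots> <= C * MV t" using V_integrable(2)[OF r] C(1) by (simp add: mult_left_mono)
   finally show "(LINT om|Q. \<bar>LL (G n) (G' n) (G'' n) f f' f'' (om r)\<bar>) <= C * MV t" .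
  qed
  show "(%om. Y om * (LINT r:{s..t}|lborel. LL (G n) (G' n) (G'' n) f f' f'' (om r))) \<in> borel_measurable Q" for n
   using Wm[of n] by measurable
  have "(%om. LINT r:{s..t}|lborel. LL g g' g'' f f' f'' (om r)) \<in> borel_measurable Q"
   by (rule borel_measurable_LIMSEQ_real[where u = "%n om. LINT r:{s..t}|lborel. LL (G n) (G' n) (G'' n) f f' f'' (om r)"])
    (use lim' Wm in auto)
  then show "(%om. Y om * (LINT r:{s..t}|lborel. LL g g' g'' f f' f'' (om r))) \<in> borel_measurable Q" by measurable
  show "AE om in Q. (%n. Y om * (LINT r:{s..t}|lborel. LL (G n) (G' n) (G'' n) f f' f'' (om r)))
    \<longlonglongrightarrow> Y om * (LINT r:{s..t}|lborel. LL g g' g'' f f' f'' (om r))"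
   using lim' by (intro AE_I2 tendsto_mult tendsto_const) auto
  show "integrable Q (%om. E * (C * (LINT r:{s..t}|lborel. V r om)))" using LINT_V[OF st] by simp
  show "AE om in Q. norm (Y om * (LINT r:{s..t}|lborel. LL (G n) (G' n) (G'' n) f f' f'' (om r)))
    <= E * (C * (LINT r:{s..t}|lborel. V r om))" for n
  proof (rule AE_I2)
   fix om assume om: "om \<in> space Q"
   then have omc: "om \<in> cadlag_paths" by simp
   have "\<bar>LINT r:{s..t}|lborel. LL (G n) (G' n) (G'' n) f f' f'' (om r)\<bar> <= C * (LINT r:{s..t}|lborel. V r om)"
    by (rule path_bounded_int(2)[OF omc st Lm Lb[OF omc] C(1)])
   then show "norm (Y om * (LINT r:{s..t}|lborel. LL (G n) (G' n) (G'' n) f f' f'' (om r)))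
     <= E * (C * (LINT r:{s..t}|lborel. V r om))"
    unfolding real_norm_def abs_mult using Y(2)[OF om] E0 by (intro mult_mono) auto
  qed
 qed
 have "(LINT om|Q. Y om * (g (z t om) - g (z s om)))
   = (LINT om|Q. Y om * (LINT r:{s..t}|lborel. LL g g' g'' f f' f'' (om r)))"
  by (rule LIMSEQ_unique[OF conv1[unfolded eq] conv2])
 then show ?thesis by (simp add: z_def)
qed

lemma isCont_scale: "isCont h 0 ==> (%n. h (z / NN n)) \<longlonglongrightarrow> h 0"
 using isCont_tendsto_compose[OF _ NN_lim] by blast

lemma isCont_G: "isCont Gid' 0" "isCont Gid'' 0" "isCont Gsq'' 0"
proof -
 show "isCont Gid' 0" using Gid_DERIV(2) by (rule DERIV_isCont)
 have "continuous_on UNIV Gid''" "continuous_on UNIV Gsq''" using C20fun_G unfolding C20fun_def by blast+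
 then show "isCont Gid'' 0" "isCont Gsq'' 0" by (simp_all add: continuous_on_eq_continuous_at)
qed

lemma first_id_nonneg:
 assumes f: "C2cfun f f' f''" "!!x. 0 <= f x" and st: "0 <= s" "s <= t"
  and Y: "Y \<in> borel_measurable (path_filt (ennreal s))" "!!om. om \<in> space Q ==> \<bar>Y om\<bar> <= E"
 shows "(LINT om|Q. Y om * ((LINT x|om t. f x) - (LINT x|om s. f x)))
   = (LINT om|Q. Y om * (LINT r:{s..t}|lborel. 1/2 * (LINT x|om r. a x * f'' x)))"
proof -
 obtain D where D: "0 <= D" "!!x. \<bar>f x\<bar> <= D" "!!x. \<bar>f' x\<bar> <= D" "!!x. \<bar>f'' x\<bar> <= D" using C2cfun_bounds[OF f(1)] by metis
 define G where "G n = (%z. NN n * Gid (z / NN n))" for n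
 define G' where "G' n = (%z. NN n / NN n * Gid' (z / NN n))" for n
 define G'' where "G'' n = (%z. NN n / (NN n)\<^sup>2 * Gid'' (z / NN n))" for n
 have gC: "C20fun (G n) (G' n) (G'' n)" for n
  unfolding G_def G'_def G''_def by (rule C20fun_scale[OF C20fun_G(1) NN_ge])
 have gd: "((G j) has_real_derivative G' j z) (at z)" "((G' j) has_real_derivative G'' j z) (at z)" for j z
  using gC[of j] unfolding C20fun_def by blast+
 have Np: "0 < NN j" "NN j \<noteq> 0" for j using NN_ge[of j] by auto
 have gb: "\<bar>G j z\<bar> <= NN j" "\<bar>G' j z\<bar> <= 5" "\<bar>G'' j z\<bar> <= 36" "\<bar>G j z\<bar> <= 1 * (1 + z\<^sup>2)" for j z
 proof -
  note b = G_bounds[of "z / NN j"] and r = rec_bounds(1)[of "z / NN j"] rec2_le[of "z / NN j"]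
  show "\<bar>G j z\<bar> <= NN j" using b(9) r Np(1)[of j] mult_left_mono[of "\<bar>Gid (z / NN j)\<bar>" 1 "NN j"] by (simp add: G_def abs_mult)
  show "\<bar>G' j z\<bar> <= 5" using b(1) r Np[of j] by (simp add: G'_def)
  have "\<bar>Gid'' (z / NN j)\<bar> <= 36" using b(2) r by linarith
  then have "\<bar>Gid'' (z / NN j)\<bar> / NN j <= 36 / 1" using NN_ge[of j] by (intro frac_le) auto
  then show "\<bar>G'' j z\<bar> <= 36"
   using Np(1)[of j] by (simp add: G''_def abs_mult power2_eq_square)
  have "NN j * \<bar>Gid (z / NN j)\<bar> <= NN j * \<bar>z / NN j\<bar>" using b(6) Np(1)[of j] by (intro mult_left_mono) auto
  then have "\<bar>G j z\<bar> <= \<bar>z\<bar>" using Np(1)[of j] by (simp add: G_def abs_mult)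
  also have "\<bar>z\<bar> <= 1 * (1 + z\<^sup>2)" using rec_bounds(3)[of z] rec_mult[of z] rec_pos[of z]
   by (metis mult.commute mult_1 mult_le_cancel_left_pos)
  finally show "\<bar>G j z\<bar> <= 1 * (1 + z\<^sup>2)" .
 qed
 have lim: "(%n. G n z) \<longlonglongrightarrow> z" "(%n. G' n z) \<longlonglongrightarrow> 1" "(%n. G'' n z) \<longlonglongrightarrow> 0" for z
 proof -
  show "(%n. G n z) \<longlonglongrightarrow> z" unfolding G_def by (rule Gid_lim[OF tendsto_const])
  show "(%n. G' n z) \<longlonglongrightarrow> 1" using isCont_scale[OF isCont_G(1), of z] Np by (simp add: G'_def Gid'_def rec_def)
  have "(%n. 1 / NN n * Gid'' (z / NN n)) \<longlonglongrightarrow> 0 * Gid'' 0" by (intro tendsto_mult NN_lim isCont_scale isCont_G)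
  then show "(%n. G'' n z) \<longlonglongrightarrow> 0" using Np by (simp add: G''_def power2_eq_square)
 qed
 define C where "C = 5 * (Ca * D) + 36 * (C\<rho> * D\<^sup>2) + 36 * ((C\<sigma> + \<Gamma>) * D\<^sup>2)"
 have C0: "0 <= C" unfolding C_def using bounds_nonneg \<Gamma> D by (intro add_nonneg_nonneg mult_nonneg_nonneg) auto
 have Cb: "\<bar>LL (G n) (G' n) (G'' n) f f' f'' \<nu>\<bar> <= C * (1 + mass \<nu>)\<^sup>2" if \<nu>: "finite_borel_measure \<nu>" for n \<nu>
 proof -
  have "\<bar>LL (G n) (G' n) (G'' n) f f' f'' \<nu>\<bar> <= 5 * (Ca * D * mass \<nu>) + 36 * (C\<rho> * D\<^sup>2 * (mass \<nu>)\<^sup>2) + 36 * ((C\<sigma> + \<Gamma>) * D\<^sup>2 * mass \<nu>)"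
   by (rule Lg_bound[OF \<nu> gd gb(3) gb(2) C2cfun_Bm[OF f(1)] D(2-4)])
  also have "\<dots> = (5 * (Ca * D) + 36 * ((C\<sigma> + \<Gamma>) * D\<^sup>2)) * mass \<nu> + (36 * (C\<rho> * D\<^sup>2)) * (mass \<nu>)\<^sup>2" by (simp add: algebra_simps)
  also have "\<dots> <= (5 * (Ca * D) + 36 * ((C\<sigma> + \<Gamma>) * D\<^sup>2)) * (1 + mass \<nu>)\<^sup>2 + (36 * (C\<rho> * D\<^sup>2)) * (1 + mass \<nu>)\<^sup>2"
   using bounds_nonneg \<Gamma> D by (intro add_mono mult_left_mono V_mass \<nu>) auto
  also have "\<dots> = C * (1 + mass \<nu>)\<^sup>2" by (simp add: C_def distrib_right)
  finally show ?thesis .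
 qed
 \<comment> \<open>For the identity both the second derivative and the jump integrand vanish, so
   neither interaction nor branching contributes to the mean.\<close>
 have eq: "LL (%z. z) (%z. 1) (%z. 0) f f' f'' \<nu> = 1/2 * (LINT x|\<nu>. a x * f'' x)" for \<nu>
  by (simp add: Lg_def jmp_def)
 then show ?thesis
  using mart_id_lim[where g = "%z. z" and g' = "%z. 1" and g'' = "%z. 0", OF gC gb(3) lim gb(1) gb(4) C0 Cb f st Y] by (simp only: eq)
qed

lemma second_id_nonneg:
 assumes f: "C2cfun f f' f''" "!!x. 0 <= f x" and st: "0 <= s" "s <= t"
  and Y: "Y \<in> borel_measurable (path_filt (ennreal s))" "!!om. om \<in> space Q ==> \<bar>Y om\<bar> <= E"
 shows "(LINT om|Q. Y om * ((LINT x|om t. f x)\<^sup>2 - (LINT x|om s. f x)\<^sup>2))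
   = (LINT om|Q. Y om * (LINT r:{s..t}|lborel. (LINT x|om r. f x) * (LINT x|om r. a x * f'' x)
    + (LINT z|(om r \<Otimes>\<^sub>M om r). \<rho> (fst z - snd z) * f' (fst z) * f' (snd z))
    + (LINT x|om r. \<sigma> x * f x * f x) + (LINT x|om r. (f x)\<^sup>2 * \<kappa>\<^sub>2 x)))"
proof -
 obtain D where D: "0 <= D" "!!x. \<bar>f x\<bar> <= D" "!!x. \<bar>f' x\<bar> <= D" "!!x. \<bar>f'' x\<bar> <= D" using C2cfun_bounds[OF f(1)] by metis
 define G where "G n = (%z. (NN n)\<^sup>2 * Gsq (z / NN n))" for n
 define G' where "G' n = (%z. (NN n)\<^sup>2 / NN n * Gsq' (z / NN n))" for n
 define G'' where "G'' n = (%z. (NN n)\<^sup>2 / (NN n)\<^sup>2 * Gsq'' (z / NN n))" for n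
 have gC: "C20fun (G n) (G' n) (G'' n)" for n
  unfolding G_def G'_def G''_def by (rule C20fun_scale[OF C20fun_G(2) NN_ge])
 have gd: "((G j) has_real_derivative G' j z) (at z)" "((G' j) has_real_derivative G'' j z) (at z)" for j z
  using gC[of j] unfolding C20fun_def by blast+
 have Np: "0 < NN j" "NN j \<noteq> 0" for j using NN_ge[of j] by auto
 have gb: "\<bar>G j z\<bar> <= (NN j)\<^sup>2" "\<bar>G' j z\<bar> <= 2 * \<bar>z\<bar>" "\<bar>G'' j z\<bar> <= 36" "\<bar>G j z\<bar> <= 1 * (1 + z\<^sup>2)" for j z
 proof -
  note b = G_bounds[of "z / NN j"] and r = rec_bounds(1)[of "z / NN j"] rec2_le[of "z / NN j"]
  have "Gsq (z / NN j) <= 1" using rec_pos[of "z / NN j"] by (simp add: Gsq_def)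
  then show "\<bar>G j z\<bar> <= (NN j)\<^sup>2" using b(7) mult_left_mono[of "Gsq (z / NN j)" 1 "(NN j)\<^sup>2"] by (simp add: G_def abs_mult)
  have "NN j * \<bar>Gsq' (z / NN j)\<bar> <= NN j * (2 * \<bar>z / NN j\<bar>)" using b(5) Np(1)[of j] by (intro mult_left_mono) auto
  then show "\<bar>G' j z\<bar> <= 2 * \<bar>z\<bar>" using Np(1)[of j] by (simp add: G'_def abs_mult power2_eq_square)
  show "\<bar>G'' j z\<bar> <= 36" using b(3) r Np[of j] by (simp add: G''_def)
  have "(NN j)\<^sup>2 * Gsq (z / NN j) <= (NN j)\<^sup>2 * (z / NN j)\<^sup>2" using b(8) by (intro mult_left_mono) auto
  then have "G j z <= z\<^sup>2" using Np[of j] by (simp add: G_def power_divide)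
  moreover have "0 <= G j z" using b(7) by (simp add: G_def)
  ultimately show "\<bar>G j z\<bar> <= 1 * (1 + z\<^sup>2)" by simp
 qed
 have lim: "(%n. G n z) \<longlonglongrightarrow> z\<^sup>2" "(%n. G' n z) \<longlonglongrightarrow> 2 * z" "(%n. G'' n z) \<longlonglongrightarrow> 2" for z
 proof -
  show "(%n. G n z) \<longlonglongrightarrow> z\<^sup>2" unfolding G_def by (rule Gsq_lim[OF tendsto_const])
  have "(%n. 2 * z * (rec (z / NN n))\<^sup>2) \<longlonglongrightarrow> 2 * z * 1\<^sup>2" by (intro tendsto_intros rec_lim[OF tendsto_const])
  then show "(%n. G' n z) \<longlonglongrightarrow> 2 * z" using Np by (simp add: G'_def Gsq'_def power2_eq_square)
  show "(%n. G'' n z) \<longlonglongrightarrow> 2" using isCont_scale[OF isCont_G(3), of z] Np by (simp add: G''_def Gsq''_def rec_def)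
 qed
 define C where "C = 2 * D * (Ca * D) + 36 * (C\<rho> * D\<^sup>2) + 36 * ((C\<sigma> + \<Gamma>) * D\<^sup>2)"
 have C0: "0 <= C" unfolding C_def using bounds_nonneg \<Gamma> D by (intro add_nonneg_nonneg mult_nonneg_nonneg) auto
 have Cb: "\<bar>LL (G n) (G' n) (G'' n) f f' f'' \<nu>\<bar> <= C * (1 + mass \<nu>)\<^sup>2" if \<nu>: "finite_borel_measure \<nu>" for n \<nu>
 proof -
  have "\<bar>\<integral>x. f x \<partial>\<nu>\<bar> <= D * mass \<nu>" by (rule fbm_integral_bound[OF \<nu> C2cfun_Bm(1)[OF f(1)] D(2)])
  then have b: "\<bar>G' n (LINT x|\<nu>. f x)\<bar> <= 2 * (D * mass \<nu>)" using gb(2)[of n "\<integral>x. f x \<partial>\<nu>"] by linarith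
  have "\<bar>LL (G n) (G' n) (G'' n) f f' f'' \<nu>\<bar> <= 2 * (D * mass \<nu>) * (Ca * D * mass \<nu>) + 36 * (C\<rho> * D\<^sup>2 * (mass \<nu>)\<^sup>2) + 36 * ((C\<sigma> + \<Gamma>) * D\<^sup>2 * mass \<nu>)"
   by (rule Lg_bound[OF \<nu> gd gb(3) b C2cfun_Bm[OF f(1)] D(2-4)])
  also have "\<dots> = (36 * ((C\<sigma> + \<Gamma>) * D\<^sup>2)) * mass \<nu> + (2 * D * (Ca * D) + 36 * (C\<rho> * D\<^sup>2)) * (mass \<nu>)\<^sup>2"
   by (simp add: algebra_simps power2_eq_square)
  also have "\<dots> <= (36 * ((C\<sigma> + \<Gamma>) * D\<^sup>2)) * (1 + mass \<nu>)\<^sup>2 + (2 * D * (Ca * D) + 36 * (C\<rho> * D\<^sup>2)) * (1 + mass \<nu>)\<^sup>2"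
   using bounds_nonneg \<Gamma> D by (intro add_mono mult_left_mono V_mass \<nu>) auto
  also have "\<dots> = C * (1 + mass \<nu>)\<^sup>2" by (simp add: C_def distrib_right)
  finally show ?thesis .
 qed
 \<comment> \<open>For the square the Taylor remainder is exact; this is how the second jump moment
   \<open>\<kappa>\<^sub>2\<close> enters.\<close>
 have j: "jmp (%z. z\<^sup>2) (%z. 2 * z) z u \<xi> = u\<^sup>2 * \<xi>\<^sup>2" for z u \<xi>
  by (simp add: jmp_def power2_eq_square algebra_simps)
 have eq: "LL (%z. z\<^sup>2) (%z. 2 * z) (%z. 2) f f' f'' \<nu> = (LINT x|\<nu>. f x) * (LINT x|\<nu>. a x * f'' x)
    + (LINT z|(\<nu> \<Otimes>\<^sub>M \<nu>). \<rho> (fst z - snd z) * f' (fst z) * f' (snd z))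
    + (LINT x|\<nu>. \<sigma> x * f x * f x) + (LINT x|\<nu>. (f x)\<^sup>2 * \<kappa>\<^sub>2 x)" for \<nu>
  unfolding Lg_def j \<kappa>\<^sub>2_def by simp
 then show ?thesis
  using mart_id_lim[where g = "%z. z\<^sup>2" and g' = "%z. 2 * z" and g'' = "%z. 2", OF gC gb(3) lim gb(1) gb(4) C0 Cb f st Y] by (simp only: eq)
qed


section \<open>Mean measures: \<open>Lam\<close> for X against a weight \<open>Y\<close>,
  \<open>mm\<close> for X \<otimes> X\<close>

definition Lam :: "((real => real measure) => real) => real => (real => real) => real" where
 "Lam Y r h = (LINT om|Q. Y om * (LINT x|om r. h x))"

definition mm :: "real => (real \<times> real => real) => real" where
 "mm r h = (LINT om|Q. (LINT z|(om r \<Otimes>\<^sub>M om r). h z))"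

lemma bounded_integrable:
 assumes m: "X \<in> borel_measurable Q" and r: "0 <= r" and b: "!!om. om \<in> cadlag_paths ==> \<bar>X om\<bar> <= C * V r om" and C: "0 <= C"
 shows "integrable Q X" "r <= T ==> (LINT om|Q. \<bar>X om\<bar>) <= C * MV T"
proof -
 show i: "integrable Q X"
 proof (rule Bochner_Integration.integrable_bound)
  show "integrable Q (%om. C * V r om)" using V_integrable(1)[OF r] by simp
  show "AE om in Q. norm (X om) <= norm (C * V r om)"
   using b by (intro AE_I2) (auto intro!: order_trans[OF _ abs_ge_self])
 qed fact
 assume T: "r <= T"
 have "(LINT om|Q. \<bar>X om\<bar>) <= (LINT om|Q. C * V r om)"
  using i V_integrable(1)[OF r] b by (intro integral_mono) auto
 also have "\<dots> <= C * MV T" using V_integrable(2)[OF r T] C by (simp add: mult_left_mono)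
 finally show "(LINT om|Q. \<bar>X om\<bar>) <= C * MV T" .
qed

lemma integral_V_bound:
 assumes h: "h \<in> Bm" "!!x. \<bar>h x\<bar> <= D" and om: "om \<in> cadlag_paths" "0 <= r"
 shows "\<bar>\<integral>x. h x \<partial>om r\<bar> <= D * V r om"
proof -
 have "0 <= D" using h(2)[of 0] by linarith
 then show ?thesis
  using fbm_integral_bound[OF cadlag_fbm[OF om] h] mult_left_mono[OF V_ge(2)[of om r], of D] by linarith
qed

lemma pair_V_bound:
 fixes h :: "real \<times> real => real"
 assumes h: "h \<in> Bm" "!!x. \<bar>h x\<bar> <= D" and om: "om \<in> cadlag_paths" "0 <= r"
 shows "\<bar>\<integral>z. h z \<partial>(om r \<Otimes>\<^sub>M om r)\<bar> <= D * V r om"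
proof -
 have "0 <= D" using order_trans[OF abs_ge_zero h(2)] .
 then show ?thesis
  using fbm_pair_bound[OF cadlag_fbm[OF om] h] mult_left_mono[OF V_ge(3)[of om r], of D] by linarith
qed

lemma Y_int_integrable:
 assumes Y: "Y \<in> borel_measurable Q" "!!om. om \<in> space Q ==> \<bar>Y om\<bar> <= E" and h: "h \<in> Bm" "!!x. \<bar>h x\<bar> <= D" and r: "0 <= r"
 shows "integrable Q (%om. Y om * (LINT x|om r. h x))" "r <= T ==> (LINT om|Q. \<bar>Y om * (LINT x|om r. h x)\<bar>) <= E * D * MV T"
proof -
 have E0: "0 <= E" using Y(2) not_empty order_trans[OF abs_ge_zero Y(2)] by blast
 have D0: "0 <= D" using order_trans[OF abs_ge_zero h(2)] .
 have m: "(%om. Y om * (LINT x|om r. h x)) \<in> borel_measurable Q"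
  using mkernel_Bm[OF mkernel_Q[OF r] h(1)] Y(1) by measurable
 have b: "\<bar>Y om * (LINT x|om r. h x)\<bar> <= E * D * V r om" if "om \<in> cadlag_paths" for om
  unfolding abs_mult mult.assoc using Y(2)[of om] integral_V_bound[OF h that r] that E0 by (intro mult_mono) auto
 show "integrable Q (%om. Y om * (LINT x|om r. h x))" "r <= T ==> (LINT om|Q. \<bar>Y om * (LINT x|om r. h x)\<bar>) <= E * D * MV T"
  using bounded_integrable[OF m r b] E0 D0 by auto
qed

lemma Lam_lin:
 assumes Y: "Y \<in> borel_measurable Q" "!!om. om \<in> space Q ==> \<bar>Y om\<bar> <= E" and r: "0 <= r"
  and f: "f \<in> Bm" and g: "g \<in> Bm"
 shows "Lam Y r (%x. f x + k * g x) = Lam Y r f + k * Lam Y r g"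
proof -
 obtain D where D: "!!x. \<bar>f x\<bar> <= D" using BmE[OF f] by metis
 obtain D' where D': "!!x. \<bar>g x\<bar> <= D'" using BmE[OF g] by metis
 have "Lam Y r (%x. f x + k * g x) = (LINT om|Q. Y om * (LINT x|om r. f x) + k * (Y om * (LINT x|om r. g x)))"
  unfolding Lam_def
 proof (rule Bochner_Integration.integral_cong[OF refl])
  fix om assume "om \<in> space Q"
  then have fb: "finite_borel_measure (om r)" using r by (auto intro: cadlag_fbm)
  show "Y om * (LINT x|om r. f x + k * g x) = Y om * (LINT x|om r. f x) + k * (Y om * (LINT x|om r. g x))"
   using fbm_integrable[OF fb f] fbm_integrable[OF fb g] by (simp add: algebra_simps)
 qed
 also have "\<dots> = Lam Y r f + k * Lam Y r g"
  unfolding Lam_def using Y_int_integrable(1)[OF Y f D r] Y_int_integrable(1)[OF Y g D' r] by simp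
 finally show ?thesis .
qed

lemma Lam_time:
 assumes Y: "Y \<in> borel_measurable Q" "!!om. om \<in> space Q ==> \<bar>Y om\<bar> <= E" and h: "h \<in> Bm" and st: "0 <= s" "s <= t"
 shows "(LINT om|Q. Y om * (LINT r:{s..t}|lborel. (LINT x|om r. h x))) = (LINT r:{s..t}|lborel. Lam Y r h)"
  and "set_integrable lborel {s..t} (%r. Lam Y r h)"
proof -
 obtain D where D: "!!x. \<bar>h x\<bar> <= D" using BmE[OF h] by metis
 have t: "0 <= t" using st by simp
 have m: "(%z. Y (snd z) * (LINT x|(snd z) (clip t (fst z)). h x)) \<in> borel_measurable (borel \<Otimes>\<^sub>M Q)"
  using mkernel_Bm[OF mkernel_joint[OF t] h] Y(1) by measurable
 note F = LINT_Fubini[where h = "%r om. Y om * (LINT x|om r. h x)", OF st m Y_int_integrable[OF Y h D]]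
 have "(LINT om|Q. (LINT r:{s..t}|lborel. Y om * (LINT x|om r. h x))) = (LINT r:{s..t}|lborel. Lam Y r h)"
  unfolding Lam_def by (rule F(2)) auto
 then show "(LINT om|Q. Y om * (LINT r:{s..t}|lborel. (LINT x|om r. h x))) = (LINT r:{s..t}|lborel. Lam Y r h)" by simp
 show "set_integrable lborel {s..t} (%r. Lam Y r h)" unfolding Lam_def by (rule F(3)) auto
qed

lemma Lam_diff:
 assumes Y: "Y \<in> borel_measurable Q" "!!om. om \<in> space Q ==> \<bar>Y om\<bar> <= E" and h: "h \<in> Bm" and st: "0 <= s" "s <= t"
 shows "(LINT om|Q. Y om * ((LINT x|om t. h x) - (LINT x|om s. h x))) = Lam Y t h - Lam Y s h"
proof -
 obtain D where D: "!!x. \<bar>h x\<bar> <= D" using BmE[OF h] by metis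
 show ?thesis unfolding Lam_def right_diff_distrib
  using Y_int_integrable(1)[OF Y h D] st by (intro Bochner_Integration.integral_diff) auto
qed

definition Gf :: "(real => real) => real => real" where "Gf f'' x = 1/2 * (a x * f'' x)"

text \<open>Admissible test functions are nonnegative. A general \<open>f\<close> is the difference
  of two such functions: a multiple of a wide bump that exceeds |f| on its support is added and
  subtracted.\<close>

theorem first_identity:
 assumes f: "C2cfun f f' f''" and st: "0 <= s" "s <= t"
  and Y: "Y \<in> borel_measurable (path_filt (ennreal s))" "!!om. om \<in> space Q ==> \<bar>Y om\<bar> <= E"
 shows "Lam Y t f - Lam Y s f = (LINT r:{s..t}|lborel. Lam Y r (Gf f''))"
proof -
 note YQ = measurable_from_subalg[OF sub_Q Y(1)]
 have GB: "Gf f'' \<in> Bm" if "f'' \<in> Bm" for f''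
  unfolding Gf_def[abs_def] by (intro Bm_mult a_Bm that Bm_const)
 have nn: "Lam Y t f - Lam Y s f = (LINT r:{s..t}|lborel. Lam Y r (Gf f''))"
  if f: "C2cfun f f' f''" "!!x. 0 <= f x" for f f' f''
  using first_id_nonneg[OF f st Y] Lam_diff[OF YQ Y(2) C2cfun_Bm(1)[OF f(1)] st] Lam_time(1)[OF YQ Y(2) GB[OF C2cfun_Bm(3)[OF f(1)]] st]
  by (simp add: Gf_def)
 obtain R where R: "0 <= R" "!!x. R < \<bar>x\<bar> ==> f x = 0 \<and> f' x = 0 \<and> f'' x = 0" using C2cfun_supp[OF f] by blast
 obtain D where D: "0 <= D" "!!x. \<bar>f x\<bar> <= D" using C2cfun_bounds[OF f] by metis
 \<comment> \<open>On the support of \<open>f\<close> this gives |m x| \<le> 1/2, so the bump is at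
   least (3/4)^3 = 27/64 there, the origin of the factor 64/27. The added 1 covers R = 0.\<close>
 define m where "m = 1 / (2 * (R + 1))"
 have m: "m \<noteq> 0" "0 < m" unfolding m_def using R(1) by auto
 define e where "e = (%x. (64/27 * D) * bump (m * x + 0))"
 define e' where "e' = (%x. (64/27 * D) * m * bump' (m * x + 0))"
 define e'' where "e'' = (%x. (64/27 * D) * m\<^sup>2 * bump'' (m * x + 0))"
 have e: "C2cfun e e' e''" unfolding e_def e'_def e''_def by (rule C2cfun_affine[OF C2cfun_bump m(1)])
 have en: "0 <= e x" for x unfolding e_def using D(1) bump_range(1) by simp
 have sn: "0 <= f x + 1 * e x" for x
 proof (cases "\<bar>x\<bar> <= R")
  case True
  have "\<bar>m * x\<bar> <= 1/2" using True R(1) by (simp add: m_def abs_mult divide_le_eq)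
  then have "(m * x)\<^sup>2 <= (1/2)\<^sup>2" by (metis abs_ge_zero power2_abs power_mono)
  then have "(m * x)\<^sup>2 <= 1/4" by (simp add: power_divide)
  then have q: "3/4 <= max 0 (1 - (m * x)\<^sup>2)" by linarith
  have "(3/4)^3 <= (max 0 (1 - (m * x)\<^sup>2))^3" by (rule power_mono[OF q]) simp
  then have "(3/4)^3 <= bump (m * x + 0)" unfolding bump_def add_0_right .
  then have "27/64 <= bump (m * x + 0)" by (simp add: power3_eq_cube)
  then have "64/27 * D * (27/64) <= e x" unfolding e_def using D(1) by (intro mult_left_mono) auto
  then have "D <= e x" by simp
  then show ?thesis using D(2)[of x] by linarith
 next
  case False
  then show ?thesis using R(2)[of x] en[of x] by simp
 qed
 have fe: "C2cfun (%x. f x + 1 * e x) (%x. f' x + 1 * e' x) (%x. f'' x + 1 * e'' x)" by (rule C2cfun_lin[OF f e])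
 note Bf = C2cfun_Bm[OF f] and Be = C2cfun_Bm[OF e]
 have t: "0 <= t" using st by simp
 note lin = Lam_lin[OF YQ Y(2)]
 have G: "Gf (%x. f'' x + 1 * e'' x) = (%x. Gf f'' x + 1 * Gf e'' x)" by (auto simp: Gf_def algebra_simps)
 have "(LINT r:{s..t}|lborel. Lam Y r (Gf (%x. f'' x + 1 * e'' x))) = (LINT r:{s..t}|lborel. Lam Y r (Gf f'') + 1 * Lam Y r (Gf e''))"
  unfolding G
 proof (rule set_lebesgue_integral_cong)
  show "\<forall>r. r \<in> {s..t} \<longrightarrow> Lam Y r (%x. Gf f'' x + 1 * Gf e'' x) = Lam Y r (Gf f'') + 1 * Lam Y r (Gf e'')"
   using st by (intro allI impI lin GB Bf Be) auto
 qed simp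
 also have "\<dots> = (LINT r:{s..t}|lborel. Lam Y r (Gf f'')) + (LINT r:{s..t}|lborel. Lam Y r (Gf e''))"
  using Lam_time(2)[OF YQ Y(2) GB[OF Bf(3)] st] Lam_time(2)[OF YQ Y(2) GB[OF Be(3)] st] by (simp add: set_integral_add(2))
 finally have "(LINT r:{s..t}|lborel. Lam Y r (Gf (%x. f'' x + 1 * e'' x))) = \<dots>" .
 moreover have "Lam Y t (%x. f x + 1 * e x) = Lam Y t f + 1 * Lam Y t e" by (rule lin[OF _ t Bf(1) Be(1)])
 moreover have "Lam Y s (%x. f x + 1 * e x) = Lam Y s f + 1 * Lam Y s e" by (rule lin[OF _ st(1) Bf(1) Be(1)])
 ultimately show ?thesis using nn[OF fe sn] nn[OF e en] by linarith
qed

end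

section \<open>Product test functions determine linear functionals\<close>

lemma unif_cont_supp:
 fixes w :: "'a::euclidean_space => real"
 assumes w: "continuous_on UNIV w" and supp: "!!z. r < norm z ==> w z = 0" and e: "0 < e"
 obtains d where "0 < d" "!!z z'. dist z z' < d ==> \<bar>w z - w z'\<bar> < e"
proof -
 have "uniformly_continuous_on (cball 0 (r + 1)) w"
  by (rule compact_uniformly_continuous[OF continuous_on_subset[OF w]]) auto
 then obtain d where d: "0 < d" "!!z z'. z \<in> cball 0 (r + 1) ==> z' \<in> cball 0 (r + 1) ==> dist z' z < d ==> dist (w z') (w z) < e"
  unfolding uniformly_continuous_on_def using e by metis
 show thesis
 proof (rule that[of "min d 1"])
  fix z z' :: 'a assume zz: "dist z z' < min d 1"
  have far: "\<bar>w y - w y'\<bar> < e" if "y \<notin> cball 0 (r + 1)" "dist y y' < 1" for y y'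
  proof -
   have "r + 1 < norm y" using that(1) by simp
   moreover have "norm y <= norm y' + dist y y'" by (metis add.commute dist_commute dist_norm norm_triangle_sub)
   ultimately have "r < norm y" "r < norm y'" using that(2) by linarith+
   then show ?thesis using supp e by simp
  qed
  show "\<bar>w z - w z'\<bar> < e"
  proof (cases "z \<in> cball 0 (r + 1) \<and> z' \<in> cball 0 (r + 1)")
   case True
   then show ?thesis using d(2)[of z' z] zz by (simp add: dist_real_def)
  next
   case False
   then show ?thesis using far[of z z'] far[of z' z] zz by (auto simp: dist_commute abs_minus_commute)
  qed
 qed (use d in simp)
qed

lemma C2cfun_unif:
 fixes A :: "real => real"
 assumes "continuous_on UNIV A" "!!x. r < \<bar>x\<bar> ==> A x = 0" "0 < e"
 obtains d where "0 < d" "!!z z'. \<bar>z - z'\<bar> < d ==> \<bar>A z - A z'\<bar> < e"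
 using unif_cont_supp[of A r e] assms by (auto simp: dist_real_def)

lemma cont_comp: "continuous_on UNIV A ==> continuous_on S g ==> continuous_on S (%z. A (g z))"
 by (rule continuous_on_compose2) auto

text \<open>Continuous maps into a Banach space are integrable over boxes; this applies to maps into
  the bounded continuous functions with the sup norm.\<close>

instance bcontfun :: (metric_space, banach) banach ..

text \<open>The convolution of \<open>w\<close> with the product kernel A \<otimes> B, provided that
  the square contains the support of \<open>w\<close>.\<close>

definition boxint :: "real => (real \<times> real => real) => (real => real) => (real => real) => real \<times> real => real" where
 "boxint R w A B p = integral (cbox (-R, -R) (R, R)) (%z. w z * (A (fst p - fst z) * B (snd p - snd z)))"

lemma boxint_integrand_cont:
 fixes w :: "real \<times> real => real" and A B :: "real => real"
 assumes "continuous_on UNIV w" "continuous_on UNIV A" "continuous_on UNIV B"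
 shows "continuous_on S (%z::real \<times> real. w z * (A (x - fst z) * B (y - snd z)))"
 by (intro continuous_intros cont_comp[OF assms(2)] cont_comp[OF assms(3)] continuous_on_subset[OF assms(1)]) auto

text \<open>\<open>\<Lambda>\<close> has to be exchanged with an integral although it is given only
  by linearity and a sup-norm bound. The integrand is read as a continuous curve in the bounded
  continuous functions, where \<open>\<Lambda>\<close> is a bounded linear map and commutes with the
  integral.\<close>

lemma boxint_functional:
 fixes \<Lambda> :: "(real \<times> real => real) => real"
 assumes lin: "!!f g k. f \<in> Bm ==> g \<in> Bm ==> \<Lambda> (%x. f x + k * g x) = \<Lambda> f + k * \<Lambda> g"
  and bd: "!!f c. f \<in> Bm ==> (!!x. \<bar>f x\<bar> <= c) ==> \<bar>\<Lambda> f\<bar> <= C * c"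
  and w: "continuous_on UNIV w" "!!z. R0 < norm z ==> w z = 0"
  and A: "continuous_on UNIV A" "!!x. r < \<bar>x\<bar> ==> A x = 0"
  and B: "continuous_on UNIV B" "!!x. r < \<bar>x\<bar> ==> B x = 0"
 shows "(%z. w z * \<Lambda> (%p. A (fst p - fst z) * B (snd p - snd z))) integrable_on cbox (-R, -R) (R, R)"
  and "\<Lambda> (boxint R w A B) = integral (cbox (-R, -R) (R, R)) (%z. w z * \<Lambda> (%p. A (fst p - fst z) * B (snd p - snd z)))"
  and "boxint R w A B \<in> Bm"
proof -
 have bdd: "\<exists>c>0. \<forall>x. \<bar>f x\<bar> <= c" if "continuous_on UNIV f" "!!z. r < norm z ==> f z = 0" for f :: "'b::euclidean_space => real" and r
 proof -
  have "f \<in> Chat UNIV" by (rule ChatI[OF that(1) compact_cball[of 0 r]]) (use that(2) in auto)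
  then obtain c where "0 <= c" "!!x. \<bar>f x\<bar> <= c" by (rule Chat_bounded) blast
  then have "0 < c + 1" "\<bar>f x\<bar> <= c + 1" for x by (auto simp: add_increasing2)
  then show ?thesis by blast
 qed
 obtain cw where cw: "0 < cw" "!!z. \<bar>w z\<bar> <= cw" using bdd[OF w] by blast
 obtain cA where cA: "0 < cA" "!!z. \<bar>A z\<bar> <= cA" using bdd[of A r] A by auto
 obtain cB where cB: "0 < cB" "!!z. \<bar>B z\<bar> <= cB" using bdd[of B r] B by auto
 have AB: "(%p. w z * (A (fst p - fst z) * B (snd p - snd z))) \<in> bcontfun" for z
 proof -
  have "continuous_on UNIV (%p. w z * (A (fst p - fst z) * B (snd p - snd z)))"
   by (intro continuous_intros cont_comp[OF A(1)] cont_comp[OF B(1)])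
  moreover have "\<bar>w z * (A (fst p - fst z) * B (snd p - snd z))\<bar> <= cw * (cA * cB)" for p
   unfolding abs_mult using cw cA cB by (intro mult_mono) auto
  then have "bounded (range (%p. w z * (A (fst p - fst z) * B (snd p - snd z))))"
   unfolding bounded_iff by (intro exI[of _ "cw * (cA * cB)"]) auto
  ultimately show ?thesis by (simp add: bcontfun_def)
 qed
 define \<Phi> where "\<Phi> z = Bcontfun (%p. w z * (A (fst p - fst z) * B (snd p - snd z)))" for z
 have \<Phi>: "apply_bcontfun (\<Phi> z) p = w z * (A (fst p - fst z) * B (snd p - snd z))" for z p
  unfolding \<Phi>_def using AB[of z] by (simp add: Bcontfun_inverse)
 have cont: "continuous_on S \<Phi>" for S
  unfolding continuous_on_iff
 proof (intro ballI allI impI)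
  fix z0 and e :: real assume e: "0 < e"
  \<comment> \<open>The three summands bound the telescoped difference of the triple product w A B,
    one factor moving at a time.\<close>
  define M where "M = cA * cB + cw * cB + cw * cA"
  have M: "0 < M" using cA(1) cB(1) cw(1) by (simp add: M_def add_pos_pos)
  define \<eta> where "\<eta> = e / (2 * M)"
  have \<eta>: "0 < \<eta>" "M * \<eta> < e" using e M by (auto simp: \<eta>_def)
  obtain d1 where d1: "0 < d1" "!!z z'. dist z z' < d1 ==> \<bar>w z - w z'\<bar> < \<eta>" using unif_cont_supp[OF w \<eta>(1)] by metis
  obtain d2 where d2: "0 < d2" "!!z z'. \<bar>z - z'\<bar> < d2 ==> \<bar>A z - A z'\<bar> < \<eta>" using C2cfun_unif[OF A \<eta>(1)] by metis
  obtain d3 where d3: "0 < d3" "!!z z'. \<bar>z - z'\<bar> < d3 ==> \<bar>B z - B z'\<bar> < \<eta>" using C2cfun_unif[OF B \<eta>(1)] by metis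
  show "\<exists>d>0. \<forall>z\<in>S. dist z z0 < d \<longrightarrow> dist (\<Phi> z) (\<Phi> z0) < e"
  proof (intro exI[of _ "min d1 (min d2 d3)"] conjI ballI impI)
   fix z assume z: "dist z z0 < min d1 (min d2 d3)"
   have f: "\<bar>fst z - fst z0\<bar> < d2" "\<bar>snd z - snd z0\<bar> < d3"
    using dist_fst_le[of z z0] dist_snd_le[of z z0] z by (auto simp: dist_real_def)
   have "dist (\<Phi> z) (\<Phi> z0) <= M * \<eta>"
   proof (rule dist_bound)
    fix p
    define x1 x2 y1 y2 where v: "x1 = A (fst p - fst z)" "x2 = A (fst p - fst z0)" "y1 = B (snd p - snd z)" "y2 = B (snd p - snd z0)"
    have 1: "\<bar>w z - w z0\<bar> <= \<eta>" using d1(2)[of z z0] z by simp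
    have 2: "\<bar>x1 - x2\<bar> <= \<eta>" unfolding v using d2(2)[of "fst p - fst z" "fst p - fst z0"] f by (simp add: abs_minus_commute)
    have 3: "\<bar>y1 - y2\<bar> <= \<eta>" unfolding v using d3(2)[of "snd p - snd z" "snd p - snd z0"] f by (simp add: abs_minus_commute)
    have "w z * (x1 * y1) - w z0 * (x2 * y2) = (w z - w z0) * (x1 * y1) + w z0 * ((x1 - x2) * y1) + w z0 * (x2 * (y1 - y2))"
     by (simp add: algebra_simps)
    also have "\<bar>\<dots>\<bar> <= \<bar>(w z - w z0) * (x1 * y1)\<bar> + \<bar>w z0 * ((x1 - x2) * y1)\<bar> + \<bar>w z0 * (x2 * (y1 - y2))\<bar>" by linarith
    also have "\<dots> <= \<eta> * (cA * cB) + cw * (\<eta> * cB) + cw * (cA * \<eta>)"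
     unfolding abs_mult using 1 2 3 cw cA cB \<eta>(1) v by (intro add_mono mult_mono) auto
    also have "\<dots> = M * \<eta>" by (simp add: M_def algebra_simps)
    finally show "dist (apply_bcontfun (\<Phi> z) p) (apply_bcontfun (\<Phi> z0) p) <= M * \<eta>"
     unfolding \<Phi> dist_real_def v .
   qed
   then show "dist (\<Phi> z) (\<Phi> z0) < e" using \<eta>(2) by simp
  qed (use d1 d2 d3 in simp)
 qed
 have Cb: "apply_bcontfun f \<in> Bm" for f :: "(real \<times> real) \<Rightarrow>\<^sub>C real"
  using apply_bcontfun[of f] by (intro Cb_UNIV_Bm) (simp add: bcontfun_def Cb_def)
 have bl: "bounded_linear (%f :: (real \<times> real) \<Rightarrow>\<^sub>C real. \<Lambda> (apply_bcontfun f))"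
 proof (rule bounded_linear_intro[where K = C])
  fix f g :: "(real \<times> real) \<Rightarrow>\<^sub>C real" and k :: real
  show "\<Lambda> (apply_bcontfun (f + g)) = \<Lambda> (apply_bcontfun f) + \<Lambda> (apply_bcontfun g)"
   using lin[OF Cb[of f] Cb[of g], of 1] by (simp add: plus_bcontfun.rep_eq)
  have "\<bar>\<Lambda> (%x. 0)\<bar> <= C * 0" by (rule bd) auto
  then show "\<Lambda> (apply_bcontfun (k *\<^sub>R f)) = k *\<^sub>R \<Lambda> (apply_bcontfun f)"
   using lin[OF Bm_const[of 0] Cb[of f], of k] by (simp add: scaleR_bcontfun.rep_eq)
  show "norm (\<Lambda> (apply_bcontfun f)) <= norm f * C"
   using bd[OF Cb[of f], of "norm f"] norm_bounded[of f] by (simp add: mult.commute)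
 qed
 have int: "\<Phi> integrable_on cbox (-R, -R) (R, R)" by (rule integrable_continuous, rule cont)
 have ev: "bounded_linear (%f :: (real \<times> real) \<Rightarrow>\<^sub>C real. apply_bcontfun f p)" for p
 proof (rule bounded_linear_intro[where K = 1])
  show "norm (apply_bcontfun f p) <= norm f * 1" for f :: "(real \<times> real) \<Rightarrow>\<^sub>C real" using norm_bounded[of f p] by simp
 qed (auto simp: plus_bcontfun.rep_eq scaleR_bcontfun.rep_eq)
 \<comment> \<open>Evaluation at a point is bounded and linear, so the function-valued integral is
   the pointwise one.\<close>
 have J: "apply_bcontfun (integral (cbox (-R, -R) (R, R)) \<Phi>) = boxint R w A B"
 proof
  fix p
  show "apply_bcontfun (integral (cbox (-R, -R) (R, R)) \<Phi>) p = boxint R w A B p"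
   using integral_linear[OF int ev[of p]] by (simp add: boxint_def \<Phi> o_def)
 qed
 have sc: "\<Lambda> (apply_bcontfun (\<Phi> z)) = w z * \<Lambda> (%p. A (fst p - fst z) * B (snd p - snd z))" for z
 proof -
  have "continuous_on UNIV (%p. A (fst p - fst z) * B (snd p - snd z))"
   by (intro continuous_intros cont_comp[OF A(1)] cont_comp[OF B(1)])
  then have "(%p. A (fst p - fst z) * B (snd p - snd z)) \<in> borel_measurable borel" by (rule borel_measurable_continuous_onI)
  moreover have "\<bar>A (fst p - fst z) * B (snd p - snd z)\<bar> <= cA * cB" for p
   unfolding abs_mult using cA cB by (intro mult_mono) auto
  ultimately have m: "(%p. A (fst p - fst z) * B (snd p - snd z)) \<in> Bm" by (rule BmI)
  have "\<bar>\<Lambda> (%x. 0)\<bar> <= C * 0" by (rule bd) auto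
  moreover have "apply_bcontfun (\<Phi> z) = (%p. w z * (A (fst p - fst z) * B (snd p - snd z)))" using \<Phi> by blast
  ultimately show ?thesis using lin[OF Bm_const[of 0] m, of "w z"] by simp
 qed
 show "(%z. w z * \<Lambda> (%p. A (fst p - fst z) * B (snd p - snd z))) integrable_on cbox (-R, -R) (R, R)"
  using integrable_linear[OF int bl] by (simp add: o_def sc)
 show "\<Lambda> (boxint R w A B) = integral (cbox (-R, -R) (R, R)) (%z. w z * \<Lambda> (%p. A (fst p - fst z) * B (snd p - snd z)))"
  using integral_linear[OF int bl] by (simp add: J o_def sc)
 show "boxint R w A B \<in> Bm" unfolding J[symmetric] by (rule Cb)
qed

text \<open>Integration by parts in one variable of the square: \<open>w\<close> vanishes on the
  edges, and the sign cancels against the one from differentiating \<open>A (x - u)\<close> in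
  \<open>u\<close>.\<close>

lemma boxint_parts:
 assumes w: "continuous_on UNIV w" "continuous_on UNIV w1" "!!z. R0 < norm z ==> w z = 0" and R: "0 <= R0" "R0 < R"
  and A: "continuous_on UNIV A'" "!!x. (A has_real_derivative A' x) (at x)" and B: "continuous_on UNIV B"
 shows "(!!u v. ((%u. w (u, v)) has_real_derivative w1 (u, v)) (at u)) ==> boxint R w A' B p = boxint R w1 A B p"
  and "(!!u v. ((%v. w (u, v)) has_real_derivative w1 (u, v)) (at v)) ==> boxint R w B A' p = boxint R w1 B A p"
proof -
 have Ac: "continuous_on UNIV A" using A(2) by (intro DERIV_continuous_on) (auto intro: has_field_derivative_at_within)
 have ibp: "integral {-R..R} (%u. q u * A' (x - u)) = integral {-R..R} (%u. q' u * A (x - u))"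
  if q: "!!u. (q has_real_derivative q' u) (at u)" "continuous_on UNIV q'" "q R = 0" "q (-R) = 0" for q q' x
 proof -
  have qc: "continuous_on UNIV q" using q(1) by (intro DERIV_continuous_on) (auto intro: has_field_derivative_at_within)
  have c: "continuous_on {-R..R} (%u. q u * A' (x - u))" "continuous_on {-R..R} (%u. q' u * A (x - u))"
   by (intro continuous_intros cont_comp[OF A(1)] cont_comp[OF Ac] continuous_on_subset[OF qc] continuous_on_subset[OF q(2)] subset_UNIV)+
  note i = integrable_continuous_real[OF c(1)] integrable_continuous_real[OF c(2)]
  have "((%u. q' u * A (x - u) - q u * A' (x - u)) has_integral (q R * A (x - R) - q (-R) * A (x - (-R)))) {-R..R}"
  proof (rule fundamental_theorem_of_calculus)
   fix u
   have "((%u. A (x - u)) has_real_derivative A' (x - u) * (0 - 1)) (at u)"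
    by (rule DERIV_chain2[OF A(2)]) (auto intro!: derivative_eq_intros)
   from DERIV_mult[OF q(1)[of u] this]
   have "((%u. q u * A (x - u)) has_real_derivative q' u * A (x - u) - q u * A' (x - u)) (at u)" by (rule DERIV_cong) (simp add: algebra_simps)
   then show "((%u. q u * A (x - u)) has_vector_derivative q' u * A (x - u) - q u * A' (x - u)) (at u within {-R..R})"
    unfolding has_real_derivative_iff_has_vector_derivative by (rule has_vector_derivative_at_within)
  qed (use R in simp)
  then have "integral {-R..R} (%u. q' u * A (x - u) - q u * A' (x - u)) = 0" using q by (simp add: integral_unique)
  then show ?thesis using Henstock_Kurzweil_Integration.integral_diff[OF i(2) i(1)] by simp
 qed
 have edge: "w (R, v) = 0" "w (-R, v) = 0" "w (v, R) = 0" "w (v, -R) = 0" for v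
  using w(3) R norm_fst_le[of R v] norm_fst_le[of "-R" v] norm_snd_le[of R v] norm_snd_le[of "-R" v] by auto
 have wc: "continuous_on UNIV (%u. w1 (u, v))" "continuous_on UNIV (%u. w1 (v, u))" for v
  by (intro continuous_intros cont_comp[OF w(2)])+
 have it: "integral (cbox (-R, -R) (R, R)) f = integral {-R..R} (%u. integral {-R..R} (%v. f (u, v)))"
  "integral (cbox (-R, -R) (R, R)) f = integral {-R..R} (%v. integral {-R..R} (%u. f (u, v)))"
  if "!!S. continuous_on S f" for f :: "real \<times> real => real"
 proof -
  show 1: "integral (cbox (-R, -R) (R, R)) f = integral {-R..R} (%u. integral {-R..R} (%v. f (u, v)))"
   using integral_prod_continuous[OF that] by simp
  have "continuous_on (cbox (-R, -R) (R, R)) (%(u, v). f (u, v))" using that by simp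
  from integral_swap_continuous[OF this] 1
  show "integral (cbox (-R, -R) (R, R)) f = integral {-R..R} (%v. integral {-R..R} (%u. f (u, v)))" by simp
 qed
 note bc = boxint_integrand_cont
 show "boxint R w A' B p = boxint R w1 A B p" if d: "!!u v. ((%u. w (u, v)) has_real_derivative w1 (u, v)) (at u)"
 proof -
  have "integral {-R..R} (%u. w (u, v) * (A' (fst p - u) * B (snd p - v))) = integral {-R..R} (%u. w1 (u, v) * (A (fst p - u) * B (snd p - v)))" for v
   using ibp[OF d wc(1) edge(1,2), of v "fst p"] by (simp add: mult.assoc[symmetric])
  then show ?thesis unfolding boxint_def it(2)[OF bc[OF w(1) A(1) B]] it(2)[OF bc[OF w(2) Ac B]] by simp
 qed
 show "boxint R w B A' p = boxint R w1 B A p" if d: "!!u v. ((%v. w (u, v)) has_real_derivative w1 (u, v)) (at v)"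
 proof -
  have "integral {-R..R} (%v. w (u, v) * (B (fst p - u) * A' (snd p - v))) = integral {-R..R} (%v. w1 (u, v) * (B (fst p - u) * A (snd p - v)))" for u
   using ibp[OF d wc(2) edge(3,4), of u "snd p"] by (simp add: mult.left_commute[of _ "B _"])
  then show ?thesis unfolding boxint_def it(1)[OF bc[OF w(1) B A(1)]] it(1)[OF bc[OF w(2) B Ac]] by simp
 qed
qed

text \<open>The kernel has the same mass in each variable, hence its square on the plane, and the
  error is the oscillation of \<open>w\<close> within distance 2 \<epsilon>. The margin 2 in
  \<open>R\<close> leaves room for kernels of radius at most 1 around the support.\<close>

lemma boxint_limit:
 assumes w: "continuous_on UNIV w" "!!z. R0 < norm z ==> w z = 0" and R0: "0 <= R0" and R: "R = R0 + 2"
  and k: "continuous_on UNIV k" "!!x. 0 <= k x" "!!x. \<epsilon> <= \<bar>x\<bar> ==> k x = 0" "!!x. k (- x) = k x" and \<epsilon>: "0 < \<epsilon>" "\<epsilon> <= 1"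
  and mod: "!!z z'. dist z z' < 2 * \<epsilon> ==> \<bar>w z - w z'\<bar> <= \<eta>"
 shows "\<bar>boxint R w k k p - (integral {-\<epsilon>..\<epsilon>} k)\<^sup>2 * w p\<bar> <= \<eta> * (integral {-\<epsilon>..\<epsilon>} k)\<^sup>2"
proof -
 obtain x y where p: "p = (x, y)" by force
 define c where "c = integral {-\<epsilon>..\<epsilon>} k"
 have \<eta>: "0 <= \<eta>" using mod[of p p] \<epsilon> by simp
 note bc = boxint_integrand_cont
 show ?thesis
 proof (cases "\<bar>x\<bar> <= R - \<epsilon> \<and> \<bar>y\<bar> <= R - \<epsilon>")
  case True
  have m: "integral {-R..R} (%u. k (x - u)) = c" if "\<bar>x\<bar> <= R - \<epsilon>" for x
  proof -
   have "k integrable_on {-\<epsilon>..\<epsilon>}" by (rule integrable_continuous_real[OF continuous_on_subset[OF k(1)]]) simp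
   then have "(k has_integral c) {-\<epsilon>..\<epsilon>}" unfolding c_def by (rule integrable_integral)
   then have "(k has_integral c) {- R - x..R - x}"
   proof (rule has_integral_on_superset)
    show "k z = 0" if "z \<notin> {-\<epsilon>..\<epsilon>}" for z using that by (intro k(3)) auto
    show "{-\<epsilon>..\<epsilon>} \<subseteq> {- R - x..R - x}" using that by auto
   qed
   then have "integral {- R - x..R - x} k = c" by (rule integral_unique)
   then have "integral {-R..R} (%u. k (u + - x)) = c" using integral_shift_real_ivl[of "-R - x" "-x" "R - x" k] by simp
   moreover have "k (u + - x) = k (x - u)" for u using k(4)[of "x - u"] by simp
   ultimately show ?thesis by simp
  qed
  have ic: "(%z. f z * (k (x - fst z) * k (y - snd z))) integrable_on cbox (-R, -R) (R, R)" if "continuous_on UNIV f" for f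
   by (rule integrable_continuous[OF bc[OF that k(1) k(1)]])
  have mass1: "integral (cbox (-R, -R) (R, R)) (%z. a * (k (x - fst z) * k (y - snd z))) = a * c\<^sup>2" for a
  proof -
   have "integral (cbox (-R, -R) (R, R)) (%z. a * (k (x - fst z) * k (y - snd z)))
     = integral {-R..R} (%u. integral {-R..R} (%v. a * (k (x - u) * k (y - v))))"
    using integral_prod_continuous[OF bc[OF continuous_on_const k(1) k(1)], of "-R" "-R" R R a x y] by simp
   also have "\<dots> = integral {-R..R} (%u. (a * c) * k (x - u))" using m[of y] True by (simp add: mult.assoc[symmetric])
   also have "\<dots> = a * c\<^sup>2" using m[of x] True by (simp add: power2_eq_square)
   finally show ?thesis .
  qed
  have "integral (cbox (-R, -R) (R, R)) (%z. w z * (k (x - fst z) * k (y - snd z))) - c\<^sup>2 * w (x, y)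
    = integral (cbox (-R, -R) (R, R)) (%z. w z * (k (x - fst z) * k (y - snd z)) - w (x, y) * (k (x - fst z) * k (y - snd z)))"
   unfolding Henstock_Kurzweil_Integration.integral_diff[OF ic[OF w(1)] ic[OF continuous_on_const]] mass1 by (simp only: mult.commute)
  then have "boxint R w k k p - c\<^sup>2 * w p = integral (cbox (-R, -R) (R, R)) (%z. (w z - w p) * (k (x - fst z) * k (y - snd z)))"
   unfolding boxint_def p fst_conv snd_conv left_diff_distrib .
  also have "norm \<dots> <= integral (cbox (-R, -R) (R, R)) (%z. \<eta> * (k (x - fst z) * k (y - snd z)))"
  proof (rule Henstock_Kurzweil_Integration.integral_norm_bound_integral)
   show "(%z. (w z - w p) * (k (x - fst z) * k (y - snd z))) integrable_on cbox (-R, -R) (R, R)"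
    by (rule ic) (intro continuous_intros w(1))
   show "(%z. \<eta> * (k (x - fst z) * k (y - snd z))) integrable_on cbox (-R, -R) (R, R)" by (rule ic) (rule continuous_on_const)
   fix z :: "real \<times> real"
   show "norm ((w z - w p) * (k (x - fst z) * k (y - snd z))) <= \<eta> * (k (x - fst z) * k (y - snd z))"
   proof (cases "\<bar>x - fst z\<bar> < \<epsilon> \<and> \<bar>y - snd z\<bar> < \<epsilon>")
    case True
    have "dist z p <= \<bar>x - fst z\<bar> + \<bar>y - snd z\<bar>"
     unfolding p dist_prod_def using sqrt_sum_squares_le_sum_abs[of "x - fst z" "y - snd z"] by (simp add: dist_real_def abs_minus_commute)
    then have "\<bar>w z - w p\<bar> <= \<eta>" using True by (intro mod) linarith
    then show ?thesis unfolding real_norm_def abs_mult using k(2) by (intro mult_mono) auto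
   next
    case False
    then have 0: "k (x - fst z) * k (y - snd z) = 0" using k(3)[of "x - fst z"] k(3)[of "y - snd z"] by auto
    show ?thesis unfolding 0 by simp
   qed
  qed
  also have "\<dots> = \<eta> * c\<^sup>2" by (rule mass1)
  finally show ?thesis unfolding c_def by simp
 next
  \<comment> \<open>Here \<open>p\<close> is farther than \<epsilon> from the support of
    \<open>w\<close> in some coordinate, so the convolution and \<open>w p\<close> both
    vanish.\<close>
  case False
  have far: "R0 < norm p" using False R \<epsilon> norm_fst_le[of x y] norm_snd_le[of y x] by (auto simp: p)
  have Z: "w z * (k (fst p - fst z) * k (snd p - snd z)) = 0" for z
  proof (cases "R0 < norm z")
   case True then show ?thesis using w(2) by simp
  next
   case nz: False
   have "\<bar>fst z\<bar> <= R0" "\<bar>snd z\<bar> <= R0" using nz norm_fst_le[of "fst z" "snd z"] norm_snd_le[of "snd z" "fst z"] by auto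
   then have "\<epsilon> <= \<bar>x - fst z\<bar> \<or> \<epsilon> <= \<bar>y - snd z\<bar>" using False R \<epsilon> by linarith
   then show ?thesis using k(3)[of "x - fst z"] k(3)[of "y - snd z"] p by auto
  qed
  have "boxint R w k k p = 0" unfolding boxint_def Z by simp
  then show ?thesis using w(2)[OF far] \<eta> by simp
 qed
qed

text \<open>\<open>pde\<close> differentiates along a line at parameter 0; shifting the parameter
  gives the ordinary partial derivatives.\<close>

lemma pde_partial:
 fixes F :: "real \<times> real => real"
 assumes "!!z. (%r. F (z + r *\<^sub>R b)) differentiable (at 0)"
 shows "b = (1, 0) ==> ((%u. F (u, v)) has_real_derivative pde b F (u, v)) (at u)"
  and "b = (0, 1) ==> ((%v. F (u, v)) has_real_derivative pde b F (u, v)) (at v)"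
proof -
 have d: "((%r. F ((u, v) + r *\<^sub>R b)) has_real_derivative pde b F (u, v)) (at 0)"
  unfolding pde_def using assms[of "(u, v)"] by (metis DERIV_deriv_iff_real_differentiable)
 show "((%u. F (u, v)) has_real_derivative pde b F (u, v)) (at u)" if "b = (1, 0)"
  using d DERIV_shift[of "%u. F (u, v)" "pde b F (u, v)" 0 u] that by (simp add: add.commute)
 show "((%v. F (u, v)) has_real_derivative pde b F (u, v)) (at v)" if "b = (0, 1)"
  using d DERIV_shift[of "%v. F (u, v)" "pde b F (u, v)" 0 v] that by (simp add: add.commute)
qed

lemma pde_supp:
 fixes F :: "'a::euclidean_space => real"
 assumes "!!z. R0 < norm z ==> F z = 0" "R0 < norm z"
 shows "pde b F z = 0"
proof -
 have c: "continuous_on UNIV (%r. norm (z + r *\<^sub>R b))" by (intro continuous_intros)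
 have "open {r. R0 < norm (z + r *\<^sub>R b)}" using open_Collect_less[OF continuous_on_const c] by simp
 then have "((%r. F (z + r *\<^sub>R b)) has_real_derivative 0) (at 0)"
  by (rule has_field_derivative_transform_within_open[OF DERIV_const[of 0]]) (use assms in auto)
 then show ?thesis unfolding pde_def by (rule DERIV_imp_deriv)
qed

text \<open>Convolution with k \<otimes> k turns F, up to a small error and a factor, into a
  superposition of shifted products, for which the identity is assumed. The functionals pass under
  the integral, the derivatives move from \<open>k\<close> onto \<open>F\<close>, and the kernel
  shrinks. \<open>\<Lambda> 3\<close> and \<open>\<Lambda> 4\<close> stand for the two orders of
  mixed differentiation, which \<open>Gop\<close> pairs with \<open>\<rho>\<close> at opposite
  arguments.\<close>

theorem tensor_extension:
 fixes \<Lambda> :: "nat => (real \<times> real => real) => real"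
 assumes lin: "!!i f g k. f \<in> Bm ==> g \<in> Bm ==> \<Lambda> i (%x. f x + k * g x) = \<Lambda> i f + k * \<Lambda> i g"
  and bd: "!!i f c. f \<in> Bm ==> (!!x. \<bar>f x\<bar> <= c) ==> \<bar>\<Lambda> i f\<bar> <= C * c"
  and id: "!!f f' f'' g g' g''. C2cfun f f' f'' ==> C2cfun g g' g'' ==> (!!x. 0 <= f x) ==> (!!x. 0 <= g x) ==>
   \<Lambda> 0 (%p. f (fst p) * g (snd p)) + \<Lambda> 1 (%p. f'' (fst p) * g (snd p)) + \<Lambda> 2 (%p. f (fst p) * g'' (snd p))
   + \<Lambda> 3 (%p. f' (fst p) * g' (snd p)) + \<Lambda> 4 (%p. f' (fst p) * g' (snd p)) = 0"
  and F: "F \<in> Ccinf"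
 defines "b1 \<equiv> (1, 0) :: real \<times> real" and "b2 \<equiv> (0, 1) :: real \<times> real"
 shows "\<Lambda> 0 F + \<Lambda> 1 (pde b1 (pde b1 F)) + \<Lambda> 2 (pde b2 (pde b2 F)) + \<Lambda> 3 (pde b1 (pde b2 F)) + \<Lambda> 4 (pde b2 (pde b1 F)) = 0"
proof -
 have bB: "b1 \<in> Basis" "b2 \<in> Basis" by (auto simp: b1_def b2_def Basis_prod_def)
 obtain K where K: "compact K" "!!x. x \<notin> K ==> F x = 0" using F unfolding Ccinf_def by blast
 obtain r0 where r0: "!!x. x \<in> K ==> norm x <= r0" using compact_imp_bounded[OF K(1)] unfolding bounded_iff by blast
 define R0 where "R0 = \<bar>r0\<bar>"
 have R0: "0 <= R0" by (simp add: R0_def)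
 have S0: "F z = 0" if "R0 < norm z" for z using K(2)[of z] r0[of z] that unfolding R0_def by (cases "z \<in> K") auto
 define W where "W = (%i::nat. if i = 0 then F else if i = 1 then pde b1 (pde b1 F) else if i = 2 then pde b2 (pde b2 F)
   else if i = 3 then pde b1 (pde b2 F) else pde b2 (pde b1 F))"
 have FC: "\<forall>bs. set bs \<subseteq> Basis \<longrightarrow> continuous_on UNIV (foldr pde bs F) \<and>
   (\<forall>b\<in>Basis. \<forall>x. (%r. foldr pde bs F (x + r *\<^sub>R b)) differentiable (at 0))"
  using F unfolding Ccinf_def by blast
 have cF: "continuous_on UNIV (foldr pde bs F)" if "set bs \<subseteq> {b1, b2}" for bs
  using FC that bB by blast
 have dF: "(%r. foldr pde bs F (x + r *\<^sub>R b)) differentiable (at 0)" if "set bs \<subseteq> {b1, b2}" "b \<in> Basis" for bs b x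
  using FC that bB by blast
 have c0: "continuous_on UNIV F" using cF[of "[]"] by simp
 have c1: "continuous_on UNIV (pde b1 F)" "continuous_on UNIV (pde b2 F)" using cF[of "[b1]"] cF[of "[b2]"] by auto
 have c2: "continuous_on UNIV (pde b1 (pde b1 F))" "continuous_on UNIV (pde b1 (pde b2 F))" "continuous_on UNIV (pde b2 (pde b1 F))" "continuous_on UNIV (pde b2 (pde b2 F))"
  using cF[of "[b1, b1]"] cF[of "[b1, b2]"] cF[of "[b2, b1]"] cF[of "[b2, b2]"] by auto
 have D0: "((%u. F (u, v)) has_real_derivative pde b1 F (u, v)) (at u)" "((%v. F (u, v)) has_real_derivative pde b2 F (u, v)) (at v)" for u v
  using pde_partial[of F b1] pde_partial[of F b2] dF[of "[]" b1] dF[of "[]" b2] bB unfolding b1_def b2_def by auto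
 have D1: "((%u. pde b1 F (u, v)) has_real_derivative pde b1 (pde b1 F) (u, v)) (at u)" "((%v. pde b1 F (u, v)) has_real_derivative pde b2 (pde b1 F) (u, v)) (at v)" for u v
  using pde_partial[of "pde b1 F" b1] pde_partial[of "pde b1 F" b2] dF[of "[b1]" b1] dF[of "[b1]" b2] bB unfolding b1_def b2_def by auto
 have D2: "((%u. pde b2 F (u, v)) has_real_derivative pde b1 (pde b2 F) (u, v)) (at u)" "((%v. pde b2 F (u, v)) has_real_derivative pde b2 (pde b2 F) (u, v)) (at v)" for u v
  using pde_partial[of "pde b2 F" b1] pde_partial[of "pde b2 F" b2] dF[of "[b2]" b1] dF[of "[b2]" b2] bB unfolding b1_def b2_def by auto
 have S1: "pde b F z = 0" if "R0 < norm z" for b z by (rule pde_supp[OF S0 that])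
 have S2: "pde b (pde b' F) z = 0" if "R0 < norm z" for b b' z by (rule pde_supp[OF S1 that])
 have W: "continuous_on UNIV (W i)" "R0 < norm z ==> W i z = 0" for i z unfolding W_def using c0 c2 S0 S2 by auto
 have WB: "W i \<in> Bm" for i by (rule Chat_Bm, rule ChatI[OF W(1) compact_cball[of 0 R0]]) (use W(2) in auto)
 define R where "R = R0 + 2"
 have R: "R0 < R" by (simp add: R_def)
 have "\<Lambda> 0 (W 0) + \<Lambda> 1 (W 1) + \<Lambda> 2 (W 2) + \<Lambda> 3 (W 3) + \<Lambda> 4 (W 4) = 0"
 proof (rule eq_0_by_eps[where C = "5 * C"])
  fix \<eta> :: real assume \<eta>: "0 < \<eta>"
  have "\<exists>d>0. \<forall>z z'. dist z z' < d \<longrightarrow> \<bar>W i z - W i z'\<bar> < \<eta>" for i using unif_cont_supp[OF W(1) W(2) \<eta>] by metis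
  then obtain d where d: "!!i. 0 < d i" "!!i z z'. dist z z' < d i ==> \<bar>W i z - W i z'\<bar> < \<eta>" by metis
  \<comment> \<open>\<open>boxint_limit\<close> sees oscillations up to distance 2 \<epsilon>, hence
    the half; the cap 1 is its condition on the radius. The minimum serves all five functions at
    once.\<close>
  define \<epsilon> where "\<epsilon> = min 1 (Min (d ` {..4}) / 2)"
  have \<epsilon>: "0 < \<epsilon>" "\<epsilon> <= 1" using d(1) by (auto simp: \<epsilon>_def)
  have \<epsilon>d: "2 * \<epsilon> <= d i" if "i <= 4" for i
  proof -
   have "Min (d ` {..4}) <= d i" using that by (intro Min_le) auto
   moreover have "2 * \<epsilon> <= Min (d ` {..4})" unfolding \<epsilon>_def by linarith
   ultimately show ?thesis by linarith
  qed
  define k where "k = (%x. 1 * bump (1/\<epsilon> * x + 0))"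
  define k' where "k' = (%x. 1 * (1/\<epsilon>) * bump' (1/\<epsilon> * x + 0))"
  define k'' where "k'' = (%x. 1 * (1/\<epsilon>)\<^sup>2 * bump'' (1/\<epsilon> * x + 0))"
  have kC: "C2cfun k k' k''" unfolding k_def k'_def k''_def by (rule C2cfun_affine[OF C2cfun_bump]) (use \<epsilon> in simp)
  have kd: "!!x. (k has_real_derivative k' x) (at x)" "!!x. (k' has_real_derivative k'' x) (at x)" "continuous_on UNIV k''"
   using kC unfolding C2cfun_def by blast+
  have kc: "continuous_on UNIV k" "continuous_on UNIV k'"
   using kd(1,2) by (auto intro!: DERIV_continuous_on intro: has_field_derivative_at_within)
  obtain r where r: "!!x. r < \<bar>x\<bar> ==> k x = 0 \<and> k' x = 0 \<and> k'' x = 0" using C2cfun_supp[OF kC] by blast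
  have k0: "0 <= k x" for x unfolding k_def using bump_range by simp
  have ks: "k x = 0" if "\<epsilon> <= \<bar>x\<bar>" for x
  proof -
   have "\<epsilon>\<^sup>2 <= x\<^sup>2" using that \<epsilon>(1) by (metis abs_le_square_iff abs_of_pos)
   then have "1 <= (x / \<epsilon>)\<^sup>2" using \<epsilon>(1) by (simp add: power_divide)
   then show ?thesis by (simp add: k_def bump_def)
  qed
  have ke: "k (- x) = k x" for x by (simp add: k_def bump_def)
  define c where "c = integral {-\<epsilon>..\<epsilon>} k"
  have c: "0 < c"
  proof -
   have kI: "continuous_on {-\<epsilon>..\<epsilon>} k" using kc(1) by (rule continuous_on_subset) simp
   have "k 0 \<noteq> 0" by (simp add: k_def bump_def)
   then have "c \<noteq> 0" unfolding c_def using integral_eq_0_iff[OF kI _ k0] \<epsilon> by auto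
   moreover have "0 <= c" unfolding c_def by (rule Henstock_Kurzweil_Integration.integral_nonneg[OF integrable_continuous_real[OF kI] k0])
   ultimately show ?thesis by simp
  qed
  have shift: "C2cfun (%x. k (x - u)) (%x. k' (x - u)) (%x. k'' (x - u))" for u
   using C2cfun_affine[OF kC, of 1 1 "-u"] by simp
  \<comment> \<open>\<open>F\<close> is the weight and the product is shifted by \<open>z\<close>;
    the sum of the five integrands then vanishes at every \<open>z\<close> by the assumed
    identity.\<close>
  define T where "T i A B = (%z. F z * \<Lambda> i (%p. A (fst p - fst z) * B (snd p - snd z)))" for i A B
  let ?I = "integral (cbox (-R, -R) (R, R))"
  have Tz: "T 0 k k z + T 1 k'' k z + T 2 k k'' z + T 3 k' k' z + T 4 k' k' z = 0" for z
   using id[OF shift[of "fst z"] shift[of "snd z"] k0 k0] unfolding T_def by (simp only: distrib_left[symmetric] mult_zero_right)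
  have bf: "(%z. F z * \<Lambda> i (%p. A (fst p - fst z) * B (snd p - snd z))) integrable_on cbox (-R, -R) (R, R)"
   "\<Lambda> i (boxint R F A B) = ?I (%z. F z * \<Lambda> i (%p. A (fst p - fst z) * B (snd p - snd z)))"
   if "continuous_on UNIV A" "!!x. r < \<bar>x\<bar> ==> A x = 0" "continuous_on UNIV B" "!!x. r < \<bar>x\<bar> ==> B x = 0" for i A B
   by (rule boxint_functional[where \<Lambda> = "\<Lambda> i"]; fact lin bd c0 S0 that)+
  have sk: "!!x. r < \<bar>x\<bar> ==> k x = 0" "!!x. r < \<bar>x\<bar> ==> k' x = 0" "!!x. r < \<bar>x\<bar> ==> k'' x = 0" using r by auto
  have Ti: "T i k k integrable_on cbox (-R, -R) (R, R)" "T i k'' k integrable_on cbox (-R, -R) (R, R)"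
   "T i k k'' integrable_on cbox (-R, -R) (R, R)" "T i k' k' integrable_on cbox (-R, -R) (R, R)" for i
   unfolding T_def by (intro bf(1) kc kd sk; assumption)+
  have TB: "\<Lambda> i (boxint R F k k) = ?I (T i k k)" "\<Lambda> i (boxint R F k'' k) = ?I (T i k'' k)"
   "\<Lambda> i (boxint R F k k'') = ?I (T i k k'')" "\<Lambda> i (boxint R F k' k') = ?I (T i k' k')" for i
   unfolding T_def by (intro bf(2) kc kd sk; assumption)+
  have s1: "(%z. T 0 k k z + T 1 k'' k z) integrable_on cbox (-R, -R) (R, R)" using Ti by (intro integrable_add)
  have s2: "(%z. T 0 k k z + T 1 k'' k z + T 2 k k'' z) integrable_on cbox (-R, -R) (R, R)" using s1 Ti by (intro integrable_add)
  have s3: "(%z. T 0 k k z + T 1 k'' k z + T 2 k k'' z + T 3 k' k' z) integrable_on cbox (-R, -R) (R, R)" using s2 Ti by (intro integrable_add)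
  have "?I (%z. T 0 k k z + T 1 k'' k z + T 2 k k'' z + T 3 k' k' z + T 4 k' k' z) = 0" unfolding Tz by simp
  then have sum0: "\<Lambda> 0 (boxint R F k k) + \<Lambda> 1 (boxint R F k'' k) + \<Lambda> 2 (boxint R F k k'') + \<Lambda> 3 (boxint R F k' k') + \<Lambda> 4 (boxint R F k' k') = 0"
   unfolding TB Henstock_Kurzweil_Integration.integral_add[OF s3 Ti(4)] Henstock_Kurzweil_Integration.integral_add[OF s2 Ti(4)]
    Henstock_Kurzweil_Integration.integral_add[OF s1 Ti(3)] Henstock_Kurzweil_Integration.integral_add[OF Ti(1) Ti(2)] .
  note ibp = boxint_parts[OF _ _ _ R0 R]
  have e1: "boxint R F k'' k = boxint R (W 1) k k"
  proof
   fix p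
   have "boxint R F k'' k p = boxint R (pde b1 F) k' k p" by (rule ibp(1)[OF c0 c1(1) S0 kd(3) kd(2) kc(1) D0(1)])
   also have "\<dots> = boxint R (pde b1 (pde b1 F)) k k p" by (rule ibp(1)[OF c1(1) c2(1) S1 kc(2) kd(1) kc(1) D1(1)])
   finally show "boxint R F k'' k p = boxint R (W 1) k k p" by (simp add: W_def)
  qed
  have e2: "boxint R F k k'' = boxint R (W 2) k k"
  proof
   fix p
   have "boxint R F k k'' p = boxint R (pde b2 F) k k' p" by (rule ibp(2)[OF c0 c1(2) S0 kd(3) kd(2) kc(1) D0(2)])
   also have "\<dots> = boxint R (pde b2 (pde b2 F)) k k p" by (rule ibp(2)[OF c1(2) c2(4) S1 kc(2) kd(1) kc(1) D2(2)])
   finally show "boxint R F k k'' p = boxint R (W 2) k k p" by (simp add: W_def)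
  qed
  \<comment> \<open>One integral is rewritten in two ways: here \<open>F\<close> is differentiated
    first in the second variable, in \<open>e4\<close> first in the first.\<close>
  have e3: "boxint R F k' k' = boxint R (W 3) k k"
  proof
   fix p
   have "boxint R F k' k' p = boxint R (pde b2 F) k' k p" by (rule ibp(2)[OF c0 c1(2) S0 kc(2) kd(1) kc(2) D0(2)])
   also have "\<dots> = boxint R (pde b1 (pde b2 F)) k k p" by (rule ibp(1)[OF c1(2) c2(2) S1 kc(2) kd(1) kc(1) D2(1)])
   finally show "boxint R F k' k' p = boxint R (W 3) k k p" by (simp add: W_def)
  qed
  have e4: "boxint R F k' k' = boxint R (W 4) k k"
  proof
   fix p
   have "boxint R F k' k' p = boxint R (pde b1 F) k k' p" by (rule ibp(1)[OF c0 c1(1) S0 kc(2) kd(1) kc(2) D0(1)])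
   also have "\<dots> = boxint R (pde b2 (pde b1 F)) k k p" by (rule ibp(2)[OF c1(1) c2(3) S1 kc(2) kd(1) kc(1) D1(2)])
   finally show "boxint R F k' k' p = boxint R (W 4) k k p" by (simp add: W_def)
  qed
  have e0: "boxint R F k k = boxint R (W 0) k k" by (simp add: W_def)
  have close: "\<bar>\<Lambda> i (boxint R (W i) k k) - c\<^sup>2 * \<Lambda> i (W i)\<bar> <= C * (\<eta> * c\<^sup>2)" if i: "i <= 4" for i
  proof -
   have B: "boxint R (W i) k k \<in> Bm" by (rule boxint_functional(3)[where \<Lambda> = "\<Lambda> i"]; fact lin bd W kc sk)
   have l: "\<bar>boxint R (W i) k k p - c\<^sup>2 * W i p\<bar> <= \<eta> * c\<^sup>2" for p unfolding c_def
    by (rule boxint_limit[OF W(1) W(2) R0 R_def kc(1) k0 ks ke \<epsilon>]) (use d(2)[of _ _ i] \<epsilon>d[OF i] in \<open>auto intro: less_imp_le\<close>)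
   have "\<bar>\<Lambda> i (%p. boxint R (W i) k k p + (- (c\<^sup>2)) * W i p)\<bar> <= C * (\<eta> * c\<^sup>2)"
    by (rule bd) (use B WB l in \<open>auto intro!: Bm_diff Bm_mult\<close>)
   then show ?thesis unfolding lin[OF B WB] by simp
  qed
  have l4: "(0::nat) <= 4" "(1::nat) <= 4" "(2::nat) <= 4" "(3::nat) <= 4" "(4::nat) <= 4" by auto
  have "c\<^sup>2 * \<bar>\<Lambda> 0 (W 0) + \<Lambda> 1 (W 1) + \<Lambda> 2 (W 2) + \<Lambda> 3 (W 3) + \<Lambda> 4 (W 4)\<bar>
    = \<bar>c\<^sup>2 * \<Lambda> 0 (W 0) + c\<^sup>2 * \<Lambda> 1 (W 1) + c\<^sup>2 * \<Lambda> 2 (W 2) + c\<^sup>2 * \<Lambda> 3 (W 3) + c\<^sup>2 * \<Lambda> 4 (W 4)\<bar>"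
   using c by (simp add: abs_mult distrib_left[symmetric] del: distrib_left)
  also have "\<dots> <= 5 * (C * (\<eta> * c\<^sup>2))"
   using close[OF l4(1)] close[OF l4(2)] close[OF l4(3)] close[OF l4(4)] close[OF l4(5)] sum0[unfolded e0 e1 e2]
    arg_cong[OF e3, of "\<Lambda> 3"] arg_cong[OF e4, of "\<Lambda> 4"] by linarith
  also have "\<dots> = c\<^sup>2 * (5 * C * \<eta>)" by simp
  finally show "\<bar>\<Lambda> 0 (W 0) + \<Lambda> 1 (W 1) + \<Lambda> 2 (W 2) + \<Lambda> 3 (W 3) + \<Lambda> 4 (W 4)\<bar> <= 5 * C * \<eta>" using c by simp
 qed
 then show ?thesis by (simp add: W_def)
qed

section \<open>First and second moments of the superprocess\<close>

lemma Bm_fst: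
 fixes f :: "real => real" assumes "f \<in> Bm" shows "(%p :: real \<times> real. f (fst p)) \<in> Bm"
 by (rule Bm_compose[OF assms], rule borel_measurable_continuous_onI) (intro continuous_intros)

lemma Bm_snd:
 fixes f :: "real => real" assumes "f \<in> Bm" shows "(%p :: real \<times> real. f (snd p)) \<in> Bm"
 by (rule Bm_compose[OF assms], rule borel_measurable_continuous_onI) (intro continuous_intros)

lemma Bm_gap:
 fixes f :: "real => real" assumes "f \<in> Bm"
 shows "(%p :: real \<times> real. f (fst p - snd p)) \<in> Bm" "(%p :: real \<times> real. f (snd p - fst p)) \<in> Bm"
proof -
 show "(%p :: real \<times> real. f (fst p - snd p)) \<in> Bm"
  by (rule Bm_compose[OF assms], rule borel_measurable_continuous_onI) (intro continuous_intros)
 show "(%p :: real \<times> real. f (snd p - fst p)) \<in> Bm"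
  by (rule Bm_compose[OF assms], rule borel_measurable_continuous_onI) (intro continuous_intros)
qed

lemma Bm_diag:
 fixes F :: "real \<times> real => real" assumes "F \<in> Bm" shows "(%x. F (x, x)) \<in> Bm"
 by (rule Bm_compose[OF assms], rule borel_measurable_continuous_onI) (intro continuous_intros)

lemma Bm_swap:
 fixes F :: "real \<times> real => real" assumes "F \<in> Bm" shows "(%p. F (snd p, fst p)) \<in> Bm"
 by (rule Bm_compose[OF assms], rule borel_measurable_continuous_onI) (intro continuous_intros)

lemma fbm_prod:
 assumes M: "finite_borel_measure M" and f: "f \<in> Bm" and g: "g \<in> Bm"
 shows "(LINT p|(M \<Otimes>\<^sub>M M). f (fst p) * g (snd p)) = (LINT x|M. f x) * (LINT x|M. g x)"
 using fbm_pair(2)[OF M Bm_mult[OF Bm_fst[OF f] Bm_snd[OF g]]] by simp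

lemma fbm_swap:
 assumes M: "finite_borel_measure M" and h: "h \<in> Bm"
 shows "(LINT p|(M \<Otimes>\<^sub>M M). h (snd p, fst p)) = (LINT p|(M \<Otimes>\<^sub>M M). h p)"
proof -
 interpret finite_measure M using M by (rule fbm_finite)
 interpret pair_sigma_finite M M ..
 have i: "integrable (M \<Otimes>\<^sub>M M) (case_prod (%x y. h (x, y)))" using fbm_pair(1)[OF M h] by simp
 show ?thesis using fbm_pair(2)[OF M h] fbm_pair(2)[OF M Bm_swap[OF h]] Fubini_integral[OF i] by simp
qed

lemma Gop_real: "Gop a \<rho> F x = 1/2 * (a x * pde 1 (pde 1 F) x)" for F :: "real => real"
 by (simp add: Gop_def)

text \<open>The sum over ordered pairs of distinct basis vectors yields two mixed terms, one for
  each order of differentiation, with \<open>\<rho>\<close> at opposite arguments.\<close>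

lemma Gop_prod:
 fixes F :: "real \<times> real => real"
 shows "Gop a \<rho> F p = (1/2 * a (fst p)) * pde (1, 0) (pde (1, 0) F) p + (1/2 * a (snd p)) * pde (0, 1) (pde (0, 1) F) p
  + (1/2 * \<rho> (fst p - snd p)) * pde (1, 0) (pde (0, 1) F) p + (1/2 * \<rho> (snd p - fst p)) * pde (0, 1) (pde (1, 0) F) p"
proof -
 have B: "(Basis :: (real \<times> real) set) = {(1, 0), (0, 1)}" by (auto simp: Basis_prod_def)
 have D: "{(1, 0), (0, 1)} - {(1::real, 0::real)} = {(0, 1)}" "{(1, 0), (0, 1)} - {(0::real, 1::real)} = {(1, 0)}" by auto
 show ?thesis unfolding Gop_def B by (cases p) (simp add: D inner_prod_def algebra_simps)
qed

lemma Ccinf_C2cfun: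
 fixes F :: "real => real"
 assumes F: "F \<in> Ccinf" shows "C2cfun F (pde 1 F) (pde 1 (pde 1 F))"
proof -
 obtain K where K: "compact K" "!!x. x \<notin> K ==> F x = 0" using F unfolding Ccinf_def by blast
 obtain R where R: "!!x. x \<in> K ==> norm x <= R" using compact_imp_bounded[OF K(1)] unfolding bounded_iff by blast
 have S0: "F z = 0" if "R < norm z" for z using K(2)[of z] R[of z] that by (cases "z \<in> K") auto
 have S1: "pde b F z = 0" if "R < norm z" for b z by (rule pde_supp[OF S0 that])
 have S2: "pde b (pde b' F) z = 0" if "R < norm z" for b b' z by (rule pde_supp[OF S1 that])
 have FC: "\<forall>bs. set bs \<subseteq> Basis \<longrightarrow> (\<forall>b\<in>Basis. \<forall>x. (%r. foldr pde bs F (x + r *\<^sub>R b)) differentiable (at 0))"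
  using F unfolding Ccinf_def by blast
 have d: "(f has_real_derivative pde 1 f z) (at z)" if "(%r. f (z + r *\<^sub>R 1)) differentiable (at 0)" for f :: "real => real" and z
  using that DERIV_shift[of f "pde 1 f z" 0 z] unfolding pde_def by (simp add: DERIV_deriv_iff_real_differentiable[symmetric] add.commute)
 have "(%r. foldr pde [] F (z + r *\<^sub>R 1)) differentiable (at 0)" "(%r. foldr pde [1] F (z + r *\<^sub>R 1)) differentiable (at 0)" for z
  using FC[rule_format, of "[]" 1 z] FC[rule_format, of "[1]" 1 z] by simp_all
 then have "(F has_real_derivative pde 1 F z) (at z)" "(pde 1 F has_real_derivative pde 1 (pde 1 F) z) (at z)" for z
  using d by auto
 moreover have "continuous_on UNIV (pde 1 (pde 1 F))" using Ccinf_cont[OF F, of "[1, 1]"] by simp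
 ultimately show ?thesis unfolding C2cfun_def using S0 S1 S2 by (metis real_norm_def)
qed

context sdsm
begin

abbreviation Lam1 :: "real => (real => real) => real" where "Lam1 \<equiv> Lam (%_. 1)"

lemma Lam1_lin: "0 <= r ==> f \<in> Bm ==> g \<in> Bm ==> Lam1 r (%x. f x + k * g x) = Lam1 r f + k * Lam1 r g"
 by (rule Lam_lin[where E = 1]) auto

lemma Lam1_time: "h \<in> Bm ==> 0 <= s ==> s <= t ==> set_integrable lborel {s..t} (%r. Lam1 r h)"
 by (rule Lam_time(2)[where E = 1]) auto

lemma coordinate_integrable:
 assumes "h \<in> Bm" "!!x. \<bar>h x\<bar> <= D" "0 <= r"
 shows "integrable Q (%om. \<integral>x. h x \<partial>om r)" "r <= T ==> (LINT om|Q. \<bar>\<integral>x. h x \<partial>om r\<bar>) <= D * MV T"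
 using Y_int_integrable(1)[where Y = "%_. 1" and E = 1, OF _ _ assms]
  Y_int_integrable(2)[where Y = "%_. 1" and E = 1, OF _ _ assms] by simp_all

lemma MV_nonneg: "0 <= r ==> 0 <= MV r"
 using V_integrable(2)[of r r] order_trans[OF Bochner_Integration.integral_nonneg[of Q "V r"]] V_ge(1)[of r] by (meson order_refl order_trans zero_le_one)

lemma Lam_bound:
 assumes "Y \<in> borel_measurable Q" "!!om. om \<in> space Q ==> \<bar>Y om\<bar> <= E" "h \<in> Bm" "!!x. \<bar>h x\<bar> <= D" "0 <= r" "r <= T"
 shows "\<bar>Lam Y r h\<bar> <= E * MV T * D"
proof -
 have "\<bar>Lam Y r h\<bar> <= (LINT om|Q. \<bar>Y om * (LINT x|om r. h x)\<bar>)" unfolding Lam_def by (rule integral_abs_bound)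
 also have "\<dots> <= E * D * MV T" by (rule Y_int_integrable(2)) (use assms in auto)
 finally show ?thesis by (simp add: mult_ac)
qed

lemma Lam_conv:
 fixes F :: "nat => real => real"
 assumes Y: "Y \<in> borel_measurable Q" "!!om. om \<in> space Q ==> \<bar>Y om\<bar> <= E" and r: "0 <= r"
  and F: "!!n. F n \<in> Bm" "!!n x. \<bar>F n x\<bar> <= c" "!!x. (%n. F n x) \<longlonglongrightarrow> f x" and f: "f \<in> Bm"
 shows "(%n. Lam Y r (F n)) \<longlonglongrightarrow> Lam Y r f"
 unfolding Lam_def
proof (rule integral_dominated_convergence[where w = "%om. E * (c * V r om)"])
 have E0: "0 <= E" using Y(2) not_empty order_trans[OF abs_ge_zero Y(2)] by blast
 show "(%om. Y om * (LINT x|om r. f x)) \<in> borel_measurable Q" "(%om. Y om * (LINT x|om r. F n x)) \<in> borel_measurable Q" for n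
  using mkernel_Bm[OF mkernel_Q[OF r] f] mkernel_Bm[OF mkernel_Q[OF r] F(1)] Y(1) by (auto intro!: borel_measurable_times)
 show "integrable Q (%om. E * (c * V r om))" using V_integrable(1)[OF r] by simp
 show "AE om in Q. (%n. Y om * (LINT x|om r. F n x)) \<longlonglongrightarrow> Y om * (LINT x|om r. f x)"
 proof (rule AE_I2)
  fix om assume "om \<in> space Q"
  then have fb: "finite_borel_measure (om r)" using r by (auto intro: cadlag_fbm)
  have "(%n. \<integral>x. F n x \<partial>om r) \<longlonglongrightarrow> (LINT x|om r. f x)"
   by (rule integral_dominated_convergence[where w = "%_. c"])
    (use fbm_integrable[OF fb f] fbm_integrable[OF fb F(1)] fbm_integrable[OF fb Bm_const] F in auto)
  then show "(%n. Y om * (LINT x|om r. F n x)) \<longlonglongrightarrow> Y om * (LINT x|om r. f x)" by (rule tendsto_mult_left)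
 qed
 show "AE om in Q. norm (Y om * (LINT x|om r. F n x)) <= E * (c * V r om)" for n
 proof (rule AE_I2)
  fix om assume om: "om \<in> space Q"
  then have "om \<in> cadlag_paths" by simp
  from integral_V_bound[OF F(1,2) this r] show "norm (Y om * (LINT x|om r. F n x)) <= E * (c * V r om)"
   unfolding real_norm_def abs_mult using Y(2)[OF om] E0 by (intro mult_mono) auto
 qed
qed

lemma mm_integrable:
 assumes h: "h \<in> Bm" "!!x. \<bar>h x\<bar> <= D" and r: "0 <= r"
 shows "integrable Q (%om. \<integral>z. h z \<partial>(om r \<Otimes>\<^sub>M om r))" "r <= T ==> (LINT om|Q. \<bar>\<integral>z. h z \<partial>(om r \<Otimes>\<^sub>M om r)\<bar>) <= D * MV T"
proof -
 have D0: "0 <= D" using order_trans[OF abs_ge_zero h(2)] .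
 have b: "\<bar>\<integral>z. h z \<partial>(om r \<Otimes>\<^sub>M om r)\<bar> <= D * V r om" if "om \<in> cadlag_paths" for om by (rule pair_V_bound[OF h that r])
 note m = mkernel_pair[OF mkernel_Q[OF r] h(1)]
 show "integrable Q (%om. \<integral>z. h z \<partial>(om r \<Otimes>\<^sub>M om r))" "r <= T ==> (LINT om|Q. \<bar>\<integral>z. h z \<partial>(om r \<Otimes>\<^sub>M om r)\<bar>) <= D * MV T"
  using bounded_integrable[OF m r b] D0 by auto
qed

lemma mm_int:
 assumes "h \<in> Bm" "0 <= r" shows "integrable Q (%om. \<integral>z. h z \<partial>(om r \<Otimes>\<^sub>M om r))"
proof -
 obtain D where "!!x. \<bar>h x\<bar> <= D" using BmE[OF assms(1)] by metis
 from mm_integrable(1)[OF assms(1) this assms(2)] show ?thesis .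
qed

lemma mm_bound:
 assumes "h \<in> Bm" "!!x. \<bar>h x\<bar> <= D" "0 <= r" "r <= T"
 shows "\<bar>mm r h\<bar> <= MV T * D"
proof -
 have "\<bar>mm r h\<bar> <= (LINT om|Q. \<bar>\<integral>z. h z \<partial>(om r \<Otimes>\<^sub>M om r)\<bar>)" unfolding mm_def by (rule integral_abs_bound)
 also have "\<dots> <= D * MV T" by (rule mm_integrable(2)[OF assms])
 finally show ?thesis by (simp add: mult_ac)
qed

lemma mm_cong:
 assumes "0 <= r" "!!M. finite_borel_measure M ==> (LINT z|(M \<Otimes>\<^sub>M M). f z) = (LINT z|(M \<Otimes>\<^sub>M M). g z)"
 shows "mm r f = mm r g"
 unfolding mm_def
proof (rule Bochner_Integration.integral_cong[OF refl])
 fix om assume "om \<in> space Q"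
 then have "finite_borel_measure (om r)" using assms(1) by (auto intro: cadlag_fbm)
 then show "(LINT z|(om r \<Otimes>\<^sub>M om r). f z) = (LINT z|(om r \<Otimes>\<^sub>M om r). g z)" by (rule assms(2))
qed

lemma mm_lin:
 assumes r: "0 <= r" and f: "f \<in> Bm" and g: "g \<in> Bm"
 shows "mm r (%x. f x + k * g x) = mm r f + k * mm r g"
proof -
 have "mm r (%x. f x + k * g x) = (LINT om|Q. (LINT x|(om r \<Otimes>\<^sub>M om r). f x) + k * (LINT x|(om r \<Otimes>\<^sub>M om r). g x))"
  unfolding mm_def
 proof (rule Bochner_Integration.integral_cong[OF refl])
  fix om assume "om \<in> space Q"
  then have fb: "finite_borel_measure (om r)" using r by (auto intro: cadlag_fbm)
  show "(LINT x|(om r \<Otimes>\<^sub>M om r). f x + k * g x) = (LINT x|(om r \<Otimes>\<^sub>M om r). f x) + k * (LINT x|(om r \<Otimes>\<^sub>M om r). g x)"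
   using fbm_pair(1)[OF fb f] fbm_pair(1)[OF fb g] by simp
 qed
 also have "\<dots> = mm r f + k * mm r g"
  unfolding mm_def using mm_int[OF f r] mm_int[OF g r] by simp
 finally show ?thesis .
qed

lemma mm_swap: "0 <= r ==> h \<in> Bm ==> mm r (%p. h (snd p, fst p)) = mm r h"
 by (rule mm_cong) (auto intro: fbm_swap)

lemma mm_conv:
 fixes F :: "nat => real \<times> real => real"
 assumes r: "0 <= r"
  and F: "!!n. F n \<in> Bm" "!!n x. \<bar>F n x\<bar> <= c" "!!x. (%n. F n x) \<longlonglongrightarrow> f x" and f: "f \<in> Bm"
 shows "(%n. mm r (F n)) \<longlonglongrightarrow> mm r f"
 unfolding mm_def
proof (rule integral_dominated_convergence[where w = "%om. c * V r om"])
 show "(%om. \<integral>x. f x \<partial>(om r \<Otimes>\<^sub>M om r)) \<in> borel_measurable Q" by (rule mkernel_pair[OF mkernel_Q[OF r] f])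
 show "(%om. \<integral>x. F n x \<partial>(om r \<Otimes>\<^sub>M om r)) \<in> borel_measurable Q" for n by (rule mkernel_pair[OF mkernel_Q[OF r] F(1)])
 show "integrable Q (%om. c * V r om)" using V_integrable(1)[OF r] by simp
 show "AE om in Q. (%n. \<integral>x. F n x \<partial>(om r \<Otimes>\<^sub>M om r)) \<longlonglongrightarrow> (LINT x|(om r \<Otimes>\<^sub>M om r). f x)"
 proof (rule AE_I2)
  fix om assume "om \<in> space Q"
  then have fb: "finite_borel_measure (om r)" using r by (auto intro: cadlag_fbm)
  show "(%n. \<integral>x. F n x \<partial>(om r \<Otimes>\<^sub>M om r)) \<longlonglongrightarrow> (LINT x|(om r \<Otimes>\<^sub>M om r). f x)"
   by (rule integral_dominated_convergence[where w = "%_. c"])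
    (use fbm_pair(1)[OF fb f] fbm_pair(1)[OF fb F(1)] fbm_pair(1)[OF fb Bm_const] F in auto)
 qed
 show "AE om in Q. norm (LINT x|(om r \<Otimes>\<^sub>M om r). F n x) <= c * V r om" for n
  using pair_V_bound[OF F(1,2) _ r] by (intro AE_I2) simp
qed

lemma mm_time:
 assumes h: "h \<in> Bm" and st: "0 <= s" "s <= t"
 shows "set_integrable lborel {s..t} (%r. mm r h)"
proof -
 obtain D where D: "!!x. \<bar>h x\<bar> <= D" using BmE[OF h] by metis
 have t: "0 <= t" using st by simp
 show ?thesis unfolding mm_def
  by (rule LINT_Fubini(3)[where h = "%r om. \<integral>z. h z \<partial>(om r \<Otimes>\<^sub>M om r)", OF st mkernel_pair[OF mkernel_joint[OF t] h] mm_integrable[OF h D]])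
qed

text \<open>The local branching variance, which feeds the second moment on the diagonal.\<close>

definition kap :: "real => real" where "kap x = \<sigma> x + \<kappa>\<^sub>2 x"

lemma kap_Bm: "kap \<in> Bm" unfolding kap_def[abs_def] by (rule Bm_add[OF \<sigma>_Bm \<kappa>\<^sub>2_Bm])

text \<open>\<open>second_id_nonneg\<close> with weight 1, read as an equation for the mean of X
  \<otimes> X: products of integrals become integrals over the product measure, and Fubini moves the
  expectation under the time integral.\<close>

lemma sq_identity:
 assumes f: "C2cfun f f' f''" "!!x. 0 <= f x" and st: "0 <= s" "s <= t"
 defines "H \<equiv> (%p. f (fst p) * (a (snd p) * f'' (snd p)) + \<rho> (fst p - snd p) * (f' (fst p) * f' (snd p)))"
 shows "mm t (%p. f (fst p) * f (snd p)) - mm s (%p. f (fst p) * f (snd p))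
   = (LINT r:{s..t}|lborel. mm r H + Lam1 r (%x. kap x * (f x * f x)))"
proof -
 note B = C2cfun_Bm[OF f(1)]
 have af: "(%x. a x * f'' x) \<in> Bm" by (rule Bm_mult[OF a_Bm B(3)])
 note BB = Bm_fst[OF B(1)] Bm_fst[OF B(2)] Bm_snd[OF B(1)] Bm_snd[OF B(2)] Bm_snd[OF af] Bm_gap[OF \<rho>_Bm]
 have H1: "(%p. f (fst p) * (a (snd p) * f'' (snd p))) \<in> Bm" "(%p. \<rho> (fst p - snd p) * (f' (fst p) * f' (snd p))) \<in> Bm"
  "(%p. f (fst p) * f (snd p)) \<in> Bm"
  by (intro Bm_mult BB)+
 have H: "H \<in> Bm" unfolding H_def by (rule Bm_add[OF H1(1,2)])
 have k: "(%x. kap x * (f x * f x)) \<in> Bm" by (intro Bm_mult kap_Bm B)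
 have k1: "(%x. \<sigma> x * f x * f x) \<in> Bm" "(%x. (f x)\<^sup>2 * \<kappa>\<^sub>2 x) \<in> Bm" unfolding power2_eq_square by (intro Bm_mult \<sigma>_Bm \<kappa>\<^sub>2_Bm B)+
 have t: "0 <= t" using st by simp
 define W where "W r om = (LINT z|(om r \<Otimes>\<^sub>M om r). H z) + (LINT x|om r. kap x * (f x * f x))" for r and om :: "real => real measure"
 have pt: "(LINT x|M. f x) * (LINT x|M. a x * f'' x) + (LINT z|(M \<Otimes>\<^sub>M M). \<rho> (fst z - snd z) * f' (fst z) * f' (snd z))
   + (LINT x|M. \<sigma> x * f x * f x) + (LINT x|M. (f x)\<^sup>2 * \<kappa>\<^sub>2 x)
   = (LINT z|(M \<Otimes>\<^sub>M M). H z) + (LINT x|M. kap x * (f x * f x))" if M: "finite_borel_measure M" for M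
 proof -
  have "(LINT z|(M \<Otimes>\<^sub>M M). H z) = (LINT z|(M \<Otimes>\<^sub>M M). f (fst z) * (a (snd z) * f'' (snd z))) + (LINT z|(M \<Otimes>\<^sub>M M). \<rho> (fst z - snd z) * (f' (fst z) * f' (snd z)))"
   unfolding H_def by (rule Bochner_Integration.integral_add[OF fbm_pair(1)[OF M H1(1)] fbm_pair(1)[OF M H1(2)]])
  moreover have "(LINT z|(M \<Otimes>\<^sub>M M). f (fst z) * (a (snd z) * f'' (snd z))) = (LINT x|M. f x) * (LINT x|M. a x * f'' x)" by (rule fbm_prod[OF M B(1) af])
  moreover have "(LINT x|M. kap x * (f x * f x)) = (LINT x|M. \<sigma> x * f x * f x + (f x)\<^sup>2 * \<kappa>\<^sub>2 x)"
   by (simp add: kap_def power2_eq_square algebra_simps)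
  moreover have "\<dots> = (LINT x|M. \<sigma> x * f x * f x) + (LINT x|M. (f x)\<^sup>2 * \<kappa>\<^sub>2 x)"
   by (rule Bochner_Integration.integral_add[OF fbm_integrable[OF M k1(1)] fbm_integrable[OF M k1(2)]])
  ultimately show ?thesis by (simp add: mult.assoc)
 qed
 obtain D where D: "!!x. \<bar>H x\<bar> <= D" using BmE[OF H] by metis
 obtain D' where D': "!!x. \<bar>kap x * (f x * f x)\<bar> <= D'" using BmE[OF k] by metis
 note i1 = mm_integrable[OF H D] and i2 = coordinate_integrable[OF k D']
 have Wi: "integrable Q (W r)" "(LINT om|Q. \<bar>W r om\<bar>) <= D * MV t + D' * MV t" "(LINT om|Q. W r om) = mm r H + Lam1 r (%x. kap x * (f x * f x))"
  if r: "0 <= r" "r <= t" for r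
 proof -
  note j = i1(1)[OF r(1)] i2(1)[OF r(1)]
  show i: "integrable Q (W r)" unfolding W_def[abs_def] by (rule Bochner_Integration.integrable_add[OF j])
  have "(LINT om|Q. \<bar>W r om\<bar>) <= (LINT om|Q. \<bar>\<integral>z. H z \<partial>(om r \<Otimes>\<^sub>M om r)\<bar> + \<bar>\<integral>x. kap x * (f x * f x) \<partial>om r\<bar>)"
   using i j unfolding W_def by (intro integral_mono Bochner_Integration.integrable_add integrable_abs) auto
  also have "\<dots> = (LINT om|Q. \<bar>\<integral>z. H z \<partial>(om r \<Otimes>\<^sub>M om r)\<bar>) + (LINT om|Q. \<bar>\<integral>x. kap x * (f x * f x) \<partial>om r\<bar>)"
   by (rule Bochner_Integration.integral_add[OF integrable_abs[OF j(1)] integrable_abs[OF j(2)]])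
  also have "\<dots> <= D * MV t + D' * MV t" using i1(2)[OF r] i2(2)[OF r] by (rule add_mono)
  finally show "(LINT om|Q. \<bar>W r om\<bar>) <= D * MV t + D' * MV t" .
  show "(LINT om|Q. W r om) = mm r H + Lam1 r (%x. kap x * (f x * f x))"
   unfolding W_def mm_def Lam_def mult_1 by (rule Bochner_Integration.integral_add[OF j])
 qed
 have Wm: "(%z. W (clip t (fst z)) (snd z)) \<in> borel_measurable (borel \<Otimes>\<^sub>M Q)"
  unfolding W_def by (intro borel_measurable_add mkernel_pair[OF mkernel_joint[OF t] H] mkernel_Bm[OF mkernel_joint[OF t] k])
 have "mm t (%p. f (fst p) * f (snd p)) - mm s (%p. f (fst p) * f (snd p))
   = (LINT om|Q. (LINT p|(om t \<Otimes>\<^sub>M om t). f (fst p) * f (snd p)) - (LINT p|(om s \<Otimes>\<^sub>M om s). f (fst p) * f (snd p)))"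
  unfolding mm_def by (rule Bochner_Integration.integral_diff[symmetric, OF mm_int[OF H1(3) t] mm_int[OF H1(3) st(1)]])
 also have "\<dots> = (LINT om|Q. 1 * ((LINT x|om t. f x)\<^sup>2 - (LINT x|om s. f x)\<^sup>2))"
  using t st(1) by (intro Bochner_Integration.integral_cong) (auto simp: power2_eq_square fbm_prod[OF cadlag_fbm B(1) B(1)])
 also have "\<dots> = (LINT om|Q. 1 * (LINT r:{s..t}|lborel. (LINT x|om r. f x) * (LINT x|om r. a x * f'' x)
    + (LINT z|(om r \<Otimes>\<^sub>M om r). \<rho> (fst z - snd z) * f' (fst z) * f' (snd z))
    + (LINT x|om r. \<sigma> x * f x * f x) + (LINT x|om r. (f x)\<^sup>2 * \<kappa>\<^sub>2 x)))"
  by (rule second_id_nonneg[OF f st, where E = 1]) auto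
 also have "\<dots> = (LINT om|Q. (LINT r:{s..t}|lborel. W r om))"
  unfolding mult_1
 proof (rule Bochner_Integration.integral_cong[OF refl], rule set_lebesgue_integral_cong)
  fix om assume "om \<in> space Q"
  then have fb: "finite_borel_measure (om r)" if "r \<in> {s..t}" for r using that st by (auto intro: cadlag_fbm)
  show "\<forall>r. r \<in> {s..t} \<longrightarrow> (LINT x|om r. f x) * (LINT x|om r. a x * f'' x)
    + (LINT z|(om r \<Otimes>\<^sub>M om r). \<rho> (fst z - snd z) * f' (fst z) * f' (snd z))
    + (LINT x|om r. \<sigma> x * f x * f x) + (LINT x|om r. (f x)\<^sup>2 * \<kappa>\<^sub>2 x) = W r om"
   unfolding W_def using pt[OF fb] by blast
 qed simp
 also have "\<dots> = (LINT r:{s..t}|lborel. (LINT om|Q. W r om))" by (rule LINT_Fubini(2)[OF st Wm Wi(1,2)])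
 also have "\<dots> = (LINT r:{s..t}|lborel. mm r H + Lam1 r (%x. kap x * (f x * f x)))"
  by (rule set_lebesgue_integral_cong) (use Wi(3) st in auto)
 finally show ?thesis .
qed

text \<open>Polarisation through f + g, which keeps the test functions nonnegative: the identity for
  f + g minus those for f and for g is twice the desired one.\<close>

lemma tensor_identity:
 assumes f: "C2cfun f f' f''" "!!x. 0 <= f x" and g: "C2cfun g g' g''" "!!x. 0 <= g x" and st: "0 <= s" "s <= t"
 shows "mm t (%p. f (fst p) * g (snd p)) - mm s (%p. f (fst p) * g (snd p))
   = (LINT r:{s..t}|lborel. mm r (%p. (1/2 * a (fst p)) * (f'' (fst p) * g (snd p)) + (1/2 * a (snd p)) * (f (fst p) * g'' (snd p))
     + (1/2 * \<rho> (fst p - snd p)) * (f' (fst p) * g' (snd p)) + (1/2 * \<rho> (snd p - fst p)) * (f' (fst p) * g' (snd p)))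
    + Lam1 r (%x. kap x * (f x * g x)))"
  (is "_ = (LINT r:_|_. mm r ?h + Lam _ r ?k)")
proof -
 define S where "S f f' f'' = (%p. f (fst p) * (a (snd p) * f'' (snd p)) + \<rho> (fst p - snd p) * (f' (fst p) * f' (snd p)))" for f f' f'' :: "real => real"
 define kk where "kk f = (%x. kap x * (f x * f x))" for f :: "real => real"
 let ?u = "%x. f x + 1 * g x" and ?u' = "%x. f' x + 1 * g' x" and ?u'' = "%x. f'' x + 1 * g'' x"
 have u: "C2cfun ?u ?u' ?u''" by (rule C2cfun_lin[OF f(1) g(1)])
 have un: "0 <= ?u x" for x using f(2) g(2) by simp
 have id: "mm t (%p. q (fst p) * q (snd p)) - mm s (%p. q (fst p) * q (snd p)) = (LINT r:{s..t}|lborel. mm r (S q q' q'') + Lam1 r (kk q))"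
  if "C2cfun q q' q''" "!!x. 0 <= q x" for q q' q'' unfolding S_def kk_def by (rule sq_identity[OF that st])
 have SB: "S q q' q'' \<in> Bm" "kk q \<in> Bm" if "C2cfun q q' q''" for q q' q''
 proof -
  note B = C2cfun_Bm[OF that]
  show "S q q' q'' \<in> Bm" unfolding S_def by (intro Bm_add Bm_mult Bm_fst[OF B(1)] Bm_fst[OF B(2)] Bm_snd[OF B(2)] Bm_snd[OF B(3)] Bm_snd[OF a_Bm] Bm_gap[OF \<rho>_Bm])
  show "kk q \<in> Bm" unfolding kk_def by (intro Bm_mult kap_Bm B)
 qed
 note Bf = C2cfun_Bm[OF f(1)] and Bg = C2cfun_Bm[OF g(1)]
 note BB = Bm_fst[OF Bf(1)] Bm_fst[OF Bf(2)] Bm_fst[OF Bf(3)] Bm_snd[OF Bf(1)] Bm_snd[OF Bf(2)] Bm_snd[OF Bf(3)]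
  Bm_fst[OF Bg(1)] Bm_fst[OF Bg(2)] Bm_fst[OF Bg(3)] Bm_snd[OF Bg(1)] Bm_snd[OF Bg(2)] Bm_snd[OF Bg(3)] Bm_gap[OF \<rho>_Bm] Bm_fst[OF a_Bm] Bm_snd[OF a_Bm]
 \<comment> \<open>\<open>X\<close> and \<open>X'\<close> are the two halves of the cross term.
   \<open>X'\<close> is brought to the order f \<otimes> g by swapping the variables, which reverses
   the argument of \<open>\<rho>\<close>; averaging the two gives the coefficients 1/2.\<close>
 define X where "X p = f (fst p) * (a (snd p) * g'' (snd p)) + \<rho> (fst p - snd p) * (f' (fst p) * g' (snd p))" for p
 define X' where "X' p = g (fst p) * (a (snd p) * f'' (snd p)) + \<rho> (fst p - snd p) * (g' (fst p) * f' (snd p))" for p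
 have XB: "X \<in> Bm" "X' \<in> Bm" unfolding X_def[abs_def] X'_def[abs_def] by (intro Bm_add Bm_mult BB)+
 have hB: "?h \<in> Bm" by (intro Bm_add Bm_mult Bm_const BB)
 have kB: "?k \<in> Bm" by (intro Bm_mult kap_Bm Bf Bg)
 have mm0: "mm r (%_. 0) = 0" for r by (simp add: mm_def)
 have hX: "2 * mm r ?h = mm r X + mm r X'" if r: "0 <= r" for r
 proof -
  have e: "?h = (%p. 0 + (1/2) * (X p + 1 * X' (snd p, fst p)))" by (auto simp: X_def X'_def algebra_simps)
  show ?thesis
   using mm_lin[OF r Bm_const[of 0] Bm_add[OF XB(1) Bm_mult[OF Bm_const[of 1] Bm_swap[OF XB(2)]]], of "1/2"]
    mm_lin[OF r XB(1) Bm_swap[OF XB(2)], of 1] mm_swap[OF r XB(2)] unfolding e mm0 by simp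
 qed
 have SX: "mm r (S ?u ?u' ?u'') = mm r (S f f' f'') + mm r (S g g' g'') + 2 * mm r ?h" if r: "0 <= r" for r
 proof -
  have e: "S ?u ?u' ?u'' = (%p. (S f f' f'' p + 1 * S g g' g'' p) + 1 * (X p + 1 * X' p))"
   by (auto simp: S_def X_def X'_def algebra_simps)
  have b: "(%p. S f f' f'' p + 1 * S g g' g'' p) \<in> Bm" "(%p. X p + 1 * X' p) \<in> Bm"
   by (intro Bm_add Bm_mult Bm_const XB SB[OF f(1)] SB[OF g(1)])+
  show ?thesis unfolding e hX[OF r] mm_lin[OF r b] mm_lin[OF r SB(1)[OF f(1)] SB(1)[OF g(1)]] mm_lin[OF r XB] by simp
 qed
 have LX: "Lam1 r (kk ?u) = Lam1 r (kk f) + Lam1 r (kk g) + 2 * Lam1 r ?k" if r: "0 <= r" for r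
 proof -
  have e: "kk ?u = (%x. (kk f x + 1 * kk g x) + 2 * ?k x)" by (auto simp: kk_def algebra_simps)
  have b: "(%x. kk f x + 1 * kk g x) \<in> Bm" by (intro Bm_add Bm_mult Bm_const SB[OF f(1)] SB[OF g(1)])
  show ?thesis unfolding e Lam1_lin[OF r b kB] Lam1_lin[OF r SB(2)[OF f(1)] SB(2)[OF g(1)]] by simp
 qed
 have PX: "mm r (%p. ?u (fst p) * ?u (snd p)) = mm r (%p. f (fst p) * f (snd p)) + mm r (%p. g (fst p) * g (snd p)) + 2 * mm r (%p. f (fst p) * g (snd p))"
  if r: "0 <= r" for r
 proof -
  let ?fg = "%p. f (fst p) * g (snd p)"
  have e: "(%p. ?u (fst p) * ?u (snd p)) = (%p. (f (fst p) * f (snd p) + 1 * (g (fst p) * g (snd p))) + 1 * (?fg p + 1 * ?fg (snd p, fst p)))"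
   by (auto simp: algebra_simps)
  have b0: "(%p. f (fst p) * f (snd p)) \<in> Bm" "(%p. g (fst p) * g (snd p)) \<in> Bm" "?fg \<in> Bm" by (intro Bm_mult BB)+
  have b: "(%p. f (fst p) * f (snd p) + 1 * (g (fst p) * g (snd p))) \<in> Bm" "(%p. ?fg p + 1 * ?fg (snd p, fst p)) \<in> Bm"
   by (intro Bm_add[OF _ Bm_mult[OF Bm_const]] b0 Bm_swap[OF b0(3)])+
  show ?thesis unfolding e mm_lin[OF r b] mm_lin[OF r b0(1,2)] mm_lin[OF r b0(3) Bm_swap[OF b0(3)]] mm_swap[OF r b0(3)] by simp
 qed
 have ar1: "(x1 + x2 + 2 * x3) + (y1 + y2 + 2 * y3) = ((x1 + y1) + (x2 + y2)) + 2 * (x3 + y3)" for x1 x2 x3 y1 y2 y3 :: real by simp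
 \<comment> \<open>The polarisation in plain numbers: the three squared identities are solved for
   the cross term.\<close>
 have ar2: "x6 - x5 = x4"
  if "u = x1 + x2 + 2 * x4" "f1 - f0 = x1" "g1 - g0 = x2" "u1 - u0 = u" "u0 = f0 + g0 + 2 * x5" "u1 = f1 + g1 + 2 * x6"
  for u x1 x2 x4 x5 x6 f0 f1 g0 g1 u0 u1 :: real using that by linarith
 have i: "set_integrable lborel {s..t} (%r. mm r (S q q' q'') + Lam1 r (kk q))" if "C2cfun q q' q''" for q q' q''
  by (rule set_integral_add(1)[OF mm_time[OF SB(1)[OF that] st] Lam1_time[OF SB(2)[OF that] st]])
 have ih: "set_integrable lborel {s..t} (%r. mm r ?h + Lam1 r ?k)"
  by (rule set_integral_add(1)[OF mm_time[OF hB st] Lam1_time[OF kB st]])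
 have "(LINT r:{s..t}|lborel. mm r (S ?u ?u' ?u'') + Lam1 r (kk ?u))
   = (LINT r:{s..t}|lborel. ((mm r (S f f' f'') + Lam1 r (kk f)) + (mm r (S g g' g'') + Lam1 r (kk g))) + 2 * (mm r ?h + Lam1 r ?k))"
 proof (rule set_lebesgue_integral_cong)
  show "\<forall>r. r \<in> {s..t} \<longrightarrow> mm r (S ?u ?u' ?u'') + Lam1 r (kk ?u)
    = ((mm r (S f f' f'') + Lam1 r (kk f)) + (mm r (S g g' g'') + Lam1 r (kk g))) + 2 * (mm r ?h + Lam1 r ?k)"
  proof (intro allI impI)
   fix r assume "r \<in> {s..t}"
   then have r: "0 <= r" using st by auto
   show "mm r (S ?u ?u' ?u'') + Lam1 r (kk ?u)
    = ((mm r (S f f' f'') + Lam1 r (kk f)) + (mm r (S g g' g'') + Lam1 r (kk g))) + 2 * (mm r ?h + Lam1 r ?k)"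
    unfolding SX[OF r] LX[OF r] by (rule ar1)
  qed
 qed simp
 also have "\<dots> = (LINT r:{s..t}|lborel. mm r (S f f' f'') + Lam1 r (kk f)) + (LINT r:{s..t}|lborel. mm r (S g g' g'') + Lam1 r (kk g))
   + 2 * (LINT r:{s..t}|lborel. mm r ?h + Lam1 r ?k)"
  unfolding set_integral_add(2)[OF set_integral_add(1)[OF i[OF f(1)] i[OF g(1)]] set_integrable_mult_right[OF ih]]
   set_integral_add(2)[OF i[OF f(1)] i[OF g(1)]] set_integral_mult_right ..
 finally show ?thesis by (rule ar2[OF _ id[OF f] id[OF g] id[OF u un] PX[OF st(1)] PX[OF order_trans[OF st]]])
qed

end

section \<open>Forward equations for the moments and their solution\<close>

lemma set_integrable_affine:
 fixes q :: "real => real"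
 shows "set_integrable lborel {\<tau> + a..\<tau> + b} q ==> set_integrable lborel {a..b} (%r. q (\<tau> + r))"
  and "set_integrable lborel {0..s} q ==> set_integrable lborel {0..s} (%u. q (s - u))"
  and "(LINT u:{0..s}|lborel. q (s - u)) = (LINT r:{0..s}|lborel. q r)"
proof -
 have e1: "(%x. indicator {\<tau> + a..\<tau> + b} (\<tau> + 1 * x) *\<^sub>R q (\<tau> + 1 * x)) = (%r. indicator {a..b} r *\<^sub>R q (\<tau> + r))"
  by (auto simp: indicator_def)
 show "set_integrable lborel {\<tau> + a..\<tau> + b} q ==> set_integrable lborel {a..b} (%r. q (\<tau> + r))"
  unfolding set_integrable_def using lborel_integrable_real_affine[of "%x. indicator {\<tau> + a..\<tau> + b} x *\<^sub>R q x" 1 \<tau>] unfolding e1 by simp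
 have e2: "(%x. indicator {0..s} (s + (-1) * x) *\<^sub>R q (s + (-1) * x)) = (%r. indicator {0..s} r *\<^sub>R q (s - r))"
  by (auto simp: indicator_def)
 show "set_integrable lborel {0..s} q ==> set_integrable lborel {0..s} (%u. q (s - u))"
  unfolding set_integrable_def using lborel_integrable_real_affine[of "%x. indicator {0..s} x *\<^sub>R q x" "-1" s] unfolding e2 by simp
 show "(LINT u:{0..s}|lborel. q (s - u)) = (LINT r:{0..s}|lborel. q r)"
  unfolding set_lebesgue_integral_def using lborel_integral_real_affine[of "-1" "%x. indicator {0..s} x *\<^sub>R q x" s] unfolding e2 by simp
qed

text \<open>Endpoints are null sets. Measurability of \<open>f\<close> comes for free, since it
  differs from \<open>g\<close> on the interval in at most two points.\<close>

lemma set_integral_endpoints: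
 fixes f g :: "real => real"
 assumes g: "set_integrable lborel {a..b} g" and eq: "!!u. a < u ==> u < b ==> f u = g u"
 shows "(LINT u:{a..b}|lborel. f u) = (LINT u:{a..b}|lborel. g u)"
 unfolding set_lebesgue_integral_def
proof (rule integral_cong_AE)
 show m: "(%u. indicator {a..b} u *\<^sub>R g u) \<in> borel_measurable lborel" using g unfolding set_integrable_def by auto
 have m2: "(%u. if u = a then x else if u = b then y else indicator {a..b} u *\<^sub>R g u) \<in> borel_measurable lborel" for x y :: real
  by (rule measurable_If[OF measurable_const measurable_If[OF measurable_const m]]) auto
 have e: "(%u. indicator {a..b} u *\<^sub>R f u)
   = (%u. if u = a then indicator {a..b} a *\<^sub>R f a else if u = b then indicator {a..b} b *\<^sub>R f b else indicator {a..b} u *\<^sub>R g u)"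
  using eq by (auto simp: indicator_def fun_eq_iff)
 show "(%u. indicator {a..b} u *\<^sub>R f u) \<in> borel_measurable lborel" unfolding e by (rule m2)
 have "AE u in lborel. u \<noteq> a" "AE u in lborel. u \<noteq> b" by (rule AE_lborel_singleton)+
 then show "AE u in lborel. indicator {a..b} u *\<^sub>R f u = indicator {a..b} u *\<^sub>R g u"
  by eventually_elim (use eq in \<open>auto simp: indicator_def\<close>)
qed

lemma (in feller) P_0_Bm:
 assumes "f \<in> Bm" shows "P 0 f x = f x"
 using assms
proof (induction f rule: Bm_induct)
 case (Chat f) then show ?case by (simp add: P_0)
next
 case (lin f g c) then show ?case using P_lin[OF order_refl lin(1,2)] by simp
next
 case (lim F f C)
 have "(%n. P 0 (F n) x) \<longlonglongrightarrow> P 0 f x" by (rule P_conv[OF order_refl lim(1-3) Bm_lim[OF lim(1-3)]])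
 then show ?case using lim(3)[of x] lim(4) LIMSEQ_unique by auto
qed

context sdsm
begin

lemma LINT_mm:
 assumes \<phi>: "\<phi> \<in> Bm" "!!p. \<bar>\<phi> p\<bar> <= c" and st: "0 <= s" "s <= t"
 shows "f \<in> Bm ==> g \<in> Bm ==> (LINT r:{s..t}|lborel. mm r (%p. \<phi> p * (f p + k * g p)))
   = (LINT r:{s..t}|lborel. mm r (%p. \<phi> p * f p)) + k * (LINT r:{s..t}|lborel. mm r (%p. \<phi> p * g p))"
  and "f \<in> Bm ==> (!!p. \<bar>f p\<bar> <= d) ==> \<bar>LINT r:{s..t}|lborel. mm r (%p. \<phi> p * f p)\<bar> <= MV t * (c * d) * (t - s)"
proof -
 note B = Bm_mult[OF \<phi>(1)]
 show "(LINT r:{s..t}|lborel. mm r (%p. \<phi> p * (f p + k * g p)))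
   = (LINT r:{s..t}|lborel. mm r (%p. \<phi> p * f p)) + k * (LINT r:{s..t}|lborel. mm r (%p. \<phi> p * g p))"
  if fg: "f \<in> Bm" "g \<in> Bm"
 proof -
  have e: "(%p. \<phi> p * (f p + k * g p)) = (%p. \<phi> p * f p + k * (\<phi> p * g p))" by (auto simp: algebra_simps)
  have "(LINT r:{s..t}|lborel. mm r (%p. \<phi> p * (f p + k * g p))) = (LINT r:{s..t}|lborel. mm r (%p. \<phi> p * f p) + k * mm r (%p. \<phi> p * g p))"
   unfolding e by (rule set_lebesgue_integral_cong) (use mm_lin[OF _ B[OF fg(1)] B[OF fg(2)]] st in auto)
  then show ?thesis
   unfolding set_integral_add(2)[OF mm_time[OF B[OF fg(1)] st] set_integrable_mult_right[OF mm_time[OF B[OF fg(2)] st]]] set_integral_mult_right .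
 qed
 show "\<bar>LINT r:{s..t}|lborel. mm r (%p. \<phi> p * f p)\<bar> <= MV t * (c * d) * (t - s)" if f: "f \<in> Bm" "!!p. \<bar>f p\<bar> <= d"
 proof (rule set_integral_bound_Icc[OF mm_time[OF B[OF f(1)] st] _ st(2)])
  fix r assume r: "s <= r" "r <= t"
  have "\<bar>\<phi> p * f p\<bar> <= c * d" for p
   unfolding abs_mult using \<phi>(2)[of p] f(2)[of p] by (intro mult_mono) (auto intro: order_trans[OF abs_ge_zero])
  then show "\<bar>mm r (%p. \<phi> p * f p)\<bar> <= MV t * (c * d)" using r st by (intro mm_bound B f(1)) auto
 qed
qed

lemma diag_lin:
 assumes "\<phi> \<in> Bm" "f \<in> Bm" "g \<in> Bm" "0 <= r"
 shows "Lam1 r (%x. \<phi> x * (f (x, x) + k * g (x, x))) = Lam1 r (%x. \<phi> x * f (x, x)) + k * Lam1 r (%x. \<phi> x * g (x, x))"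
proof -
 have "(%x. \<phi> x * (f (x, x) + k * g (x, x))) = (%x. \<phi> x * f (x, x) + k * (\<phi> x * g (x, x)))" by (auto simp: algebra_simps)
 then show ?thesis using Lam1_lin[OF assms(4) Bm_mult[OF assms(1) Bm_diag[OF assms(2)]] Bm_mult[OF assms(1) Bm_diag[OF assms(3)]]] by simp
qed

lemma diag_bound:
 assumes "\<phi> \<in> Bm" "!!x. \<bar>\<phi> x\<bar> <= c" "f \<in> Bm" "!!p. \<bar>f p\<bar> <= d" "0 <= r" "r <= T"
 shows "\<bar>Lam1 r (%x. \<phi> x * f (x, x))\<bar> <= MV T * (c * d)"
proof -
 have "\<bar>\<phi> x * f (x, x)\<bar> <= c * d" for x
  unfolding abs_mult using assms(2)[of x] assms(4)[of "(x, x)"] by (intro mult_mono) (auto intro: order_trans[OF abs_ge_zero])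
 then have "\<bar>Lam1 r (%x. \<phi> x * f (x, x))\<bar> <= 1 * MV T * (c * d)"
  using assms by (intro Lam_bound Bm_mult Bm_diag) auto
 then show ?thesis by simp
qed

lemma diag_time: "\<phi> \<in> Bm ==> f \<in> Bm ==> 0 <= s ==> s <= t ==> set_integrable lborel {s..t} (%r. Lam1 r (%x. \<phi> x * f (x, x)))"
 by (intro Lam1_time Bm_mult Bm_diag)

lemma kap_bound: "\<bar>kap x\<bar> <= C\<sigma> + \<Gamma>"
 unfolding kap_def using \<sigma>(2)[of x] \<kappa>\<^sub>2_bounds[of x] by linarith

lemma Gop_pair_Bm:
 fixes F :: "real \<times> real => real"
 assumes F: "F \<in> Ccinf"
 shows "b \<in> Basis ==> b' \<in> Basis ==> pde b (pde b' F) \<in> Bm" "Gop a \<rho> F \<in> Bm"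
proof -
 show p: "pde b (pde b' F) \<in> Bm" if "b \<in> Basis" "b' \<in> Basis" for b b'
 proof -
  obtain K where K: "compact K" "!!x. x \<notin> K ==> F x = 0" using F unfolding Ccinf_def by blast
  obtain R where R: "!!x. x \<in> K ==> norm x <= R" using compact_imp_bounded[OF K(1)] unfolding bounded_iff by blast
  have S0: "F z = 0" if "R < norm z" for z using K(2)[of z] R[of z] that by (cases "z \<in> K") auto
  have S1: "pde b F z = 0" if "R < norm z" for b z by (rule pde_supp[OF S0 that])
  have S2: "pde b (pde b' F) z = 0" if "R < norm z" for b b' z by (rule pde_supp[OF S1 that])
  have "continuous_on UNIV (pde b (pde b' F))" using Ccinf_cont[OF F, of "[b, b']"] that by simp
  then show ?thesis by (rule Chat_Bm[OF ChatI[OF _ compact_cball[of 0 R]]]) (use S2 in auto)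
 qed
 have B: "(1, 0) \<in> (Basis :: (real \<times> real) set)" "(0, 1) \<in> (Basis :: (real \<times> real) set)" by (auto simp: Basis_prod_def)
 have "(%p. Gop a \<rho> F p) \<in> Bm" unfolding Gop_prod
  by (intro Bm_add Bm_mult Bm_const Bm_fst[OF a_Bm] Bm_snd[OF a_Bm] Bm_gap[OF \<rho>_Bm] p B)
 then show "Gop a \<rho> F \<in> Bm" .
qed

text \<open>The tensor identity is cast into the form of \<open>tensor_extension\<close>:
  \<open>\<Lambda> 0\<close> is the time increment minus the diagonal source, and each further
  functional is minus the time integral against one coefficient of the generator.\<close>

theorem pair_identity:
 fixes F :: "real \<times> real => real"
 assumes F: "F \<in> Ccinf" and st: "0 <= s" "s <= t"
 shows "mm t F - mm s F = (LINT r:{s..t}|lborel. mm r (Gop a \<rho> F) + Lam1 r (%x. kap x * F (x, x)))"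
proof -
 have t: "0 <= t" using st by simp
 define \<phi> where "\<phi> i p = (if i = 1 then 1/2 * a (fst p) else if i = 2 then 1/2 * a (snd p) else if i = 3 then 1/2 * \<rho> (fst p - snd p) else 1/2 * \<rho> (snd p - fst p))"
  for i :: nat and p :: "real \<times> real"
 have \<phi>e: "\<phi> 1 = (%p. 1/2 * a (fst p))" "\<phi> 2 = (%p. 1/2 * a (snd p))" "\<phi> 3 = (%p. 1/2 * \<rho> (fst p - snd p))" "\<phi> 4 = (%p. 1/2 * \<rho> (snd p - fst p))"
  by (auto simp: \<phi>_def fun_eq_iff)
 have \<phi>c: "\<phi> i \<in> {\<phi> 1, \<phi> 2, \<phi> 3, \<phi> 4}" for i by (auto simp: \<phi>_def fun_eq_iff)
 have \<phi>B: "\<phi> i \<in> Bm" for i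
 proof -
  have "\<phi> 1 \<in> Bm" "\<phi> 2 \<in> Bm" "\<phi> 3 \<in> Bm" "\<phi> 4 \<in> Bm" unfolding \<phi>e
   by (intro Bm_mult Bm_const Bm_fst[OF a_Bm] Bm_snd[OF a_Bm] Bm_gap[OF \<rho>_Bm])+
  then show ?thesis using \<phi>c[of i] by auto
 qed
 have \<phi>b: "\<bar>\<phi> i p\<bar> <= Ca + C\<rho>" for i p
  unfolding \<phi>_def using a(2)[of "fst p"] a(2)[of "snd p"] \<rho>(2)[of "fst p - snd p"] \<rho>(2)[of "snd p - fst p"] bounds_nonneg by auto
 let ?J = "%\<phi> h. LINT r:{s..t}|lborel. mm r (%p. \<phi> p * h p)"
 let ?K = "%h. LINT r:{s..t}|lborel. Lam1 r (%x. kap x * h (x, x))"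
 have split: "(LINT r:{s..t}|lborel. mm r (%p. \<phi> 1 p * A1 p + \<phi> 2 p * A2 p + \<phi> 3 p * A3 p + \<phi> 4 p * A4 p) + Lam1 r (%x. kap x * h (x, x)))
   = ?J (\<phi> 1) A1 + ?J (\<phi> 2) A2 + ?J (\<phi> 3) A3 + ?J (\<phi> 4) A4 + ?K h"
  if A: "A1 \<in> Bm" "A2 \<in> Bm" "A3 \<in> Bm" "A4 \<in> Bm" and h: "h \<in> Bm" for A1 A2 A3 A4 h
 proof -
  have B: "(%p. \<phi> 1 p * A1 p) \<in> Bm" "(%p. \<phi> 2 p * A2 p) \<in> Bm" "(%p. \<phi> 3 p * A3 p) \<in> Bm" "(%p. \<phi> 4 p * A4 p) \<in> Bm"
   using A by (auto intro: Bm_mult \<phi>B)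
  have B2: "(%p. \<phi> 1 p * A1 p + \<phi> 2 p * A2 p) \<in> Bm" by (rule Bm_add[OF B(1,2)])
  have B3: "(%p. \<phi> 1 p * A1 p + \<phi> 2 p * A2 p + \<phi> 3 p * A3 p) \<in> Bm" by (rule Bm_add[OF B2 B(3)])
  have m: "mm r (%p. \<phi> 1 p * A1 p + \<phi> 2 p * A2 p + \<phi> 3 p * A3 p + \<phi> 4 p * A4 p)
    = mm r (%p. \<phi> 1 p * A1 p) + mm r (%p. \<phi> 2 p * A2 p) + mm r (%p. \<phi> 3 p * A3 p) + mm r (%p. \<phi> 4 p * A4 p)" if r: "0 <= r" for r
   using mm_lin[OF r B3 B(4), of 1] mm_lin[OF r B2 B(3), of 1] mm_lin[OF r B(1,2), of 1] by simp
  note i = mm_time[OF B(1) st] mm_time[OF B(2) st] mm_time[OF B(3) st] mm_time[OF B(4) st] diag_time[OF kap_Bm h st]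
  note i2 = set_integral_add(1)[OF i(1,2)]
  note i3 = set_integral_add(1)[OF i2 i(3)]
  note i4 = set_integral_add(1)[OF i3 i(4)]
  have "(LINT r:{s..t}|lborel. mm r (%p. \<phi> 1 p * A1 p + \<phi> 2 p * A2 p + \<phi> 3 p * A3 p + \<phi> 4 p * A4 p) + Lam1 r (%x. kap x * h (x, x)))
   = (LINT r:{s..t}|lborel. mm r (%p. \<phi> 1 p * A1 p) + mm r (%p. \<phi> 2 p * A2 p) + mm r (%p. \<phi> 3 p * A3 p) + mm r (%p. \<phi> 4 p * A4 p) + Lam1 r (%x. kap x * h (x, x)))"
   using m st by (intro set_lebesgue_integral_cong) auto
  then show ?thesis unfolding set_integral_add(2)[OF i4 i(5)] set_integral_add(2)[OF i3 i(4)] set_integral_add(2)[OF i2 i(3)] set_integral_add(2)[OF i(1,2)] .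
 qed
 define \<Lambda> where "\<Lambda> i h = (if i = 0 then mm t h - mm s h - ?K h else - ?J (\<phi> i) h)" for i :: nat and h :: "real \<times> real => real"
 \<comment> \<open>2 comes from the two times in the increment; the remaining terms are the bounds
   of branching variance and coefficients times the length of the interval.\<close>
 define C where "C = MV t * (2 + (C\<sigma> + \<Gamma> + Ca + C\<rho>) * (t - s))"
 have "\<Lambda> 0 F + \<Lambda> 1 (pde (1, 0) (pde (1, 0) F)) + \<Lambda> 2 (pde (0, 1) (pde (0, 1) F)) + \<Lambda> 3 (pde (1, 0) (pde (0, 1) F)) + \<Lambda> 4 (pde (0, 1) (pde (1, 0) F)) = 0"
 proof (rule tensor_extension[where C = C])
  fix i :: nat and f g :: "real \<times> real => real" and k :: real assume fg: "f \<in> Bm" "g \<in> Bm"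
  have "?K (%p. f p + k * g p) = (LINT r:{s..t}|lborel. Lam1 r (%x. kap x * f (x, x)) + k * Lam1 r (%x. kap x * g (x, x)))"
   by (rule set_lebesgue_integral_cong) (use diag_lin[OF kap_Bm fg] st in auto)
  also have "\<dots> = ?K f + k * ?K g"
   unfolding set_integral_add(2)[OF diag_time[OF kap_Bm fg(1) st] set_integrable_mult_right[OF diag_time[OF kap_Bm fg(2) st]]] set_integral_mult_right ..
  finally show "\<Lambda> i (%x. f x + k * g x) = \<Lambda> i f + k * \<Lambda> i g"
   unfolding \<Lambda>_def using mm_lin[OF t fg, of k] mm_lin[OF st(1) fg, of k] LINT_mm(1)[OF \<phi>B \<phi>b st fg, of i k] by (simp add: algebra_simps)
 next
  fix i :: nat and f :: "real \<times> real => real" and c assume f: "f \<in> Bm" "!!x. \<bar>f x\<bar> <= c"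
  have c: "0 <= c" using order_trans[OF abs_ge_zero f(2)] .
  note M = MV_nonneg[OF t]
  have m: "\<bar>mm t f\<bar> <= MV t * c" "\<bar>mm s f\<bar> <= MV t * c" using mm_bound[OF f] t st by auto
  have k: "\<bar>?K f\<bar> <= MV t * ((C\<sigma> + \<Gamma>) * c) * (t - s)"
  proof (rule set_integral_bound_Icc[OF diag_time[OF kap_Bm f(1) st] _ st(2)])
   fix r assume "s <= r" "r <= t"
   then show "\<bar>Lam1 r (%x. kap x * f (x, x))\<bar> <= MV t * ((C\<sigma> + \<Gamma>) * c)" using st by (intro diag_bound kap_Bm kap_bound f) auto
  qed
  have j: "\<bar>?J (\<phi> i) f\<bar> <= MV t * ((Ca + C\<rho>) * c) * (t - s)" by (rule LINT_mm(2)[OF \<phi>B \<phi>b st f])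
  have z: "0 <= MV t * c" "0 <= MV t * ((C\<sigma> + \<Gamma>) * c) * (t - s)" "0 <= MV t * ((Ca + C\<rho>) * c) * (t - s)"
   using M c st bounds_nonneg \<Gamma> by auto
  have "C * c = 2 * (MV t * c) + MV t * ((C\<sigma> + \<Gamma>) * c) * (t - s) + MV t * ((Ca + C\<rho>) * c) * (t - s)" by (simp add: C_def algebra_simps)
  then show "\<bar>\<Lambda> i f\<bar> <= C * c" unfolding \<Lambda>_def using m k j z by (cases "i = 0") auto
 next
  fix f f' f'' g g' g'' :: "real => real" assume fg: "C2cfun f f' f''" "C2cfun g g' g''" "!!x. 0 <= f x" "!!x. 0 <= g x"
  note Bf = C2cfun_Bm[OF fg(1)] and Bg = C2cfun_Bm[OF fg(2)]
  have B: "(%p. f (fst p) * g (snd p)) \<in> Bm" "(%p. f'' (fst p) * g (snd p)) \<in> Bm" "(%p. f (fst p) * g'' (snd p)) \<in> Bm" "(%p. f' (fst p) * g' (snd p)) \<in> Bm"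
   using Bf Bg by (auto intro!: Bm_mult Bm_fst Bm_snd)
  have "mm t (%p. f (fst p) * g (snd p)) - mm s (%p. f (fst p) * g (snd p))
    = ?J (\<phi> 1) (%p. f'' (fst p) * g (snd p)) + ?J (\<phi> 2) (%p. f (fst p) * g'' (snd p)) + ?J (\<phi> 3) (%p. f' (fst p) * g' (snd p))
    + ?J (\<phi> 4) (%p. f' (fst p) * g' (snd p)) + ?K (%p. f (fst p) * g (snd p))"
   using tensor_identity[OF fg(1,3,2,4) st] split[OF B(2,3,4,4,1)] unfolding \<phi>e fst_conv snd_conv by simp
  then show "\<Lambda> 0 (%p. f (fst p) * g (snd p)) + \<Lambda> 1 (%p. f'' (fst p) * g (snd p)) + \<Lambda> 2 (%p. f (fst p) * g'' (snd p))
   + \<Lambda> 3 (%p. f' (fst p) * g' (snd p)) + \<Lambda> 4 (%p. f' (fst p) * g' (snd p)) = 0"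
   unfolding \<Lambda>_def by simp
 qed (rule F)
 moreover have B: "(1, 0) \<in> (Basis :: (real \<times> real) set)" "(0, 1) \<in> (Basis :: (real \<times> real) set)" by (auto simp: Basis_prod_def)
 have Ge: "Gop a \<rho> F = (%p. \<phi> 1 p * pde (1, 0) (pde (1, 0) F) p + \<phi> 2 p * pde (0, 1) (pde (0, 1) F) p
   + \<phi> 3 p * pde (1, 0) (pde (0, 1) F) p + \<phi> 4 p * pde (0, 1) (pde (1, 0) F) p)"
  unfolding \<phi>e by (rule ext) (rule Gop_prod)
 have "(LINT r:{s..t}|lborel. mm r (Gop a \<rho> F) + Lam1 r (%x. kap x * F (x, x)))
   = ?J (\<phi> 1) (pde (1, 0) (pde (1, 0) F)) + ?J (\<phi> 2) (pde (0, 1) (pde (0, 1) F)) + ?J (\<phi> 3) (pde (1, 0) (pde (0, 1) F)) + ?J (\<phi> 4) (pde (0, 1) (pde (1, 0) F)) + ?K F"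
  unfolding Ge by (rule split) (intro Gop_pair_Bm(1)[OF F] B Chat_Bm[OF Ccinf_Chat[OF F]])+
 ultimately show ?thesis unfolding \<Lambda>_def by simp
qed

text \<open>As \<open>Y\<close> is measurable at time s, the weighted mean solves a forward equation
  without source from s on. With time shifted by s, Duhamel's formula reduces to the semigroup
  acting on \<open>f\<close>.\<close>

lemma Lam_solution:
 fixes P :: "real => (real => real) => real => real"
 assumes P: "G_semigroup a \<rho> P" and f: "f \<in> Bm" and st: "0 <= s" "s <= t"
  and Y: "Y \<in> borel_measurable (path_filt (ennreal s))" "!!om. om \<in> space Q ==> \<bar>Y om\<bar> <= E"
 shows "Lam Y t f = Lam Y s (P (t - s) f)"
proof -
 note YQ = measurable_from_subalg[OF sub_Q Y(1)]
 have E0: "0 <= E" using Y(2) not_empty order_trans[OF abs_ge_zero Y(2)] by blast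
 have t: "0 <= t" using st by simp
 have M: "0 <= E * MV t" using E0 MV_nonneg[OF t] by simp
 have GB: "Gop a \<rho> F \<in> Bm" "Gop a \<rho> F = Gf (pde 1 (pde 1 F))" if F: "F \<in> Ccinf" for F :: "real => real"
 proof -
  show e: "Gop a \<rho> F = Gf (pde 1 (pde 1 F))" by (auto simp: Gop_real Gf_def)
  show "Gop a \<rho> F \<in> Bm" unfolding e Gf_def[abs_def] by (intro Bm_mult Bm_const a_Bm C2cfun_Bm(3)[OF Ccinf_C2cfun[OF F]])
 qed
 interpret forward a \<rho> P "%_ _. 0" "E * MV t" "t - s" "%r. Lam Y (s + r)"
 proof
  show "G_semigroup a \<rho> P" by (rule P)
  show "0 <= t - s" "0 <= E * MV t" using st M by auto
  show "\<bar>0 :: real\<bar> <= E * MV t * c" if "!!x. \<bar>f x\<bar> <= c" for f :: "real => real" and c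
   using M order_trans[OF abs_ge_zero that] by simp
  show "set_integrable lborel {0..t - s} (%r. 0 :: real)" by (simp add: set_integrable_def)
  show "Lam Y (s + r) (%x. f x + k * g x) = Lam Y (s + r) f + k * Lam Y (s + r) g" if "0 <= r" "f \<in> Bm" "g \<in> Bm" for r f g k
   by (rule Lam_lin[OF YQ Y(2)]) (use that st in auto)
  show "\<bar>Lam Y (s + r) f\<bar> <= E * MV t * c" if "0 <= r" "r <= t - s" "f \<in> Bm" "!!x. \<bar>f x\<bar> <= c" for r f c
   by (rule Lam_bound[OF YQ Y(2)]) (use that st in auto)
  show "(%n. Lam Y (s + r) (F n)) \<longlonglongrightarrow> Lam Y (s + r) f"
   if "0 <= r" "!!n::nat. F n \<in> Bm" "!!n x. \<bar>F n x\<bar> <= c" "!!x. (%n. F n x) \<longlonglongrightarrow> f x" "f \<in> Bm" for r F f c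
   by (rule Lam_conv[OF YQ Y(2)]) (use that st in auto)
  show "set_integrable lborel {0..t - s} (%r. Lam Y (s + r) f)" if "f \<in> Bm" for f
   by (rule set_integrable_affine(1)) (use Lam_time(2)[OF YQ Y(2) that st] in simp)
  show "Gop a \<rho> F \<in> Bm" if "F \<in> Ccinf" for F :: "real => real" by (rule GB(1)[OF that])
  show "Lam Y (s + t') F - Lam Y (s + s') F = (LINT r:{s'..t'}|lborel. Lam Y (s + r) (Gop a \<rho> F) + 0)"
   if F: "F \<in> Ccinf" and "0 <= s'" "s' <= t'" for F s' t'
  proof -
   have "subalgebra (path_filt (ennreal (s + s'))) (path_filt (ennreal s))"
    unfolding subalgebra_def using path_filt_mono[of "ennreal s" "ennreal (s + s')"] \<open>0 <= s'\<close> by (simp add: ennreal_leI)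
   from measurable_from_subalg[OF this Y(1)]
   have "Lam Y (s + t') F - Lam Y (s + s') F = (LINT r:{s + s'..s + t'}|lborel. Lam Y r (Gf (pde 1 (pde 1 F))))"
    using that st by (intro first_identity[OF Ccinf_C2cfun[OF F] _ _ _ Y(2)]) auto
   then show ?thesis unfolding GB(2)[OF F] add_0_right
    using set_integral_shift[of s' t' "%r. Lam Y r (Gf (pde 1 (pde 1 F)))" s] by simp
  qed
 qed auto
 show ?thesis using forward_solution[OF f] by simp
qed

text \<open>In the constant 1 + c the summand c bounds the source; the 1 makes room for
  \<open>mm\<close>, because the locale \<open>forward\<close> uses one constant for both.\<close>

lemma diag_source:
 fixes P :: "real => (real \<times> real => real) => real \<times> real => real"
 assumes P: "G_semigroup a \<rho> P" and \<phi>: "\<phi> \<in> Bm" "!!x. \<bar>\<phi> x\<bar> <= c" and T: "0 <= T"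
 shows "source a \<rho> P (%r F. Lam1 r (%x. \<phi> x * F (x, x))) (MV T * (1 + c)) T"
proof
 have c: "0 <= c" using order_trans[OF abs_ge_zero \<phi>(2)] .
 show "G_semigroup a \<rho> P" "0 <= T" by fact+
 show "0 <= MV T * (1 + c)" using c MV_nonneg[OF T] by simp
 show "Lam1 r (%x. \<phi> x * (f (x, x) + k * g (x, x))) = Lam1 r (%x. \<phi> x * f (x, x)) + k * Lam1 r (%x. \<phi> x * g (x, x))"
  if "0 <= r" "f \<in> Bm" "g \<in> Bm" for r f g k by (rule diag_lin[OF \<phi>(1) that(2,3,1)])
 show "\<bar>Lam1 r (%x. \<phi> x * f (x, x))\<bar> <= MV T * (1 + c) * d" if r: "0 <= r" "r <= T" and f: "f \<in> Bm" "!!x. \<bar>f x\<bar> <= d" for r f d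
 proof -
  have "0 <= d" using order_trans[OF abs_ge_zero f(2)] .
  then have "MV T * (c * d) <= MV T * ((1 + c) * d)" using MV_nonneg[OF T] by (intro mult_left_mono) (auto simp: algebra_simps)
  then show ?thesis using diag_bound[OF \<phi> f r] by (simp add: mult.assoc)
 qed
 show "(%n. Lam1 r (%x. \<phi> x * F n (x, x))) \<longlonglongrightarrow> Lam1 r (%x. \<phi> x * f (x, x))"
  if r: "0 <= r" and F: "!!n::nat. F n \<in> Bm" "!!n x. \<bar>F n x\<bar> <= d" "!!x. (%n. F n x) \<longlonglongrightarrow> f x" "f \<in> Bm" for r F f d
 proof (rule Lam_conv[where E = 1 and c = "c * d"])
  show "\<bar>\<phi> x * F n (x, x)\<bar> <= c * d" for n x unfolding abs_mult using \<phi>(2)[of x] F(2)[of n "(x, x)"] c by (intro mult_mono) auto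
  show "(%x. \<phi> x * F n (x, x)) \<in> Bm" "(%x. \<phi> x * f (x, x)) \<in> Bm" for n by (intro Bm_mult \<phi>(1) Bm_diag F)+
  show "(%n. \<phi> x * F n (x, x)) \<longlonglongrightarrow> \<phi> x * f (x, x)" for x by (rule tendsto_mult_left[OF F(3)])
 qed (use r in auto)
 show "set_integrable lborel {0..T} (%r. Lam1 r (%x. \<phi> x * f (x, x)))" if "f \<in> Bm" for f
  by (rule diag_time[OF \<phi>(1) that order_refl T])
qed

lemma mm_solution:
 fixes P :: "real => (real \<times> real => real) => real \<times> real => real"
 assumes P: "G_semigroup a \<rho> P" and h: "h \<in> Bm" and T: "0 <= T"
 shows "mm T h = mm 0 (P T h) + (LINT r:{0..T}|lborel. Lam1 r (%x. kap x * P (T - r) h (x, x)))"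
proof -
 interpret source a \<rho> P "%r F. Lam1 r (%x. kap x * F (x, x))" "MV T * (1 + (C\<sigma> + \<Gamma>))" T
  by (rule diag_source[OF P kap_Bm kap_bound T])
 interpret forward a \<rho> P "%r F. Lam1 r (%x. kap x * F (x, x))" "MV T * (1 + (C\<sigma> + \<Gamma>))" T mm
 proof
  show "mm r (%x. f x + k * g x) = mm r f + k * mm r g" if "0 <= r" "f \<in> Bm" "g \<in> Bm" for r f g k by (rule mm_lin[OF that])
  show "\<bar>mm r f\<bar> <= MV T * (1 + (C\<sigma> + \<Gamma>)) * d" if r: "0 <= r" "r <= T" and f: "f \<in> Bm" "!!x. \<bar>f x\<bar> <= d" for r f d
  proof -
   have "0 <= d" using order_trans[OF abs_ge_zero f(2)] .
   then have "MV T * d <= MV T * ((1 + (C\<sigma> + \<Gamma>)) * d)" using MV_nonneg[OF T] bounds_nonneg \<Gamma> by (intro mult_left_mono) (auto simp: algebra_simps)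
   then show ?thesis using mm_bound[OF f r] by (simp add: mult.assoc)
  qed
  show "(%n. mm r (F n)) \<longlonglongrightarrow> mm r f"
   if "0 <= r" "!!n::nat. F n \<in> Bm" "!!n x. \<bar>F n x\<bar> <= d" "!!x. (%n. F n x) \<longlonglongrightarrow> f x" "f \<in> Bm" for r F f d
   by (rule mm_conv[OF that])
  show "set_integrable lborel {0..T} (%r. mm r f)" if "f \<in> Bm" for f by (rule mm_time[OF that order_refl T])
  show "Gop a \<rho> F \<in> Bm" if "F \<in> Ccinf" for F :: "real \<times> real => real" by (rule Gop_pair_Bm(2)[OF that])
  show "mm t F - mm s F = (LINT r:{s..t}|lborel. mm r (Gop a \<rho> F) + Lam1 r (%x. kap x * F (x, x)))"
   if "F \<in> Ccinf" "0 <= s" "s <= t" for F s t by (rule pair_identity[OF that])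
 qed
 show ?thesis by (rule forward_solution[OF h])
qed

end

section \<open>Moment formulas\<close>

context sdsm
begin

lemma Lam_0:
 assumes h: "h \<in> Bm" shows "Lam1 0 h = (LINT x|\<mu>. h x)"
proof -
 have "(LINT om|Q. (LINT x|om 0. h x)) = (LINT om|Q. (LINT x|\<mu>. h x))"
  by (rule integral_cong_AE) (use Q_init mkernel_Bm[OF mkernel_Q[OF order_refl] h] in auto)
 then show ?thesis by (simp add: Lam_def prob_space)
qed

lemma mm_0:
 assumes h: "h \<in> Bm" shows "mm 0 h = (LINT x|\<mu>. (LINT y|\<mu>. h (x, y)))"
proof -
 have "(LINT om|Q. (LINT z|(om 0 \<Otimes>\<^sub>M om 0). h z)) = (LINT om|Q. (LINT z|(\<mu> \<Otimes>\<^sub>M \<mu>). h z))"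
  by (rule integral_cong_AE) (use Q_init mkernel_pair[OF mkernel_Q[OF order_refl] h] in auto)
 then show ?thesis by (simp add: mm_def prob_space fbm_pair(2)[OF \<mu> h])
qed

text \<open>Weights have to be bounded to enter \<open>Lam_solution\<close>, which the integral of
  \<open>f\<close> against X_s is not. Truncation at level n is removed by domination: a product of
  masses at two times is at most the sum of their squares.\<close>

lemma trunc_limit:
 assumes f: "f \<in> Bm" and g: "g \<in> Bm" and s: "0 <= s" and t: "0 <= t"
 shows "(%n. Lam (%om. max (- real n) (min (real n) (LINT x|om s. f x))) t g) \<longlonglongrightarrow> (LINT om|Q. (LINT x|om s. f x) * (LINT x|om t. g x))"
proof -
 obtain D where D: "0 <= D" "!!x. \<bar>f x\<bar> <= D" using BmE[OF f] by metis
 obtain D' where D': "0 <= D'" "!!x. \<bar>g x\<bar> <= D'" using BmE[OF g] by metis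
 note m[measurable] = mkernel_Bm[OF mkernel_Q[OF s] f] mkernel_Bm[OF mkernel_Q[OF t] g]
 show ?thesis unfolding Lam_def
 proof (rule integral_dominated_convergence[where w = "%om. D * D' * (V s om + V t om)"])
  show "integrable Q (%om. D * D' * (V s om + V t om))" using V_integrable(1)[OF s] V_integrable(1)[OF t] by simp
  show "AE om in Q. (%n. max (- real n) (min (real n) (LINT x|om s. f x)) * (LINT x|om t. g x)) \<longlonglongrightarrow> (LINT x|om s. f x) * (LINT x|om t. g x)"
  proof (intro AE_I2 tendsto_mult_right)
   fix om
   obtain N :: nat where N: "\<bar>\<integral>x. f x \<partial>om s\<bar> <= real N" using real_arch_simple by blast
   have "max (- real n) (min (real n) (LINT x|om s. f x)) = (LINT x|om s. f x)" if "N <= n" for n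
   proof -
    have "real N <= real n" using that by simp
    then show ?thesis using N by linarith
   qed
   then have "eventually (%n. max (- real n) (min (real n) (LINT x|om s. f x)) = (LINT x|om s. f x)) sequentially"
    unfolding eventually_sequentially by blast
   then show "(%n. max (- real n) (min (real n) (LINT x|om s. f x))) \<longlonglongrightarrow> (LINT x|om s. f x)" by (rule tendsto_eventually)
  qed
  show "AE om in Q. norm (max (- real n) (min (real n) (LINT x|om s. f x)) * (LINT x|om t. g x)) <= D * D' * (V s om + V t om)" for n
  proof (rule AE_I2)
   fix om assume "om \<in> space Q"
   then have om: "om \<in> cadlag_paths" by simp
   have m0: "0 <= mass (om s)" "0 <= mass (om t)" by simp_all
   have "\<bar>max (- real n) (min (real n) (LINT x|om s. f x))\<bar> <= \<bar>\<integral>x. f x \<partial>om s\<bar>" by linarith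
   also have "\<dots> <= D * mass (om s)" by (rule fbm_integral_bound[OF cadlag_fbm[OF om s] f D(2)])
   finally have 1: "\<bar>max (- real n) (min (real n) (LINT x|om s. f x))\<bar> <= D * mass (om s)" .
   have 2: "\<bar>\<integral>x. g x \<partial>om t\<bar> <= D' * mass (om t)" by (rule fbm_integral_bound[OF cadlag_fbm[OF om t] g D'(2)])
   have "0 <= (mass (om s) - mass (om t))\<^sup>2" "0 <= (mass (om s))\<^sup>2" "0 <= (mass (om t))\<^sup>2" by simp_all
   then have "mass (om s) * mass (om t) <= (mass (om s))\<^sup>2 + (mass (om t))\<^sup>2" unfolding power2_diff by linarith
   also have "\<dots> <= V s om + V t om" by (intro add_mono V_ge)
   finally have 3: "D * D' * (mass (om s) * mass (om t)) <= D * D' * (V s om + V t om)" using D(1) D'(1) by (intro mult_left_mono) auto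
   have "\<bar>max (- real n) (min (real n) (LINT x|om s. f x))\<bar> * \<bar>\<integral>x. g x \<partial>om t\<bar> <= (D * mass (om s)) * (D' * mass (om t))"
    using 1 2 D(1) m0 by (intro mult_mono) auto
   also have "\<dots> = D * D' * (mass (om s) * mass (om t))" by simp
   finally show "norm (max (- real n) (min (real n) (LINT x|om s. f x)) * (LINT x|om t. g x)) <= D * D' * (V s om + V t om)"
    using 3 unfolding real_norm_def abs_mult by linarith
  qed
 qed measurable
qed

lemma two_time:
 fixes P :: "real => (real => real) => real => real"
 assumes P: "G_semigroup a \<rho> P" and f: "f \<in> Bm" and g: "g \<in> Bm" and st: "0 <= s" "s <= t"
 shows "(LINT om|Q. (LINT x|om s. f x) * (LINT x|om t. g x)) = (LINT om|Q. (LINT x|om s. f x) * (LINT x|om s. P (t - s) g x))"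
proof -
 interpret feller a \<rho> P by unfold_locales (rule P)
 have t: "0 <= t" and ts: "0 <= t - s" using st by auto
 let ?Y = "%n om. max (- real n) (min (real n) (LINT x|om s. f x))"
 have "Lam (?Y n) t g = Lam (?Y n) s (P (t - s) g)" for n
 proof (rule Lam_solution[OF P g st, where E = "real n"])
  have "(%om. \<integral>x. f x \<partial>om s) \<in> borel_measurable (path_filt (ennreal s))" by (rule mkernel_Bm[OF mkernel_at[OF st(1) order_refl] f])
  then show "?Y n \<in> borel_measurable (path_filt (ennreal s))" by measurable
 qed auto
 then show ?thesis using LIMSEQ_unique[OF trunc_limit[OF f g st(1) t]] trunc_limit[OF f P_Bm[OF ts g] st(1) st(1)] by simp
qed

lemma Lam_start:
 fixes P :: "real => (real => real) => real => real"
 assumes P: "G_semigroup a \<rho> P" and f: "f \<in> Bm" and t: "0 <= t"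
 shows "Lam1 t f = (LINT x|\<mu>. P t f x)"
proof -
 interpret feller a \<rho> P by unfold_locales (rule P)
 have "Lam1 t f = Lam1 0 (P (t - 0) f)" by (rule Lam_solution[OF P f order_refl t, where E = 1]) auto
 then show ?thesis using Lam_0[OF P_Bm[OF t f]] by simp
qed

theorem first_moment:
 assumes P: "G_semigroup a \<rho> P" and p: "transition_density P p" and f: "f \<in> Bm" and t: "0 < t"
 shows "(LINT om|Q. (LINT x|om t. f x)) = (LINT x|\<mu>. (LINT y|lborel. f y * p t x y))"
 using Lam_start[OF P f less_imp_le[OF t]] p t f by (simp add: Lam_def transition_density_def)

text \<open>The integral over the plane is \<open>P2 u\<close> applied to f \<otimes> w on the
  diagonal, the next one is \<open>P1 (s - u)\<close>, and integration against \<open>\<mu>\<close>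
  gives the mean of X at time s - u by \<open>Lam_start\<close>. The substitution r = s - u matches
  this with Duhamel's formula.\<close>

lemma branching_term:
 fixes P1 :: "real => (real => real) => real => real" and P2 :: "real => (real \<times> real => real) => real \<times> real => real"
 assumes P1: "G_semigroup a \<rho> P1" and p1: "transition_density P1 p1"
  and P2: "G_semigroup a \<rho> P2" and p2: "transition_density P2 p2"
  and \<phi>: "\<phi> \<in> Bm" and f: "f \<in> Bm" and w: "w \<in> Bm" and s: "0 <= s"
 defines "h \<equiv> (%p. f (fst p) * w (snd p))"
 shows "set_integrable lborel {0..s} (%r. Lam1 r (%x. \<phi> x * P2 (s - r) h (x, x)))"
  and "(LINT u:{0..s}|lborel. (LINT x|\<mu>. (LINT y|lborel. (LINT (y1, y2)|lborel. p1 (s - u) x y * \<phi> y * p2 u (y, y) (y1, y2) * f y1 * w y2))))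
   = (LINT r:{0..s}|lborel. Lam1 r (%x. \<phi> x * P2 (s - r) h (x, x)))"
proof -
 obtain c where c: "!!x. \<bar>\<phi> x\<bar> <= c" using BmE[OF \<phi>] by metis
 interpret source a \<rho> P2 "%r F. Lam1 r (%x. \<phi> x * F (x, x))" "MV s * (1 + c)" s
  by (rule diag_source[OF P2 \<phi> c s])
 have h: "h \<in> Bm" unfolding h_def by (rule Bm_mult[OF Bm_fst[OF f] Bm_snd[OF w]])
 show i: "set_integrable lborel {0..s} (%r. Lam1 r (%x. \<phi> x * P2 (s - r) h (x, x)))"
  by (rule D_path(2)[OF h]) auto
 define q where "q r = Lam1 r (%x. \<phi> x * P2 (s - r) h (x, x))" for r
 have "(LINT u:{0..s}|lborel. (LINT x|\<mu>. (LINT y|lborel. (LINT (y1, y2)|lborel. p1 (s - u) x y * \<phi> y * p2 u (y, y) (y1, y2) * f y1 * w y2))))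
   = (LINT u:{0..s}|lborel. q (s - u))"
 \<comment> \<open>At u = 0 and at u = s one of the densities is taken at time 0, where
   \<open>transition_density\<close> says nothing about it.\<close>
 proof (rule set_integral_endpoints)
  show "set_integrable lborel {0..s} (%u. q (s - u))" by (rule set_integrable_affine(2)) (use i in \<open>simp add: q_def[abs_def]\<close>)
  fix u assume u: "0 < u" "u < s"
  define G where "G = (%y. \<phi> y * P2 u h (y, y))"
  have G: "G \<in> Bm" unfolding G_def using u by (intro Bm_mult \<phi> Bm_diag P_Bm h) simp
  have in1: "(LINT (y1, y2)|lborel. p1 (s - u) x y * \<phi> y * p2 u (y, y) (y1, y2) * f y1 * w y2) = G y * p1 (s - u) x y" for x y
  proof -
   have "(%(y1, y2). p1 (s - u) x y * \<phi> y * p2 u (y, y) (y1, y2) * f y1 * w y2) = (%p. (p1 (s - u) x y * \<phi> y) * (h p * p2 u (y, y) p))"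
    by (auto simp: fun_eq_iff h_def)
   then have "(LINT (y1, y2)|lborel. p1 (s - u) x y * \<phi> y * p2 u (y, y) (y1, y2) * f y1 * w y2)
     = (p1 (s - u) x y * \<phi> y) * (LINT p|lborel. h p * p2 u (y, y) p)" by simp
   also have "(LINT p|lborel. h p * p2 u (y, y) p) = P2 u h (y, y)" using p2 u(1) h by (simp add: transition_density_def)
   finally show ?thesis by (simp add: G_def)
  qed
  have "(LINT y|lborel. G y * p1 (s - u) x y) = P1 (s - u) G x" for x using p1 u G by (simp add: transition_density_def)
  then have "(LINT x|\<mu>. (LINT y|lborel. (LINT (y1, y2)|lborel. p1 (s - u) x y * \<phi> y * p2 u (y, y) (y1, y2) * f y1 * w y2))) = (LINT x|\<mu>. P1 (s - u) G x)"
   unfolding in1 by simp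
  also have "\<dots> = Lam1 (s - u) G" by (rule Lam_start[OF P1 G, symmetric]) (use u in simp)
  finally show "(LINT x|\<mu>. (LINT y|lborel. (LINT (y1, y2)|lborel. p1 (s - u) x y * \<phi> y * p2 u (y, y) (y1, y2) * f y1 * w y2))) = q (s - u)"
   by (simp add: q_def G_def)
 qed
 also have "\<dots> = (LINT r:{0..s}|lborel. q r)" by (rule set_integrable_affine(3))
 finally show "(LINT u:{0..s}|lborel. (LINT x|\<mu>. (LINT y|lborel. (LINT (y1, y2)|lborel. p1 (s - u) x y * \<phi> y * p2 u (y, y) (y1, y2) * f y1 * w y2))))
   = (LINT r:{0..s}|lborel. Lam1 r (%x. \<phi> x * P2 (s - r) h (x, x)))"
  unfolding q_def .
qed

text \<open>Duhamel's formula for the mean of X \<otimes> X at the product f \<otimes> w; the source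
  \<open>kap\<close> splits into its Gaussian and its jump part.\<close>

theorem second_moment:
 fixes P1 :: "real => (real => real) => real => real" and P2 :: "real => (real \<times> real => real) => real \<times> real => real"
 assumes P1: "G_semigroup a \<rho> P1" and p1: "transition_density P1 p1"
  and P2: "G_semigroup a \<rho> P2" and p2: "transition_density P2 p2"
  and f: "f \<in> Bm" and w: "w \<in> Bm" and s: "0 < s"
 shows "(LINT om|Q. (LINT x|om s. f x) * (LINT x|om s. w x))
   = (LINT x|\<mu>. (LINT y|\<mu>. (LINT (y1, y2)|lborel. f y1 * w y2 * p2 s (x, y) (y1, y2))))
    + (LINT u:{0..s}|lborel. (LINT x|\<mu>. (LINT y|lborel. (LINT (y1, y2)|lborel. p1 (s - u) x y * \<sigma> y * p2 u (y, y) (y1, y2) * f y1 * w y2))))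
    + (LINT u:{0..s}|lborel. (LINT x|\<mu>. (LINT y|lborel. (LINT (y1, y2)|lborel. p1 (s - u) x y * (LINT \<xi>|\<gamma> y. \<xi>\<^sup>2) * p2 u (y, y) (y1, y2) * f y1 * w y2))))"
proof -
 interpret feller a \<rho> P2 by unfold_locales (rule P2)
 have s0: "0 <= s" using s by simp
 define h where "h = (%p. f (fst p) * w (snd p))"
 have h: "h \<in> Bm" unfolding h_def by (rule Bm_mult[OF Bm_fst[OF f] Bm_snd[OF w]])
 have k: "(LINT \<xi>|\<gamma> y. \<xi>\<^sup>2) = \<kappa>\<^sub>2 y" for y by (simp add: \<kappa>\<^sub>2_def)
 note bt = branching_term[OF P1 p1 P2 p2 _ f w s0, folded h_def]
 have "(LINT om|Q. (LINT x|om s. f x) * (LINT x|om s. w x)) = mm s h"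
  unfolding mm_def h_def
 proof (rule Bochner_Integration.integral_cong[OF refl])
  fix om assume "om \<in> space Q"
  then have "finite_borel_measure (om s)" using s0 by (auto intro: cadlag_fbm)
  from fbm_prod[OF this f w, symmetric]
  show "(LINT x|om s. f x) * (LINT x|om s. w x) = (LINT p|(om s \<Otimes>\<^sub>M om s). f (fst p) * w (snd p))" .
 qed
 also have "\<dots> = mm 0 (P2 s h) + (LINT r:{0..s}|lborel. Lam1 r (%x. kap x * P2 (s - r) h (x, x)))" by (rule mm_solution[OF P2 h s0])
 also have "(LINT r:{0..s}|lborel. Lam1 r (%x. kap x * P2 (s - r) h (x, x)))
   = (LINT r:{0..s}|lborel. Lam1 r (%x. \<sigma> x * P2 (s - r) h (x, x)) + Lam1 r (%x. \<kappa>\<^sub>2 x * P2 (s - r) h (x, x)))"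
 proof (rule set_lebesgue_integral_cong)
  show "\<forall>r. r \<in> {0..s} \<longrightarrow> Lam1 r (%x. kap x * P2 (s - r) h (x, x))
   = Lam1 r (%x. \<sigma> x * P2 (s - r) h (x, x)) + Lam1 r (%x. \<kappa>\<^sub>2 x * P2 (s - r) h (x, x))"
  proof (intro allI impI)
   fix r assume "r \<in> {0..s}"
   then have r: "0 <= r" "0 <= s - r" by auto
   have d: "(%x. P2 (s - r) h (x, x)) \<in> Bm" by (rule Bm_diag[OF P_Bm[OF r(2) h]])
   have "(%x. kap x * P2 (s - r) h (x, x)) = (%x. \<sigma> x * P2 (s - r) h (x, x) + 1 * (\<kappa>\<^sub>2 x * P2 (s - r) h (x, x)))"
    by (auto simp: kap_def algebra_simps)
   then show "Lam1 r (%x. kap x * P2 (s - r) h (x, x))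
    = Lam1 r (%x. \<sigma> x * P2 (s - r) h (x, x)) + Lam1 r (%x. \<kappa>\<^sub>2 x * P2 (s - r) h (x, x))"
    using Lam1_lin[OF r(1) Bm_mult[OF \<sigma>_Bm d] Bm_mult[OF \<kappa>\<^sub>2_Bm d], of 1] by simp
  qed
 qed simp
 also have "\<dots> = (LINT r:{0..s}|lborel. Lam1 r (%x. \<sigma> x * P2 (s - r) h (x, x)))
   + (LINT r:{0..s}|lborel. Lam1 r (%x. \<kappa>\<^sub>2 x * P2 (s - r) h (x, x)))"
  by (rule set_integral_add(2)[OF bt(1)[OF \<sigma>_Bm] bt(1)[OF \<kappa>\<^sub>2_Bm]])
 also have "mm 0 (P2 s h) = (LINT x|\<mu>. (LINT y|\<mu>. (LINT (y1, y2)|lborel. f y1 * w y2 * p2 s (x, y) (y1, y2))))"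
 proof -
  have e: "(%(y1, y2). f y1 * w y2 * p2 s z (y1, y2)) = (%p. h p * p2 s z p)" for z by (auto simp: fun_eq_iff h_def)
  have "P2 s h z = (LINT p|lborel. h p * p2 s z p)" for z using p2 s h by (cases z) (simp add: transition_density_def)
  then show ?thesis unfolding mm_0[OF P_Bm[OF s0 h]] e by simp
 qed
 finally show ?thesis unfolding k bt(2)[OF \<sigma>_Bm] bt(2)[OF \<kappa>\<^sub>2_Bm] by (simp only: add.assoc)
qed

end

text \<open>Regularity on \<open>Rn 1\<close> is pulled back along the embedding of the line that
  fills the other indices with \<open>undefined\<close>.\<close>

lemma Cb_on_real:
 fixes g :: "real => real"
 assumes "(%v. g (v 0)) \<in> Cb (Rn 1)"
 shows "continuous_on UNIV g" "\<exists>C. \<forall>x. \<bar>g x\<bar> <= C"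
proof -
 define e where "e r i = (if i \<in> {..<1::nat} then r else undefined)" for r :: real and i
 have e: "e r \<in> Rn 1" "e r 0 = r" for r by (auto simp: e_def Rn_def PiE_def extensional_def)
 have c1: "continuous_on UNIV e"
 proof (rule continuous_on_coordinatewise_then_product)
  show "continuous_on UNIV (%r. e r i)" for i by (cases "i \<in> {..<1}") (simp_all add: e_def)
 qed
 have c2: "continuous_on (Rn 1) (%v. g (v 0))" using assms by (simp add: Cb_def)
 have "e ` UNIV \<subseteq> Rn 1" using e(1) by auto
 from continuous_on_compose2[OF c2 c1 this]
 show "continuous_on UNIV g" by (simp add: e(2))
 obtain C where C: "!!v. v \<in> Rn 1 ==> \<bar>g (v 0)\<bar> <= C" using assms by (auto simp: Cb_def bounded_iff)
 have "\<bar>g x\<bar> <= C" for x using C[OF e(1)[of x]] e(2) by simp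
 then show "\<exists>C. \<forall>x. \<bar>g x\<bar> <= C" by blast
qed

text \<open>At r = 0 the convention in \<open>pint\<close> agrees with \<open>P 0\<close>, which is
  the identity on all of \<open>Bm\<close> by \<open>P_0_Bm\<close>.\<close>

lemma pint_eq:
 assumes "G_semigroup a \<rho> P" "transition_density P p" "g \<in> Bm" "0 <= r"
 shows "pint p r g y = P r g y"
proof -
 interpret feller a \<rho> P by unfold_locales (rule assms(1))
 show ?thesis using assms(2-4) P_0_Bm[OF assms(3)] by (cases "r = 0") (auto simp: pint_def transition_density_def mult.commute)
qed

theorem theorem4p1:
  fixes c h \<rho> a \<sigma> :: "real \<Rightarrow> real"
    and \<gamma> :: "real \<Rightarrow> real measure"
    and \<epsilon> :: real
    and P1 :: "real \<Rightarrow> (real \<Rightarrow> real) \<Rightarrow> real \<Rightarrow> real"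
    and P2 :: "real \<Rightarrow> (real \<times> real \<Rightarrow> real) \<Rightarrow> real \<times> real \<Rightarrow> real"
    and p1 :: "real \<Rightarrow> real \<Rightarrow> real \<Rightarrow> real"
    and p2 :: "real \<Rightarrow> real \<times> real \<Rightarrow> real \<times> real \<Rightarrow> real"
    and \<mu> :: "real measure"
    and Q :: "(real \<Rightarrow> real measure) measure"
  assumes c: "c \<in> on_real (C2 1)"
    and eps: "0 < \<epsilon>" "\<epsilon> \<le> (INF x. \<bar>c x\<bar>)"
    and h: "h \<in> Cb UNIV" "integrable lborel (\<lambda>x. (h x)\<^sup>2)"
    and rho_def: "\<rho> = (\<lambda>x. \<integral>y. h (y - x) * h y \<partial>lborel)"
    and rho: "\<rho> \<in> on_real (C2 1)"
    and a_def: "a = (\<lambda>x. (c x)\<^sup>2 + \<rho> 0)"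
    and sigma: "\<sigma> \<in> nonneg (on_real (C2del 1))"
    and gamma_kernel: "kernel_pos \<gamma>"
    and gamma_bdd: "(SUP x. \<integral>\<^sup>+\<xi>. ennreal (min \<xi> (\<xi>\<^sup>2)) \<partial>\<gamma> x) < \<infinity>"
    and gamma_smooth: "\<And>\<Gamma>. \<Gamma> \<in> sets borel \<Longrightarrow> \<Gamma> \<subseteq> {0<..} \<Longrightarrow>
      (\<lambda>x. LINT \<xi>:\<Gamma>|\<gamma> x. min \<xi> (\<xi>\<^sup>2)) \<in> on_real (C2del 1)"
    and gamma_second_moment: "(SUP x. \<integral>\<^sup>+\<xi>. ennreal (\<xi>\<^sup>2) \<partial>\<gamma> x) < \<infinity>"
    and P1: "G_semigroup a \<rho> P1" and p1: "transition_density P1 p1"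
    and P2: "G_semigroup a \<rho> P2" and p2: "transition_density P2 p2"
    and mu: "finite_borel_measure \<mu>"
    and Q: "SDSM a \<rho> \<sigma> \<gamma> \<mu> Q"
  shows "(\<forall>f\<in>Bm. \<forall>t>0.
           (\<integral>\<omega>. (\<integral>x. f x \<partial>\<omega> t) \<partial>Q) = (\<integral>x. (\<integral>y. f y * p1 t x y \<partial>lborel) \<partial>\<mu>)) \<and>
         (\<forall>f\<in>Bm. \<forall>g\<in>Bm. \<forall>s t. 0 < s \<and> s \<le> t \<longrightarrow>
           (\<integral>\<omega>. (\<integral>x. f x \<partial>\<omega> s) * (\<integral>x. g x \<partial>\<omega> t) \<partial>Q)
             = (\<integral>\<omega>. (\<integral>x. f x \<partial>\<omega> s) * (\<integral>x. P1 (t - s) g x \<partial>\<omega> s) \<partial>Q) \<and>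
           (\<integral>\<omega>. (\<integral>x. f x \<partial>\<omega> s) * (\<integral>x. P1 (t - s) g x \<partial>\<omega> s) \<partial>Q)
             = (\<integral>x. (\<integral>y. (\<integral>(y1, y2). f y1 * pint p1 (t - s) g y2 * p2 s (x, y) (y1, y2)
                   \<partial>lborel) \<partial>\<mu>) \<partial>\<mu>)
               + (LINT u:{0..s}|lborel. (\<integral>x. (\<integral>y. (\<integral>(y1, y2).
                   p1 (s - u) x y * \<sigma> y * p2 u (y, y) (y1, y2) * f y1 * pint p1 (t - s) g y2
                   \<partial>lborel) \<partial>lborel) \<partial>\<mu>))
               + (LINT u:{0..s}|lborel. (\<integral>x. (\<integral>y. (\<integral>(y1, y2).
                   p1 (s - u) x y * (\<integral>\<xi>. \<xi>\<^sup>2 \<partial>\<gamma> y) * p2 u (y, y) (y1, y2) * f y1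
                     * pint p1 (t - s) g y2
                   \<partial>lborel) \<partial>lborel) \<partial>\<mu>)))"
proof -
 have cb: "\<exists>C. continuous_on UNIV g \<and> (\<forall>x. \<bar>g x\<bar> <= C)" if "g \<in> on_real (C2 1)" for g
  using Cb_on_real[of g] that by (simp add: on_real_def C2_def)
 obtain Cc where Cc: "continuous_on UNIV c" "!!x. \<bar>c x\<bar> <= Cc" using cb[OF c] by blast
 obtain C\<rho> where C\<rho>: "continuous_on UNIV \<rho>" "!!x. \<bar>\<rho> x\<bar> <= C\<rho>" using cb[OF rho] by blast
 \<comment> \<open>\<open>\<sigma>\<close> is a constant plus a function in \<open>C2hat 1\<close>,
   hence continuous and bounded.\<close>
 obtain k where "(%v. \<sigma> (v 0) - k) \<in> C2hat 1" using sigma by (auto simp: nonneg_def on_real_def C2del_def)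
 then have "(%x. \<sigma> x - k) \<in> on_real (C2 1)" by (simp add: C2hat_def on_real_def)
 from cb[OF this] obtain C where C: "continuous_on UNIV (%x. \<sigma> x - k)" "!!x. \<bar>\<sigma> x - k\<bar> <= C" by blast
 have "continuous_on UNIV (%x. (\<sigma> x - k) + k)" by (intro continuous_on_add C(1) continuous_on_const)
 then have \<sigma>c: "continuous_on UNIV \<sigma>" by simp
 have \<sigma>b: "\<bar>\<sigma> x\<bar> <= C + \<bar>k\<bar>" for x using C(2)[of x] by linarith
 have ac: "continuous_on UNIV a" unfolding a_def by (intro continuous_intros Cc(1))
 have ab: "\<bar>a x\<bar> <= Cc\<^sup>2 + C\<rho>" for x
 proof -
  have "(c x)\<^sup>2 <= Cc\<^sup>2" using Cc(2)[of x] by (metis abs_ge_zero power2_abs power_mono)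
  moreover have "\<bar>\<rho> 0\<bar> <= C\<rho>" by (rule C\<rho>(2))
  moreover have "0 <= (c x)\<^sup>2" by simp
  ultimately show ?thesis unfolding a_def by linarith
 qed
 define \<Gamma> where "\<Gamma> = enn2real (SUP x. \<integral>\<^sup>+\<xi>. ennreal (\<xi>\<^sup>2) \<partial>\<gamma> x)"
 have \<Gamma>: "(\<integral>\<^sup>+\<xi>. ennreal (\<xi>\<^sup>2) \<partial>\<gamma> x) <= ennreal \<Gamma>" for x
 proof -
  have "(\<integral>\<^sup>+\<xi>. ennreal (\<xi>\<^sup>2) \<partial>\<gamma> x) <= (SUP x. \<integral>\<^sup>+\<xi>. ennreal (\<xi>\<^sup>2) \<partial>\<gamma> x)" by (rule SUP_upper) simp
  also have "\<dots> = ennreal \<Gamma>" unfolding \<Gamma>_def by (rule ennreal_enn2real[symmetric]) (use gamma_second_moment in simp)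
  finally show ?thesis .
 qed
 have \<Gamma>0: "0 <= \<Gamma>" by (simp add: \<Gamma>_def)
 interpret sdsm a \<rho> \<sigma> \<gamma> "Cc\<^sup>2 + C\<rho>" C\<rho> "C + \<bar>k\<bar>" \<Gamma> \<mu> Q
  by (intro sdsm.intro coefficients.intro sdsm_axioms.intro) (rule ac ab C\<rho> \<sigma>c \<sigma>b gamma_kernel \<Gamma> \<Gamma>0 mu Q)+
 interpret P: feller a \<rho> P1 by unfold_locales (rule P1)
 show ?thesis
 proof (intro conjI ballI allI impI)
  show "(LINT om|Q. (LINT x|om t. f x)) = (LINT x|\<mu>. (LINT y|lborel. f y * p1 t x y))" if "f \<in> Bm" "0 < t" for f t
   by (rule first_moment[OF P1 p1 that])
 next
  fix f g :: "real => real" and s t :: real assume fg: "f \<in> Bm" "g \<in> Bm" and st: "0 < s \<and> s <= t"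
  then have s: "0 <= s" "s <= t" "0 < s" "0 <= t - s" by auto
  show "(LINT om|Q. (LINT x|om s. f x) * (LINT x|om t. g x)) = (LINT om|Q. (LINT x|om s. f x) * (LINT x|om s. P1 (t - s) g x))"
   by (rule two_time[OF P1 fg s(1,2)])
  \<comment> \<open>Applied with \<open>P1 (t - s) g\<close> as the second function;
    \<open>pint_eq\<close> brings the goal to the same form, including the case s = t.\<close>
  note second_moment[OF P1 p1 P2 p2 fg(1) P.P_Bm[OF s(4) fg(2)] s(3)]
  then show "(LINT om|Q. (LINT x|om s. f x) * (LINT x|om s. P1 (t - s) g x))
       = (LINT x|\<mu>. (LINT y|\<mu>. (LINT (y1, y2)|lborel. f y1 * pint p1 (t - s) g y2 * p2 s (x, y) (y1, y2))))
        + (LINT u:{0..s}|lborel. (LINT x|\<mu>. (LINT y|lborel. (LINT (y1, y2)|lborel. p1 (s - u) x y * \<sigma> y * p2 u (y, y) (y1, y2) * f y1 * pint p1 (t - s) g y2))))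
        + (LINT u:{0..s}|lborel. (LINT x|\<mu>. (LINT y|lborel. (LINT (y1, y2)|lborel. p1 (s - u) x y * (LINT \<xi>|\<gamma> y. \<xi>\<^sup>2) * p2 u (y, y) (y1, y2) * f y1
           * pint p1 (t - s) g y2))))"
   unfolding pint_eq[OF P1 p1 fg(2) s(4)] .
 qed
qed

end
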